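(* Let $\iota:\Gamma\to M$ be a closed Lagrangian embedding, $U\subset M$ an open set such that $U_\Gamma=\iota^{-1}(U)$ is contractible, $t_\Gamma$ a flat unitary section of $\iota^*L\to U_\Gamma$, $V$ an open set with $\overline V\subset U$, and suppose $K=L_1\otimes\delta$ over $U$, where $(\delta,\varphi)$ is a half-form bundle. Let $\Psi_k$ be a Lagrangian section over $V$ associated to $(\Gamma,t_\Gamma)$ with principal symbol $g_0$. Let $\xi\in C^\infty_o(V)$ (smooth with compact support in $V$). Then $$\int_M\xi\,\|\Psi_k\|^2_{L^k\otimes L_1\otimes\delta}\;\mu_M=\int_\Gamma(\iota^*\xi)\,m(g_0)+O(k^{-1}).$$
   Context: $M$ is a connected compact Kähler manifold of complex dimension $n$ with fundamental form $\omega$ and Liouville form $\mu_M=\omega^n/n!$. $L\to M$ is a prequantization bundle: a Hermitian line bundle with a connection of curvature $\frac1i\omega$, with the induced holomorphic structure. $K\to M$ is a Hermitian holomorphic line bundle. For each positive integer $k$, $\mathcal H_k$ is the space of holomorphic sections of $L^k\otimes K$. **Lagrangian sections.** A sequence $\Psi_k\in\mathcal H_k$ is a Lagrangian section over $V$ associated to $(\Gamma,t_\Gamma)$ with symbol $\sum\hbar^\ell g_\ell\in C^\infty(U_\Gamma,\iota^*K)[[\hbar]]$ if $$\Psi_k(x)=\Bigl(\frac{k}{2\pi}\Bigr)^{n/4}F^k(x)\,\tilde g(x,k)+O(k^{-\infty})\quad\text{over }V,$$ where - $F$ is a section of $L\to U$ such that $\iota^*F=t_\Gamma$, $\bar\partial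 F\equiv0$ modulo a section vanishing to every order along $\iota(\Gamma)$, and $|F(x)|<1$ if $x\notin\iota(\Gamma)$; - $\tilde g(\cdot,k)$ is a sequence of $C^\infty(U,K)$ with an asymptotic expansion $\sum k^{-\ell}\tilde g_\ell$ in the $C^\infty$ topology such that $\iota^*\tilde g_\ell=g_\ell$ and $\bar\partial\tilde g_\ell\equiv0$ modulo a section vanishing to every order along $\iota(\Gamma)$. It is furthermore required that $\Psi_k$ be admissible: $\Psi_k(x)$ is uniformly $O(k^N)$ for some $N$, and the same holds for its successive covariant derivatives. "$O(k^{-\infty})$ over $V$" means $O(k^{-N})$ for every $N$, uniformly on $V$. The coefficient $g_0$ is the principal symbol. **Half-forms.** A half-form bundle over $U$ is a line bundle $\delta$ with an isomorphism $\varphi:\delta^{\otimes2}\to\Lambda^{n,0}T^*U$; $\delta$ carries the Hermitian and holomorphic structures making $\varphi$ an isomorphism of Hermitian holomorphic line bundles. The metric on $\Lambda^{n,0}T^*M$ is induced by the Kähler structure, normalized so that $\theta^1\wedge\dots\wedge\theta^n$ has norm $1$ when $(\theta^i)$ is dual to a basis $(\partial_i)$ of $T^{1,0}_xM$ with $\frac1i\omega(\partial_i,\bar\partial_j)=\delta_{ij}$. $L_1$ is the Hermitian holomorphic line bundle with $K=L_1\otimes\delta$ over $U$. The bundle $\delta_\Gamma=\iota^*\delta$ is a square root of $\Lambda^nT^*\Gamma\otimes\mathbb C$ through the isomorphism $\varphi_\Gamma:\delta_\Gamma^{\otimes 2}\to\Lambda^nT^*\Gamma\otimes\mathbb C$,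 $u\mapsto\iota^*\varphi(u)$ (pullback of $n$-forms to $\Gamma$). The map $m:\iota^*L_1\otimes\delta_\Gamma\to|\Lambda|(\Gamma)$, with values in the bundle of densities of $\Gamma$, is $$m(u\otimes v)=\|u\|^2_{L_1}\,|\varphi_\Gamma(v^{\otimes2})|.$$ *)

theory Defs
  imports "HOL-Analysis.Analysis" "HOL-Library.Landau_Symbols"
begin

section \<open>Smooth and complex manifolds\<close>

text \<open>
  A manifold is a type carrying its topology, together with an atlas. A chart is a pair of its
  domain and its coordinate map. Tensor-like objects (vector fields, forms, densities) are given
  by their components in every chart of the atlas, subject to the usual transformation rule.
\<close>

type_synonym ('m, 'e) chart = "'m set \<times> ('m \<Rightarrow> 'e)"

fun iter_deriv :: "'e::real_normed_vector list \<Rightarrow> ('e \<Rightarrow> 'b::real_normed_vector) \<Rightarrow> 'e \<Rightarrow> 'b" where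
  "iter_deriv [] f = f"
| "iter_deriv (v # vs) f = (\<lambda>x. frechet_derivative (iter_deriv vs f) (at x) v)"

text \<open>To be used for open \<open>S\<close> and finite-dimensional domains only.\<close>

definition smooth_on :: "'e::euclidean_space set \<Rightarrow> ('e \<Rightarrow> 'b::real_normed_vector) \<Rightarrow> bool" where
  "smooth_on S f \<longleftrightarrow> (\<forall>vs. \<forall>x\<in>S. iter_deriv vs f differentiable (at x))"

definition chart_inv :: "('m, 'e) chart \<Rightarrow> 'e \<Rightarrow> 'm" where
  "chart_inv c = inv_into (fst c) (snd c)"

definition is_chart :: "('m::topological_space, 'e::euclidean_space) chart \<Rightarrow> bool" where
  "is_chart c \<longleftrightarrow> open (fst c) \<and> open (snd c ` fst c) \<and>
     homeomorphism (fst c) (snd c ` fst c) (snd c) (chart_inv c)"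

definition smooth_atlas :: "('m::topological_space, 'e::euclidean_space) chart set \<Rightarrow> bool" where
  "smooth_atlas A \<longleftrightarrow>
     (\<forall>c\<in>A. is_chart c) \<and> (\<Union>c\<in>A. fst c) = UNIV \<and>
     (\<forall>c\<in>A. \<forall>d\<in>A. smooth_on (snd c ` (fst c \<inter> fst d)) (snd d \<circ> chart_inv c))"

text \<open>The differential of \<open>f\<close> at \<open>p\<close>, read in a chart \<open>c\<close> at \<open>p\<close> and a chart \<open>d\<close> at \<open>f p\<close>.\<close>

definition tangent_map ::
  "('m, 'e::euclidean_space) chart \<Rightarrow> ('n, 'f::euclidean_space) chart \<Rightarrow> ('m \<Rightarrow> 'n) \<Rightarrow> 'm \<Rightarrow> 'e \<Rightarrow> 'f"
  where "tangent_map c d f p = frechet_derivative (snd d \<circ> f \<circ> chart_inv c) (at (snd c p))"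

definition smooth_map ::
  "('m::topological_space, 'e::euclidean_space) chart set \<Rightarrow>
   ('n::topological_space, 'f::euclidean_space) chart set \<Rightarrow> ('m \<Rightarrow> 'n) \<Rightarrow> bool" where
  "smooth_map A B f \<longleftrightarrow> continuous_on UNIV f \<and>
     (\<forall>c\<in>A. \<forall>d\<in>B. smooth_on (snd c ` (fst c \<inter> f -` fst d)) (snd d \<circ> f \<circ> chart_inv c))"

definition smooth_function ::
  "('m::topological_space, 'e::euclidean_space) chart set \<Rightarrow> ('m \<Rightarrow> 'b::real_normed_vector) \<Rightarrow> bool"
  where "smooth_function A f \<longleftrightarrow> (\<forall>c\<in>A. smooth_on (snd c ` fst c) (f \<circ> chart_inv c))"

text \<open>Functions that are smooth with compact support contained in the open set \<open>V\<close>.\<close>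

definition test_function ::
  "('m::topological_space, 'e::euclidean_space) chart set \<Rightarrow> 'm set \<Rightarrow>
   ('m \<Rightarrow> 'b::real_normed_vector) \<Rightarrow> bool" where
  "test_function A V f \<longleftrightarrow> smooth_function A f \<and>
     (\<exists>C. compact C \<and> C \<subseteq> V \<and> (\<forall>x. x \<notin> C \<longrightarrow> f x = 0))"

definition complex_atlas :: "('m::topological_space, complex^'n) chart set \<Rightarrow> bool" where
  "complex_atlas A \<longleftrightarrow> smooth_atlas A \<and>
     (\<forall>c\<in>A. \<forall>d\<in>A. \<forall>p\<in>fst c \<inter> fst d. \<forall>v.
        tangent_map c d id p (\<i> *s v) = \<i> *s tangent_map c d id p v)"

definition holomorphic_in_chart ::
  "('m, complex^'n) chart \<Rightarrow> 'm set \<Rightarrow> ('m \<Rightarrow> complex) \<Rightarrow> bool" where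
  "holomorphic_in_chart c S f \<longleftrightarrow> smooth_on (snd c ` (fst c \<inter> S)) (f \<circ> chart_inv c) \<and>
     (\<forall>x\<in>snd c ` (fst c \<inter> S). \<forall>v. frechet_derivative (f \<circ> chart_inv c) (at x) (\<i> *s v) =
        \<i> * frechet_derivative (f \<circ> chart_inv c) (at x) v)"

definition vector_field ::
  "('m::topological_space, 'e::euclidean_space) chart set \<Rightarrow> (('m, 'e) chart \<Rightarrow> 'm \<Rightarrow> 'e) \<Rightarrow> bool"
  where
  "vector_field A X \<longleftrightarrow>
     (\<forall>c\<in>A. smooth_on (snd c ` fst c) (X c \<circ> chart_inv c)) \<and>
     (\<forall>c\<in>A. \<forall>d\<in>A. \<forall>p\<in>fst c \<inter> fst d. X d p = tangent_map c d id p (X c p))"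

text \<open>
  The integral of a density on a compact manifold. \<open>\<sigma> c\<close> is the coefficient of the density
  relative to Lebesgue measure in the chart \<open>c\<close>. The manifold is cut along a finite cover by
  charts into disjoint Borel pieces; by the change of variables formula the value does not
  depend on the cover that is chosen.
\<close>

definition density_integral ::
  "('m, 'e::euclidean_space) chart set \<Rightarrow> (('m, 'e) chart \<Rightarrow> 'm \<Rightarrow> complex) \<Rightarrow> complex" where
  "density_integral A \<sigma> =
     (let cs = (SOME cs. set cs \<subseteq> A \<and> (\<Union>c\<in>set cs. fst c) = UNIV) in
      \<Sum>r<length cs. LINT y:snd (cs ! r) ` (fst (cs ! r) - (\<Union>q<r. fst (cs ! q)))|lborel.
        \<sigma> (cs ! r) (chart_inv (cs ! r) y))"


section \<open>Kaehler forms\<close>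

text \<open>
  \<open>\<omega> c p\<close> is the value of the real two-form at \<open>p\<close> on tangent vectors read in the chart \<open>c\<close>;
  the complex structure acts on the tangent vectors as multiplication by \<open>\<i>\<close>.
\<close>

type_synonym ('m, 'e) two_form = "('m, 'e) chart \<Rightarrow> 'm \<Rightarrow> 'e \<Rightarrow> 'e \<Rightarrow> real"

definition smooth_two_form ::
  "('m::topological_space, 'e::euclidean_space) chart set \<Rightarrow> ('m, 'e) two_form \<Rightarrow> bool" where
  "smooth_two_form A \<omega> \<longleftrightarrow>
     (\<forall>c\<in>A. \<forall>p\<in>fst c. bilinear (\<omega> c p) \<and> (\<forall>v. \<omega> c p v v = 0)) \<and>
     (\<forall>c\<in>A. \<forall>v w. smooth_on (snd c ` fst c) (\<lambda>x. \<omega> c (chart_inv c x) v w)) \<and>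
     (\<forall>c\<in>A. \<forall>d\<in>A. \<forall>p\<in>fst c \<inter> fst d. \<forall>v w.
        \<omega> c p v w = \<omega> d p (tangent_map c d id p v) (tangent_map c d id p w))"

definition closed_two_form ::
  "('m::topological_space, 'e::euclidean_space) chart set \<Rightarrow> ('m, 'e) two_form \<Rightarrow> bool" where
  "closed_two_form A \<omega> \<longleftrightarrow> (\<forall>c\<in>A. \<forall>x\<in>snd c ` fst c. \<forall>u v w.
     frechet_derivative (\<lambda>x. \<omega> c (chart_inv c x) v w) (at x) u +
     frechet_derivative (\<lambda>x. \<omega> c (chart_inv c x) w u) (at x) v +
     frechet_derivative (\<lambda>x. \<omega> c (chart_inv c x) u v) (at x) w = 0)"

definition kaehler_form ::
  "('m::topological_space, complex^'n) chart set \<Rightarrow> ('m, complex^'n) two_form \<Rightarrow> bool" where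
  "kaehler_form A \<omega> \<longleftrightarrow> smooth_two_form A \<omega> \<and> closed_two_form A \<omega> \<and>
     (\<forall>c\<in>A. \<forall>p\<in>fst c. \<forall>v w. \<omega> c p (\<i> *s v) (\<i> *s w) = \<omega> c p v w) \<and>
     (\<forall>c\<in>A. \<forall>p\<in>fst c. \<forall>v. v \<noteq> 0 \<longrightarrow> \<omega> c p v (\<i> *s v) > 0)"

definition compact_connected_kaehler ::
  "('m::t2_space, complex^'n) chart set \<Rightarrow> ('m, complex^'n) two_form \<Rightarrow> bool" where
  "compact_connected_kaehler A \<omega> \<longleftrightarrow>
     compact (UNIV :: 'm set) \<and> connected (UNIV :: 'm set) \<and> complex_atlas A \<and> kaehler_form A \<omega>"

text \<open>
  \<open>\<partial>/\<partial>x\<^sub>j\<close> is indexed by \<open>(j, False)\<close> and \<open>\<partial>/\<partial>y\<^sub>j\<close> by \<open>(j, True)\<close>. This basis is orthonormal for the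
  inner product of \<^typ>\<open>complex^'n\<close>, so the coefficient of a top degree form with respect to
  \<^const>\<open>lborel\<close> is its value on this basis.
\<close>

definition real_coord_vector :: "'n::finite \<times> bool \<Rightarrow> complex^'n" where
  "real_coord_vector jb = axis (fst jb) (if snd jb then \<i> else 1)"

text \<open>
  The coefficient of \<open>\<omega>\<^sup>n / n!\<close>: the \<open>n\<close>-th wedge power is the alternating sum over all
  permutations of the \<open>2n\<close> basis vectors, divided by \<open>2\<^sup>n\<close>.
\<close>

definition liouville ::
  "('m, complex^'n) two_form \<Rightarrow> ('m, complex^'n) chart \<Rightarrow> 'm \<Rightarrow> real" where
  "liouville \<omega> c p =
     (\<Sum>\<pi> | \<pi> permutes (UNIV :: ('n::finite \<times> bool) set). of_int (sign \<pi>) *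
        (\<Prod>j\<in>(UNIV :: 'n set). \<omega> c p (real_coord_vector (\<pi> (j, False))) (real_coord_vector (\<pi> (j, True)))))
     / (2 ^ CARD('n) * fact CARD('n))"

text \<open>
  For \<open>v\<close> in \<open>\<complex>\<^sup>n\<close> the vector \<open>\<Sum>\<^sub>a v\<^sub>a \<partial>/\<partial>z\<^sub>a\<close> of type \<open>(1,0)\<close> is \<open>(v - \<i> Jv)/2\<close>. The following is
  \<open>(1/\<i>) \<omega>(\<partial>\<^sub>v, conj \<partial>\<^sub>w)\<close> for the complex bilinear extension of \<open>\<omega>\<close>, where \<open>\<partial>\<^sub>v\<close>, \<open>\<partial>\<^sub>w\<close> are the
  \<open>(1,0)\<close>-vectors given by \<open>v\<close> and \<open>w\<close>.
\<close>

definition herm_form ::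
  "(complex^'n \<Rightarrow> complex^'n \<Rightarrow> real) \<Rightarrow> complex^'n \<Rightarrow> complex^'n \<Rightarrow> complex" where
  "herm_form B v w = (1/\<i>) *
     (complex_of_real (B v w) + \<i> * complex_of_real (B v (\<i> *s w))
      - \<i> * complex_of_real (B (\<i> *s v) w) + complex_of_real (B (\<i> *s v) (\<i> *s w))) / 4"

text \<open>The columns of \<open>P\<close> form a basis of \<open>T\<^sup>1\<^sup>,\<^sup>0\<close> orthonormal for \<^const>\<open>herm_form\<close>.\<close>

definition unitary_basis ::
  "(complex^'n \<Rightarrow> complex^'n \<Rightarrow> real) \<Rightarrow> complex^'n^'n \<Rightarrow> bool" where
  "unitary_basis B P \<longleftrightarrow>
     (\<forall>a b. herm_form B (column a P) (column b P) = (if a = b then 1 else 0))"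


section \<open>Hermitian line bundles\<close>

text \<open>
  A Hermitian line bundle is presented by local frames \<open>e\<^sub>i\<close> over the open sets \<open>bdom E i\<close>, with
  \<open>e\<^sub>j = btrans E i j \<cdot> e\<^sub>i\<close> and \<open>bweight E i = \<parallel>e\<^sub>i\<parallel>\<^sup>2\<close>. A section is the family of its coefficients
  \<open>s i\<close> in the frames \<open>e\<^sub>i\<close>. A connection is given by its one-forms:
  \<open>\<nabla> e\<^sub>i = bconn E i c \<otimes> e\<^sub>i\<close> in the chart \<open>c\<close>.
\<close>

record ('m, 'i) herm_bundle =
  bdom :: "'i \<Rightarrow> 'm set"
  btrans :: "'i \<Rightarrow> 'i \<Rightarrow> 'm \<Rightarrow> complex"
  bweight :: "'i \<Rightarrow> 'm \<Rightarrow> real"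

record ('m, 'i, 'e) conn_bundle = "('m, 'i) herm_bundle" +
  bconn :: "'i \<Rightarrow> ('m, 'e) chart \<Rightarrow> 'm \<Rightarrow> 'e \<Rightarrow> complex"

definition hermitian_bundle ::
  "('m::topological_space, 'e::euclidean_space) chart set \<Rightarrow> 'm set \<Rightarrow>
   ('m, 'i, 'z) herm_bundle_scheme \<Rightarrow> bool" where
  "hermitian_bundle A S E \<longleftrightarrow>
     (\<forall>i. open (bdom E i)) \<and> (\<Union>i. bdom E i) = S \<and>
     (\<forall>i j. \<forall>c\<in>A. smooth_on (snd c ` (fst c \<inter> bdom E i \<inter> bdom E j)) (btrans E i j \<circ> chart_inv c)) \<and>
     (\<forall>i. \<forall>p\<in>bdom E i. btrans E i i p = 1) \<and>
     (\<forall>i j. \<forall>p\<in>bdom E i \<inter> bdom E j. btrans E i j p \<noteq> 0) \<and>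
     (\<forall>i j l. \<forall>p\<in>bdom E i \<inter> bdom E j \<inter> bdom E l.
        btrans E i l p = btrans E i j p * btrans E j l p) \<and>
     (\<forall>i. \<forall>c\<in>A. smooth_on (snd c ` (fst c \<inter> bdom E i)) (bweight E i \<circ> chart_inv c)) \<and>
     (\<forall>i. \<forall>p\<in>bdom E i. bweight E i p > 0) \<and>
     (\<forall>i j. \<forall>p\<in>bdom E i \<inter> bdom E j.
        bweight E j p = bweight E i p * (cmod (btrans E i j p))\<^sup>2)"

text \<open>A smooth connection preserving the Hermitian metric.\<close>

definition unitary_connection ::
  "('m::topological_space, 'e::euclidean_space) chart set \<Rightarrow>
   ('m, 'i, 'e, 'z) conn_bundle_scheme \<Rightarrow> bool" where
  "unitary_connection A E \<longleftrightarrow>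
     (\<forall>i. \<forall>c\<in>A. \<forall>p\<in>fst c \<inter> bdom E i. linear (bconn E i c p)) \<and>
     (\<forall>i. \<forall>c\<in>A. \<forall>v. smooth_on (snd c ` (fst c \<inter> bdom E i)) (\<lambda>x. bconn E i c (chart_inv c x) v)) \<and>
     (\<forall>i. \<forall>c\<in>A. \<forall>d\<in>A. \<forall>p\<in>fst c \<inter> fst d \<inter> bdom E i. \<forall>v.
        bconn E i c p v = bconn E i d p (tangent_map c d id p v)) \<and>
     (\<forall>i j. \<forall>c\<in>A. \<forall>p\<in>fst c \<inter> bdom E i \<inter> bdom E j. \<forall>v.
        bconn E j c p v = bconn E i c p v +
          frechet_derivative (btrans E i j \<circ> chart_inv c) (at (snd c p)) v / btrans E i j p) \<and>
     (\<forall>i. \<forall>c\<in>A. \<forall>p\<in>fst c \<inter> bdom E i. \<forall>v.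
        frechet_derivative (bweight E i \<circ> chart_inv c) (at (snd c p)) v =
          2 * Re (bconn E i c p v) * bweight E i p)"

text \<open>
  A Hermitian holomorphic line bundle over \<open>S\<close>, given in holomorphic frames and with its Chern
  connection, i.e. the unitary connection whose forms in holomorphic frames have type \<open>(1,0)\<close>.
\<close>

definition hermitian_holomorphic_bundle ::
  "('m::topological_space, complex^'n) chart set \<Rightarrow> 'm set \<Rightarrow>
   ('m, 'i, complex^'n, 'z) conn_bundle_scheme \<Rightarrow> bool" where
  "hermitian_holomorphic_bundle A S E \<longleftrightarrow> hermitian_bundle A S E \<and> unitary_connection A E \<and>
     (\<forall>i j. \<forall>c\<in>A. holomorphic_in_chart c (bdom E i \<inter> bdom E j) (btrans E i j)) \<and>
     (\<forall>i. \<forall>c\<in>A. \<forall>p\<in>fst c \<inter> bdom E i. \<forall>v. bconn E i c p (\<i> *s v) = \<i> * bconn E i c p v)"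

text \<open>The frames of a prequantum bundle are only required to be smooth.\<close>

definition prequantum_bundle ::
  "('m::topological_space, complex^'n) chart set \<Rightarrow> ('m, complex^'n) two_form \<Rightarrow>
   ('m, 'i, complex^'n, 'z) conn_bundle_scheme \<Rightarrow> bool" where
  "prequantum_bundle A \<omega> L \<longleftrightarrow> hermitian_bundle A UNIV L \<and> unitary_connection A L \<and>
     (\<forall>i. \<forall>c\<in>A. \<forall>x\<in>snd c ` (fst c \<inter> bdom L i). \<forall>v w.
        frechet_derivative (\<lambda>x. bconn L i c (chart_inv c x) w) (at x) v -
        frechet_derivative (\<lambda>x. bconn L i c (chart_inv c x) v) (at x) w =
          (1/\<i>) * complex_of_real (\<omega> c (chart_inv c x) v w))"

definition bundle_tensor ::
  "('m, 'i, 'e) conn_bundle \<Rightarrow> ('m, 'j, 'e) conn_bundle \<Rightarrow> ('m, 'i \<times> 'j, 'e) conn_bundle" where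
  "bundle_tensor E E' =
     \<lparr>bdom = (\<lambda>(i, j). bdom E i \<inter> bdom E' j),
      btrans = (\<lambda>(i, j) (i', j') p. btrans E i i' p * btrans E' j j' p),
      bweight = (\<lambda>(i, j) p. bweight E i p * bweight E' j p),
      bconn = (\<lambda>(i, j) c p v. bconn E i c p v + bconn E' j c p v)\<rparr>"

definition bundle_power ::
  "('m, 'i, 'e) conn_bundle \<Rightarrow> nat \<Rightarrow> ('m, 'i, 'e) conn_bundle" where
  "bundle_power E k =
     \<lparr>bdom = bdom E,
      btrans = (\<lambda>i j p. btrans E i j p ^ k),
      bweight = (\<lambda>i p. bweight E i p ^ k),
      bconn = (\<lambda>i c p v. of_nat k * bconn E i c p v)\<rparr>"

definition bundle_pullback ::
  "('m, 'e::euclidean_space) chart set \<Rightarrow> ('g \<Rightarrow> 'm) \<Rightarrow>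
   ('m, 'i, 'e) conn_bundle \<Rightarrow> ('g, 'i, 'f::euclidean_space) conn_bundle" where
  "bundle_pullback A \<iota> E =
     \<lparr>bdom = (\<lambda>i. \<iota> -` bdom E i),
      btrans = (\<lambda>i j p. btrans E i j (\<iota> p)),
      bweight = (\<lambda>i p. bweight E i (\<iota> p)),
      bconn = (\<lambda>i d p v. let c = (SOME c. c \<in> A \<and> \<iota> p \<in> fst c) in
                 bconn E i c (\<iota> p) (tangent_map d c \<iota> p v))\<rparr>"

text \<open>
  An isomorphism of Hermitian holomorphic line bundles \<open>E \<rightarrow> E'\<close> over \<open>S\<close>, both given in
  holomorphic frames: it sends the frame \<open>e\<^sub>i\<close> to \<open>a j i \<cdot> e'\<^sub>j\<close>.
\<close>

definition bundle_iso ::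
  "('m::topological_space, complex^'n) chart set \<Rightarrow> 'm set \<Rightarrow> ('m, 'i, 'z) herm_bundle_scheme \<Rightarrow>
   ('m, 'j, 'y) herm_bundle_scheme \<Rightarrow> ('j \<Rightarrow> 'i \<Rightarrow> 'm \<Rightarrow> complex) \<Rightarrow> bool" where
  "bundle_iso A S E E' a \<longleftrightarrow>
     (\<forall>i j. \<forall>c\<in>A. holomorphic_in_chart c (S \<inter> bdom E i \<inter> bdom E' j) (a j i)) \<and>
     (\<forall>i j. \<forall>p\<in>S \<inter> bdom E i \<inter> bdom E' j.
        a j i p \<noteq> 0 \<and> bweight E i p = bweight E' j p * (cmod (a j i p))\<^sup>2) \<and>
     (\<forall>i i' j j'. \<forall>p\<in>S \<inter> bdom E i \<inter> bdom E i' \<inter> bdom E' j \<inter> bdom E' j'.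
        a j' i' p = btrans E' j' j p * a j i p * btrans E i i' p)"


section \<open>Sections\<close>

type_synonym ('m, 'i) bsec = "'i \<Rightarrow> 'm \<Rightarrow> complex"

definition smooth_section ::
  "('m::topological_space, 'e::euclidean_space) chart set \<Rightarrow> ('m, 'i, 'z) herm_bundle_scheme \<Rightarrow>
   'm set \<Rightarrow> ('m, 'i) bsec \<Rightarrow> bool" where
  "smooth_section A E S s \<longleftrightarrow>
     (\<forall>i j. \<forall>p\<in>S \<inter> bdom E i \<inter> bdom E j. s i p = btrans E i j p * s j p) \<and>
     (\<forall>i. \<forall>c\<in>A. smooth_on (snd c ` (fst c \<inter> (S \<inter> bdom E i))) (s i \<circ> chart_inv c))"

definition section_norm ::
  "('m, 'i, 'z) herm_bundle_scheme \<Rightarrow> ('m, 'i) bsec \<Rightarrow> 'm \<Rightarrow> real" where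
  "section_norm E s p = (let i = (SOME i. p \<in> bdom E i) in sqrt (bweight E i p) * cmod (s i p))"

definition covariant_derivative ::
  "('m, 'i, 'e::euclidean_space, 'z) conn_bundle_scheme \<Rightarrow> ('m, 'i) bsec \<Rightarrow>
   'i \<Rightarrow> ('m, 'e) chart \<Rightarrow> 'm \<Rightarrow> 'e \<Rightarrow> complex" where
  "covariant_derivative E s i c p v =
     frechet_derivative (s i \<circ> chart_inv c) (at (snd c p)) v + bconn E i c p v * s i p"

text \<open>The \<open>(0,1)\<close>-part of the covariant derivative, evaluated on the real tangent vector \<open>v\<close>.\<close>

definition dbar ::
  "('m, 'i, complex^'n, 'z) conn_bundle_scheme \<Rightarrow> ('m, 'i) bsec \<Rightarrow>
   'i \<Rightarrow> ('m, complex^'n) chart \<Rightarrow> 'm \<Rightarrow> complex^'n \<Rightarrow> complex" where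
  "dbar E s i c p v =
     (covariant_derivative E s i c p v + \<i> * covariant_derivative E s i c p (\<i> *s v)) / 2"

definition holomorphic_section ::
  "('m::topological_space, complex^'n) chart set \<Rightarrow>
   ('m, 'i, complex^'n, 'z) conn_bundle_scheme \<Rightarrow> ('m, 'i) bsec \<Rightarrow> bool" where
  "holomorphic_section A E s \<longleftrightarrow> smooth_section A E UNIV s \<and>
     (\<forall>i. \<forall>c\<in>A. \<forall>p\<in>fst c \<inter> bdom E i. \<forall>v. dbar E s i c p v = 0)"

text \<open>\<open>\<partial>\<close>-bar of the section \<open>s\<close> over \<open>U\<close> vanishes to every order along \<open>Z\<close>.\<close>

definition dbar_flat_along ::
  "('m::topological_space, complex^'n) chart set \<Rightarrow>
   ('m, 'i, complex^'n, 'z) conn_bundle_scheme \<Rightarrow> 'm set \<Rightarrow> 'm set \<Rightarrow> ('m, 'i) bsec \<Rightarrow> bool" where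
  "dbar_flat_along A E U Z s \<longleftrightarrow>
     (\<forall>i. \<forall>c\<in>A. \<forall>p\<in>fst c \<inter> bdom E i \<inter> U \<inter> Z. \<forall>v vs.
        iter_deriv vs (\<lambda>x. dbar E s i c (chart_inv c x) v) (snd c p) = 0)"

definition flat_unitary_section ::
  "('m::topological_space, 'e::euclidean_space) chart set \<Rightarrow>
   ('m, 'i, 'e, 'z) conn_bundle_scheme \<Rightarrow> 'm set \<Rightarrow> ('m, 'i) bsec \<Rightarrow> bool" where
  "flat_unitary_section A E S s \<longleftrightarrow> smooth_section A E S s \<and>
     (\<forall>i. \<forall>c\<in>A. \<forall>p\<in>fst c \<inter> bdom E i \<inter> S. \<forall>v. covariant_derivative E s i c p v = 0) \<and>
     (\<forall>p\<in>S. section_norm E s p = 1)"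

definition section_tensor ::
  "('m, 'i) bsec \<Rightarrow> ('m, 'j) bsec \<Rightarrow> ('m, 'i \<times> 'j) bsec" where
  "section_tensor s t = (\<lambda>(i, j) p. s i p * t j p)"

definition section_power :: "('m, 'i) bsec \<Rightarrow> nat \<Rightarrow> ('m, 'i) bsec" where
  "section_power s k = (\<lambda>i p. s i p ^ k)"

definition covariant_along ::
  "('m, 'e::euclidean_space) chart set \<Rightarrow> ('m, 'i, 'e, 'z) conn_bundle_scheme \<Rightarrow>
   (('m, 'e) chart \<Rightarrow> 'm \<Rightarrow> 'e) \<Rightarrow> ('m, 'i) bsec \<Rightarrow> ('m, 'i) bsec" where
  "covariant_along A E X s =
     (\<lambda>i p. let c = (SOME c. c \<in> A \<and> p \<in> fst c) in covariant_derivative E s i c p (X c p))"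

text \<open>The exponent \<open>N\<close> may depend on the number of derivatives.\<close>

definition admissible ::
  "('m::topological_space, 'e::euclidean_space) chart set \<Rightarrow>
   (nat \<Rightarrow> ('m, 'i, 'e, 'z) conn_bundle_scheme) \<Rightarrow> (nat \<Rightarrow> ('m, 'i) bsec) \<Rightarrow> bool" where
  "admissible A E \<Psi> \<longleftrightarrow> (\<forall>Xs. (\<forall>X\<in>set Xs. vector_field A X) \<longrightarrow>
     (\<exists>N C. \<forall>k\<ge>1. \<forall>p.
        section_norm (E k) (foldr (covariant_along A (E k)) Xs (\<Psi> k)) p \<le> C * real k ^ N))"

text \<open>\<open>gt k \<sim> \<Sum>\<^sub>l k\<^sup>-\<^sup>l gl l\<close> in the \<open>C\<^sup>\<infinity>\<close> topology over \<open>U\<close> (uniformly on compact sets with all derivatives).\<close>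

definition asymptotic_expansion ::
  "('m::topological_space, 'e::euclidean_space) chart set \<Rightarrow> ('m, 'i, 'z) herm_bundle_scheme \<Rightarrow>
   'm set \<Rightarrow> (nat \<Rightarrow> ('m, 'i) bsec) \<Rightarrow> (nat \<Rightarrow> ('m, 'i) bsec) \<Rightarrow> bool" where
  "asymptotic_expansion A E U gt gl \<longleftrightarrow>
     (\<forall>N i vs. \<forall>c\<in>A. \<forall>C. compact C \<and> C \<subseteq> fst c \<inter> bdom E i \<inter> U \<longrightarrow>
        (\<exists>B. \<forall>k\<ge>1. \<forall>p\<in>C.
           cmod (iter_deriv vs ((\<lambda>q. gt k i q - (\<Sum>l<N. gl l i q / of_nat k ^ l)) \<circ> chart_inv c) (snd c p))
             \<le> B / real k ^ N))"


section \<open>Lagrangian sections\<close>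

definition closed_lagrangian_embedding ::
  "('m::t2_space, complex^'n) chart set \<Rightarrow> ('m, complex^'n) two_form \<Rightarrow>
   ('g::t2_space, real^'n) chart set \<Rightarrow> ('g \<Rightarrow> 'm) \<Rightarrow> bool" where
  "closed_lagrangian_embedding A \<omega> B \<iota> \<longleftrightarrow>
     compact (UNIV :: 'g set) \<and> smooth_atlas B \<and> smooth_map B A \<iota> \<and>
     (\<exists>h. homeomorphism UNIV (range \<iota>) \<iota> h) \<and>
     (\<forall>d\<in>B. \<forall>c\<in>A. \<forall>p\<in>fst d \<inter> \<iota> -` fst c.
        inj (tangent_map d c \<iota> p) \<and>
        (\<forall>v w. \<omega> c (\<iota> p) (tangent_map d c \<iota> p v) (tangent_map d c \<iota> p w) = 0))"

abbreviation quantum_bundle ::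
  "('m, 'a, 'e) conn_bundle \<Rightarrow> ('m, 'b, 'e) conn_bundle \<Rightarrow> nat \<Rightarrow> ('m, 'a \<times> 'b, 'e) conn_bundle" where
  "quantum_bundle L K k \<equiv> bundle_tensor (bundle_power L k) K"

text \<open>\<open>g l\<close> is the coefficient of \<open>\<hbar>\<^sup>l\<close> in the symbol; in particular \<open>g 0\<close> is the principal symbol.\<close>

definition lagrangian_section ::
  "('m::t2_space, complex^'n) chart set \<Rightarrow> ('m, 'a, complex^'n) conn_bundle \<Rightarrow>
   ('m, 'b, complex^'n) conn_bundle \<Rightarrow> ('g::t2_space, real^'n) chart set \<Rightarrow> ('g \<Rightarrow> 'm) \<Rightarrow>
   'm set \<Rightarrow> 'm set \<Rightarrow> ('g, 'a) bsec \<Rightarrow> (nat \<Rightarrow> ('g, 'b) bsec) \<Rightarrow>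
   (nat \<Rightarrow> ('m, 'a \<times> 'b) bsec) \<Rightarrow> bool" where
  "lagrangian_section A L K B \<iota> U V t g \<Psi> \<longleftrightarrow>
     (\<forall>k\<ge>1. holomorphic_section A (quantum_bundle L K k) (\<Psi> k)) \<and>
     admissible A (quantum_bundle L K) \<Psi> \<and>
     (\<forall>l. smooth_section B (bundle_pullback A \<iota> K :: ('g, 'b, real^'n) conn_bundle) (\<iota> -` U) (g l)) \<and>
     (\<exists>F gt gl.
        smooth_section A L U F \<and>
        (\<forall>i. \<forall>p\<in>\<iota> -` (U \<inter> bdom L i). F i (\<iota> p) = t i p) \<and>
        dbar_flat_along A L U (range \<iota>) F \<and>
        (\<forall>x\<in>U - range \<iota>. section_norm L F x < 1) \<and>
        (\<forall>k\<ge>1. smooth_section A K U (gt k)) \<and>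
        (\<forall>l. smooth_section A K U (gl l)) \<and>
        asymptotic_expansion A K U gt gl \<and>
        (\<forall>l j. \<forall>p\<in>\<iota> -` (U \<inter> bdom K j). gl l j (\<iota> p) = g l j p) \<and>
        (\<forall>l. dbar_flat_along A K U (range \<iota>) (gl l)) \<and>
        (\<forall>N. \<exists>C. \<forall>k\<ge>1. \<forall>x\<in>V.
           section_norm (quantum_bundle L K k)
             (\<lambda>ij p. \<Psi> k ij p - of_real ((real k / (2 * pi)) powr (real CARD('n) / 4)) *
                section_tensor (section_power F k) (gt k) ij p) x
           \<le> C / real k ^ N))"


section \<open>Half-forms\<close>

text \<open>
  \<open>\<Lambda>\<^sup>n\<^sup>,\<^sup>0 T\<^sup>*M\<close> with the frames \<open>dz\<^sub>1 \<and> \<dots> \<and> dz\<^sub>n\<close> of the charts. The norm of a form is the absolute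
  value it takes on a unitary basis of \<open>T\<^sup>1\<^sup>,\<^sup>0\<close>, which is the metric for which
  \<open>\<theta>\<^sup>1 \<and> \<dots> \<and> \<theta>\<^sup>n\<close> has norm 1 when \<open>(\<theta>\<^sup>i)\<close> is dual to such a basis.
\<close>

definition canonical_bundle ::
  "('m, complex^'n) chart set \<Rightarrow> ('m, complex^'n) two_form \<Rightarrow>
   ('m, ('m, complex^'n) chart) herm_bundle" where
  "canonical_bundle A \<omega> =
     \<lparr>bdom = (\<lambda>c. if c \<in> A then fst c else {}),
      btrans = (\<lambda>c d p. det (\<chi> a b. tangent_map c d id p (axis b 1) $ a)),
      bweight = (\<lambda>c p. (cmod (det (SOME P. unitary_basis (\<omega> c p) P)))\<^sup>2)\<rparr>"

text \<open>\<open>\<phi> c j\<close> is the coefficient of \<open>\<phi>(f\<^sub>j \<otimes> f\<^sub>j)\<close> relative to \<open>dz\<^sub>1 \<and> \<dots> \<and> dz\<^sub>n\<close> in the chart \<open>c\<close>.\<close>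

definition half_form_bundle ::
  "('m::t2_space, complex^'n) chart set \<Rightarrow> ('m, complex^'n) two_form \<Rightarrow> 'm set \<Rightarrow>
   ('m, 'd, complex^'n) conn_bundle \<Rightarrow>
   (('m, complex^'n) chart \<Rightarrow> 'd \<Rightarrow> 'm \<Rightarrow> complex) \<Rightarrow> bool" where
  "half_form_bundle A \<omega> U \<delta> \<phi> \<longleftrightarrow> hermitian_holomorphic_bundle A U \<delta> \<and>
     bundle_iso A U (bundle_power \<delta> 2) (canonical_bundle A \<omega>) \<phi>"

text \<open>
  \<open>\<phi>\<^sub>\<Gamma>((z f\<^sub>j)\<^sup>\<otimes>\<^sup>2)\<close> at \<open>p\<close>, i.e. the value of the pullback to \<open>\<Gamma>\<close> of the corresponding \<open>n\<close>-form on the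
  coordinate basis of the chart \<open>d\<close> of \<open>\<Gamma>\<close>.
\<close>

definition phi_Gamma ::
  "('g \<Rightarrow> 'm) \<Rightarrow> (('m, complex^'n) chart \<Rightarrow> 'd \<Rightarrow> 'm \<Rightarrow> complex) \<Rightarrow> ('m, complex^'n) chart \<Rightarrow> 'd \<Rightarrow>
   ('g, real^'n) chart \<Rightarrow> 'g \<Rightarrow> complex \<Rightarrow> complex" where
  "phi_Gamma \<iota> \<phi> c j d p z =
     z\<^sup>2 * \<phi> c j (\<iota> p) * det (\<chi> a b. tangent_map d c \<iota> p (axis b 1) $ a)"

text \<open>
  The density \<open>m(s)\<close> of a section \<open>s\<close> of \<open>\<iota>\<^sup>*K\<close>, read in the chart \<open>d\<close> of \<open>\<Gamma>\<close>. Here \<open>\<tau>\<close> is the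
  identification \<open>L\<^sub>1 \<otimes> \<delta> \<rightarrow> K\<close>, and at \<open>p\<close> the value of \<open>s\<close> is decomposed as
  \<open>u \<otimes> v\<close> with \<open>u = (s l p / \<tau> l (i, j) (\<iota> p)) e\<^sub>i\<close> and \<open>v = f\<^sub>j\<close>. The frames and the chart of \<open>M\<close>
  at \<open>\<iota> p\<close> are arbitrary and the result does not depend on them.
\<close>

definition m_density ::
  "('m, complex^'n) chart set \<Rightarrow> ('g \<Rightarrow> 'm) \<Rightarrow> ('m, 'b, complex^'n) conn_bundle \<Rightarrow>
   ('m, 'c, complex^'n) conn_bundle \<Rightarrow> ('m, 'd, complex^'n) conn_bundle \<Rightarrow>
   (('m, complex^'n) chart \<Rightarrow> 'd \<Rightarrow> 'm \<Rightarrow> complex) \<Rightarrow> ('b \<Rightarrow> 'c \<times> 'd \<Rightarrow> 'm \<Rightarrow> complex) \<Rightarrow>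
   ('g, 'b) bsec \<Rightarrow> ('g, real^'n) chart \<Rightarrow> 'g \<Rightarrow> real" where
  "m_density A \<iota> K L1 \<delta> \<phi> \<tau> s d p =
     (let c = (SOME c. c \<in> A \<and> \<iota> p \<in> fst c);
          l = (SOME l. \<iota> p \<in> bdom K l);
          i = (SOME i. \<iota> p \<in> bdom L1 i);
          j = (SOME j. \<iota> p \<in> bdom \<delta> j)
      in bweight L1 i (\<iota> p) * (cmod (s l p / \<tau> l (i, j) (\<iota> p)))\<^sup>2 * cmod (phi_Gamma \<iota> \<phi> c j d p 1))"

end

theory Submission
  imports Defs "HOL-Probability.Probability" "HOL-Combinatorics.Permutations"
begin

text \<open>
  Write \<open>|F|\<^sup>2 = e\<^sup>-\<^sup>\<phi>\<close>. Up to \<open>O(1/k)\<close> the integrand is \<open>(k/2\<pi>)\<^sup>n\<^sup>/\<^sup>2 e\<^sup>-\<^sup>k\<^sup>\<phi> |g\<^sub>0|\<^sup>2 \<mu>\<^sub>M\<close>, and \<open>\<phi>\<close>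
  is positive off \<open>\<Gamma>\<close>, so everything happens near \<open>\<Gamma>\<close>. There \<open>F\<close> is holomorphic to infinite order and
  \<open>|F| = 1\<close> is maximal, so its logarithmic covariant derivative \<open>\<alpha>\<close> vanishes along \<open>\<Gamma>\<close>; as \<open>d\<alpha>\<close> is the
  curvature, the Hessian of \<open>\<phi>\<close> in the directions \<open>i T\<Gamma>\<close> is \<open>2 \<omega>(v, i v)\<close>. In the coordinates
  \<open>y + i s \<mapsto> f(y) + i f'(y) s\<close>, with \<open>f\<close> a parametrization of \<open>\<Gamma>\<close>, the method of Laplace in \<open>s\<close> gives
  an integral over \<open>\<Gamma>\<close>. If \<open>Q\<close> maps the standard basis to a basis of \<open>T\<Gamma>\<close> orthonormal for \<open>\<omega>(v, i v)\<close>,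
  its density is \<open>|g\<^sub>0|\<^sup>2 / (2\<^sup>n\<^sup>/\<^sup>2 |det Q|)\<close>. This is \<open>m(g\<^sub>0)\<close>: multiplied by \<open>\<surd>2\<close>, such a basis becomes
  unitary for the metric that normalizes \<open>\<Lambda>\<^sup>n\<^sup>,\<^sup>0\<close>.
\<close>

text \<open>The constant in the density has two sources. On the fibre over y the phase is h(s) =
  omega(f' s, i f' s) to second order, so integrating exp(-k h) yields (pi/k)^(n/2) |det Q|, and the
  prefactor (k/2pi)^(n/2) leaves 2^(-n/2). The Liouville coefficient times the Jacobian of the
  coordinates is 1/|det Q|^2, because an orthonormal basis of T Gamma together with its multiples by
  i is a Darboux basis; one factor |det Q| cancels. The frame Q is chosen point by point and need
  not be continuous in y, but only |det Q| enters the integrals, and the same identity determines it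
  from omega and f'. The coordinates are affine in s, so the Hessian of the phase along a fibre is
  read off without correction terms. The other obstacle is that \<open>density_integral\<close>
  chooses its own cover: densities are treated in one chart each and then added. Since the claim is
  linear in the test function, cutoffs suffice for this, and C^2 cutoffs are enough, because the
  amplitude is expanded to second order only.\<close>

section \<open>Finitely differentiable functions\<close>

text \<open>C^n on an open set through iterated directional derivatives, so that no operator-valued
  derivative is needed. A finite order is kept because the cutoffs below are only C^2; the phase is
  expanded with order 4, the amplitude with order 2.\<close>

fun Ck :: "nat \<Rightarrow> 'a::euclidean_space set \<Rightarrow> ('a \<Rightarrow> 'b::real_normed_vector) \<Rightarrow> bool" where
  "Ck 0 S f \<longleftrightarrow> continuous_on S f"
| "Ck (Suc n) S f \<longleftrightarrow> (\<forall>x\<in>S. f differentiable at x) \<and>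
     (\<forall>v. Ck n S (\<lambda>x. frechet_derivative f (at x) v))"

lemma smooth_on_iter_deriv: "smooth_on S f \<Longrightarrow> smooth_on S (iter_deriv vs f)"
proof -
  have "iter_deriv ws (iter_deriv vs f) = iter_deriv (ws @ vs) f" for ws
    by (induction ws) auto
  then show "smooth_on S f \<Longrightarrow> smooth_on S (iter_deriv vs f)"
    by (auto simp: smooth_on_def)
qed

lemma smooth_on_imp_Ck: "smooth_on S f \<Longrightarrow> Ck n S f"
proof (induction n arbitrary: f)
  case 0
  then show ?case
    by (auto simp: smooth_on_def intro!: differentiable_imp_continuous_on
        simp: differentiable_on_def differentiable_at_withinI dest: spec[of _ "[]"])
next
  case (Suc n)
  have "smooth_on S (iter_deriv [v] f)" for v
    using Suc.prems by (rule smooth_on_iter_deriv)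
  then have "Ck n S (\<lambda>x. frechet_derivative f (at x) v)" for v
    using Suc.IH[of "iter_deriv [v] f"] by simp
  moreover have "\<forall>x\<in>S. f differentiable at x"
    using Suc.prems by (auto simp: smooth_on_def dest: spec[of _ "[]"])
  ultimately show ?case by simp
qed

lemma Ck_Suc_imp: "Ck (Suc n) S f \<Longrightarrow> Ck n S f"
proof (induction n arbitrary: f)
  case 0
  then show ?case
    by (auto intro!: differentiable_imp_continuous_on
        simp: differentiable_on_def differentiable_at_withinI)
qed auto

lemma Ck_mono: "Ck n S f \<Longrightarrow> m \<le> n \<Longrightarrow> Ck m S f"
  by (induction n) (auto simp del: Ck.simps simp: le_Suc_eq dest: Ck_Suc_imp)

lemma Ck_subset: "Ck n S f \<Longrightarrow> T \<subseteq> S \<Longrightarrow> Ck n T f"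
  by (induction n arbitrary: f) (auto intro: continuous_on_subset)

lemma Ck_imp_continuous_on: "Ck n S f \<Longrightarrow> continuous_on S f"
  using Ck_mono[of n S f 0] by simp

lemma Ck_Suc_has_derivative:
  "Ck (Suc n) S f \<Longrightarrow> x \<in> S \<Longrightarrow> (f has_derivative frechet_derivative f (at x)) (at x)"
  by (simp add: frechet_derivative_works)

lemma Ck_Suc_derivative: "Ck (Suc n) S f \<Longrightarrow> Ck n S (\<lambda>x. frechet_derivative f (at x) v)"
  by simp

declare Ck.simps(2) [simp del]

lemma frechet_derivative_cong_open:
  assumes "open S" "x \<in> S" "\<And>y. y \<in> S \<Longrightarrow> f y = g y"
  shows "frechet_derivative f (at x) = frechet_derivative g (at x)"
proof -
  have "(f has_derivative D) (at x) \<longleftrightarrow> (g has_derivative D) (at x)" for D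
    using has_derivative_transform_within_open[of f D x UNIV S g]
      has_derivative_transform_within_open[of g D x UNIV S f] assms by auto
  then show ?thesis by (simp add: frechet_derivative_def)
qed

lemma differentiable_cong_open:
  assumes "open S" "x \<in> S" "\<And>y. y \<in> S \<Longrightarrow> f y = g y"
  shows "f differentiable at x \<longleftrightarrow> g differentiable at x"
  unfolding differentiable_def
  using has_derivative_transform_within_open[of f _ x UNIV S g]
      has_derivative_transform_within_open[of g _ x UNIV S f] assms by metis

lemma Ck_cong:
  assumes "open S" "\<And>x. x \<in> S \<Longrightarrow> f x = g x" "Ck n S f"
  shows "Ck n S g"
  using assms(2,3)
proof (induction n arbitrary: f g)
  case 0
  then show ?case using continuous_on_cong[of S S f g] by simp
next
  case (Suc n)
  have "Ck n S (\<lambda>x. frechet_derivative g (at x) v)" for v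
    by (rule Suc.IH[of "\<lambda>x. frechet_derivative f (at x) v"])
       (use Suc.prems frechet_derivative_cong_open[OF assms(1) _ Suc.prems(1)] Ck_Suc_derivative in auto)
  moreover have "\<forall>x\<in>S. g differentiable at x"
    using Suc.prems differentiable_cong_open[OF assms(1)] by (metis Ck.simps(2))
  ultimately show ?case by (simp add: Ck.simps(2))
qed

text \<open>The working introduction rule: it accepts any explicit formula for the derivative, which
  is then identified with \<open>frechet_derivative\<close> by uniqueness.\<close>

lemma Ck_SucI:
  assumes "open S" "\<And>x. x \<in> S \<Longrightarrow> (f has_derivative D x) (at x)" "\<And>v. Ck n S (\<lambda>x. D x v)"
  shows "Ck (Suc n) S f"
proof -
  have "frechet_derivative f (at x) = D x" if "x \<in> S" for x
    using assms(2)[OF that] frechet_derivative_at by metis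
  then have "Ck n S (\<lambda>x. frechet_derivative f (at x) v)" for v
    using Ck_cong[OF assms(1) _ assms(3)[of v]] by simp
  with assms(2) show ?thesis by (auto simp: differentiable_def Ck.simps(2))
qed

lemma Ck_Un:
  assumes "open S" "open T" "Ck n S f" "Ck n T f"
  shows "Ck n (S \<union> T) f"
  using assms(3,4)
  by (induction n arbitrary: f) (use assms in \<open>auto intro: continuous_on_open_Un simp: Ck.simps(2)\<close>)

lemma Ck_const: "open S \<Longrightarrow> Ck n S (\<lambda>x. c)"
proof (induction n arbitrary: c)
  case (Suc n)
  show ?case by (rule Ck_SucI[where D="\<lambda>x v. 0"]) (use Suc in auto)
qed auto

lemma Ck_bounded_linear: "open S \<Longrightarrow> bounded_linear f \<Longrightarrow> Ck n S f"
proof (induction n)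
  case 0 then show ?case by (simp add: linear_continuous_on)
next
  case (Suc n)
  show ?case by (rule Ck_SucI[where D="\<lambda>x. f"])
     (use Suc in \<open>auto intro: bounded_linear_imp_has_derivative Ck_const\<close>)
qed

lemma Ck_add: "open S \<Longrightarrow> Ck n S f \<Longrightarrow> Ck n S g \<Longrightarrow> Ck n S (\<lambda>x. f x + g x)"
proof (induction n arbitrary: f g)
  case 0 then show ?case by (simp add: continuous_on_add)
next
  case (Suc n)
  show ?case
    by (rule Ck_SucI[where D="\<lambda>x v. frechet_derivative f (at x) v + frechet_derivative g (at x) v"])
      (use Suc in \<open>auto intro!: has_derivative_add Ck_Suc_has_derivative dest: Ck_Suc_derivative\<close>)
qed

lemma Ck_sum:
  "open S \<Longrightarrow> (\<And>i. i \<in> I \<Longrightarrow> Ck n S (f i)) \<Longrightarrow> Ck n S (\<lambda>x. \<Sum>i\<in>I. f i x)"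
  by (induction I rule: infinite_finite_induct) (auto intro: Ck_const Ck_add)

lemma Ck_bilinear:
  assumes b: "bounded_bilinear b"
  shows "open S \<Longrightarrow> Ck n S f \<Longrightarrow> Ck n S g \<Longrightarrow> Ck n S (\<lambda>x. b (f x) (g x))"
proof (induction n arbitrary: f g)
  case 0 then show ?case by (simp add: bounded_bilinear.continuous_on[OF b])
next
  case (Suc n)
  show ?case
  proof (rule Ck_SucI[where D="\<lambda>x v. b (f x) (frechet_derivative g (at x) v) +
        b (frechet_derivative f (at x) v) (g x)"])
    fix x assume "x \<in> S"
    then show "((\<lambda>x. b (f x) (g x)) has_derivative (\<lambda>v. b (f x) (frechet_derivative g (at x) v) +
        b (frechet_derivative f (at x) v) (g x))) (at x)"
      using Suc.prems by (intro bounded_bilinear.FDERIV[OF b] Ck_Suc_has_derivative)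
  next
    fix v
    have "Ck n S f" "Ck n S g" "Ck n S (\<lambda>x. frechet_derivative f (at x) v)"
      "Ck n S (\<lambda>x. frechet_derivative g (at x) v)"
      using Suc.prems by (auto dest: Ck_Suc_imp Ck_Suc_derivative)
    then show "Ck n S (\<lambda>x. b (f x) (frechet_derivative g (at x) v) +
        b (frechet_derivative f (at x) v) (g x))"
      using Suc.prems by (intro Ck_add Suc.IH)
  qed (use Suc.prems in simp)
qed

lemmas Ck_scaleR = Ck_bilinear[OF bounded_bilinear_scaleR]
lemmas Ck_mult = Ck_bilinear[OF bounded_bilinear_mult]
lemmas Ck_inner = Ck_bilinear[OF bounded_bilinear_inner]

lemma Ck_prod:
  fixes f :: "_ \<Rightarrow> _ \<Rightarrow> 'b::{real_normed_field}"
  shows "open S \<Longrightarrow> (\<And>i. i \<in> I \<Longrightarrow> Ck n S (f i)) \<Longrightarrow> Ck n S (\<lambda>x. \<Prod>i\<in>I. f i x)"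
  by (induction I rule: infinite_finite_induct) (auto intro: Ck_const Ck_mult)

lemma Ck_power:
  fixes f :: "_ \<Rightarrow> 'b::{real_normed_field}"
  shows "open S \<Longrightarrow> Ck n S f \<Longrightarrow> Ck n S (\<lambda>x. f x ^ k)"
  by (induction k) (auto intro: Ck_const Ck_mult)

lemma Ck_linear_compose:
  assumes "open S" "bounded_linear l" "Ck n S f"
  shows "Ck n S (\<lambda>x. l (f x))"
  using assms(3)
proof (induction n arbitrary: f)
  case 0 then show ?case
    using bounded_linear.continuous_on[OF assms(2), of S f] by simp
next
  case (Suc n)
  show ?case
    by (rule Ck_SucI[where D="\<lambda>x v. l (frechet_derivative f (at x) v)"])
      (use Suc assms bounded_linear.has_derivative[OF assms(2)] Ck_Suc_has_derivative Ck_Suc_derivative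
        in \<open>blast+\<close>)
qed

lemma Ck_compose:
  fixes g :: "'a::euclidean_space \<Rightarrow> 'b::euclidean_space"
  assumes "open S" "open T"
  shows "Ck n T f \<Longrightarrow> Ck n S g \<Longrightarrow> g ` S \<subseteq> T \<Longrightarrow> Ck n S (\<lambda>x. f (g x))"
proof (induction n arbitrary: f g)
  case 0 then show ?case by (auto intro: continuous_on_compose2)
next
  case (Suc n)
  let ?D = "\<lambda>x v. frechet_derivative f (at (g x)) (frechet_derivative g (at x) v)"
  show ?case
  proof (rule Ck_SucI[where D="?D"])
    fix x assume x: "x \<in> S"
    show "((\<lambda>x. f (g x)) has_derivative ?D x) (at x)"
      using has_derivative_compose[OF Ck_Suc_has_derivative[OF Suc.prems(2) x]
          Ck_Suc_has_derivative[OF Suc.prems(1)]] x Suc.prems by auto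
  next
    fix v
    \<comment> \<open>The direction fed to the derivative of \<open>f\<close> varies with x, while
      the induction hypothesis handles fixed directions; expanding it in the basis separates the
      two.\<close>
    have "Ck n S (\<lambda>x. \<Sum>b\<in>Basis. (frechet_derivative g (at x) v \<bullet> b) *\<^sub>R
             frechet_derivative f (at (g x)) b)"
    proof (intro Ck_sum Ck_scaleR Ck_inner Ck_const assms)
      show "Ck n S (\<lambda>x. frechet_derivative g (at x) v)" using Suc.prems by (auto dest: Ck_Suc_derivative)
      show "Ck n S (\<lambda>x. frechet_derivative f (at (g x)) b)" for b
        by (rule Suc.IH[OF Ck_Suc_derivative[OF Suc.prems(1)] Ck_Suc_imp[OF Suc.prems(2)] Suc.prems(3)])
    qed
    then show "Ck n S (\<lambda>x. ?D x v)"
    proof (rule Ck_cong[OF assms(1), rotated])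
      fix x assume "x \<in> S"
      then have lin: "linear (frechet_derivative f (at (g x)))"
        using Suc.prems by (intro linear_frechet_derivative) (auto simp: Ck.simps(2))
      show "(\<Sum>b\<in>Basis. (frechet_derivative g (at x) v \<bullet> b) *\<^sub>R
             frechet_derivative f (at (g x)) b) = ?D x v"
        by (subst (2) euclidean_representation[of "frechet_derivative g (at x) v", symmetric])
          (simp add: linear_sum[OF lin] linear_scale[OF lin])
    qed
  qed (use assms in auto)
qed

lemma Ck_inverse: "Ck n (- {0::real}) inverse"
proof (induction n)
  case 0 show ?case by (auto intro!: continuous_intros)
next
  case (Suc n)
  have o: "open (- {0::real})" by auto
  show ?case
  proof (rule Ck_SucI[OF o])
    show "(inverse has_derivative (\<lambda>v. - (inverse x * v * inverse x))) (at x)" if "x \<in> - {0}" for x :: real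
      using that by (intro has_derivative_inverse') auto
    show "Ck n (- {0}) (\<lambda>x::real. - (inverse x * v * inverse x))" for v
      by (rule Ck_linear_compose[OF o bounded_linear_minus[OF bounded_linear_ident]])
        (intro Ck_mult Ck_const Suc o)
  qed
qed

lemma Ck_ln: "Ck n {0::real<..} ln"
proof (cases n)
  case 0 then show ?thesis by (auto intro!: continuous_intros)
next
  case (Suc m)
  show ?thesis unfolding Suc
  proof (rule Ck_SucI)
    show "(ln has_derivative (\<lambda>v. inverse x * v)) (at x)" if "x \<in> {0<..}" for x :: real
      using that by (auto intro!: derivative_eq_intros simp: fun_eq_iff field_simps)
    show "Ck m {0<..} (\<lambda>x::real. inverse x * v)" for v
      by (intro Ck_mult Ck_const Ck_subset[OF Ck_inverse]) auto
  qed auto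
qed

text \<open>The only delicate point is 0, where the difference quotient is at most |y|^(j+1) in
  absolute value.\<close>

lemma has_real_derivative_pos_part_power:
  "((\<lambda>u::real. (max 0 u) ^ Suc (Suc j)) has_real_derivative
      of_nat (Suc (Suc j)) * (max 0 x) ^ Suc j) (at x)"
proof -
  consider "x > 0" | "x < 0" | "x = 0" by linarith
  then show ?thesis
  proof cases
    case 1
    have "((\<lambda>u::real. u ^ Suc (Suc j)) has_real_derivative of_nat (Suc (Suc j)) * (max 0 x) ^ Suc j) (at x)"
      using DERIV_pow[of "Suc (Suc j)" x] 1 by (simp add: max_def)
    then show ?thesis
      by (rule has_field_derivative_transform_within_open[where S="{0<..}"]) (use 1 in \<open>auto simp: max_def\<close>)
  next
    case 2
    have "((\<lambda>u::real. 0) has_real_derivative of_nat (Suc (Suc j)) * (max 0 x) ^ Suc j) (at x)"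
      using 2 by (simp add: max_def)
    then show ?thesis
      by (rule has_field_derivative_transform_within_open[where S="{..<0}"]) (use 2 in \<open>auto simp: max_def\<close>)
  next
    case 3
    have "((\<lambda>y::real. (max 0 y) ^ Suc (Suc j) / y) \<longlongrightarrow> 0) (at 0)"
    proof (rule Lim_null_comparison[where g="\<lambda>y. \<bar>y\<bar> ^ Suc j"])
      have "norm ((max 0 y) ^ Suc (Suc j) / y) \<le> \<bar>y\<bar> ^ Suc j" for y :: real
      proof (cases "y > 0")
        case False
        then have "max 0 y = 0" by simp
        then show ?thesis by (simp del: power_Suc)
      qed (simp add: max_def)
      then show "\<forall>\<^sub>F y in at (0::real). norm (max 0 y ^ Suc (Suc j) / y) \<le> \<bar>y\<bar> ^ Suc j"
        by simp
      have "((\<lambda>y. \<bar>y\<bar> ^ Suc j) \<longlongrightarrow> \<bar>0\<bar> ^ Suc j) (at (0::real))"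
        by (intro tendsto_intros)
      then show "((\<lambda>y. \<bar>y\<bar> ^ Suc j) \<longlongrightarrow> 0) (at (0::real))" by simp
    qed
    then show ?thesis
      using 3 by (simp add: has_field_derivative_iff)
  qed
qed

text \<open>The building block of the cutoff functions: 3 is the least exponent for which a power of
  the positive part has two continuous derivatives.\<close>

lemma Ck_pos_part_cube: "Ck 2 UNIV (\<lambda>u::real. (max 0 u) ^ 3)"
proof -
  have "Ck (Suc (Suc 0)) UNIV (\<lambda>u::real. (max 0 u) ^ 3)"
  proof (rule Ck_SucI[where D="\<lambda>x v. 3 * (max 0 x) ^ 2 * v"])
    show "((\<lambda>u. max 0 u ^ 3) has_derivative (\<lambda>v. 3 * (max 0 x)\<^sup>2 * v)) (at x)" for x :: real
      using has_real_derivative_pos_part_power[of 1 x]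
      by (simp add: numeral_3_eq_3 numeral_2_eq_2 has_field_derivative_def)
    have "Ck (Suc 0) UNIV (\<lambda>x::real. (max 0 x)\<^sup>2)"
    proof (rule Ck_SucI[where D="\<lambda>x v. 2 * (max 0 x) * v"])
      show "((\<lambda>u. (max 0 u)\<^sup>2) has_derivative (\<lambda>v. 2 * (max 0 x) * v)) (at x)" for x :: real
        using has_real_derivative_pos_part_power[of 0 x]
        by (simp add: numeral_2_eq_2 has_field_derivative_def)
      show "Ck 0 UNIV (\<lambda>x::real. 2 * max 0 x * v)" for v
        by (simp, intro continuous_intros)
    qed auto
    then show "Ck (Suc 0) UNIV (\<lambda>x::real. 3 * (max 0 x)\<^sup>2 * v)" for v
      by (intro Ck_mult Ck_const) auto
  qed auto
  then show ?thesis by (simp add: numeral_2_eq_2)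
qed

lemma Ck_Pair: "open S \<Longrightarrow> Ck n S f \<Longrightarrow> Ck n S g \<Longrightarrow> Ck n S (\<lambda>x. (f x, g x))"
proof (induction n arbitrary: f g)
  case 0 then show ?case by (simp add: continuous_on_Pair)
next
  case (Suc n)
  show ?case
    by (rule Ck_SucI[where D="\<lambda>x v. (frechet_derivative f (at x) v, frechet_derivative g (at x) v)"])
      (use Suc in \<open>auto intro!: has_derivative_Pair Ck_Suc_has_derivative dest: Ck_Suc_derivative\<close>)
qed

lemma Ck_fst: "open S \<Longrightarrow> Ck n S fst"
  by (rule Ck_bounded_linear[OF _ bounded_linear_fst])

lemma Ck_snd: "open S \<Longrightarrow> Ck n S snd"
  by (rule Ck_bounded_linear[OF _ bounded_linear_snd])

lemma Ck_iter_directional: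
  "Ck (m + n) S f \<Longrightarrow> Ck n S (((\<lambda>F x. frechet_derivative F (at x) v) ^^ m) f)"
proof (induction m arbitrary: n)
  case (Suc m)
  have "Ck (Suc n) S (((\<lambda>F x. frechet_derivative F (at x) v) ^^ m) f)"
    using Suc.prems by (intro Suc.IH) simp
  then show ?case by (simp add: Ck_Suc_derivative)
qed simp

section \<open>Taylor expansion along rays\<close>

text \<open>The constant is a bound for the n-th derivative on the compact set K x [-rho, rho],
  hence uniform in the parameter x.\<close>

lemma taylor_in_last_variable:
  fixes \<psi> :: "'p::euclidean_space \<times> real \<Rightarrow> real"
  assumes "open W" "Ck n W \<psi>" "compact K" "0 < \<rho>" "K \<times> {-\<rho>..\<rho>} \<subseteq> W" "0 < n"
  defines "P \<equiv> \<lambda>m. ((\<lambda>F x. frechet_derivative F (at x) (0, 1)) ^^ m) \<psi>"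
  obtains C where "C > 0"
    "\<And>x t. x \<in> K \<Longrightarrow> \<bar>t\<bar> \<le> \<rho> \<Longrightarrow> \<bar>\<psi> (x, t) - (\<Sum>m<n. P m (x, 0) / fact m * t ^ m)\<bar> \<le> C * \<bar>t\<bar> ^ n"
proof -
  have "continuous_on W (P n)"
    using Ck_iter_directional[of n 0 W \<psi>] assms by (simp add: P_def)
  then have "compact (P n ` (K \<times> {-\<rho>..\<rho>}))"
    using assms by (intro compact_continuous_image compact_Times) (auto intro: continuous_on_subset)
  then obtain C where C: "C > 0" "\<And>x t. x \<in> K \<Longrightarrow> t \<in> {-\<rho>..\<rho>} \<Longrightarrow> \<bar>P n (x, t)\<bar> \<le> C"
    using bounded_pos[of "P n ` (K \<times> {-\<rho>..\<rho>})"] compact_imp_bounded by (metis SigmaI imageI real_norm_def)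
  have der: "DERIV (\<lambda>t. P m (x, t)) t :> P (Suc m) (x, t)"
    if "m < n" "x \<in> K" "- \<rho> \<le> t" "t \<le> \<rho>" for m x t
  proof -
    have "Ck (Suc 0) W (P m)"
      using Ck_iter_directional[of m "Suc 0" W \<psi>] Ck_mono[OF assms(2), of "m + Suc 0"] that
      by (simp add: P_def)
    then have "(P m has_derivative frechet_derivative (P m) (at (x, t))) (at (x, t))"
      using that assms by (intro Ck_Suc_has_derivative) auto
    moreover have "((\<lambda>t. (x, t)) has_derivative (\<lambda>h. (0, h))) (at t)"
      by (auto intro!: derivative_eq_intros)
    ultimately have *: "((\<lambda>t. P m (x, t)) has_derivative (\<lambda>h. frechet_derivative (P m) (at (x, t)) (0, h))) (at t)"
      by (rule has_derivative_compose[rotated])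
    then have "linear (\<lambda>h. frechet_derivative (P m) (at (x, t)) (0, h))"
      by (rule has_derivative_linear)
    have "frechet_derivative (P m) (at (x, t)) (0, h) = P (Suc m) (x, t) * h" for h
      using linear_scale[OF \<open>linear _\<close>, of h 1] by (simp only: P_def funpow.simps o_def) simp
    with * show ?thesis
      by (simp add: has_field_derivative_def)
  qed
  show ?thesis
  proof (rule that[OF C(1)])
    fix x t assume x: "x \<in> K" and t: "\<bar>t\<bar> \<le> \<rho>"
    have P0: "P 0 = \<psi>" by (simp add: P_def)
    show "\<bar>\<psi> (x, t) - (\<Sum>m<n. P m (x, 0) / fact m * t ^ m)\<bar> \<le> C * \<bar>t\<bar> ^ n"
    \<comment> \<open>The Lagrange form of the remainder needs a point different from the
      centre.\<close>
    proof (cases "t = 0")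
      case True
      then have "(\<Sum>m<n. P m (x, 0) / fact m * t ^ m) = (\<Sum>m<n. if m = 0 then P 0 (x, 0) else 0)"
        by (intro sum.cong) auto
      also have "\<dots> = \<psi> (x, t)" using assms(6) True by (simp add: P_def)
      finally show ?thesis using C(1) by simp
    next
      case False
      have "\<exists>s. (if t < 0 then t < s \<and> s < 0 else 0 < s \<and> s < t) \<and>
         P 0 (x, t) = (\<Sum>m<n. P m (x, 0) / fact m * (t - 0) ^ m) + P n (x, s) / fact n * (t - 0) ^ n"
        using Taylor[of n "\<lambda>m t. P m (x, t)" "\<lambda>t. P 0 (x, t)" "-\<rho>" \<rho> 0 t] assms False t der[OF _ x] by auto
      then obtain s where s0: "if t < 0 then t < s \<and> s < 0 else 0 < s \<and> s < t"
        "P 0 (x, t) = (\<Sum>m<n. P m (x, 0) / fact m * (t - 0) ^ m) + P n (x, s) / fact n * (t - 0) ^ n"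
        by blast
      have s: "\<bar>s\<bar> \<le> \<rho>" "\<psi> (x, t) - (\<Sum>m<n. P m (x, 0) / fact m * t ^ m) = P n (x, s) / fact n * t ^ n"
        using s0(1) t s0(2) by (auto split: if_splits simp: P0)
      have "\<bar>P n (x, s)\<bar> / fact n \<le> C / 1"
        using C x s by (intro frac_le) (auto simp: abs_le_iff fact_ge_1)
      then have "\<bar>P n (x, s)\<bar> / fact n * \<bar>t\<bar> ^ n \<le> C * \<bar>t\<bar> ^ n"
        by (intro mult_right_mono) auto
      then show ?thesis unfolding s(2) by (simp add: abs_mult power_abs)
    qed
  qed
qed

text \<open>Polar coordinates in the last variable: with the direction u as a further parameter,
  expansions in s become expansions in the single real variable t, without multi-indices.\<close>

lemma ray_function_Ck:
  fixes f :: "'a::euclidean_space \<times> 'b::euclidean_space \<Rightarrow> real"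
  assumes "open U" "Ck n (U \<times> ball 0 r) f"
  defines "W \<equiv> {x :: ('a \<times> 'b) \<times> real. fst (fst x) \<in> U \<and> norm (snd x *\<^sub>R snd (fst x)) < r}"
  shows "open W" "Ck n W (\<lambda>x. f (fst (fst x), snd x *\<^sub>R snd (fst x)))"
proof -
  have "W = (\<lambda>x. fst (fst x)) -` U \<inter> {x. norm (snd x *\<^sub>R snd (fst x)) < r}"
    by (auto simp: W_def)
  moreover have "open ((\<lambda>x::('a \<times> 'b) \<times> real. fst (fst x)) -` U)"
    using assms by (intro open_vimage continuous_intros)
  moreover have "open {x :: ('a \<times> 'b) \<times> real. norm (snd x *\<^sub>R snd (fst x)) < r}"
    by (intro open_Collect_less continuous_intros)
  ultimately show o: "open W" by auto
  have "Ck n W (\<lambda>x. fst x)" and s: "Ck n W (\<lambda>x. snd x)"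
    using o by (auto intro: Ck_fst Ck_snd)
  then have "Ck n W (\<lambda>x. (fst (fst x), snd x *\<^sub>R snd (fst x)))"
    using Ck_linear_compose[OF o bounded_linear_fst] Ck_linear_compose[OF o bounded_linear_snd]
    by (intro Ck_Pair Ck_scaleR o) auto
  moreover have "(\<lambda>x. (fst (fst x), snd x *\<^sub>R snd (fst x))) ` W \<subseteq> U \<times> ball 0 r"
    by (auto simp: W_def)
  moreover have "open (U \<times> ball (0::'b) r)" using assms by (intro open_Times) auto
  ultimately show "Ck n W (\<lambda>x. f (fst (fst x), snd x *\<^sub>R snd (fst x)))"
    using Ck_compose[OF o _ assms(2)] by blast
qed

lemma polar_cball:
  fixes s :: "'b::euclidean_space"
  obtains u t where "norm u = 1" "t *\<^sub>R u = s" "norm s = t"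
proof (cases "s = 0")
  case True
  obtain u :: 'b where "u \<in> Basis" using nonempty_Basis by blast
  with True show ?thesis by (intro that[of u 0]) auto
next
  case False
  then show ?thesis by (intro that[of "s /\<^sub>R norm s" "norm s"]) auto
qed

text \<open>The parameters (y, u) run through Y times the unit sphere, which is compact; this makes
  the constant uniform in all directions.\<close>

lemma ray_taylor:
  fixes f :: "'a::euclidean_space \<times> 'b::euclidean_space \<Rightarrow> real"
  assumes "open U" "Ck n (U \<times> ball 0 r) f" "compact Y" "Y \<subseteq> U" "0 < \<rho>" "\<rho> < r" "0 < n"
  defines "P \<equiv> \<lambda>m. ((\<lambda>F x. frechet_derivative F (at x) (0, 1)) ^^ m) (\<lambda>x. f (fst (fst x), snd x *\<^sub>R snd (fst x)))"
  obtains C where "C > 0"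
    "\<And>y u t. y \<in> Y \<Longrightarrow> norm u = 1 \<Longrightarrow> \<bar>t\<bar> \<le> \<rho> \<Longrightarrow>
      \<bar>f (y, t *\<^sub>R u) - (\<Sum>m<n. P m ((y, u), 0) / fact m * t ^ m)\<bar> \<le> C * \<bar>t\<bar> ^ n"
proof -
  let ?W = "{x :: ('a \<times> 'b) \<times> real. fst (fst x) \<in> U \<and> norm (snd x *\<^sub>R snd (fst x)) < r}"
  have "(Y \<times> sphere 0 1) \<times> {-\<rho>..\<rho>} \<subseteq> ?W"
    using assms by (auto simp: abs_le_iff)
  from taylor_in_last_variable[OF ray_function_Ck[OF assms(1,2)] _ assms(5) this assms(7)]
  obtain C where C: "C > 0" "\<And>x t. x \<in> Y \<times> sphere 0 1 \<Longrightarrow> \<bar>t\<bar> \<le> \<rho> \<Longrightarrow>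
      \<bar>f (fst (fst (x, t)), snd (x, t) *\<^sub>R snd (fst (x, t))) - (\<Sum>m<n. P m (x, 0) / fact m * t ^ m)\<bar> \<le> C * \<bar>t\<bar> ^ n"
    unfolding P_def using compact_Times[OF assms(3) compact_sphere] by blast
  show ?thesis
  proof (rule that[OF C(1)])
    fix y u t assume "y \<in> Y" "norm (u::'b) = 1" "\<bar>t\<bar> \<le> \<rho>"
    then show "\<bar>f (y, t *\<^sub>R u) - (\<Sum>m<n. P m ((y, u), 0) / fact m * t ^ m)\<bar> \<le> C * \<bar>t\<bar> ^ n"
      using C(2)[of "(y, u)" t] by simp
  qed
qed

text \<open>In the second bound the terms of first order at t and -t cancel, and two remainders of
  second order are left.\<close>

lemma amplitude_taylor:
  fixes f :: "'a::euclidean_space \<times> 'b::euclidean_space \<Rightarrow> real"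
  assumes "open U" "Ck 2 (U \<times> ball 0 r) f" "compact Y" "Y \<subseteq> U" "0 < \<rho>" "\<rho> < r"
  obtains C where "C > 0"
    "\<And>y s. y \<in> Y \<Longrightarrow> norm s \<le> \<rho> \<Longrightarrow> \<bar>f (y, s) - f (y, 0)\<bar> \<le> C * norm s"
    "\<And>y s. y \<in> Y \<Longrightarrow> norm s \<le> \<rho> \<Longrightarrow> \<bar>f (y, s) + f (y, - s) - 2 * f (y, 0)\<bar> \<le> C * (norm s)\<^sup>2"
proof -
  define P where "P \<equiv> \<lambda>m. ((\<lambda>F x. frechet_derivative F (at x) (0, 1)) ^^ m)
    (\<lambda>x::('a\<times>'b)\<times>real. f (fst (fst x), snd x *\<^sub>R snd (fst x)))"
  have "Ck 1 (U \<times> ball 0 r) f" using Ck_mono[OF assms(2), of 1] by simp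
  then obtain C1 where C1: "C1 > 0" "\<And>y u t. y \<in> Y \<Longrightarrow> norm u = 1 \<Longrightarrow> \<bar>t\<bar> \<le> \<rho> \<Longrightarrow>
      \<bar>f (y, t *\<^sub>R u) - (\<Sum>m<1. P m ((y, u), 0) / fact m * t ^ m)\<bar> \<le> C1 * \<bar>t\<bar> ^ 1"
    using ray_taylor[OF assms(1) _ assms(3-6), of 1 f] unfolding P_def by auto
  obtain C2 where C2: "C2 > 0" "\<And>y u t. y \<in> Y \<Longrightarrow> norm u = 1 \<Longrightarrow> \<bar>t\<bar> \<le> \<rho> \<Longrightarrow>
      \<bar>f (y, t *\<^sub>R u) - (\<Sum>m<2. P m ((y, u), 0) / fact m * t ^ m)\<bar> \<le> C2 * \<bar>t\<bar> ^ 2"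
    using ray_taylor[OF assms(1) assms(2) assms(3-6)] unfolding P_def by auto
  have P0: "P 0 ((y, u), 0) = f (y, 0)" for y u by (simp add: P_def)
  show ?thesis
  proof (rule that[of "C1 + 2 * C2"])
    fix y and s :: 'b assume y: "y \<in> Y" and s: "norm s \<le> \<rho>"
    obtain u t where u: "norm u = 1" "t *\<^sub>R u = s" "norm s = t" by (rule polar_cball)
    then have t: "\<bar>t\<bar> \<le> \<rho>" "\<bar>-t\<bar> \<le> \<rho>" using s norm_ge_zero[of s] by linarith+
    have "\<bar>f (y, s) - f (y, 0)\<bar> \<le> C1 * \<bar>t\<bar>"
      using C1(2)[OF y u(1) t(1)] u(2) by (simp add: P0)
    also have "\<dots> \<le> (C1 + 2 * C2) * norm s"
      using C1(1) C2(1) u(3) by (intro mult_mono) auto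
    finally show "\<bar>f (y, s) - f (y, 0)\<bar> \<le> (C1 + 2 * C2) * norm s" .
    have "\<bar>f (y, s) + f (y, - s) - 2 * f (y, 0)\<bar> \<le> C2 * t\<^sup>2 + C2 * t\<^sup>2"
      using C2(2)[OF y u(1) t(1)] C2(2)[OF y u(1) t(2)] u(2) by (simp add: P0 numeral_2_eq_2)
    also have "\<dots> \<le> (C1 + 2 * C2) * (norm s)\<^sup>2"
      using C1(1) u(3) by (simp add: algebra_simps)
    finally show "\<bar>f (y, s) + f (y, - s) - 2 * f (y, 0)\<bar> \<le> (C1 + 2 * C2) * (norm s)\<^sup>2" .
  qed (use C1(1) C2(1) in simp)
qed

text \<open>Terms of order 0 and 1 in s vanish and the quadratic term is h. The cubic term is odd in
  s and drops out of the symmetrized estimate, which leaves order four; hence four derivatives are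
  required.\<close>

lemma phase_taylor:
  fixes f :: "'a::euclidean_space \<times> 'b::euclidean_space \<Rightarrow> real"
  assumes "open U" "Ck 4 (U \<times> ball 0 r) f" "compact Y" "Y \<subseteq> U" "0 < \<rho>" "\<rho> < r"
    and f0: "\<And>y. y \<in> Y \<Longrightarrow> f (y, 0) = 0"
    and f1: "\<And>y s. y \<in> Y \<Longrightarrow> frechet_derivative f (at (y, 0)) (0, s) = 0"
    and f2: "\<And>y s. y \<in> Y \<Longrightarrow>
      frechet_derivative (\<lambda>x. frechet_derivative f (at x) (0, s)) (at (y, 0)) (0, s) = 2 * h y s"
  shows "\<exists>C>0. \<forall>y\<in>Y. \<forall>s. norm s \<le> \<rho> \<longrightarrow>
    \<bar>f (y, s) - h y s\<bar> \<le> C * (norm s)^3 \<and> \<bar>f (y, s) + f (y, - s) - 2 * h y s\<bar> \<le> C * (norm s)^4"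
proof -
  let ?\<psi> = "\<lambda>x::('a\<times>'b)\<times>real. f (fst (fst x), snd x *\<^sub>R snd (fst x))"
  define W where "W = {x :: ('a \<times> 'b) \<times> real. fst (fst x) \<in> U \<and> norm (snd x *\<^sub>R snd (fst x)) < r}"
  define P where "P \<equiv> \<lambda>m. ((\<lambda>F x. frechet_derivative F (at x) (0, 1)) ^^ m) ?\<psi>"
  have W: "open W" "Ck 4 W ?\<psi>" using ray_function_Ck[OF assms(1,2)] by (auto simp: W_def)
  have oU: "open (U \<times> ball 0 r)" using assms(1) by (auto intro: open_Times)
  have C2: "Ck (Suc (Suc 0)) (U \<times> ball 0 r) f" using Ck_mono[OF assms(2)] by simp
  then have C1: "Ck (Suc 0) (U \<times> ball 0 r) f" by (rule Ck_Suc_imp)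
  \<comment> \<open>Nothing is assumed about \<open>h\<close> itself; its homogeneity is inherited
    from the second derivative in \<open>f2\<close>.\<close>
  have hom: "h y (t *\<^sub>R u) = t\<^sup>2 * h y u" if "y \<in> Y" for y t u
  proof -
    have *: "(y, 0) \<in> U \<times> ball 0 r" using that assms by auto
    have sc: "frechet_derivative f (at x) (0, t *\<^sub>R u) = t * frechet_derivative f (at x) (0, u)"
      if "x \<in> U \<times> ball 0 r" for x
      using linear_scale[OF has_derivative_linear[OF Ck_Suc_has_derivative[OF C1 that]], of t "(0, u)"]
      by simp
    have D: "((\<lambda>x. frechet_derivative f (at x) (0, u)) has_derivative
       frechet_derivative (\<lambda>x. frechet_derivative f (at x) (0, u)) (at (y, 0))) (at (y, 0))"
      by (rule Ck_Suc_has_derivative[OF Ck_Suc_derivative[OF C2] *])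
    have "frechet_derivative (\<lambda>x. frechet_derivative f (at x) (0, t *\<^sub>R u)) (at (y, 0)) =
      frechet_derivative (\<lambda>x. t * frechet_derivative f (at x) (0, u)) (at (y, 0))"
      by (rule frechet_derivative_cong_open[OF oU *]) (rule sc)
    also have "\<dots> = (\<lambda>v. t * frechet_derivative (\<lambda>x. frechet_derivative f (at x) (0, u)) (at (y, 0)) v)"
      by (rule frechet_derivative_at[symmetric]) (intro has_derivative_mult_right D)
    finally have "2 * h y (t *\<^sub>R u) = t * (t * (2 * h y u))"
      using f2[OF that, of "t *\<^sub>R u"] f2[OF that, of u]
        linear_scale[OF has_derivative_linear[OF D], of t "(0, u)"] by simp
    then show ?thesis by (simp add: power2_eq_square)
  qed
  have P0: "P 0 ((y, u), 0) = 0" if "y \<in> Y" for y u using f0[OF that] by (simp add: P_def)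
  \<comment> \<open>The first radial derivative is computed on all of \<open>W\<close>, and not just
    at t = 0, because it is differentiated once more below.\<close>
  have P1W: "P 1 x = frechet_derivative f (at (fst (fst x), snd x *\<^sub>R snd (fst x))) (0, snd (fst x))"
    if "x \<in> W" for x
  proof -
    have "((\<lambda>x. (fst (fst x), snd x *\<^sub>R snd (fst x))) has_derivative
       (\<lambda>v. (fst (fst v), snd x *\<^sub>R snd (fst v) + snd v *\<^sub>R snd (fst x)))) (at x)"
      by (auto intro!: derivative_eq_intros)
    moreover have "(f has_derivative frechet_derivative f (at (fst (fst x), snd x *\<^sub>R snd (fst x))))
        (at (fst (fst x), snd x *\<^sub>R snd (fst x)))"
      by (rule Ck_Suc_has_derivative[OF C1]) (use that in \<open>auto simp: W_def\<close>)
    ultimately have "(?\<psi> has_derivative (\<lambda>v. frechet_derivative f (at (fst (fst x), snd x *\<^sub>R snd (fst x)))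
        (fst (fst v), snd x *\<^sub>R snd (fst v) + snd v *\<^sub>R snd (fst x)))) (at x)"
      by (rule has_derivative_compose)
    then show ?thesis
      unfolding P_def by (simp add: frechet_derivative_at[symmetric])
  qed
  have inW: "((y, u), 0) \<in> W" if "y \<in> Y" for y u using that assms by (auto simp: W_def)
  have P1: "P 1 ((y, u), 0) = 0" if "y \<in> Y" for y u
    using P1W[OF inW[OF that]] f1[OF that] by simp
  have P2: "P 2 ((y, u), 0) = 2 * h y u" if "y \<in> Y" for y u
  proof -
    let ?g = "\<lambda>t. P 1 ((y, u), t)"
    have "Ck (Suc 0) W (P 1)"
      using Ck_iter_directional[of 1 "Suc 0" W ?\<psi>] Ck_mono[OF W(2), of "1 + Suc 0"] by (simp add: P_def)
    then have "(P 1 has_derivative frechet_derivative (P 1) (at ((y, u), 0))) (at ((y, u), 0))"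
      by (rule Ck_Suc_has_derivative[OF _ inW[OF that]])
    moreover have "((\<lambda>t. ((y, u), t)) has_derivative (\<lambda>h. (0, h))) (at 0)"
      by (auto intro!: derivative_eq_intros simp: zero_prod_def)
    ultimately have d1: "(?g has_derivative (\<lambda>h. frechet_derivative (P 1) (at ((y, u), 0)) (0, h))) (at 0)"
      by (rule has_derivative_compose[rotated])
    have D: "((\<lambda>x. frechet_derivative f (at x) (0, u)) has_derivative
       frechet_derivative (\<lambda>x. frechet_derivative f (at x) (0, u)) (at (y, 0))) (at (y, 0 *\<^sub>R u))"
      using Ck_Suc_has_derivative[OF Ck_Suc_derivative[OF C2], of "(y,0)" "(0,u)"] that assms by auto
    have "((\<lambda>t. (y, t *\<^sub>R u)) has_derivative (\<lambda>h. (0, h *\<^sub>R u))) (at 0)"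
      by (auto intro!: derivative_eq_intros)
    from has_derivative_compose[OF this D]
    have "((\<lambda>t. frechet_derivative f (at (y, t *\<^sub>R u)) (0, u)) has_derivative
       (\<lambda>h. frechet_derivative (\<lambda>x. frechet_derivative f (at x) (0, u)) (at (y, 0)) (0, h *\<^sub>R u))) (at 0)" .
    moreover have oI: "open ((\<lambda>t. ((y, u), t)) -` W)" "0 \<in> (\<lambda>t. ((y, u), t)) -` W"
      using W(1) inW[OF that] by (auto intro!: open_vimage continuous_intros)
    ultimately have d2: "(?g has_derivative
       (\<lambda>h. frechet_derivative (\<lambda>x. frechet_derivative f (at x) (0, u)) (at (y, 0)) (0, h *\<^sub>R u))) (at 0)"
      by (rule has_derivative_transform_within_open) (use P1W in auto)
    have "P 2 ((y, u), 0) = frechet_derivative (P 1) (at ((y, u), 0)) (0, 1)"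
      by (simp add: P_def numeral_2_eq_2)
    also have "\<dots> = 2 * h y u"
      using fun_cong[OF has_derivative_unique[OF d1 d2], of 1] f2[OF that] by simp
    finally show ?thesis .
  qed
  obtain C3 where C3: "C3 > 0" "\<And>y u t. y \<in> Y \<Longrightarrow> norm u = 1 \<Longrightarrow> \<bar>t\<bar> \<le> \<rho> \<Longrightarrow>
      \<bar>f (y, t *\<^sub>R u) - (\<Sum>m<3. P m ((y, u), 0) / fact m * t ^ m)\<bar> \<le> C3 * \<bar>t\<bar> ^ 3"
    using ray_taylor[OF assms(1) Ck_mono[OF assms(2)] assms(3-6), of 3] unfolding P_def by auto
  obtain C4 where C4: "C4 > 0" "\<And>y u t. y \<in> Y \<Longrightarrow> norm u = 1 \<Longrightarrow> \<bar>t\<bar> \<le> \<rho> \<Longrightarrow>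
      \<bar>f (y, t *\<^sub>R u) - (\<Sum>m<4. P m ((y, u), 0) / fact m * t ^ m)\<bar> \<le> C4 * \<bar>t\<bar> ^ 4"
    using ray_taylor[OF assms(1) assms(2) assms(3-6)] unfolding P_def by auto
  have sum3: "(\<Sum>m<3. P m ((y, u), 0) / fact m * t ^ m) = h y (t *\<^sub>R u)" if "y \<in> Y" for y u t
    using P0[OF that] P1[OF that] P2[OF that] hom[OF that]
    by (simp add: numeral_3_eq_3 numeral_2_eq_2)
  have sum4: "(\<Sum>m<4. P m ((y, u), 0) / fact m * t ^ m) = h y (t *\<^sub>R u) + P 3 ((y, u), 0) / 6 * t ^ 3"
    if "y \<in> Y" for y u t
  proof -
    have "(\<Sum>m<4. P m ((y, u), 0) / fact m * t ^ m) =
      (\<Sum>m<3. P m ((y, u), 0) / fact m * t ^ m) + P 3 ((y, u), 0) / fact 3 * t ^ 3"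
      using sum.lessThan_Suc[of "\<lambda>m. P m ((y, u), 0) / fact m * t ^ m" 3] by simp
    then show ?thesis unfolding sum3[OF that] by (simp add: fact_numeral)
  qed
  show ?thesis
  proof (intro exI[of _ "C3 + 2 * C4"] conjI ballI allI impI)
    fix y and s :: 'b assume y: "y \<in> Y" and s: "norm s \<le> \<rho>"
    obtain u t where u: "norm u = 1" "t *\<^sub>R u = s" "norm s = t" by (rule polar_cball)
    then have t: "\<bar>t\<bar> \<le> \<rho>" "\<bar>-t\<bar> \<le> \<rho>" using s norm_ge_zero[of s] by linarith+
    have t0: "0 \<le> t" using u(3) norm_ge_zero[of s] by linarith
    have "\<bar>f (y, s) - h y s\<bar> \<le> C3 * \<bar>t\<bar> ^ 3"
      using C3(2)[OF y u(1) t(1)] unfolding sum3[OF y] u(2) .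
    also have "\<dots> \<le> (C3 + 2 * C4) * (norm s)^3"
      unfolding u(3) abs_of_nonneg[OF t0] using C4(1) t0 by (intro mult_right_mono) auto
    finally show "\<bar>f (y, s) - h y s\<bar> \<le> (C3 + 2 * C4) * (norm s)^3" .
    have mu: "(- t) *\<^sub>R u = - s" using u(2) by simp
    have hm: "h y (- s) = h y s" using hom[OF y, of "-1" s] by simp
    have "\<bar>f (y, s) - (h y s + P 3 ((y, u), 0) / 6 * t ^ 3)\<bar> \<le> C4 * \<bar>t\<bar> ^ 4"
      using C4(2)[OF y u(1) t(1)] unfolding sum4[OF y] u(2) .
    moreover have "\<bar>f (y, - s) - (h y s + P 3 ((y, u), 0) / 6 * (- t) ^ 3)\<bar> \<le> C4 * \<bar>- t\<bar> ^ 4"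
      using C4(2)[OF y u(1) t(2)] unfolding sum4[OF y] mu hm .
    ultimately have "\<bar>f (y, s) + f (y, - s) - 2 * h y s\<bar> \<le> C4 * t ^ 4 + C4 * t ^ 4"
      by (simp add: power_even_abs)
    also have "\<dots> \<le> (C3 + 2 * C4) * (norm s) ^ 4"
      unfolding u(3) using C3(1) t0 by (simp add: algebra_simps)
    finally show "\<bar>f (y, s) + f (y, - s) - 2 * h y s\<bar> \<le> (C3 + 2 * C4) * (norm s) ^ 4" .
  qed (use C3(1) C4(1) in linarith)
qed

section \<open>Change of variables in Euclidean spaces\<close>

text \<open>The change of variables theorem of the library is stated for \<open>real ^ 'n\<close> with a well-ordered
  index type. The following copy of the standard basis serves as such an index type.\<close>

typedef (overloaded) ('a::euclidean_space) idx = "Basis :: 'a set"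
  using nonempty_Basis by blast

instance idx :: (euclidean_space) finite
proof
  have "(UNIV :: 'a idx set) = Abs_idx ` Basis"
    using type_definition.Abs_image[OF type_definition_idx] by metis
  then show "finite (UNIV :: 'a idx set)" by (metis finite_Basis finite_imageI)
qed

instantiation idx :: (euclidean_space) wellorder
begin

text \<open>The order is pulled back from the natural numbers along an enumeration of the finite set
  \<open>Basis\<close>; any enumeration would serve.\<close>

definition less_eq_idx :: "'a idx \<Rightarrow> 'a idx \<Rightarrow> bool" where
  "x \<le> y \<longleftrightarrow> to_nat_on (Basis :: 'a set) (Rep_idx x) \<le> to_nat_on (Basis :: 'a set) (Rep_idx y)"

definition less_idx :: "'a idx \<Rightarrow> 'a idx \<Rightarrow> bool" where
  "x < y \<longleftrightarrow> to_nat_on (Basis :: 'a set) (Rep_idx x) < to_nat_on (Basis :: 'a set) (Rep_idx y)"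

instance
proof
  have inj: "x = y" if "to_nat_on (Basis :: 'a set) (Rep_idx x) = to_nat_on (Basis :: 'a set) (Rep_idx y)"
    for x y :: "'a idx"
    using that inj_on_to_nat_on[of "Basis :: 'a set"] Rep_idx[of x] Rep_idx[of y]
    by (metis Rep_idx_inject countable_finite finite_Basis inj_onD)
  show "x \<le> y \<Longrightarrow> y \<le> x \<Longrightarrow> x = y" for x y :: "'a idx"
    by (rule inj) (simp add: less_eq_idx_def)
  show "(x < y) = (x \<le> y \<and> \<not> y \<le> x)" for x y :: "'a idx"
    by (auto simp: less_eq_idx_def less_idx_def)
  show "(\<And>x. (\<And>y. y < x \<Longrightarrow> P y) \<Longrightarrow> P x) \<Longrightarrow> P a" for P and a :: "'a idx"
  proof -
    assume *: "\<And>x. (\<And>y. y < x \<Longrightarrow> P y) \<Longrightarrow> P x"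
    show "P a"
      by (induction "to_nat_on (Basis :: 'a set) (Rep_idx a)" arbitrary: a rule: less_induct)
        (auto intro: * simp: less_idx_def)
  qed
qed (auto simp: less_eq_idx_def)

end

lemma bij_betw_Rep_idx: "bij_betw Rep_idx (UNIV :: 'a::euclidean_space idx set) Basis"
  using type_definition.Rep_range[OF type_definition_idx]
  by (auto simp: bij_betw_def inj_on_def Rep_idx_inject)

lemma Rep_idx_Basis [simp]: "Rep_idx (i :: 'a::euclidean_space idx) \<in> Basis"
  by (rule Rep_idx)

definition to_vec :: "'a::euclidean_space \<Rightarrow> real ^ 'a idx" where
  "to_vec x = (\<chi> i. x \<bullet> Rep_idx i)"

definition of_vec :: "real ^ ('a::euclidean_space) idx \<Rightarrow> 'a" where
  "of_vec v = (\<Sum>i\<in>UNIV. v $ i *\<^sub>R Rep_idx i)"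

lemma linear_to_vec: "linear to_vec"
  by (auto simp: to_vec_def vec_eq_iff inner_left_distrib intro!: linearI)

lemma of_vec_to_vec [simp]: "of_vec (to_vec x) = (x::'a::euclidean_space)"
proof -
  have "(\<Sum>i\<in>UNIV. (x \<bullet> Rep_idx i) *\<^sub>R Rep_idx i) = (\<Sum>b\<in>Basis. (x \<bullet> b) *\<^sub>R b)"
    by (rule sum.reindex_bij_betw[OF bij_betw_Rep_idx])
  then show ?thesis by (simp add: of_vec_def to_vec_def euclidean_representation)
qed

lemma inner_Rep_idx: "Rep_idx i \<bullet> Rep_idx j = (if i = j then 1 else 0)"
  by (simp add: inner_Basis Rep_idx_inject)

lemma to_vec_of_vec [simp]: "to_vec (of_vec v) = v"
  by (simp add: of_vec_def to_vec_def vec_eq_iff inner_sum_left inner_Rep_idx if_distrib[of "(*) _"]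
      cong: if_cong)

lemma linear_of_vec: "linear of_vec"
  by (auto simp: of_vec_def sum.distrib scaleR_left_distrib scaleR_sum_right intro!: linearI)

lemma borel_measurable_to_vec [measurable]: "to_vec \<in> borel_measurable borel"
  by (intro borel_measurable_continuous_onI linear_continuous_on linear_conv_bounded_linear[THEN iffD1] linear_to_vec)

lemma borel_measurable_of_vec [measurable]: "of_vec \<in> borel_measurable borel"
  by (intro borel_measurable_continuous_onI linear_continuous_on linear_conv_bounded_linear[THEN iffD1] linear_of_vec)

lemma to_vec_nth [simp]: "to_vec x $ i = x \<bullet> Rep_idx i"
  by (simp add: to_vec_def)

lemma inner_of_vec [simp]: "of_vec v \<bullet> Rep_idx i = v $ i"
  using to_vec_of_vec[of v] to_vec_nth[of "of_vec v" i] by simp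

lemma ball_Basis_idx: "(\<forall>b\<in>Basis. P b) \<longleftrightarrow> (\<forall>i. P (Rep_idx i))"
  by (metis Abs_idx_inverse Rep_idx)

lemma to_vec_vimage_box: "to_vec -` box l u = box (of_vec l) (of_vec u)"
  by (auto simp: mem_box_cart mem_box ball_Basis_idx)

text \<open>Boxes correspond to boxes with the same side lengths, and their measures determine
  Lebesgue measure.\<close>

lemma distr_lborel_to_vec: "distr lborel borel to_vec = (lborel :: (real ^ 'a::euclidean_space idx) measure)"
proof (rule lborel_eqI[symmetric])
  fix l u :: "real ^ 'a idx" assume lu: "\<And>b. b \<in> Basis \<Longrightarrow> l \<bullet> b \<le> u \<bullet> b"
  have lu': "l $ i \<le> u $ i" for i
    using lu[of "axis i 1"] by (simp add: inner_axis)
  have "emeasure (distr lborel borel to_vec) (box l u) = (\<Prod>b\<in>Basis. (of_vec u - of_vec l) \<bullet> (b::'a))"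
    using lu' by (simp add: emeasure_distr to_vec_vimage_box emeasure_lborel_box_eq ball_Basis_idx)
  also have "(\<Prod>b\<in>Basis. (of_vec u - of_vec l) \<bullet> (b::'a)) = (\<Prod>i\<in>UNIV. (of_vec u - of_vec l) \<bullet> Rep_idx (i::'a idx))"
    by (rule prod.reindex_bij_betw[OF bij_betw_Rep_idx, symmetric])
  also have "\<dots> = (\<Prod>i\<in>UNIV. u $ i - l $ i)"
    by (simp add: inner_diff_left)
  also have "\<dots> = (\<Prod>i\<in>UNIV. (u - l) \<bullet> axis i 1)"
    by (simp add: inner_axis)
  also have "\<dots> = (\<Prod>b\<in>Basis. (u - l) \<bullet> b)"
    by (simp add: axis_inverse prod.reindex inj_on_def axis_eq_axis Basis_vec_def UNION_singleton_eq_range)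
  finally show "emeasure (distr lborel borel to_vec) (box l u) = (\<Prod>b\<in>Basis. (u - l) \<bullet> b)" .
qed simp

text \<open>|det T| for an endomorphism of any Euclidean space. By \<open>jac_eq_det\<close> it can
  be computed with any enumeration of the basis, so the auxiliary order leaves no trace.\<close>

definition jac :: "('a::euclidean_space \<Rightarrow> 'a) \<Rightarrow> real" where
  "jac T = \<bar>det (matrix (\<lambda>v. to_vec (T (of_vec v))))\<bar>"

lemma jac_nonneg: "jac T \<ge> 0"
  by (simp add: jac_def)

lemma jac_compose: "linear S \<Longrightarrow> linear T \<Longrightarrow> jac (\<lambda>x. S (T x)) = jac S * jac T"
proof -
  assume S: "linear S" and T: "linear T"
  have "linear (\<lambda>v. to_vec (S (of_vec v)))" "linear (\<lambda>v. to_vec (T (of_vec v)))"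
    using linear_compose[OF linear_compose[OF linear_of_vec S] linear_to_vec]
      linear_compose[OF linear_compose[OF linear_of_vec T] linear_to_vec] by (auto simp: o_def)
  from matrix_compose[OF this(2,1)]
  show ?thesis by (simp add: jac_def o_def det_mul abs_mult)
qed

lemma jac_id: "jac (\<lambda>x. x) = 1"
  by (simp add: jac_def matrix_id[unfolded id_def])

lemma jac_nonzero: "linear T \<Longrightarrow> inj T \<Longrightarrow> jac T > 0"
proof -
  assume T: "linear T" "inj T"
  then obtain S where S: "linear S" "\<And>x. S (T x) = x"
    using linear_injective_left_inverse[of T] by (auto simp: o_def fun_eq_iff)
  have "jac S * jac T = 1" using jac_compose[OF S(1) T(1)] by (simp add: S(2) jac_id)
  then show ?thesis using jac_nonneg[of T] by (auto simp: less_le)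
qed

text \<open>Passes from gauge integrals and sets of finite measure to nonnegative integrals, so that
  infinite measure is included.\<close>

lemma emeasure_differentiable_image:
  fixes g :: "real^'n::{finite,wellorder} \<Rightarrow> real^'n::_"
  assumes S: "S \<in> sets borel" "g ` S \<in> sets borel"
    and g: "\<And>x. x \<in> S \<Longrightarrow> (g has_derivative g' x) (at x)" "inj_on g S"
    and m: "(\<lambda>x. indicator S x * \<bar>det (matrix (g' x))\<bar>) \<in> borel_measurable borel"
  shows "emeasure lborel (g ` S) = (\<integral>\<^sup>+x\<in>S. ennreal \<bar>det (matrix (g' x))\<bar> \<partial>lborel)"
proof -
  let ?d = "\<lambda>x. indicator S x * \<bar>det (matrix (g' x))\<bar>"
  have I: "(\<integral>\<^sup>+x\<in>S. ennreal \<bar>det (matrix (g' x))\<bar> \<partial>lborel) = (\<integral>\<^sup>+x. ennreal (?d x) \<partial>lborel)"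
    by (intro nn_integral_cong) (auto simp: indicator_def)
  have eq: "g ` S \<in> lmeasurable \<and> measure lebesgue (g ` S) = r \<longleftrightarrow> (?d has_integral r) UNIV" for r
  proof -
    have "g ` S \<in> lmeasurable \<and> measure lebesgue (g ` S) = r \<longleftrightarrow> ((\<lambda>x. \<bar>det (matrix (g' x))\<bar>) has_integral r) S"
      by (rule has_measure_differentiable_image)
        (use S g in \<open>auto intro: has_derivative_at_withinI\<close>)
    also have "\<dots> \<longleftrightarrow> ((\<lambda>x. if x \<in> S then \<bar>det (matrix (g' x))\<bar> else 0) has_integral r) UNIV"
      by (rule has_integral_restrict_UNIV[symmetric])
    also have "(\<lambda>x. if x \<in> S then \<bar>det (matrix (g' x))\<bar> else 0) = ?d"
      by (auto simp: fun_eq_iff)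
    finally show ?thesis .
  qed
  show ?thesis
  proof (cases "(\<integral>\<^sup>+x. ennreal (?d x) \<partial>lborel) = \<infinity>")
    case False
    then obtain r where r: "(\<integral>\<^sup>+x. ennreal (?d x) \<partial>lborel) = ennreal r" "0 \<le> r"
      by (cases "\<integral>\<^sup>+x. ennreal (?d x) \<partial>lborel" rule: ennreal_cases) auto
    then have "(?d has_integral r) UNIV"
      by (intro nn_integral_has_integral m) auto
    then have "g ` S \<in> lmeasurable" "measure lebesgue (g ` S) = r" using eq by auto
    then have "emeasure lebesgue (g ` S) = ennreal r"
      by (simp add: emeasure_eq_measure2 fmeasurableD2)
    then show ?thesis using S r I by (simp add: emeasure_completion)
  next
    \<comment> \<open>If the image had finite measure, the gauge integral of the Jacobian would
      exist, and the nonnegative integral would be finite.\<close>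
    case True
    have "\<not> g ` S \<in> lmeasurable"
    proof
      assume "g ` S \<in> lmeasurable"
      then have "(?d has_integral measure lebesgue (g ` S)) UNIV" using eq by blast
      from nn_integral_has_integral_lborel[OF m _ this] True show False by simp
    qed
    then have "emeasure lebesgue (g ` S) = \<infinity>"
      using S(2) by (auto simp: fmeasurable_def less_top[symmetric])
    then show ?thesis using True S I by (simp add: emeasure_completion)
  qed
qed

abbreviation Jac :: "('a::euclidean_space \<Rightarrow> 'a) \<Rightarrow> 'a \<Rightarrow> real" where
  "Jac g x \<equiv> jac (frechet_derivative g (at x))"

lemma Ck_det_derivative:
  fixes g :: "'a::euclidean_space \<Rightarrow> 'a"
  assumes "open S" "Ck (Suc n) S g"
  shows "Ck n S (\<lambda>x. det (matrix (\<lambda>v. to_vec (frechet_derivative g (at x) (of_vec v)))))"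
  unfolding det_def matrix_def
  by (auto intro!: Ck_sum Ck_mult Ck_const Ck_prod assms Ck_inner Ck_Suc_derivative)

lemma continuous_on_Jac:
  fixes g :: "'a::euclidean_space \<Rightarrow> 'a"
  assumes "open S" "Ck (Suc n) S g"
  shows "continuous_on S (Jac g)"
  unfolding jac_def
  by (intro continuous_intros Ck_imp_continuous_on[OF Ck_det_derivative[OF assms]])

text \<open>By invariance of domain \<open>g\<close> has a continuous inverse on the open image of
  U, and the image of S is a preimage under it. The inverse is extended by 0 to make it a Borel
  function on the whole space.\<close>

lemma borel_image_open_map:
  fixes g :: "'a::euclidean_space \<Rightarrow> 'a"
  assumes "open U" "continuous_on U g" "inj_on g U" "S \<in> sets borel" "S \<subseteq> U"
  shows "g ` S \<in> sets borel"
proof -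
  obtain h where h: "homeomorphism U (g ` U) g h"
    using invariance_of_domain_homeomorphism[OF assms(1,2) _ assms(3)] by auto
  have o: "open (g ` U)" using assms by (intro invariance_of_domain)
  have "g ` S = (\<lambda>x. indicator (g ` U) x *\<^sub>R h x) -` (S \<inter> S) \<inter> g ` U"
    using h assms(5) by (force simp: homeomorphism_def)
  moreover have "(\<lambda>x. indicator (g ` U) x *\<^sub>R h x) \<in> borel_measurable borel"
    using o h by (intro borel_measurable_continuous_on_indicator) (auto simp: homeomorphism_def)
  from measurable_sets[OF this assms(4)]
  have "(\<lambda>x. indicator (g ` U) x *\<^sub>R h x) -` S \<in> sets borel" by simp
  ultimately show ?thesis using o by auto
qed

text \<open>Conjugation by the measure preserving isomorphism \<open>to_vec\<close> reduces this to
  coordinate spaces.\<close>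

lemma emeasure_image_Jac:
  fixes g :: "'a::euclidean_space \<Rightarrow> 'a"
  assumes "open U" "Ck 1 U g" "inj_on g U" "S \<in> sets borel" "S \<subseteq> U"
  shows "emeasure lborel (g ` S) = (\<integral>\<^sup>+x. ennreal (indicator S x * Jac g x) \<partial>lborel)"
proof -
  let ?G = "\<lambda>v. to_vec (g (of_vec v))" and ?S = "of_vec -` S"
  let ?G' = "\<lambda>v w. to_vec (frechet_derivative g (at (of_vec v)) (of_vec w))"
  have gS: "g ` S \<in> sets borel"
    using assms Ck_imp_continuous_on by (intro borel_image_open_map) auto
  have img: "?G ` ?S = of_vec -` (g ` S)"
  proof (intro set_eqI iffI)
    fix w assume "w \<in> of_vec -` (g ` S)"
    then obtain x where "x \<in> S" "of_vec w = g x" by auto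
    then show "w \<in> ?G ` ?S"
      by (intro image_eqI[where x="to_vec x"]) (auto simp flip: \<open>of_vec w = g x\<close>)
  qed auto
  have em: "emeasure lborel (of_vec -` X) = emeasure lborel X" if "X \<in> sets borel" for X :: "'a set"
  proof -
    have "emeasure (distr lborel borel to_vec) (of_vec -` X) = emeasure lborel (to_vec -` (of_vec -` X))"
      using that measurable_sets[OF borel_measurable_of_vec that] by (subst emeasure_distr) auto
    then show ?thesis by (simp add: distr_lborel_to_vec vimage_def)
  qed
  have der: "(?G has_derivative ?G' v) (at v)" if "v \<in> ?S" for v
  proof -
    have "(g has_derivative frechet_derivative g (at (of_vec v))) (at (of_vec v))"
      using Ck_Suc_has_derivative[of 0 U g] assms that by auto
    from has_derivative_compose[OF linear_imp_has_derivative[OF linear_of_vec] this]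
    show ?thesis
      by (rule has_derivative_compose[OF _ linear_imp_has_derivative[OF linear_to_vec]])
  qed
  have inj: "inj_on ?G ?S"
  proof (rule inj_onI)
    fix v w assume *: "v \<in> ?S" "w \<in> ?S" "?G v = ?G w"
    then have "g (of_vec v) = g (of_vec w)" by (metis of_vec_to_vec)
    then have "of_vec v = of_vec w" using * assms by (auto simp: inj_on_def)
    then show "v = w" by (metis to_vec_of_vec)
  qed
  have cont: "continuous_on S (Jac g)"
    using continuous_on_Jac[of U 0 g] assms continuous_on_subset by auto
  have m0: "(\<lambda>x. indicator S x *\<^sub>R Jac g x) \<in> borel_measurable borel"
    by (rule borel_measurable_continuous_on_indicator[OF assms(4) cont])
  have m: "(\<lambda>v. indicator ?S v * \<bar>det (matrix (?G' v))\<bar>) \<in> borel_measurable borel"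
  proof -
    have "(\<lambda>v. indicator S (of_vec v) *\<^sub>R Jac g (of_vec v)) \<in> borel_measurable borel"
      using measurable_compose[OF borel_measurable_of_vec m0] .
    then show ?thesis by (simp add: jac_def indicator_def vimage_def)
  qed
  have Sm: "?S \<in> sets borel" using measurable_sets[OF borel_measurable_of_vec assms(4)] by simp
  have "emeasure lborel (g ` S) = emeasure lborel (?G ` ?S)"
    unfolding img by (rule em[OF gS, symmetric])
  also have "\<dots> = (\<integral>\<^sup>+v\<in>?S. ennreal \<bar>det (matrix (?G' v))\<bar> \<partial>lborel)"
    by (rule emeasure_differentiable_image[OF Sm _ der inj m])
      (use img measurable_sets[OF borel_measurable_of_vec gS] in auto)
  also have "\<dots> = (\<integral>\<^sup>+v. ennreal (indicator ?S v * \<bar>det (matrix (?G' v))\<bar>) \<partial>lborel)"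
    by (intro nn_integral_cong) (auto simp: indicator_def)
  also have "\<dots> = (\<integral>\<^sup>+v. ennreal (indicator ?S v * \<bar>det (matrix (?G' v))\<bar>) \<partial>distr lborel borel to_vec)"
    by (simp add: distr_lborel_to_vec)
  also have "\<dots> = (\<integral>\<^sup>+x. ennreal (indicator S x * Jac g x) \<partial>lborel)"
    using m by (subst nn_integral_distr) (auto simp: jac_def indicator_def intro!: nn_integral_cong)
  finally show ?thesis .
qed

text \<open>Everything follows from one equality of measures: the image under \<open>g\<close> of
  the measure with density \<open>Jac g\<close> on S is Lebesgue measure on the image of S.
  Integrability and the value of the integral then transfer together.\<close>

lemma change_of_variables:
  fixes g :: "'a::euclidean_space \<Rightarrow> 'a" and f :: "'a \<Rightarrow> 'b::{banach, second_countable_topology}"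
  assumes "open U" "Ck 1 U g" "inj_on g U" "S \<in> sets borel" "S \<subseteq> U"
    and f: "set_borel_measurable borel (g ` S) f"
  shows "set_integrable lborel (g ` S) f \<longleftrightarrow> set_integrable lborel S (\<lambda>x. Jac g x *\<^sub>R f (g x))"
    and "(LINT y:g ` S|lborel. f y) = (LINT x:S|lborel. Jac g x *\<^sub>R f (g x))"
proof -
  \<comment> \<open>All three functions are extended by 0 off S or its image, since measurability is
    required on the whole space.\<close>
  define F where "F = (\<lambda>y. indicator (g ` S) y *\<^sub>R f y)"
  define G where "G = (\<lambda>x. indicator S x *\<^sub>R g x)"
  define J where "J = (\<lambda>x. indicator S x * Jac g x)"
  have contg: "continuous_on U g" using assms Ck_imp_continuous_on by blast
  have gS: "g ` S \<in> sets borel" by (rule borel_image_open_map[OF assms(1) contg assms(3-5)])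
  have [measurable]: "F \<in> borel_measurable borel" using f by (simp add: F_def set_borel_measurable_def)
  have [measurable]: "G \<in> borel_measurable borel"
    unfolding G_def by (rule borel_measurable_continuous_on_indicator[OF assms(4) continuous_on_subset[OF contg assms(5)]])
  have "continuous_on S (Jac g)"
    using continuous_on_Jac[of U 0 g] assms continuous_on_subset by auto
  from borel_measurable_continuous_on_indicator[OF assms(4) this]
  have [measurable]: "J \<in> borel_measurable borel" by (simp add: J_def)
  have J0: "0 \<le> J x" for x by (simp add: J_def jac_nonneg)
  have eq: "distr (density lborel (\<lambda>x. ennreal (J x))) borel G = density lborel (\<lambda>y. ennreal (indicator (g ` S) y))"
  proof (rule measure_eqI)
    fix X assume "X \<in> sets (distr (density lborel (\<lambda>x. ennreal (J x))) borel G)"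
    then have X[measurable]: "X \<in> sets borel" by simp
    let ?T = "S \<inter> G -` X"
    have T: "?T \<in> sets borel" using assms(4) measurable_sets[of G borel borel X] X by auto
    have "emeasure (distr (density lborel (\<lambda>x. ennreal (J x))) borel G) X
      = (\<integral>\<^sup>+x\<in>G -` X. ennreal (J x) \<partial>lborel)"
      using measurable_sets[of G borel borel X] X by (subst emeasure_distr) (auto simp: emeasure_density)
    also have "\<dots> = (\<integral>\<^sup>+x. ennreal (indicator ?T x * Jac g x) \<partial>lborel)"
      by (intro nn_integral_cong) (auto simp: J_def indicator_def)
    also have "\<dots> = emeasure lborel (g ` ?T)"
      by (rule emeasure_image_Jac[symmetric]) (use assms T in auto)
    also have "g ` ?T = g ` S \<inter> X" by (auto simp: G_def)
    also have "emeasure lborel (g ` S \<inter> X) = emeasure (density lborel (\<lambda>y. ennreal (indicator (g ` S) y))) X"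
    proof -
      have "(\<lambda>y. ennreal (indicator (g ` S) y) * indicator X y) = indicator (g ` S \<inter> X)"
        by (auto simp: fun_eq_iff indicator_def)
      then show ?thesis using gS by (subst emeasure_density) (auto simp: nn_integral_indicator)
    qed
    finally show "emeasure (distr (density lborel (\<lambda>x. ennreal (J x))) borel G) X =
      emeasure (density lborel (\<lambda>y. ennreal (indicator (g ` S) y))) X" .
  qed simp
  have FG: "J x *\<^sub>R F (G x) = indicator S x *\<^sub>R (Jac g x *\<^sub>R f (g x))" for x
    by (auto simp: J_def F_def G_def indicator_def)
  have FF: "indicator (g ` S) y *\<^sub>R F y = F y" for y by (auto simp: F_def indicator_def)
  have "set_integrable lborel (g ` S) f \<longleftrightarrow> integrable (density lborel (\<lambda>y. ennreal (indicator (g ` S) y))) F"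
    using gS by (subst integrable_density) (auto simp: set_integrable_def FF, auto simp: F_def)
  also have "\<dots> \<longleftrightarrow> integrable (density lborel (\<lambda>x. ennreal (J x))) (\<lambda>x. F (G x))"
    unfolding eq[symmetric] by (subst integrable_distr_eq) auto
  also have "\<dots> \<longleftrightarrow> set_integrable lborel S (\<lambda>x. Jac g x *\<^sub>R f (g x))"
    by (subst integrable_density) (auto simp: set_integrable_def FG J0)
  finally show "set_integrable lborel (g ` S) f \<longleftrightarrow> set_integrable lborel S (\<lambda>x. Jac g x *\<^sub>R f (g x))" .
  have "(LINT y:g ` S|lborel. f y) = integral\<^sup>L (density lborel (\<lambda>y. ennreal (indicator (g ` S) y))) F"
    using gS by (subst integral_density) (auto simp: set_lebesgue_integral_def FF, auto simp: F_def)
  also have "\<dots> = integral\<^sup>L (density lborel (\<lambda>x. ennreal (J x))) (\<lambda>x. F (G x))"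
    unfolding eq[symmetric] by (subst integral_distr) auto
  also have "\<dots> = (LINT x:S|lborel. Jac g x *\<^sub>R f (g x))"
    by (subst integral_density) (auto simp: set_lebesgue_integral_def FG J0)
  finally show "(LINT y:g ` S|lborel. f y) = (LINT x:S|lborel. Jac g x *\<^sub>R f (g x))" .
qed

text \<open>A bijection between the two index types conjugates permutations of one into permutations
  of the other and preserves their signs.\<close>

lemma det_reindex:
  fixes M :: "'j::finite \<Rightarrow> 'j \<Rightarrow> 'a::comm_ring_1" and \<sigma> :: "'i::finite \<Rightarrow> 'j"
  assumes "bij \<sigma>"
  shows "det (\<chi> i j. M (\<sigma> i) (\<sigma> j)) = det (\<chi> i j. M i j)"
proof -
  let ?f = "\<lambda>p. \<sigma> \<circ> p \<circ> inv \<sigma>" and ?g = "\<lambda>p. inv \<sigma> \<circ> p \<circ> \<sigma>"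
  have bij: "bij_betw \<sigma> UNIV UNIV" using assms by simp
  have s1: "\<sigma> (inv \<sigma> x) = x" "inv \<sigma> (\<sigma> y) = y" for x y
    using assms by (auto simp: bij_def surj_f_inv_f)
  have mp: "map_permutation UNIV \<sigma> p = ?f p" for p
    using assms by (auto simp: map_permutation_def restrict_id_def fun_eq_iff bij_def)
  have perm: "p permutes UNIV \<longleftrightarrow> bij p" for p :: "'x \<Rightarrow> 'x"
    by (auto simp: permutes_bij intro: bij_imp_permutes)
  have sgn: "sign (?f p) = sign p" if "p permutes UNIV" for p
    using sign_map_permutation[of \<sigma> UNIV p] that assms by (simp add: mp bij_is_inj)
  have "det (\<chi> i j. M i j) = (\<Sum>p | p permutes (UNIV::'i set). of_int (sign p) * (\<Prod>i\<in>UNIV. M (\<sigma> i) (\<sigma> (p i))))"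
    unfolding det_def
  proof (rule sum.reindex_bij_witness[of _ ?f ?g])
    fix p assume "p \<in> {p. p permutes (UNIV::'j set)}"
    then show "?g p \<in> {p. p permutes (UNIV::'i set)}" "?f (?g p) = p"
      using assms by (auto simp: perm bij_comp bij_imp_bij_inv s1 fun_eq_iff)
    then have "sign p = sign (?g p)" using sgn[of "?g p"] by simp
    moreover have "(\<Prod>i\<in>UNIV. M (\<sigma> i) (\<sigma> (?g p i))) = (\<Prod>i\<in>UNIV. M i (p i))"
      using prod.reindex_bij_betw[OF bij, of "\<lambda>i. M i (p i)"] by (simp add: s1)
    ultimately show "of_int (sign (?g p)) * (\<Prod>i\<in>UNIV. M (\<sigma> i) (\<sigma> (?g p i))) =
      of_int (sign p) * (\<Prod>i\<in>UNIV. (\<chi> i j. M i j) $ i $ p i)" by simp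
  next
    fix p assume "p \<in> {p. p permutes (UNIV::'i set)}"
    then show "?f p \<in> {p. p permutes (UNIV::'j set)}" "?g (?f p) = p"
      using assms by (auto simp: perm bij_comp bij_imp_bij_inv s1 fun_eq_iff)
  qed
  then show ?thesis by (simp add: det_def)
qed

text \<open>Needed for the basis indexed by \<open>'n \<times> bool\<close>, in which
  \<open>liouville\<close> is written.\<close>

lemma jac_eq_det:
  fixes T :: "'a::euclidean_space \<Rightarrow> 'a" and \<rho> :: "'i::finite \<Rightarrow> 'a"
  assumes "bij_betw \<rho> UNIV Basis"
  shows "jac T = \<bar>det (\<chi> i j. T (\<rho> j) \<bullet> \<rho> i)\<bar>"
proof -
  have "bij_betw (\<lambda>x. Abs_idx (\<rho> x)) UNIV (UNIV :: 'a idx set)"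
    using bij_betw_trans[OF assms bij_betw_inv_into[OF bij_betw_Rep_idx]]
    by (rule bij_betw_cong[THEN iffD1, rotated])
      (metis Abs_idx_inverse UNIV_I assms bij_betw_Rep_idx bij_betwE bij_betw_inv_into_left comp_apply)
  from det_reindex[OF this, of "\<lambda>i j. T (Rep_idx j) \<bullet> Rep_idx i"]
  have "det (\<chi> i j. T (\<rho> j) \<bullet> \<rho> i) = det (\<chi> i j::'a idx. T (Rep_idx j) \<bullet> Rep_idx i)"
    using assms by (simp add: Abs_idx_inverse bij_betwE)
  also have "(\<chi> i j::'a idx. T (Rep_idx j) \<bullet> Rep_idx i) = matrix (\<lambda>v. to_vec (T (of_vec v)))"
    by (simp add: matrix_def of_vec_def axis_def if_distrib[of "\<lambda>x. x *\<^sub>R _"] cong: if_cong)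
  finally show ?thesis by (simp add: jac_def)
qed

lemma jac_real_vec: "jac T = \<bar>det (matrix (T :: real^'n \<Rightarrow> real^'n))\<bar>"
proof -
  have "bij_betw (\<lambda>i. axis i (1::real)) UNIV (Basis :: (real^'n) set)"
    by (auto simp: bij_betw_def inj_on_def axis_eq_axis Basis_vec_def)
  from jac_eq_det[OF this, of T] show ?thesis
    by (simp add: matrix_def inner_axis)
qed

lemma bij_betw_real_coord_vector:
  "bij_betw real_coord_vector UNIV (Basis :: (complex^'n) set)"
proof -
  have "inj (real_coord_vector :: 'n \<times> bool \<Rightarrow> complex^'n)"
    by (auto simp: inj_on_def real_coord_vector_def axis_eq_axis split: if_splits)
  moreover have "range (real_coord_vector :: 'n \<times> bool \<Rightarrow> complex^'n) = Basis"
    by (auto simp: real_coord_vector_def Basis_vec_def Basis_complex_def image_iff split: if_splits) force+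
  ultimately show ?thesis by (simp add: bij_betw_def)
qed

section \<open>Orthonormal bases and Pfaffians\<close>

text \<open>The hypotheses ask for linearity in the first argument and symmetry of orthogonality, so
  that the result applies both to a real inner product and to a Hermitian form.\<close>

lemma gram_schmidt:
  fixes H :: "'a::field^'n \<Rightarrow> 'a^'n \<Rightarrow> 'a"
  assumes add: "\<And>x y z. H (x + y) z = H x z + H y z"
    and scale: "\<And>c x z. H (c *s x) z = c * H x z"
    and sym: "\<And>x y. H x y = 0 \<Longrightarrow> H y x = 0"
    and normalize: "\<And>x. x \<noteq> 0 \<Longrightarrow> \<exists>c. H (c *s x) (c *s x) = 1"
  obtains q :: "'n \<Rightarrow> 'a^'n" where "\<And>i j. H (q i) (q j) = (if i = j then 1 else 0)"
proof -
  define ON where "ON S \<longleftrightarrow> finite S \<and> (\<forall>x\<in>S. \<forall>y\<in>S. H x y = (if x = y then 1 else 0))" for S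
  have z: "H 0 y = 0" for y using scale[of 0 0 y] by simp
  have sum: "H (\<Sum>x\<in>S. f x) y = (\<Sum>x\<in>S. H (f x) y)" for S y and f :: "'a^'n \<Rightarrow> 'a^'n"
    by (induction S rule: infinite_finite_induct) (auto simp: z add)
  have coeff: "H (\<Sum>x\<in>S. c x *s x) y = c y" if "ON S" "y \<in> S" for S c y
  proof -
    have "(\<Sum>x\<in>S. c x * H x y) = (\<Sum>x\<in>S. if x = y then c x else 0)"
      using that by (intro sum.cong) (auto simp: ON_def)
    then show ?thesis using that by (simp add: sum scale ON_def)
  qed
  have indep: "vec.independent S" if "ON S" for S
  proof (rule vec.independent_if_scalars_zero)
    show "finite S" using that by (simp add: ON_def)
    show "c x = 0" if "(\<Sum>x\<in>S. c x *s x) = 0" "x \<in> S" for c x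
      using coeff[OF \<open>ON S\<close> that(2), of c] that(1) z by simp
  qed
  have card: "card S \<le> CARD('n)" if "ON S" for S
    using vec.independent_card_le_dim[OF subset_UNIV indep[OF that]] unfolding vec_dim_card .
  have "ON {}" by (simp add: ON_def)
  \<comment> \<open>Orthonormal sets are independent, hence of bounded size; one of largest size
    must span, since otherwise a normalized residual vector could be added.\<close>
  then obtain S where S: "ON S" "\<And>T. ON T \<Longrightarrow> card T \<le> card S"
    using ex_has_greatest_nat[of ON "{}" card "CARD('n) + 1"] card by (metis less_Suc_eq_le Suc_eq_plus1)
  have "v \<in> vec.span S" for v
  proof (rule ccontr)
    assume v: "v \<notin> vec.span S"
    define w where "w = v - (\<Sum>x\<in>S. H v x *s x)"
    have s: "(\<Sum>x\<in>S. H v x *s x) \<in> vec.span S"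
      by (intro vec.span_sum vec.span_scale vec.span_base)
    then have "w \<noteq> 0" using v by (auto simp: w_def)
    then obtain c where c: "H (c *s w) (c *s w) = 1" using normalize by blast
    have minus: "H (x - y) u = H x u - H y u" for x y u
      using add[of "x - y" y u] by simp
    have wy: "H (c *s w) y = 0" if "y \<in> S" for y
      using coeff[OF S(1) that, of "H v"] by (simp add: scale w_def minus)
    have "c *s w \<notin> S" using wy c by force
    moreover have "ON (insert (c *s w) S)"
      using S(1) wy sym c by (auto simp: ON_def)
    ultimately show False
      using S(2)[of "insert (c *s w) S"] S(1) by (simp add: ON_def)
  qed
  then have "card S = CARD('n)"
    using vec.basis_card_eq_dim[OF subset_UNIV _ indep[OF S(1)]] unfolding vec_dim_card by blast
  then obtain q where q: "bij_betw q (UNIV :: 'n set) S"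
    using S(1) finite_same_card_bij[of "UNIV :: 'n set" S] by (auto simp: ON_def)
  have "H (q i) (q j) = (if i = j then 1 else 0)" for i j
    using S(1) q by (auto simp: ON_def bij_betw_def inj_on_def)
  then show ?thesis by (rule that)
qed

text \<open>This is 2^n n! times the usual Pfaffian of the matrix of B on the family X. Keeping the
  family as an argument makes changes of basis expressible.\<close>

definition pfaffian :: "('v \<Rightarrow> 'v \<Rightarrow> real) \<Rightarrow> ('n::finite \<times> bool \<Rightarrow> 'v) \<Rightarrow> real" where
  "pfaffian B X = (\<Sum>\<pi> | \<pi> permutes (UNIV :: ('n \<times> bool) set). of_int (sign \<pi>) *
        (\<Prod>j\<in>UNIV. B (X (\<pi> (j, False))) (X (\<pi> (j, True)))))"

lemma liouville_eq_pfaffian: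
  fixes \<omega> :: "('m, complex^'n) two_form"
  shows "liouville \<omega> c p = pfaffian (\<omega> c p) real_coord_vector / (2 ^ CARD('n) * fact CARD('n))"
  by (simp add: liouville_def pfaffian_def)

lemma prod_UNIV_times_bool:
  "(\<Prod>a\<in>(UNIV::('n::finite \<times> bool) set). f a) = (\<Prod>j\<in>UNIV. f (j, False) * f (j, True))"
proof -
  have "(\<Prod>a\<in>(UNIV::('n \<times> bool) set). f a) = (\<Prod>j\<in>UNIV. \<Prod>b\<in>UNIV. f (j, b))"
    by (simp add: prod.cartesian_product)
  then show ?thesis by (simp add: UNIV_bool)
qed

text \<open>The left side is the determinant of the matrix whose rows are selected by beta. A
  repeated row makes it vanish, so only permutations contribute.\<close>

lemma det_rows_function:
  fixes M :: "'i::finite \<Rightarrow> 'i \<Rightarrow> real"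
  shows "(\<Sum>\<pi> | \<pi> permutes UNIV. of_int (sign \<pi>) * (\<Prod>a\<in>UNIV. M (\<beta> a) (\<pi> a))) =
    (if \<beta> permutes UNIV then of_int (sign \<beta>) * det (\<chi> a b. M a b) else 0)"
proof -
  have *: "(\<Sum>\<pi> | \<pi> permutes UNIV. of_int (sign \<pi>) * (\<Prod>a\<in>UNIV. M (\<beta> a) (\<pi> a))) =
    det (\<chi> a. (\<chi> a b. M a b) $ \<beta> a)"
    by (simp add: det_def)
  show ?thesis
  proof (cases "\<beta> permutes UNIV")
    case True
    then show ?thesis unfolding * by (subst det_permute_rows) auto
  next
    case False
    then have "\<not> inj \<beta>" using finite_UNIV_inj_surj[of \<beta>] by (auto simp: bij_def intro: bij_imp_permutes)
    then obtain a b where "a \<noteq> b" "\<beta> a = \<beta> b" by (auto simp: inj_on_def)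
    then have "det (\<chi> a. (\<chi> a b. M a b) $ \<beta> a) = 0"
      by (intro det_identical_rows[of a b]) (auto simp: row_def)
    then show ?thesis using False * by simp
  qed
qed

text \<open>The identity Pf(M^T B M) = det M Pf B. When each factor is expanded bilinearly, the sum
  over permutations becomes a determinant whose rows are selected by the chosen indices, and
  \<open>det_rows_function\<close> removes all selections with repetitions.\<close>

lemma pfaffian_linear:
  fixes B :: "'v::real_vector \<Rightarrow> 'v \<Rightarrow> real" and M :: "'n::finite \<times> bool \<Rightarrow> 'n \<times> bool \<Rightarrow> real"
  assumes B: "bilinear B" and X: "\<And>a. X a = (\<Sum>b\<in>UNIV. M b a *\<^sub>R E b)"
  shows "pfaffian B X = det (\<chi> a b. M a b) * pfaffian B E"
proof -
  let ?I = "UNIV :: ('n \<times> bool) set"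
  \<comment> \<open>A choice of two indices for each factor j, read as a selfmap of the index
    set.\<close>
  define beta where "beta g = (\<lambda>(j, b). if b then snd (g j) else fst (g j))"
    for g :: "'n \<Rightarrow> ('n \<times> bool) \<times> ('n \<times> bool)"
  have BX: "B (X a) (X b) = (\<Sum>c\<in>UNIV. M (fst c) a * M (snd c) b * B (E (fst c)) (E (snd c)))" for a b
  proof -
    have "B (X a) (X b) = (\<Sum>(c, d)\<in>UNIV \<times> UNIV. M c a * M d b * B (E c) (E d))"
      unfolding X bilinear_sum[OF B]
      by (intro sum.cong) (auto simp: bilinear_lmul[OF B] bilinear_rmul[OF B])
    then show ?thesis by (simp add: case_prod_beta)
  qed
  have "pfaffian B X = (\<Sum>\<pi> | \<pi> permutes ?I. of_int (sign \<pi>) * (\<Sum>g\<in>UNIV. \<Prod>j\<in>UNIV.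
      M (fst (g j)) (\<pi> (j, False)) * M (snd (g j)) (\<pi> (j, True)) * B (E (fst (g j))) (E (snd (g j)))))"
    unfolding pfaffian_def BX by (subst prod_sum_PiE) auto
  also have "\<dots> = (\<Sum>\<pi> | \<pi> permutes ?I. \<Sum>g\<in>UNIV. of_int (sign \<pi>) * (\<Prod>a\<in>UNIV. M (beta g a) (\<pi> a)) *
      (\<Prod>j\<in>UNIV. B (E (fst (g j))) (E (snd (g j)))))"
    by (simp add: sum_distrib_left prod_UNIV_times_bool beta_def prod.distrib mult_ac)
  also have "\<dots> = (\<Sum>g\<in>UNIV. (\<Sum>\<pi> | \<pi> permutes ?I. of_int (sign \<pi>) * (\<Prod>a\<in>UNIV. M (beta g a) (\<pi> a))) *
      (\<Prod>j\<in>UNIV. B (E (fst (g j))) (E (snd (g j)))))"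
    unfolding sum_distrib_right by (rule sum.swap)
  also have "\<dots> = (\<Sum>g\<in>UNIV. (if beta g permutes ?I then of_int (sign (beta g)) * det (\<chi> a b. M a b) else 0) *
      (\<Prod>j\<in>UNIV. B (E (fst (g j))) (E (snd (g j)))))"
    unfolding det_rows_function ..
  also have "\<dots> = (\<Sum>\<beta>\<in>UNIV. (if \<beta> permutes ?I then of_int (sign \<beta>) * det (\<chi> a b. M a b) else 0) *
      (\<Prod>j\<in>UNIV. B (E (\<beta> (j, False))) (E (\<beta> (j, True)))))"
    by (rule sum.reindex_bij_witness[of _ "\<lambda>\<beta> j. (\<beta> (j, False), \<beta> (j, True))" beta])
      (auto simp: beta_def fun_eq_iff)
  also have "\<dots> = (\<Sum>\<beta>\<in>UNIV. if \<beta> permutes ?I then of_int (sign \<beta>) * det (\<chi> a b. M a b) *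
      (\<Prod>j\<in>UNIV. B (E (\<beta> (j, False))) (E (\<beta> (j, True)))) else 0)"
    by (intro sum.cong) auto
  also have "\<dots> = (\<Sum>\<beta> | \<beta> permutes ?I. of_int (sign \<beta>) * det (\<chi> a b. M a b) *
      (\<Prod>j\<in>UNIV. B (E (\<beta> (j, False))) (E (\<beta> (j, True)))))"
    by (subst sum.inter_filter[symmetric]) auto
  also have "\<dots> = det (\<chi> a b. M a b) * pfaffian B E"
    by (simp add: pfaffian_def sum_distrib_left mult_ac)
  finally show ?thesis .
qed

text \<open>A Darboux basis: \<open>X (i, False)\<close> and \<open>X (i, True)\<close> play the
  roles of e_i and f_i.\<close>

definition symplectic_basis :: "('v \<Rightarrow> 'v \<Rightarrow> real) \<Rightarrow> ('n \<times> bool \<Rightarrow> 'v) \<Rightarrow> bool" where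
  "symplectic_basis B X \<longleftrightarrow> (\<forall>i j x y. B (X (i, x)) (X (j, y)) =
     (if i = j \<and> x \<noteq> y then if x then - 1 else 1 else 0))"

text \<open>A signed permutation: the pairs are permuted by sigma, and the two members are exchanged
  in the pairs that F selects.\<close>

definition pair_perm :: "('n \<Rightarrow> 'n) \<Rightarrow> 'n set \<Rightarrow> 'n \<times> bool \<Rightarrow> 'n \<times> bool" where
  "pair_perm \<sigma> F = (\<lambda>(j, b). (\<sigma> j, b \<noteq> (j \<in> F)))"

text \<open>A transposition of two pairs is a product of two transpositions, so sigma has no
  influence on the sign; every exchange within a pair contributes -1.\<close>

lemma sign_pair_perm:
  fixes \<sigma> :: "'n::finite \<Rightarrow> 'n"
  assumes "\<sigma> permutes UNIV"
  shows "pair_perm \<sigma> F permutes UNIV \<and> sign (pair_perm \<sigma> F) = (\<Prod>j\<in>UNIV. if j \<in> F then - 1 else 1)"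
proof -
  have T: "Transposition.transpose a b permutes UNIV" for a b :: "'x"
    by (intro permutes_swap_id) auto
  have perm: "permutation p" if "p permutes UNIV" for p :: "'n \<times> bool \<Rightarrow> 'n \<times> bool"
    using that by (auto simp: permutation_permutes)
  have comp: "p \<circ> q permutes UNIV" "sign (p \<circ> q) = sign p * sign q"
    if "p permutes UNIV" "q permutes UNIV" for p q :: "'n \<times> bool \<Rightarrow> 'n \<times> bool"
    using that perm by (auto simp: permutes_compose sign_compose)
  have 1: "pair_perm \<sigma> {} permutes UNIV \<and> sign (pair_perm \<sigma> {}) = 1"
    using assms finite[of "UNIV :: 'n set"]
  proof (induction rule: permutes_induct)
    case id
    have eq: "pair_perm id {} = (id :: 'n \<times> bool \<Rightarrow> _)" by (auto simp: pair_perm_def fun_eq_iff)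
    show ?case unfolding eq by (intro conjI permutes_id sign_id)
  next
    case (swap a b p)
    have eq: "pair_perm (Transposition.transpose a b \<circ> p) {} =
      Transposition.transpose (a, False) (b, False) \<circ> (Transposition.transpose (a, True) (b, True) \<circ> pair_perm p {})"
      by (auto simp: pair_perm_def fun_eq_iff Transposition.transpose_def)
    have p: "pair_perm p {} permutes UNIV" "sign (pair_perm p {}) = 1" using swap by auto
    note c = comp(1)[OF T p(1)]
    show ?case
      unfolding eq comp(2)[OF T c] comp(2)[OF T p(1)] p(2)
      by (rule conjI[OF comp(1)[OF T c]]) (use swap(3) in \<open>simp add: sign_swap_id\<close>)
  qed
  have "finite F" by simp
  then have "pair_perm \<sigma> F permutes UNIV \<and> sign (pair_perm \<sigma> F) = (\<Prod>j\<in>F. - 1)"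
  proof (induction F)
    case empty then show ?case using 1 by simp
  next
    case (insert j F)
    have eq: "pair_perm \<sigma> (insert j F) = pair_perm \<sigma> F \<circ> Transposition.transpose (j, False) (j, True)"
      using insert by (auto simp: pair_perm_def fun_eq_iff Transposition.transpose_def)
    have p: "pair_perm \<sigma> F permutes UNIV" "sign (pair_perm \<sigma> F) = (\<Prod>j\<in>F. - 1)" using insert by auto
    show ?case
      unfolding eq comp(2)[OF p(1) T] p(2)
      by (rule conjI[OF comp(1)[OF p(1) T]]) (use insert in \<open>simp add: sign_swap_id\<close>)
  qed
  moreover have "(\<Prod>j\<in>F. - 1 :: int) = (\<Prod>j\<in>UNIV. if j \<in> F then - 1 else 1)"
    by (simp add: prod.If_cases)
  ultimately show ?thesis by simp
qed

text \<open>In a Darboux basis only the permutations that preserve pairs contribute. These are the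
  2^n n! signed permutations, and each contributes 1, because its sign cancels the signs of the
  factors.\<close>

lemma pfaffian_symplectic_basis:
  fixes X :: "'n::finite \<times> bool \<Rightarrow> 'v"
  assumes "symplectic_basis B X"
  shows "pfaffian B X = 2 ^ CARD('n) * fact CARD('n)"
proof -
  let ?t = "\<lambda>\<pi>. of_int (sign \<pi>) * (\<Prod>j\<in>UNIV. B (X (\<pi> (j, False))) (X (\<pi> (j, True))))"
  let ?N = "{\<sigma>. \<sigma> permutes (UNIV :: 'n set)} \<times> (UNIV :: 'n set set)"
  have B: "B (X a) (X b) = (if fst a = fst b \<and> snd a \<noteq> snd b then if snd a then - 1 else 1 else 0)" for a b
    using assms by (cases a; cases b) (simp add: symplectic_basis_def)
  have zero: "?t \<pi> = 0" if \<pi>: "\<pi> permutes UNIV" "\<pi> \<notin> (\<lambda>(\<sigma>, F). pair_perm \<sigma> F) ` ?N" for \<pi>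
  proof (rule ccontr)
    assume "?t \<pi> \<noteq> 0"
    then have nz: "B (X (\<pi> (j, False))) (X (\<pi> (j, True))) \<noteq> 0" for j by auto
    have *: "fst (\<pi> (j, False)) = fst (\<pi> (j, True))" "snd (\<pi> (j, False)) \<noteq> snd (\<pi> (j, True))" for j
      using nz[of j] by (auto simp: B split: if_splits)
    define \<sigma> where "\<sigma> j = fst (\<pi> (j, False))" for j
    define F where "F = {j. snd (\<pi> (j, False))}"
    have eq: "\<pi> = pair_perm \<sigma> F"
    proof
      fix a :: "'n \<times> bool"
      obtain j b where a: "a = (j, b)" by (cases a)
      show "\<pi> a = pair_perm \<sigma> F a"
        using *[of j] unfolding a by (cases b) (auto simp: pair_perm_def \<sigma>_def F_def prod_eq_iff)
    qed
    have "surj \<pi>" using \<pi>(1) by (simp add: permutes_surj)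
    have "surj \<sigma>"
      unfolding surj_def
    proof
      fix y
      obtain a where "\<pi> a = (y, False)" using \<open>surj \<pi>\<close> by (metis surjD)
      then have "\<sigma> (fst a) = y" unfolding eq by (cases a) (auto simp: pair_perm_def)
      then show "\<exists>x. y = \<sigma> x" by blast
    qed
    then have "\<sigma> permutes UNIV"
      using finite_UNIV_surj_inj[of \<sigma>] by (auto intro: bij_imp_permutes simp: bij_def)
    with \<pi>(2) eq show False by auto
  qed
  have one: "?t (pair_perm \<sigma> F) = 1" if "\<sigma> permutes UNIV" for \<sigma> F
  proof -
    have "(\<Prod>j\<in>UNIV. B (X (pair_perm \<sigma> F (j, False))) (X (pair_perm \<sigma> F (j, True)))) = (\<Prod>j\<in>UNIV. if j \<in> F then - 1 else 1)"
      by (intro prod.cong) (auto simp: B pair_perm_def)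
    then have "?t (pair_perm \<sigma> F) = (\<Prod>j\<in>UNIV. if j \<in> F then - 1 else 1) * (\<Prod>j\<in>UNIV. if j \<in> F then - 1 else 1)"
      using sign_pair_perm[OF that, of F] by (simp add: of_int_prod if_distrib[of of_int] cong: if_cong)
    also have "\<dots> = 1" unfolding prod.distrib[symmetric] by (intro prod.neutral) auto
    finally show ?thesis .
  qed
  have inj: "inj_on (\<lambda>(\<sigma>, F). pair_perm \<sigma> F) ?N"
  proof (rule inj_onI, clarify)
    fix \<sigma> F \<tau> G assume eq: "pair_perm \<sigma> F = pair_perm \<tau> (G :: 'n set)"
    have "\<sigma> j = \<tau> j \<and> (j \<in> F) = (j \<in> G)" for j
      using fun_cong[OF eq, of "(j, False)"] by (auto simp: pair_perm_def)
    then show "\<sigma> = \<tau> \<and> F = G" by (auto simp: fun_eq_iff)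
  qed
  have "pfaffian B X = sum ?t ((\<lambda>(\<sigma>, F). pair_perm \<sigma> F) ` ?N)"
    unfolding pfaffian_def
    by (rule sum.mono_neutral_right) (use zero sign_pair_perm in auto)
  also have "\<dots> = (\<Sum>(\<sigma>, F)\<in>?N. ?t (pair_perm \<sigma> F))"
    by (subst sum.reindex[OF inj]) (auto simp: case_prod_beta)
  also have "\<dots> = (\<Sum>(\<sigma>, F)\<in>?N. 1)"
    by (intro sum.cong) (auto simp: one)
  also have "\<dots> = real (card ?N)" by (simp add: case_prod_beta)
  also have "card ?N = fact CARD('n) * 2 ^ CARD('n)"
    by (simp add: card_cartesian_product card_permutations card_UNIV_set)
  finally show ?thesis by simp
qed

section \<open>Positive forms of type (1,1)\<close>

text \<open>The value of a Kaehler form at one point, read in a chart.\<close>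

definition positive_form :: "(complex^'n \<Rightarrow> complex^'n \<Rightarrow> real) \<Rightarrow> bool" where
  "positive_form B \<longleftrightarrow> bilinear B \<and> (\<forall>v. B v v = 0) \<and>
     (\<forall>v w. B (\<i> *s v) (\<i> *s w) = B v w) \<and> (\<forall>v. v \<noteq> 0 \<longrightarrow> B v (\<i> *s v) > 0)"

lemma positive_formD:
  assumes "positive_form B"
  shows "bilinear B" "B v v = 0" "B (\<i> *s v) (\<i> *s w) = B v w" "v \<noteq> 0 \<Longrightarrow> B v (\<i> *s v) > 0"
    "B w v = - B v w" "B (\<i> *s v) w = - B v (\<i> *s w)"
proof -
  show b: "bilinear B" and "v \<noteq> 0 \<Longrightarrow> B v (\<i> *s v) > 0"
    using assms by (auto simp: positive_form_def)
  show z: "B v v = 0" for v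
    using assms by (auto simp: positive_form_def)
  show J: "B (\<i> *s v) (\<i> *s w) = B v w" for v w
    using assms by (auto simp: positive_form_def)
  show a: "B w v = - B v w" for v w
    using z[of "v + w"] z[of v] z[of w] by (simp add: bilinear_ladd[OF b] bilinear_radd[OF b])
  have ii: "\<i> *s (\<i> *s v) = - v" unfolding vec_eq_iff by simp
  show "B (\<i> *s v) w = - B v (\<i> *s w)"
    using J[of "\<i> *s v" w] unfolding ii bilinear_lneg[OF b] by simp
qed

text \<open>On the diagonal this becomes B(v, iv)/2. The factor 1/2 is where the factors sqrt 2
  below come from.\<close>

lemma herm_form_eq:
  assumes "positive_form B"
  shows "herm_form B v w = (complex_of_real (B v (\<i> *s w)) - \<i> * complex_of_real (B v w)) / 2"
  by (simp add: herm_form_def positive_formD(3)[OF assms] positive_formD(6)[OF assms]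
      bilinear_rneg[OF positive_formD(1)[OF assms]] field_simps)

lemma of_real_smult_eq: "complex_of_real r *s v = r *\<^sub>R v"
  by (simp add: vec_eq_iff scaleR_conv_of_real[where 'a=complex])

lemma herm_form_sesquilinear:
  fixes B :: "complex^'n \<Rightarrow> complex^'n \<Rightarrow> real"
  assumes B: "positive_form B"
  shows "herm_form B (x + y) z = herm_form B x z + herm_form B y z"
    and "herm_form B (c *s x) z = c * herm_form B x z"
    and "herm_form B y x = cnj (herm_form B x y)"
    and "herm_form B z (x + y) = herm_form B z x + herm_form B z y"
    and "herm_form B z (c *s x) = cnj c * herm_form B z x"
proof -
  note b = positive_formD(1)[OF B]
  show add: "herm_form B (x + y) z = herm_form B x z + herm_form B y z" for x y z
    by (simp add: herm_form_eq[OF B] bilinear_ladd[OF b] field_simps)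
  have i: "herm_form B (\<i> *s x) z = \<i> * herm_form B x z" for x z
    by (simp add: herm_form_eq[OF B] positive_formD(3)[OF B] positive_formD(6)[OF B] bilinear_rneg[OF b] field_simps)
  have r: "herm_form B (complex_of_real r *s x) z = of_real r * herm_form B x z" for r x z
    by (simp add: herm_form_eq[OF B] of_real_smult_eq bilinear_lmul[OF b] field_simps)
  show scale: "herm_form B (c *s x) z = c * herm_form B x z" for c x z
  proof -
    have "c *s x = (complex_of_real (Re c) + \<i> * complex_of_real (Im c)) *s x"
      by (simp only: complex_eq[symmetric])
    also have "\<dots> = complex_of_real (Re c) *s x + \<i> *s (complex_of_real (Im c) *s x)"
      by (simp only: vector_smult_assoc vector_sadd_rdistrib)
    finally have "herm_form B (c *s x) z = (complex_of_real (Re c) + \<i> * complex_of_real (Im c)) * herm_form B x z"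
      by (simp only: add i r ring_distribs mult.assoc)
    then show ?thesis by (simp only: complex_eq[symmetric])
  qed
  show cnj: "herm_form B y x = cnj (herm_form B x y)" for x y
    using positive_formD(6)[OF B, of x y] positive_formD(5)[OF B, of x y]
      positive_formD(5)[OF B, of "\<i> *s x" y]
    by (simp add: herm_form_eq[OF B])
  show "herm_form B z (x + y) = herm_form B z x + herm_form B z y"
    by (metis add cnj complex_cnj_add)
  show "herm_form B z (c *s x) = cnj c * herm_form B z x"
    by (metis scale cnj complex_cnj_mult)
qed

lemma herm_form_self:
  assumes "positive_form B"
  shows "herm_form B x x = of_real (B x (\<i> *s x) / 2)"
  by (simp add: herm_form_eq[OF assms] positive_formD(2)[OF assms])

lemma unitary_family_exists:
  fixes B :: "complex^'n \<Rightarrow> complex^'n \<Rightarrow> real"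
  assumes B: "positive_form B"
  obtains q :: "'n \<Rightarrow> complex^'n" where "\<And>i j. herm_form B (q i) (q j) = (if i = j then 1 else 0)"
proof -
  have n: "\<exists>c. herm_form B (c *s x) (c *s x) = 1" if "x \<noteq> 0" for x
  proof -
    define r where "r = B x (\<i> *s x) / 2"
    have "r > 0" using positive_formD(4)[OF B that] by (simp add: r_def)
    have "herm_form B (of_real (1 / sqrt r) *s x) (of_real (1 / sqrt r) *s x) =
        of_real (1 / sqrt r) * (of_real (1 / sqrt r) * of_real r)"
      unfolding herm_form_sesquilinear(2,5)[OF B] herm_form_self[OF B, of x] r_def complex_cnj_complex_of_real ..
    also have "\<dots> = of_real (1 / sqrt r * (1 / sqrt r * r))"
      by (simp only: of_real_mult)
    also have "1 / sqrt r * (1 / sqrt r * r) = 1"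
      using \<open>r > 0\<close> by (simp add: field_simps)
    finally have "herm_form B (of_real (1 / sqrt r) *s x) (of_real (1 / sqrt r) *s x) = 1"
      by simp
    then show ?thesis by blast
  qed
  have "herm_form B y x = 0" if "herm_form B x y = 0" for x y
    using herm_form_sesquilinear(3)[OF B, of y x] that by simp
  from gram_schmidt[of "herm_form B", OF herm_form_sesquilinear(1,2)[OF B] this n]
  obtain q :: "'n \<Rightarrow> complex^'n" where "\<And>i j. herm_form B (q i) (q j) = (if i = j then 1 else 0)"
    by metis
  then show ?thesis by (rule that)
qed

text \<open>Since B is invariant under i, an orthonormal basis of a Lagrangian subspace can be
  completed to a Darboux basis by its multiples by i.\<close>

lemma symplectic_basis_of_unitary:
  assumes B: "positive_form B"
    and q: "\<And>i j. B (q i) (\<i> *s q j) = (if i = j then 1 else 0)" "\<And>i j. B (q i) (q j) = 0"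
  shows "symplectic_basis B (\<lambda>(j, b). if b then \<i> *s q j else q j)"
  using positive_formD(3)[OF B] positive_formD(6)[OF B] bilinear_rneg[OF positive_formD(1)[OF B]] q
  by (auto simp: symplectic_basis_def)

lemma real_coord_expansion:
  fixes v :: "complex^'n"
  shows "v = (\<Sum>b\<in>UNIV. (v \<bullet> real_coord_vector b) *\<^sub>R real_coord_vector b)"
  using sum.reindex_bij_betw[OF bij_betw_real_coord_vector, of "\<lambda>b. (v \<bullet> b) *\<^sub>R b"]
  by (simp add: euclidean_representation)

lemma pfaffian_real_coord:
  fixes X :: "'n::finite \<times> bool \<Rightarrow> complex^'n"
  assumes "bilinear B"
  shows "pfaffian B X = det (\<chi> a b. X b \<bullet> real_coord_vector a) * pfaffian B real_coord_vector"
  by (rule pfaffian_linear[OF assms]) (rule real_coord_expansion)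

lemma symplectic_family_exists:
  fixes B :: "complex^'n \<Rightarrow> complex^'n \<Rightarrow> real"
  assumes B: "positive_form B"
  obtains X :: "'n \<times> bool \<Rightarrow> complex^'n" where "symplectic_basis B X"
proof -
  obtain q :: "'n \<Rightarrow> complex^'n" where q: "\<And>i j. herm_form B (q i) (q j) = (if i = j then 1 else 0)"
    using unitary_family_exists[OF B] by metis
  \<comment> \<open>The scaling matches the factor 1/2 in \<open>herm_form_eq\<close>: the real part
    of the Hermitian form then gives the pairings B(p_i, i p_j), and its imaginary part the
    vanishing of B(p_i, p_j).\<close>
  define p where "p i = (1 / sqrt 2) *\<^sub>R q i" for i
  have pp: "herm_form B (p i) (p j) = (if i = j then 1 / 2 else 0)" for i j
  proof -
    have "herm_form B (p i) (p j) = of_real (1 / sqrt 2) * (of_real (1 / sqrt 2) * (if i = j then 1 else 0))"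
      unfolding p_def of_real_smult_eq[symmetric] herm_form_sesquilinear(2,5)[OF B] q complex_cnj_complex_of_real ..
    moreover have "complex_of_real (1 / sqrt 2) * of_real (1 / sqrt 2) = 1 / 2"
      by (simp flip: of_real_mult)
    ultimately show ?thesis by (cases "i = j") (simp_all add: mult.assoc[symmetric])
  qed
  have "B (p i) (\<i> *s p j) = (if i = j then 1 else 0) \<and> B (p i) (p j) = 0" for i j
    using pp[of i j] by (auto simp: herm_form_eq[OF B] complex_eq_iff split: if_splits)
  with symplectic_basis_of_unitary[OF B, of p] show ?thesis by (intro that) auto
qed

text \<open>The sum of the forms dx_j \<and> dy_j, the end point of the deformation in
  \<open>pfaffian_positive\<close>.\<close>

definition standard_form :: "complex^'n \<Rightarrow> complex^'n \<Rightarrow> real" where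
  "standard_form v w = (\<Sum>j\<in>UNIV. Re (v $ j) * Im (w $ j) - Im (v $ j) * Re (w $ j))"

lemma positive_standard_form: "positive_form (standard_form :: complex^'n \<Rightarrow> complex^'n \<Rightarrow> real)"
proof -
  have "standard_form v (\<i> *s v) > 0" if "v \<noteq> 0" for v :: "complex^'n"
  proof -
    obtain k where "v $ k \<noteq> 0" using \<open>v \<noteq> 0\<close> by (metis vec_eq_iff zero_index)
    then have "0 < (Re (v $ k))\<^sup>2 + (Im (v $ k))\<^sup>2"
      by (simp add: complex_eq_iff sum_power2_gt_zero_iff del: zero_less_power2)
    then show ?thesis
      unfolding standard_form_def
      by (intro sum_pos2[of UNIV k]) (auto simp: power2_eq_square)
  qed
  moreover have "bilinear (standard_form :: complex^'n \<Rightarrow> complex^'n \<Rightarrow> real)"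
    unfolding bilinear_def standard_form_def
    by (auto intro!: linearI simp: sum.distrib[symmetric] sum_subtractf[symmetric] sum_distrib_left algebra_simps)
  ultimately show ?thesis
    by (auto simp: positive_form_def standard_form_def algebra_simps)
qed

lemma positive_form_convex:
  assumes "positive_form B" "positive_form B'" "0 \<le> t" "t \<le> 1"
  shows "positive_form (\<lambda>v w. (1 - t) * B v w + t * B' v w)"
proof -
  have "(1 - t) * B v (\<i> *s v) + t * B' v (\<i> *s v) > 0" if "v \<noteq> 0" for v
    using positive_formD(4)[OF assms(1) that] positive_formD(4)[OF assms(2) that] assms(3,4)
    by (cases "t = 0") (auto intro!: add_nonneg_pos)
  moreover have "bilinear (\<lambda>v w. (1 - t) * B v w + t * B' v w)"
    using positive_formD(1)[OF assms(1)] positive_formD(1)[OF assms(2)]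
    unfolding bilinear_def[of "\<lambda>v w. _ v w + _ v w"]
    by (auto intro!: linearI simp: bilinear_ladd bilinear_radd bilinear_lmul bilinear_rmul algebra_simps)
  ultimately show ?thesis
    by (simp add: positive_form_def positive_formD(2,3)[OF assms(1)] positive_formD(2,3)[OF assms(2)])
qed

lemma symplectic_real_coord: "symplectic_basis standard_form (real_coord_vector :: 'n::finite \<times> bool \<Rightarrow> complex^'n)"
proof -
  have "(\<Sum>k\<in>UNIV. Re (axis i x $ k) * Im (axis j y $ k) - Im (axis i x $ k) * Re (axis j y $ k)) =
    (if i = j then Re x * Im y - Im x * Re y else 0)" for i j :: 'n and x y :: complex
  proof -
    have "(\<Sum>k\<in>UNIV. Re (axis i x $ k) * Im (axis j y $ k) - Im (axis i x $ k) * Re (axis j y $ k)) =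
      (\<Sum>k\<in>UNIV. if k = i then (if i = j then Re x * Im y - Im x * Re y else 0) else 0)"
      by (intro sum.cong) (auto simp: axis_def)
    then show ?thesis by simp
  qed
  then show ?thesis
    by (simp add: symplectic_basis_def standard_form_def real_coord_vector_def)
qed

text \<open>The sign is determined by deforming the form, through positive forms, to the standard one.\<close>

lemma pfaffian_positive:
  fixes B :: "complex^'n \<Rightarrow> complex^'n \<Rightarrow> real"
  assumes B: "positive_form B"
  shows "pfaffian B real_coord_vector > 0"
proof (rule ccontr)
  let ?B = "\<lambda>t v w. (1 - t) * B v w + t * standard_form v w"
  let ?p = "\<lambda>t. pfaffian (?B t) (real_coord_vector :: 'n \<times> bool \<Rightarrow> complex^'n)"
  assume "\<not> pfaffian B real_coord_vector > 0"
  then have "?p 0 \<le> 0" by simp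
  moreover have "?p 1 \<ge> 0"
    using pfaffian_symplectic_basis[OF symplectic_real_coord, where 'n='n] by simp
  moreover have "continuous_on {0..1} ?p"
    unfolding pfaffian_def by (intro continuous_intros)
  \<comment> \<open>If the Pfaffian of B were not positive, that of some form on the segment would
    vanish. But this form is positive, hence has a Darboux basis, and its Pfaffian cannot be
    0.\<close>
  ultimately obtain t where t: "0 \<le> t" "t \<le> 1" "?p t = 0"
    using IVT'[of ?p 0 0 1] by auto
  have pf: "positive_form (?B t)"
    by (rule positive_form_convex[OF B positive_standard_form t(1,2)])
  obtain X :: "'n \<times> bool \<Rightarrow> complex^'n" where "symplectic_basis (?B t) X"
    by (rule symplectic_family_exists[OF pf])
  then have "pfaffian (?B t) X \<noteq> 0" by (simp add: pfaffian_symplectic_basis)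
  then show False
    using pfaffian_real_coord[OF positive_formD(1)[OF pf], of X] t(3) by simp
qed

lemma unitary_basis_exists:
  fixes B :: "complex^'n \<Rightarrow> complex^'n \<Rightarrow> real"
  assumes "positive_form B"
  shows "\<exists>P. unitary_basis B P"
proof -
  obtain q :: "'n \<Rightarrow> complex^'n" where q: "\<And>i j. herm_form B (q i) (q j) = (if i = j then 1 else 0)"
    using unitary_family_exists[OF assms] by metis
  have "column a (\<chi> i j. q j $ i) = q a" for a by (simp add: column_def vec_eq_iff)
  with q have "unitary_basis B (\<chi> i j. q j $ i)" by (simp add: unitary_basis_def)
  then show ?thesis ..
qed

text \<open>P^T G conj(P) is the identity, where G is the Gram matrix of the coordinate
  vectors.\<close>

lemma unitary_basis_det:
  fixes B :: "complex^'n \<Rightarrow> complex^'n \<Rightarrow> real"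
  assumes B: "positive_form B" and P: "unitary_basis B P"
  shows "det (\<chi> a b. herm_form B (axis a 1) (axis b 1)) * of_real ((cmod (det P))\<^sup>2) = 1"
proof -
  let ?G = "\<chi> a b. herm_form B (axis a 1) (axis b 1)"
  let ?C = "\<chi> a b. cnj (P $ a $ b)"
  have sl: "herm_form B (\<Sum>i\<in>S. f i) y = (\<Sum>i\<in>S. herm_form B (f i) y)" for S f y
    using herm_form_sesquilinear(2)[OF B, of 0 0] 
    by (induction S rule: infinite_finite_induct) (auto simp: herm_form_sesquilinear(1)[OF B])
  have sr: "herm_form B y (\<Sum>i\<in>S. f i) = (\<Sum>i\<in>S. herm_form B y (f i))" for S f y
    using herm_form_sesquilinear(5)[OF B, of _ 0 0] 
    by (induction S rule: infinite_finite_induct) (auto simp: herm_form_sesquilinear(4)[OF B])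
  have col: "column a P = (\<Sum>i\<in>UNIV. P $ i $ a *s axis i 1)" for a
    by (simp add: column_def vec_eq_iff axis_def if_distrib[of "(*) _"] cong: if_cong)
  have "transpose P ** ?G ** ?C = mat 1"
  proof -
    have "(transpose P ** ?G ** ?C) $ a $ b = herm_form B (column a P) (column b P)" for a b
      unfolding col
      by (simp add: sl sr herm_form_sesquilinear(2,5)[OF B] matrix_matrix_mult_def transpose_def
          sum_distrib_left sum_distrib_right mult_ac)
    then show ?thesis using P by (simp add: vec_eq_iff unitary_basis_def mat_def)
  qed
  then have "det P * det ?G * det ?C = 1"
    by (metis det_I det_mul det_transpose)
  moreover have "det ?C = cnj (det P)"
    by (simp add: det_def)
  ultimately show ?thesis
    unfolding complex_norm_square by (simp add: mult_ac)
qed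

text \<open>The Gram matrix alone determines |det P|, so the choice operator in the weight of
  \<open>canonical_bundle\<close> is harmless.\<close>

lemma unitary_basis_cmod_det:
  assumes "positive_form B" "unitary_basis B P" "unitary_basis B P'"
  shows "cmod (det P) = cmod (det P')" "cmod (det P) > 0"
proof -
  let ?D = "det (\<chi> a b. herm_form B (axis a 1) (axis b 1))"
  have "?D * of_real ((cmod (det P))\<^sup>2) = ?D * of_real ((cmod (det P'))\<^sup>2)" "?D * of_real ((cmod (det P))\<^sup>2) \<noteq> 0"
    using unitary_basis_det[OF assms(1,2)] unitary_basis_det[OF assms(1,3)] by auto
  then show "cmod (det P) = cmod (det P')" "cmod (det P) > 0"
    by (auto simp flip: of_real_power simp: power2_eq_iff_nonneg)
qed

section \<open>Real and imaginary parts of complex vectors\<close>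

definition Re_vec :: "complex^'n \<Rightarrow> real^'n" where "Re_vec z = (\<chi> j. Re (z $ j))"
definition Im_vec :: "complex^'n \<Rightarrow> real^'n" where "Im_vec z = (\<chi> j. Im (z $ j))"
definition Complex_vec :: "(real^'n) \<times> (real^'n) \<Rightarrow> complex^'n" where
  "Complex_vec p = (\<chi> j. Complex (fst p $ j) (snd p $ j))"

lemma Re_Im_Complex_vec [simp]:
  "Re_vec (Complex_vec p) = fst p" "Im_vec (Complex_vec p) = snd p"
  "Complex_vec (Re_vec z, Im_vec z) = z"
  by (simp_all add: Re_vec_def Im_vec_def Complex_vec_def vec_eq_iff complex_eq_iff)

lemma linear_Re_vec: "linear Re_vec" and linear_Im_vec: "linear Im_vec"
  and linear_Complex_vec: "linear Complex_vec"
  by (auto intro!: linearI simp: Re_vec_def Im_vec_def Complex_vec_def vec_eq_iff complex_eq_iff)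

lemma borel_measurable_linear: "linear (f :: 'a::euclidean_space \<Rightarrow> 'b::euclidean_space) \<Longrightarrow> f \<in> borel_measurable borel"
  by (intro borel_measurable_continuous_onI linear_continuous_on) (simp add: linear_conv_bounded_linear)

lemma Complex_vec_image: "Complex_vec ` (X \<times> Y) = {z. Re_vec z \<in> X \<and> Im_vec z \<in> Y}"
  by (auto simp: image_iff) (metis Re_Im_Complex_vec(3))

lemma emeasure_lborel_box_vec:
  fixes l u :: "real^'n"
  assumes "\<And>j. l $ j \<le> u $ j"
  shows "emeasure lborel (box l u) = ennreal (\<Prod>j\<in>UNIV. u $ j - l $ j)"
proof -
  have "bij_betw (\<lambda>i. axis i (1::real)) UNIV (Basis :: (real^'n) set)"
    by (auto simp: bij_betw_def inj_on_def axis_eq_axis Basis_vec_def)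
  from prod.reindex_bij_betw[OF this, of "\<lambda>b. (u - l) \<bullet> b"]
  have "(\<Prod>b\<in>Basis. (u - l) \<bullet> b) = (\<Prod>j\<in>UNIV. u $ j - l $ j)"
    by (simp add: inner_axis)
  moreover have "\<forall>b\<in>Basis. l \<bullet> b \<le> u \<bullet> b"
    using assms by (auto simp: Basis_vec_def inner_axis)
  ultimately show ?thesis by (simp add: emeasure_lborel_box_eq)
qed

text \<open>A box in complex space is the product of a box for the real parts and a box for the
  imaginary parts.\<close>

lemma distr_Complex_vec: "distr lborel borel Complex_vec = (lborel :: (complex^'n) measure)"
proof (rule lborel_eqI[symmetric])
  fix l u :: "complex^'n" assume lu: "\<And>b. b \<in> Basis \<Longrightarrow> l \<bullet> b \<le> u \<bullet> b"
  have E: "real_coord_vector b \<in> (Basis :: (complex^'n) set)" for b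
    using bij_betw_real_coord_vector by (auto simp: bij_betw_def)
  have inner: "z \<bullet> real_coord_vector (j, False) = Re (z $ j)" "z \<bullet> real_coord_vector (j, True) = Im (z $ j)"
    for z :: "complex^'n" and j
    by (simp_all add: real_coord_vector_def inner_axis inner_complex_def)
  have le: "Re (l $ j) \<le> Re (u $ j)" "Im (l $ j) \<le> Im (u $ j)" for j
    using lu[OF E, of "(j, False)"] lu[OF E, of "(j, True)"] by (simp_all add: inner)
  have "Complex_vec -` box l u = box (Re_vec l) (Re_vec u) \<times> box (Im_vec l) (Im_vec u)"
  proof -
    have "z \<in> box l u \<longleftrightarrow> (\<forall>b. l \<bullet> real_coord_vector b < z \<bullet> real_coord_vector b \<and> z \<bullet> real_coord_vector b < u \<bullet> real_coord_vector b)" for z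
      unfolding mem_box bij_betw_imp_surj_on[OF bij_betw_real_coord_vector, symmetric] by simp
    also have "\<And>z. (\<forall>b. l \<bullet> real_coord_vector b < z \<bullet> real_coord_vector b \<and> z \<bullet> real_coord_vector b < u \<bullet> real_coord_vector b) \<longleftrightarrow>
      Re_vec z \<in> box (Re_vec l) (Re_vec u) \<and> Im_vec z \<in> box (Im_vec l) (Im_vec u)"
      by (auto simp: split_paired_All all_bool_eq inner mem_box_cart Re_vec_def Im_vec_def)
    finally show ?thesis by auto
  qed
  then have "emeasure (distr lborel borel Complex_vec) (box l u) =
      emeasure (lborel \<Otimes>\<^sub>M lborel) (box (Re_vec l) (Re_vec u) \<times> box (Im_vec l) (Im_vec u))"
    using borel_measurable_linear[OF linear_Complex_vec]
    by (subst emeasure_distr) (auto simp: lborel_prod)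
  also have "\<dots> = emeasure lborel (box (Re_vec l) (Re_vec u)) * emeasure lborel (box (Im_vec l) (Im_vec u))"
    by (intro lborel.emeasure_pair_measure_Times) auto
  also have "\<dots> = ennreal ((\<Prod>j\<in>UNIV. Re (u $ j) - Re (l $ j)) * (\<Prod>j\<in>UNIV. Im (u $ j) - Im (l $ j)))"
    using le by (subst (1 2) emeasure_lborel_box_vec) (auto simp: Re_vec_def Im_vec_def ennreal_mult' prod_nonneg)
  also have "(\<Prod>j\<in>UNIV. Re (u $ j) - Re (l $ j)) * (\<Prod>j\<in>UNIV. Im (u $ j) - Im (l $ j)) =
      (\<Prod>b\<in>UNIV. (u - l) \<bullet> real_coord_vector b)"
    by (simp add: prod_UNIV_times_bool prod.distrib inner inner_diff_left)
  also have "\<dots> = (\<Prod>b\<in>Basis. (u - l) \<bullet> b)"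
    by (rule prod.reindex_bij_betw[OF bij_betw_real_coord_vector])
  finally show "emeasure (distr lborel borel Complex_vec) (box l u) = (\<Prod>b\<in>Basis. (u - l) \<bullet> b)" .
qed simp

lemma frechet_derivative_linear: "linear (f::'a::euclidean_space \<Rightarrow> 'b::euclidean_space) \<Longrightarrow> frechet_derivative f (at x) = f"
  by (metis frechet_derivative_at linear_imp_has_derivative)

lemma emeasure_linear_image:
  fixes T :: "'a::euclidean_space \<Rightarrow> 'a"
  assumes "linear T" "inj T" "S \<in> sets borel"
  shows "emeasure lborel (T ` S) = ennreal (jac T) * emeasure lborel S"
proof -
  have "Ck 1 UNIV T" using assms(1) by (intro Ck_bounded_linear) (auto simp: linear_conv_bounded_linear)
  then have "emeasure lborel (T ` S) = (\<integral>\<^sup>+x. ennreal (indicator S x * jac T) \<partial>lborel)"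
    using emeasure_image_Jac[of UNIV T S] assms by (simp add: frechet_derivative_linear)
  also have "\<dots> = (\<integral>\<^sup>+x. ennreal (jac T) * indicator S x \<partial>lborel)"
    by (intro nn_integral_cong) (auto simp: indicator_def)
  also have "\<dots> = ennreal (jac T) * emeasure lborel S"
    using assms(3) by (subst nn_integral_cmult_indicator) auto
  finally show ?thesis .
qed

text \<open>When T is the differential of a parametrization of Gamma, this complex linear extension
  is the differential at s = 0 of the coordinates used for the method of Laplace.\<close>

definition complexify :: "(real^'n \<Rightarrow> complex^'n) \<Rightarrow> complex^'n \<Rightarrow> complex^'n" where
  "complexify T z = T (Re_vec z) + \<i> *s T (Im_vec z)"

text \<open>The complexification of a real endomorphism; \<open>complexify T\<close> after
  \<open>complex_ext Q\<close> is the complex linear extension of T after Q.\<close>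

definition complex_ext :: "(real^'n \<Rightarrow> real^'n) \<Rightarrow> complex^'n \<Rightarrow> complex^'n" where
  "complex_ext Q z = Complex_vec (Q (Re_vec z), Q (Im_vec z))"

lemma linear_complexify: "linear T \<Longrightarrow> linear (complexify T)"
proof -
  assume T: "linear T"
  have i: "\<i> *s (r *\<^sub>R z) = r *\<^sub>R (\<i> *s z)" for r and z :: "complex^'n"
    by (simp add: vec_eq_iff)
  show ?thesis
    unfolding complexify_def
    by (rule linearI) (simp_all add: linear_add[OF linear_Re_vec] linear_add[OF linear_Im_vec]
      linear_scale[OF linear_Re_vec] linear_scale[OF linear_Im_vec] linear_add[OF T] linear_scale[OF T]
      vector_add_ldistrib scaleR_add_right i)
qed

lemma linear_complex_ext: "linear Q \<Longrightarrow> linear (complex_ext Q)"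
  unfolding complex_ext_def
  by (rule linearI) (simp_all add: linear_add[OF linear_Re_vec] linear_add[OF linear_Im_vec]
      linear_scale[OF linear_Re_vec] linear_scale[OF linear_Im_vec] linear_add[of Q] linear_scale[of Q]
      flip: linear_add[OF linear_Complex_vec] linear_scale[OF linear_Complex_vec])

text \<open>Measured on the unit cube: its image is a product of two copies of the image of the real
  cube, each of measure \<open>jac Q\<close>.\<close>

lemma jac_complex_ext:
  assumes "linear Q" "inj Q"
  shows "jac (complex_ext Q) = (jac Q)\<^sup>2"
proof -
  let ?C = "box 0 One :: (real^'n) set"
  have QC: "Q ` ?C \<in> sets borel"
    using borel_image_open_map[OF open_UNIV _ assms(2)] assms(1)
    by (simp add: linear_continuous_on linear_conv_bounded_linear)
  have inj: "inj (complex_ext Q)"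
    using assms(2) by (auto simp: inj_on_def complex_ext_def)
      (metis Re_Im_Complex_vec fst_conv snd_conv)
  have em: "emeasure lborel (Complex_vec ` (X \<times> Y)) = emeasure lborel X * emeasure lborel Y"
    if "X \<in> sets borel" "Y \<in> sets borel" for X Y :: "(real^'n) set"
  proof -
    let ?Z = "{z. Re_vec z \<in> X \<and> Im_vec z \<in> Y}"
    have Z: "?Z \<in> sets borel"
      using measurable_sets[OF borel_measurable_linear[OF linear_Re_vec] that(1)]
        measurable_sets[OF borel_measurable_linear[OF linear_Im_vec] that(2)]
      by (auto simp: vimage_def Collect_conj_eq)
    have "emeasure lborel (Complex_vec ` (X \<times> Y)) = emeasure (distr lborel borel Complex_vec) ?Z"
      by (simp add: Complex_vec_image distr_Complex_vec)
    also have "\<dots> = emeasure (lborel \<Otimes>\<^sub>M lborel) (X \<times> Y)"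
      using borel_measurable_linear[OF linear_Complex_vec] Z
      by (subst emeasure_distr) (auto simp: lborel_prod intro!: arg_cong[where f="emeasure lborel"])
    also have "\<dots> = emeasure lborel X * emeasure lborel Y"
      using that by (intro lborel.emeasure_pair_measure_Times) auto
    finally show ?thesis .
  qed
  have one: "emeasure lborel ?C = 1"
    by (subst emeasure_lborel_box_eq) auto
  have "complex_ext Q ` (Complex_vec ` (?C \<times> ?C)) = Complex_vec ` ((Q ` ?C) \<times> (Q ` ?C))"
    by (force simp: complex_ext_def image_iff)
  then have "emeasure lborel (complex_ext Q ` (Complex_vec ` (?C \<times> ?C))) = ennreal (jac Q) * ennreal (jac Q)"
    using em[OF QC QC] emeasure_linear_image[OF assms, of ?C] one by simp
  moreover have CC: "Complex_vec ` (?C \<times> ?C) \<in> sets borel"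
    using measurable_sets[OF borel_measurable_linear[OF linear_Re_vec], of ?C]
        measurable_sets[OF borel_measurable_linear[OF linear_Im_vec], of ?C]
    by (auto simp: Complex_vec_image vimage_def Collect_conj_eq)
  have "emeasure lborel (complex_ext Q ` (Complex_vec ` (?C \<times> ?C))) = ennreal (jac (complex_ext Q))"
    unfolding emeasure_linear_image[OF linear_complex_ext[OF assms(1)] inj CC]
    by (subst em) (simp_all add: one)
  ultimately show ?thesis
    by (simp add: power2_eq_square jac_nonneg flip: ennreal_mult)
qed

section \<open>Densities along a Lagrangian subspace\<close>

definition coord_matrix :: "(real^'n \<Rightarrow> complex^'n) \<Rightarrow> complex^'n^'n" where
  "coord_matrix T = (\<chi> a b. T (axis b 1) $ a)"

definition liouville_coeff :: "(complex^'n \<Rightarrow> complex^'n \<Rightarrow> real) \<Rightarrow> real" where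
  "liouville_coeff B = pfaffian B real_coord_vector / (2 ^ CARD('n) * fact CARD('n))"

text \<open>For a form of type (1,1) the pairing B(v, iw) is symmetric, and its pullback by the
  injective map T is positive definite, so \<open>gram_schmidt\<close> applies.\<close>

lemma lagrangian_orthonormal_exists:
  fixes B :: "complex^'n \<Rightarrow> complex^'n \<Rightarrow> real" and T :: "real^'n \<Rightarrow> complex^'n"
  assumes B: "positive_form B" and T: "linear T" "inj T" and lag: "\<And>a b. B (T a) (T b) = 0"
  obtains Q :: "real^'n \<Rightarrow> real^'n" where "linear Q" "\<And>x. B (T (Q x)) (\<i> *s T (Q x)) = x \<bullet> x"
proof -
  note b = positive_formD(1)[OF B]
  define H where "H a b = B (T a) (\<i> *s T b)" for a b
  have i: "\<i> *s (r *\<^sub>R z) = r *\<^sub>R (\<i> *s z)" for r and z :: "complex^'n"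
    by (simp add: vec_eq_iff)
  have s: "(c::real) *s x = c *\<^sub>R x" for c and x :: "real^'n" by (simp add: vec_eq_iff)
  have H1: "H (x + y) z = H x z + H y z" "H (c *s x) z = c * H x z" for x y z c
    by (simp_all add: H_def s linear_add[OF T(1)] linear_scale[OF T(1)] bilinear_ladd[OF b] bilinear_lmul[OF b])
  have H2: "H z (x + y) = H z x + H z y" "H z (c *s x) = c * H z x" for x y z c
    by (simp_all add: H_def s i vector_add_ldistrib linear_add[OF T(1)] linear_scale[OF T(1)] bilinear_radd[OF b] bilinear_rmul[OF b])
  have Hsym: "H x y = H y x" for x y
    using positive_formD(5)[OF B, of "\<i> *s T x" "T y"] positive_formD(6)[OF B, of "T x" "T y"]
    by (simp add: H_def)
  have n: "\<exists>c. H (c *s x) (c *s x) = 1" if "x \<noteq> 0" for x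
  proof -
    have "T x \<noteq> 0" using T that by (metis injD linear_0)
    then have "H x x > 0" unfolding H_def by (rule positive_formD(4)[OF B])
    then have "H ((1 / sqrt (H x x)) *s x) ((1 / sqrt (H x x)) *s x) = 1"
      by (simp add: H1(2) H2(2) field_simps)
    then show ?thesis by blast
  qed
  obtain q where q: "\<And>i j. H (q i) (q j) = (if i = (j::'n) then 1 else 0)"
    using gram_schmidt[of H, OF H1(1) H1(2) _ n] Hsym by metis
  define Q where "Q x = (\<Sum>j\<in>UNIV. x $ j *s q j)" for x :: "real^'n"
  have "linear Q"
    unfolding Q_def by (rule linearI) (simp_all add: vector_sadd_rdistrib sum.distrib s scaleR_sum_right scaleR_left_distrib)
  moreover have "B (T (Q x)) (\<i> *s T (Q x)) = x \<bullet> x" for x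
  proof -
    have sl: "H (\<Sum>j\<in>S. f j) z = (\<Sum>j\<in>S. H (f j) z)" for f z and S :: "'n set"
      using H1(2)[of 0 0] by (induction S rule: infinite_finite_induct) (auto simp: H1(1))
    have sr: "H z (\<Sum>j\<in>S. f j) = (\<Sum>j\<in>S. H z (f j))" for f z and S :: "'n set"
      using H2(2)[of _ 0 0] by (induction S rule: infinite_finite_induct) (auto simp: H2(1))
    have "H (Q x) (Q x) = (\<Sum>i\<in>UNIV. x $ i * x $ i)"
      unfolding Q_def sl sr H1(2) H2(2) q by (simp add: if_distrib[of "(*) _"] cong: if_cong)
    then show ?thesis by (simp add: H_def inner_vec_def)
  qed
  ultimately show ?thesis by (rule that)
qed

text \<open>The situation at one point of Gamma: T is the differential of a parametrization, and T
  after Q carries the standard basis to an orthonormal basis of the tangent space for the metric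
  B(v, iw).\<close>

locale lagrangian_frame =
  fixes B :: "complex^'n \<Rightarrow> complex^'n \<Rightarrow> real" and T :: "real^'n \<Rightarrow> complex^'n" and Q :: "real^'n \<Rightarrow> real^'n"
  assumes B: "positive_form B" and T: "linear T" and lag: "\<And>a b. B (T a) (T b) = 0"
    and Q: "linear Q" "\<And>x. B (T (Q x)) (\<i> *s T (Q x)) = x \<bullet> x"
begin

lemma inj_Q: "inj Q"
proof (rule linear_injective_0[OF Q(1), THEN iffD2], clarify)
  fix x assume "Q x = 0"
  then have "x \<bullet> x = 0" using Q(2)[of x] linear_0[OF T] bilinear_lzero[OF positive_formD(1)[OF B]] by simp
  then show "x = 0" by simp
qed

lemma jac_Q_pos: "jac Q > 0"
  by (rule jac_nonzero[OF Q(1) inj_Q])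

definition v :: "'n \<Rightarrow> complex^'n" where "v j = T (Q (axis j 1))"

lemma v_orthonormal: "B (v i) (\<i> *s v j) = (if i = j then 1 else 0)"
proof -
  note b = positive_formD(1)[OF B]
  define H where "H x y = B (T (Q x)) (\<i> *s T (Q y))" for x y
  have sym: "H x y = H y x" for x y
    using positive_formD(5)[OF B, of "\<i> *s T (Q x)" "T (Q y)"] positive_formD(6)[OF B, of "T (Q x)" "T (Q y)"]
    by (simp add: H_def)
  have HQ: "H x x = x \<bullet> x" for x by (simp add: H_def Q(2))
  \<comment> \<open>Polarization: the assumption on Q only gives the values on the diagonal.\<close>
  have ex: "H (x + y) (x + y) = H x x + H x y + H y x + H y y" for x y
    by (simp add: H_def linear_add[OF T] linear_add[OF Q(1)] vector_add_ldistrib bilinear_ladd[OF b] bilinear_radd[OF b])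
  have "H x y = x \<bullet> y" for x y
    using ex[of x y] sym[of x y] unfolding HQ by (simp add: inner_add_left inner_add_right inner_commute)
  from this[of "axis i 1" "axis j 1"] show ?thesis
    by (simp add: H_def v_def inner_axis_axis)
qed

text \<open>All unitary bases have determinants of the same modulus, so P may be compared with the
  matrix of columns sqrt 2 v_j, which is sqrt 2 times \<open>coord_matrix T\<close> times the matrix
  of Q. The quotient on the left is the modulus of a unit (n,0)-form on the coordinate vectors of
  Gamma.\<close>

lemma det_coord_matrix:
  assumes P: "unitary_basis B P"
  shows "cmod (det (coord_matrix T)) / cmod (det P) = 1 / (sqrt 2 ^ CARD('n) * jac Q)"
proof -
  let ?P = "\<chi> a b. of_real (sqrt 2) * v b $ a"
  have lv: "B (v a) (v b) = 0" for a b by (simp add: v_def lag)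
  have "herm_form B (column a ?P) (column b ?P) = (if a = b then 1 else 0)" for a b
  proof -
    have hv: "herm_form B (v a) (v b) = (if a = b then 1 / 2 else 0)"
      unfolding herm_form_eq[OF B] v_orthonormal lv by simp
    have c: "column b ?P = of_real (sqrt 2) *s v b" for b by (simp add: column_def vec_eq_iff)
    have "herm_form B (column a ?P) (column b ?P) =
      of_real (sqrt 2) * (of_real (sqrt 2) * herm_form B (v a) (v b))"
      unfolding c herm_form_sesquilinear(2,5)[OF B] complex_cnj_complex_of_real ..
    also have "\<dots> = of_real (sqrt 2 * sqrt 2) * herm_form B (v a) (v b)"
      by (simp only: of_real_mult mult.assoc)
    finally show ?thesis
      unfolding hv by simp
  qed
  then have uP: "unitary_basis B ?P" by (simp add: unitary_basis_def)
  have "?P = (\<chi> a. of_real (sqrt 2) *s ((coord_matrix T ** (\<chi> i j. of_real (matrix Q $ i $ j))) $ a))"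
  proof -
    have "v b $ a = (\<Sum>j\<in>UNIV. T (axis j 1) $ a * of_real (matrix Q $ j $ b))" for a b
    proof -
      have "Q (axis b 1) = (\<Sum>j\<in>UNIV. matrix Q $ j $ b *\<^sub>R axis j 1)"
        by (simp add: matrix_def vec_eq_iff axis_def if_distrib[of "\<lambda>x. _ * x"] cong: if_cong)
      then have "v b = (\<Sum>j\<in>UNIV. matrix Q $ j $ b *\<^sub>R T (axis j 1))"
        by (simp add: v_def linear_sum[OF T] linear_scale[OF T])
      then show ?thesis by (simp add: scaleR_conv_of_real[where 'a=complex] mult.commute)
    qed
    then show ?thesis by (simp add: vec_eq_iff matrix_matrix_mult_def coord_matrix_def)
  qed
  then have "det ?P = (\<Prod>a\<in>(UNIV::'n set). of_real (sqrt 2)) * det (coord_matrix T ** (\<chi> i j. of_real (matrix Q $ i $ j)))"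
    by (simp only: det_rows_mul vec_lambda_eta)
  moreover have "det (\<chi> i j. complex_of_real (matrix Q $ i $ j)) = of_real (det (matrix Q))"
    by (simp add: det_def)
  ultimately have "cmod (det ?P) = sqrt 2 ^ CARD('n) * (cmod (det (coord_matrix T)) * jac Q)"
    by (simp add: det_mul norm_mult norm_power jac_real_vec)
  then have "cmod (det P) = cmod (det (coord_matrix T)) * (sqrt 2 ^ CARD('n) * jac Q)"
    using unitary_basis_cmod_det(1)[OF B P uP] by simp
  moreover from this have "cmod (det (coord_matrix T)) \<noteq> 0"
    using unitary_basis_cmod_det(2)[OF B P P] by auto
  ultimately show ?thesis using jac_Q_pos by simp
qed

text \<open>The vectors v_j and i v_j form a Darboux basis, so the Pfaffian on them is 2^n n!. They
  are the images of the coordinate vectors under \<open>complexify T\<close> after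
  \<open>complex_ext Q\<close>, and \<open>pfaffian_real_coord\<close> brings in the determinant of
  that map.\<close>

lemma liouville_coeff_jac: "liouville_coeff B * jac (complexify T) * (jac Q)\<^sup>2 = 1"
proof -
  let ?X = "\<lambda>(j, b). if b then \<i> *s v j else v j" and ?S = "\<lambda>z. complexify T (complex_ext Q z)"
  have "symplectic_basis B ?X"
    by (rule symplectic_basis_of_unitary[OF B v_orthonormal]) (simp add: v_def lag)
  then have pf: "pfaffian B ?X = 2 ^ CARD('n) * fact CARD('n)"
    by (rule pfaffian_symplectic_basis)
  have [simp]: "Re_vec (axis j x) = axis j (Re x)" "Im_vec (axis j x) = axis j (Im x)" for j :: 'n and x
    by (simp_all add: Re_vec_def Im_vec_def axis_def vec_eq_iff)
  have [simp]: "axis j (0::real) = 0" for j :: 'n by (simp add: axis_def vec_eq_iff)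
  have X: "?X b = ?S (real_coord_vector b)" for b
    by (cases b) (simp add: real_coord_vector_def complexify_def complex_ext_def v_def linear_0[OF Q(1)] linear_0[OF T])
  have "jac (complexify T) * (jac Q)\<^sup>2 = jac ?S"
    by (simp add: jac_compose linear_complexify linear_complex_ext T Q(1) jac_complex_ext inj_Q)
  also have "\<dots> = \<bar>det (\<chi> i j. ?S (real_coord_vector j) \<bullet> real_coord_vector i)\<bar>"
    by (rule jac_eq_det[OF bij_betw_real_coord_vector])
  finally have J: "jac (complexify T) * (jac Q)\<^sup>2 = \<bar>det (\<chi> i j. ?X j \<bullet> real_coord_vector i)\<bar>"
    by (simp only: X)
  let ?d = "det (\<chi> i j. ?X j \<bullet> real_coord_vector i)"
  have eq: "?d * pfaffian B real_coord_vector = 2 ^ CARD('n) * fact CARD('n)"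
    using pfaffian_real_coord[OF positive_formD(1)[OF B], of ?X] pf by simp
  have "0 < ?d"
    by (rule zero_less_mult_pos2[OF _ pfaffian_positive[OF B]]) (unfold eq, simp)
  then have "\<bar>?d\<bar> * pfaffian B real_coord_vector = 2 ^ CARD('n) * fact CARD('n)"
    using eq by (simp only: abs_of_pos)
  then show ?thesis
    unfolding mult.assoc J by (simp add: liouville_coeff_def mult.commute field_simps)
qed

end

text \<open>Both Pfaffians are positive, hence so is the determinant of S, and it agrees with
  \<open>jac S\<close>. This is why the Liouville form can be treated as a density.\<close>

lemma liouville_coeff_transform:
  fixes S :: "complex^'n \<Rightarrow> complex^'n"
  assumes "positive_form B" "positive_form B'" "linear S" "\<And>v w. B v w = B' (S v) (S w)"
  shows "liouville_coeff B = liouville_coeff B' * jac S"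
proof -
  have "pfaffian B real_coord_vector = pfaffian B' (\<lambda>b. S (real_coord_vector b :: complex^'n))"
    by (simp add: pfaffian_def assms(4))
  also have "\<dots> = det (\<chi> a b. S (real_coord_vector b) \<bullet> real_coord_vector a) * pfaffian B' real_coord_vector"
    by (rule pfaffian_real_coord[OF positive_formD(1)[OF assms(2)]])
  finally have eq: "pfaffian B real_coord_vector = \<dots>" .
  with pfaffian_positive[OF assms(1)] pfaffian_positive[OF assms(2)]
  have "det (\<chi> a b. S (real_coord_vector b) \<bullet> real_coord_vector a) > 0"
    by (simp add: zero_less_mult_iff)
  then have "jac S = det (\<chi> a b. S (real_coord_vector b) \<bullet> real_coord_vector a)"
    using jac_eq_det[OF bij_betw_real_coord_vector, of S] by simp
  then show ?thesis using eq by (simp add: liouville_coeff_def)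
qed

section \<open>Gaussian integrals\<close>

lemma has_bochner_integral_gaussian_real:
  assumes "0 < c"
  shows "has_bochner_integral lborel (\<lambda>x::real. exp (- c * x\<^sup>2)) (sqrt (pi / c))"
proof -
  \<comment> \<open>The Gaussian is a multiple of the normal density with variance 1/(2c).\<close>
  let ?\<sigma> = "sqrt (1 / (2 * c))"
  have s: "?\<sigma> > 0" "?\<sigma>\<^sup>2 = 1 / (2 * c)" using assms by auto
  have "exp (- c * x\<^sup>2) = sqrt (pi / c) * normal_density 0 ?\<sigma> x" for x
    using assms by (simp add: normal_density_def s(2) real_sqrt_divide field_simps)
  moreover have "has_bochner_integral lborel (\<lambda>x. sqrt (pi / c) * normal_density 0 ?\<sigma> x) (sqrt (pi / c) * 1)"
    using s(1) by (intro has_bochner_integral_mult_right)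
      (simp add: has_bochner_integral_iff integral_normal_density)
  ultimately show ?thesis by simp
qed

lemma has_bochner_integral_gaussian:
  assumes "0 < c"
  shows "has_bochner_integral lborel (\<lambda>x::'a::euclidean_space. exp (- c * (x \<bullet> x))) (sqrt (pi / c) ^ DIM('a))"
proof (rule has_bochner_integral_nn_integral)
  have "exp (- c * (x \<bullet> x)) = (\<Prod>b\<in>Basis. exp (- c * (x \<bullet> b)\<^sup>2))" for x :: 'a
    by (subst euclidean_inner) (simp add: exp_sum power2_eq_square sum_distrib_left sum_negf[symmetric])
  then have "(\<integral>\<^sup>+x. ennreal (exp (- c * ((x::'a) \<bullet> x))) \<partial>lborel) = (\<integral>\<^sup>+x. (\<Prod>b\<in>Basis. ennreal (exp (- c * ((x::'a) \<bullet> b)\<^sup>2))) \<partial>lborel)"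
    by (simp add: prod_ennreal)
  also have "\<dots> = (\<Prod>b\<in>(Basis :: 'a set). \<integral>\<^sup>+x. ennreal (exp (- c * x\<^sup>2)) \<partial>lborel)"
    by (rule nn_integral_lborel_prod) auto
  also have "(\<integral>\<^sup>+x. ennreal (exp (- c * x\<^sup>2)) \<partial>lborel) = ennreal (sqrt (pi / c))"
    using has_bochner_integral_gaussian_real[OF assms]
    by (subst nn_integral_eq_integral) (auto simp: has_bochner_integral_iff)
  finally show "(\<integral>\<^sup>+x. ennreal (exp (- c * ((x::'a) \<bullet> x))) \<partial>lborel) = ennreal (sqrt (pi / c) ^ DIM('a))"
    using assms by (simp add: ennreal_power)
qed (use assms in auto)

text \<open>The substitution s = Q x turns h into the standard square norm.\<close>

lemma has_bochner_integral_gaussian_form: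
  fixes h :: "'a::euclidean_space \<Rightarrow> real"
  assumes "0 < c" "linear Q" "inj Q" "\<And>x. h (Q x) = x \<bullet> x"
  shows "has_bochner_integral lborel (\<lambda>s. exp (- c * h s)) (jac Q * sqrt (pi / c) ^ DIM('a))"
proof -
  have surj: "range Q = UNIV" by (rule linear_inj_imp_surj[OF assms(2,3)])
  obtain R where R: "linear R" "\<And>x. Q (R x) = x"
    using linear_surjective_right_inverse[OF assms(2) surj] by (auto simp: o_def fun_eq_iff)
  have h: "h s = R s \<bullet> R s" for s using assms(4)[of "R s"] by (simp add: R(2))
  have m: "(\<lambda>s. exp (- c * h s)) \<in> borel_measurable borel"
    using borel_measurable_linear[OF R(1)] by (simp add: h)
  have Ck: "Ck 1 UNIV Q" using assms(2) by (intro Ck_bounded_linear) (auto simp: linear_conv_bounded_linear)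
  have F: "frechet_derivative Q (at x) = Q" for x by (rule frechet_derivative_linear[OF assms(2)])
  note cov = change_of_variables[OF open_UNIV Ck assms(3) _ subset_UNIV, where S=UNIV and f="\<lambda>s. exp (- c * h s)", unfolded surj F assms(4)]
  note g = has_bochner_integral_gaussian[OF assms(1), where 'a='a]
  show ?thesis
    using cov m g jac_nonzero[OF assms(2,3)]
    by (simp add: has_bochner_integral_iff set_integrable_def set_lebesgue_integral_def set_borel_measurable_def)
qed

section \<open>The method of Laplace\<close>

lemma exp_minus_diff:
  fixes x z :: real
  assumes "\<kappa> \<le> x" "\<kappa> \<le> z"
  shows "\<bar>exp (- x) - exp (- z)\<bar> \<le> \<bar>x - z\<bar> * exp (- \<kappa>)"
proof -
  have *: "exp (- x) - exp (- z) \<le> (z - x) * exp (- \<kappa>)" if "x \<le> z" "\<kappa> \<le> x" for x z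
  proof -
    have "exp (- x) - exp (- z) = exp (- x) * (1 - exp (- (z - x)))"
      by (simp add: right_diff_distrib flip: exp_add)
    moreover have "1 - exp (- (z - x)) \<le> z - x"
      using exp_ge_add_one_self[of "- (z - x)"] by linarith
    then have "exp (- x) * (1 - exp (- (z - x))) \<le> exp (- \<kappa>) * (z - x)"
      using that by (intro mult_mono) auto
    ultimately show ?thesis by (simp add: mult.commute)
  qed
  show ?thesis
    using *[of x z] *[of z x] assms by (cases "x \<le> z") (auto simp: abs_if)
qed

lemma exp_minus_second_order:
  fixes x z :: real
  assumes "\<kappa> \<le> x" "\<kappa> \<le> z"
  shows "\<bar>exp (- x) - exp (- z) + (x - z) * exp (- z)\<bar> \<le> (x - z)\<^sup>2 * exp (- \<kappa>)"
proof -
  have e: "exp (- x) = exp (- z) * exp (- (x - z))" by (simp flip: exp_add)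
  have "0 \<le> exp (- (x - z)) - 1 + (x - z)"
    using exp_ge_add_one_self[of "- (x - z)"] by linarith
  then have "0 \<le> exp (- z) * (exp (- (x - z)) - 1 + (x - z))"
    by (intro mult_nonneg_nonneg) auto
  also have lo: "exp (- z) * (exp (- (x - z)) - 1 + (x - z)) = exp (- x) - exp (- z) + (x - z) * exp (- z)"
    by (simp add: e algebra_simps)
  finally have "\<bar>exp (- x) - exp (- z) + (x - z) * exp (- z)\<bar> = exp (- z) * (exp (- (x - z)) - 1 + (x - z))"
    unfolding lo by (rule abs_of_nonneg)
  \<comment> \<open>With d = x - z, the inequality exp(-d) - 1 + d \<le> d (1 - exp(-d)) amounts to
    exp(-d) (1 + d) \<le> 1. What remains is reduced to the first order bound
    \<open>exp_minus_diff\<close>.\<close>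
  also have "\<dots> \<le> exp (- z) * ((x - z) * (1 - exp (- (x - z))))"
  proof (intro mult_left_mono)
    have "exp (- (x - z)) * (1 + (x - z)) \<le> exp (- (x - z)) * exp (x - z)"
      by (intro mult_left_mono exp_ge_add_one_self) auto
    also have "\<dots> = 1" by (simp flip: exp_add)
    finally show "exp (- (x - z)) - 1 + (x - z) \<le> (x - z) * (1 - exp (- (x - z)))"
      by (simp add: algebra_simps)
  qed auto
  also have "\<dots> = (x - z) * (exp (- z) - exp (- x))"
    by (simp add: e algebra_simps)
  also have "\<dots> \<le> \<bar>x - z\<bar> * \<bar>exp (- x) - exp (- z)\<bar>"
    by (metis abs_ge_self abs_minus_commute abs_mult)
  also have "\<dots> \<le> \<bar>x - z\<bar> * (\<bar>x - z\<bar> * exp (- \<kappa>))"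
    by (intro mult_left_mono exp_minus_diff assms) auto
  finally show ?thesis by (simp add: power2_eq_square abs_mult_self_eq flip: mult.assoc)
qed

text \<open>The unprimed and primed quantities stand for the values at s and at -s, while
  \<open>a0\<close> and \<open>z\<close> belong to the Gaussian model. In the application kappa is c
  k r^2 with r = |s|.\<close>

lemma symmetrized_integrand_bound:
  fixes a a' a0 :: complex and x x' z :: real
  assumes "\<kappa> \<le> x" "\<kappa> \<le> x'" "\<kappa> \<le> z" "0 \<le> k" "0 \<le> r" "0 \<le> C"
    and "\<bar>x - z\<bar> \<le> k * (C * r ^ 3)" "\<bar>x' - z\<bar> \<le> k * (C * r ^ 3)" "\<bar>x + x' - 2 * z\<bar> \<le> k * (C * r ^ 4)"
    and "cmod (a - a0) \<le> C * r" "cmod (a + a' - 2 * a0) \<le> C * r\<^sup>2" "cmod a0 \<le> M"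
  shows "cmod (a * of_real (exp (- x)) + a' * of_real (exp (- x')) - 2 * (a0 * of_real (exp (- z))))
    \<le> (M * (k * C * r ^ 4 + 2 * C\<^sup>2 * k\<^sup>2 * r ^ 6) + 2 * C\<^sup>2 * k * r ^ 4 + C * r\<^sup>2) * exp (- \<kappa>)"
proof -
  define X X' Z where "X = exp (- x)" and "X' = exp (- x')" and "Z = exp (- z)"
  have M: "0 \<le> M" using assms(12) norm_ge_zero order_trans by blast
  have sq: "d\<^sup>2 \<le> C\<^sup>2 * k\<^sup>2 * r ^ 6" if "\<bar>d\<bar> \<le> k * (C * r ^ 3)" for d :: real
  proof -
    have "\<bar>d\<bar>\<^sup>2 \<le> (k * (C * r ^ 3))\<^sup>2" using that by (intro power_mono) auto
    then show ?thesis by (simp add: power_mult_distrib mult_ac flip: power_mult)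
  qed
  have X'1: "X' \<le> exp (- \<kappa>)" and Z1: "Z \<le> exp (- \<kappa>)" using assms by (auto simp: X'_def Z_def)
  have "\<bar>X + X' - 2 * Z\<bar> \<le> \<bar>X - Z + (x - z) * Z\<bar> + \<bar>X' - Z + (x' - z) * Z\<bar> + \<bar>x + x' - 2 * z\<bar> * Z"
  proof -
    have "X + X' - 2 * Z = (X - Z + (x - z) * Z) + (X' - Z + (x' - z) * Z) - (x + x' - 2 * z) * Z"
      by (simp add: algebra_simps)
    moreover have "\<bar>(x + x' - 2 * z) * Z\<bar> = \<bar>x + x' - 2 * z\<bar> * Z" by (simp add: abs_mult Z_def)
    ultimately show ?thesis by linarith
  qed
  also have "\<dots> \<le> C\<^sup>2 * k\<^sup>2 * r ^ 6 * exp (- \<kappa>) + C\<^sup>2 * k\<^sup>2 * r ^ 6 * exp (- \<kappa>) + k * (C * r ^ 4) * exp (- \<kappa>)"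
  proof (intro add_mono)
    show "\<bar>X - Z + (x - z) * Z\<bar> \<le> C\<^sup>2 * k\<^sup>2 * r ^ 6 * exp (- \<kappa>)"
      unfolding X_def Z_def
      by (rule order_trans[OF exp_minus_second_order[OF assms(1,3)] mult_right_mono[OF sq[OF assms(7)]]]) simp
    show "\<bar>X' - Z + (x' - z) * Z\<bar> \<le> C\<^sup>2 * k\<^sup>2 * r ^ 6 * exp (- \<kappa>)"
      unfolding X'_def Z_def
      by (rule order_trans[OF exp_minus_second_order[OF assms(2,3)] mult_right_mono[OF sq[OF assms(8)]]]) simp
    show "\<bar>x + x' - 2 * z\<bar> * Z \<le> k * (C * r ^ 4) * exp (- \<kappa>)"
      using assms Z1 by (intro mult_mono) (auto simp: Z_def)
  qed
  finally have 1: "\<bar>X + X' - 2 * Z\<bar> \<le> (k * C * r ^ 4 + 2 * C\<^sup>2 * k\<^sup>2 * r ^ 6) * exp (- \<kappa>)"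
    by (simp add: algebra_simps)
  have "\<bar>X - X'\<bar> \<le> \<bar>x - x'\<bar> * exp (- \<kappa>)"
    unfolding X_def X'_def by (rule exp_minus_diff[OF assms(1,2)])
  also have "\<dots> \<le> (2 * (k * (C * r ^ 3))) * exp (- \<kappa>)"
    using assms(7,8) by (intro mult_right_mono) auto
  finally have 2: "\<bar>X - X'\<bar> \<le> 2 * (k * (C * r ^ 3)) * exp (- \<kappa>)" .
  \<comment> \<open>The three terms are an even error of the phase, a product of two odd errors of
    lowest order, and an even error of the amplitude. The odd errors taken singly would be too
    large.\<close>
  have "a * of_real X + a' * of_real X' - 2 * (a0 * of_real Z) =
    a0 * of_real (X + X' - 2 * Z) + (a - a0) * of_real (X - X') + (a + a' - 2 * a0) * of_real X'"
    by (simp add: algebra_simps)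
  also have "cmod \<dots> \<le> cmod (a0 * of_real (X + X' - 2 * Z)) + cmod ((a - a0) * of_real (X - X')) + cmod ((a + a' - 2 * a0) * of_real X')"
    by (intro norm_triangle_le add_mono) auto
  also have "\<dots> \<le> M * ((k * C * r ^ 4 + 2 * C\<^sup>2 * k\<^sup>2 * r ^ 6) * exp (- \<kappa>)) +
      (C * r) * (2 * (k * (C * r ^ 3)) * exp (- \<kappa>)) + (C * r\<^sup>2) * exp (- \<kappa>)"
    unfolding norm_mult norm_of_real
    by (intro add_mono mult_mono 1 2 assms X'1 M) (use X'1 assms in \<open>auto simp: X'_def\<close>)
  also have "\<dots> = (M * (k * C * r ^ 4 + 2 * C\<^sup>2 * k\<^sup>2 * r ^ 6) + 2 * C\<^sup>2 * k * r ^ 4 + C * r\<^sup>2) * exp (- \<kappa>)"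
    by (simp add: algebra_simps power2_eq_square power4_eq_xxxx power3_eq_cube)
  finally show ?thesis unfolding X_def X'_def Z_def .
qed

text \<open>Apply 1 + x \<le> exp x to x = u/(2j) and raise it to the power j.\<close>

lemma power_le_exp_half:
  fixes u :: real
  assumes "0 \<le> u" "0 < j"
  shows "u ^ j \<le> (2 * real j) ^ j * exp (u / 2)"
proof -
  have "u / (2 * real j) \<le> exp (u / (2 * real j))"
    using exp_ge_add_one_self[of "u / (2 * real j)"] by linarith
  then have "(u / (2 * real j)) ^ j \<le> exp (u / (2 * real j)) ^ j"
    using assms by (intro power_mono) auto
  also have "exp (u / (2 * real j)) ^ j = exp (u / 2)"
    using assms(2) by (simp flip: exp_of_nat_mult)
  finally show ?thesis
    using assms(2) by (simp add: power_divide pos_divide_le_eq mult.commute)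
qed

text \<open>In each monomial the power of r^2 exceeds that of k by one, so it is a constant times
  u^j / k with u = c k r^2. Half of the exponential absorbs u^j, and the constants are (2j)^j for j
  = 1, 2, 3.\<close>

lemma gaussian_absorb:
  fixes k c r :: real
  assumes "1 \<le> k" "0 < c" "0 \<le> r"
  shows "r\<^sup>2 * exp (- (c * k * r\<^sup>2)) \<le> (2 / c) / k * exp (- (c / 2 * k * r\<^sup>2))"
    and "k * r ^ 4 * exp (- (c * k * r\<^sup>2)) \<le> (16 / c\<^sup>2) / k * exp (- (c / 2 * k * r\<^sup>2))"
    and "k\<^sup>2 * r ^ 6 * exp (- (c * k * r\<^sup>2)) \<le> (216 / c ^ 3) / k * exp (- (c / 2 * k * r\<^sup>2))"
proof -
  define u where "u = c * k * r\<^sup>2"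
  have u: "0 \<le> u" using assms by (simp add: u_def)
  have e: "exp (- (c * k * r\<^sup>2)) = exp (- (c / 2 * k * r\<^sup>2)) / exp (u / 2)"
    by (simp add: u_def flip: exp_diff)
  have *: "w * exp (- (c * k * r\<^sup>2)) \<le> D / k * exp (- (c / 2 * k * r\<^sup>2))"
    if "w = u ^ j / (d * k)" "0 < d" "(2 * real j) ^ j = D * d" "0 < j" for w j d D
  proof -
    have "w = u ^ j / (d * k)" by fact
    also have "\<dots> \<le> (2 * real j) ^ j * exp (u / 2) / (d * k)"
      using power_le_exp_half[OF u, of j] that assms by (intro divide_right_mono) auto
    also have "\<dots> = D / k * exp (u / 2)" using that by simp
    finally have "w / exp (u / 2) \<le> D / k" by (simp add: pos_divide_le_eq)
    then have "w / exp (u / 2) * exp (- (c / 2 * k * r\<^sup>2)) \<le> D / k * exp (- (c / 2 * k * r\<^sup>2))"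
      by (intro mult_right_mono) auto
    then show ?thesis unfolding e by simp
  qed
  show "r\<^sup>2 * exp (- (c * k * r\<^sup>2)) \<le> (2 / c) / k * exp (- (c / 2 * k * r\<^sup>2))"
    by (rule *[of _ 1 c]) (use assms in \<open>auto simp: u_def\<close>)
  show "k * r ^ 4 * exp (- (c * k * r\<^sup>2)) \<le> (16 / c\<^sup>2) / k * exp (- (c / 2 * k * r\<^sup>2))"
    by (rule *[of _ 2 "c\<^sup>2"]) (use assms in \<open>auto simp: u_def power_mult_distrib power2_eq_square power4_eq_xxxx\<close>)
  show "k\<^sup>2 * r ^ 6 * exp (- (c * k * r\<^sup>2)) \<le> (216 / c ^ 3) / k * exp (- (c / 2 * k * r\<^sup>2))"
    by (rule *[of _ 3 "c ^ 3"]) (use assms in \<open>auto simp: u_def power_mult_distrib power2_eq_square power3_eq_cube eval_nat_numeral\<close>)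
qed

lemma integral_reflect_snd:
  fixes f :: "'a::euclidean_space \<times> 'b::euclidean_space \<Rightarrow> 'c::{banach, second_countable_topology}"
  assumes "integrable lborel f"
  shows "integrable lborel (\<lambda>p. f (fst p, - snd p))"
    and "integral\<^sup>L lborel (\<lambda>p. f (fst p, - snd p)) = integral\<^sup>L lborel f"
proof -
  let ?\<sigma> = "\<lambda>p::'a \<times> 'b. (fst p, - snd p)"
  have lin: "linear ?\<sigma>" by (auto intro!: linearI simp: scaleR_prod_def)
  have inj: "inj ?\<sigma>" and surj: "range ?\<sigma> = UNIV"
    by (auto simp: inj_on_def prod_eq_iff intro!: surjI[of _ ?\<sigma>])
  have "jac ?\<sigma> * jac ?\<sigma> = 1" using jac_compose[OF lin lin] by (simp add: jac_id)
  then have J: "jac ?\<sigma> = 1" using jac_nonneg[of ?\<sigma>] by (simp add: square_eq_1_iff)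
  have Ck: "Ck 1 UNIV ?\<sigma>" using lin by (intro Ck_bounded_linear) (auto simp: linear_conv_bounded_linear)
  have F: "frechet_derivative ?\<sigma> (at x) = ?\<sigma>" for x by (rule frechet_derivative_linear[OF lin])
  note cov = change_of_variables[OF open_UNIV Ck inj _ subset_UNIV, where S=UNIV and f=f, unfolded surj F J]
  show "integrable lborel (\<lambda>p. f (fst p, - snd p))"
    and "integral\<^sup>L lborel (\<lambda>p. f (fst p, - snd p)) = integral\<^sup>L lborel f"
    using cov assms by (simp_all add: set_integrable_def set_lebesgue_integral_def set_borel_measurable_def)
qed

text \<open>Provides the dominating function for the error in the method of Laplace, together with
  its mass.\<close>

lemma integral_gaussian_strip:
  assumes "compact (Y :: 'a::euclidean_space set)" "0 < \<kappa>"
  defines "B \<equiv> \<lambda>p. indicator Y (fst p) * exp (- \<kappa> * ((snd p :: 'b::euclidean_space) \<bullet> snd p))"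
  shows "integrable lborel B" "integral\<^sup>L lborel B = measure lborel Y * sqrt (pi / \<kappa>) ^ DIM('b)"
proof -
  note g = has_bochner_integral_gaussian[OF assms(2), where 'a='b]
  have Y: "Y \<in> sets borel" using assms(1) by (simp add: borel_compact)
  have fin: "emeasure lborel Y < \<infinity>" using emeasure_compact_finite[OF assms(1)] by simp
  have m: "B \<in> borel_measurable (lborel \<Otimes>\<^sub>M lborel)"
  proof -
    have "(\<lambda>p. indicator (Y \<times> UNIV) p *\<^sub>R exp (- \<kappa> * (snd p \<bullet> snd p))) \<in> borel_measurable (borel :: ('a \<times> 'b) measure)"
      using assms(1) by (intro borel_measurable_continuous_on_indicator borel_closed closed_Times continuous_intros)
        (auto simp: compact_imp_closed)
    moreover have "B = (\<lambda>p. indicator (Y \<times> UNIV) p *\<^sub>R exp (- \<kappa> * (snd p \<bullet> snd p)))"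
      by (auto simp: B_def fun_eq_iff indicator_def)
    ultimately show ?thesis by (simp add: lborel_prod)
  qed
  have inner: "(\<integral>s. B (y, s) \<partial>lborel) = indicator Y y * sqrt (pi / \<kappa>) ^ DIM('b)" for y
    using g by (simp add: B_def has_bochner_integral_iff)
  have int: "integrable (lborel \<Otimes>\<^sub>M lborel) B"
  proof (rule lborel_pair.Fubini_integrable[OF m])
    have "(\<lambda>x. \<integral>y. norm (B (x, y)) \<partial>lborel) = (\<lambda>x. indicator Y x * sqrt (pi / \<kappa>) ^ DIM('b))"
      using g by (simp add: B_def abs_mult has_bochner_integral_iff)
    then show "integrable lborel (\<lambda>x. \<integral>y. norm (B (x, y)) \<partial>lborel)"
      using Y fin by (simp add: integrable_real_indicator)
    show "AE x in lborel. integrable lborel (\<lambda>y. B (x, y))"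
      using g by (simp add: B_def has_bochner_integral_iff)
  qed
  then show "integrable lborel B" by (simp add: lborel_prod)
  have "integral\<^sup>L lborel B = (\<integral>y. (\<integral>s. B (y, s) \<partial>lborel) \<partial>lborel)"
    using lborel_pair.integral_fst'[OF int] by (simp add: lborel_prod)
  also have "\<dots> = measure lborel Y * sqrt (pi / \<kappa>) ^ DIM('b)"
    using Y fin by (simp add: inner)
  finally show "integral\<^sup>L lborel B = measure lborel Y * sqrt (pi / \<kappa>) ^ DIM('b)" .
qed

text \<open>The cubic term of the phase and the linear term of the amplitude are odd in \<open>s\<close> and cancel in the
  integrand symmetrized under \<open>s \<mapsto> - s\<close>; hence the error is \<open>1/k\<close> rather than \<open>k\<^sup>-\<^sup>1\<^sup>/\<^sup>2\<close>.\<close>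

lemma laplace_method:
  fixes a :: "'a::euclidean_space \<times> 'b::euclidean_space \<Rightarrow> complex" and \<phi> :: "'a \<times> 'b \<Rightarrow> real"
    and h :: "'a \<Rightarrow> 'b \<Rightarrow> real" and Q :: "'a \<Rightarrow> 'b \<Rightarrow> 'b"
  assumes Y: "compact Y" and \<rho>: "0 < \<rho>" and c: "0 < c" and C: "0 < C"
    and cont: "continuous_on (Y \<times> cball 0 \<rho>) a" "continuous_on (Y \<times> cball 0 \<rho>) \<phi>"
      "continuous_on (Y \<times> UNIV) (\<lambda>p. h (fst p) (snd p))"
    and \<phi>lower: "\<And>y s. y \<in> Y \<Longrightarrow> norm s \<le> \<rho> \<Longrightarrow> c * (norm s)\<^sup>2 \<le> \<phi> (y, s)"
    and hlower: "\<And>y s. y \<in> Y \<Longrightarrow> c * (norm s)\<^sup>2 \<le> h y s"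
    and a1: "\<And>y s. y \<in> Y \<Longrightarrow> norm s \<le> \<rho> \<Longrightarrow> cmod (a (y, s) - a (y, 0)) \<le> C * norm s"
    and a2: "\<And>y s. y \<in> Y \<Longrightarrow> norm s \<le> \<rho> \<Longrightarrow> cmod (a (y, s) + a (y, - s) - 2 * a (y, 0)) \<le> C * (norm s)\<^sup>2"
    and \<phi>3: "\<And>y s. y \<in> Y \<Longrightarrow> norm s \<le> \<rho> \<Longrightarrow> \<bar>\<phi> (y, s) - h y s\<bar> \<le> C * (norm s) ^ 3"
    and \<phi>4: "\<And>y s. y \<in> Y \<Longrightarrow> norm s \<le> \<rho> \<Longrightarrow> \<bar>\<phi> (y, s) + \<phi> (y, - s) - 2 * h y s\<bar> \<le> C * (norm s) ^ 4"
    and Q: "\<And>y. y \<in> Y \<Longrightarrow> linear (Q y)" "\<And>y. y \<in> Y \<Longrightarrow> inj (Q y)" "\<And>y x. y \<in> Y \<Longrightarrow> h y (Q y x) = x \<bullet> x"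
  obtains D where "\<And>k. 1 \<le> k \<Longrightarrow> cmod (of_real (sqrt (k / pi) ^ DIM('b)) *
        (LINT p:Y \<times> cball 0 \<rho>|lborel. a p * of_real (exp (- k * \<phi> p)))
      - (LINT y:Y|lborel. a (y, 0) * of_real (jac (Q y)))) \<le> D / k"
proof -
  let ?Z = "Y \<times> cball (0::'b) \<rho>" and ?n = "DIM('b)"
  \<comment> \<open>\<open>h\<close> is even because Q y is onto and carries it to the square
    norm.\<close>
  have hm: "h y (- s) = h y s" if "y \<in> Y" for y s
  proof -
    have "surj (Q y)" using that Q by (intro linear_inj_imp_surj) auto
    then obtain x where x: "s = Q y x" by (metis surjD)
    then have "- s = Q y (- x)" using linear_neg[OF Q(1)[OF that]] by simp
    then show ?thesis using Q(3)[OF that] x by simp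
  qed
  have a0: "continuous_on Y (\<lambda>y. a (y, 0))"
    by (rule continuous_on_compose2[OF cont(1)]) (use \<rho> in \<open>auto intro!: continuous_intros\<close>)
  then obtain M where M: "M > 0" "\<And>y. y \<in> Y \<Longrightarrow> cmod (a (y, 0)) \<le> M"
    using compact_imp_bounded[OF compact_continuous_image[OF a0 Y]] unfolding bounded_pos by auto
  \<comment> \<open>\<open>G\<close> is the integrand cut off at |s| = rho, \<open>E\<close> its
    Gaussian model on the whole fibre, \<open>Bd\<close> the dominating Gaussian.\<close>
  define G where "G k p = indicator ?Z p *\<^sub>R (a p * of_real (exp (- k * \<phi> p)))" for k p
  define E where "E k p = indicator (Y \<times> UNIV) p *\<^sub>R (a (fst p, 0) * of_real (exp (- k * h (fst p) (snd p))))" for k and p :: "'a \<times> 'b"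
  define Bd where "Bd \<kappa> p = indicator Y (fst p) * exp (- \<kappa> * (snd p \<bullet> snd p))" for \<kappa> and p :: "'a \<times> 'b"
  have Bd_eq: "Bd \<kappa> = (\<lambda>p. indicator Y (fst p) * exp (- \<kappa> * (snd p \<bullet> snd p)))" for \<kappa>
    by (simp add: Bd_def fun_eq_iff)
  have intG: "integrable lborel (G k)" for k
    unfolding G_def
    by (intro borel_integrable_compact compact_Times Y compact_cball continuous_intros cont)
  have Ym: "Y \<in> sets borel" using Y by (simp add: borel_compact)
  have mE: "E k \<in> borel_measurable borel" for k
    unfolding E_def
  proof (rule borel_measurable_continuous_on_indicator)
    show "Y \<times> (UNIV :: 'b set) \<in> sets borel"
      using Y by (intro borel_closed closed_Times) (auto simp: compact_imp_closed)
    show "continuous_on (Y \<times> UNIV) (\<lambda>p. a (fst p, 0) * of_real (exp (- k * h (fst p) (snd p))))"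
      by (intro continuous_intros cont continuous_on_compose2[OF a0]) auto
  qed
  have nE: "cmod (E k p) \<le> M * Bd (k * c) p" if "0 < k" for k p
  proof (cases "fst p \<in> Y")
    case True
    have "exp (- k * h (fst p) (snd p)) \<le> exp (- (k * c) * (snd p \<bullet> snd p))"
      using hlower[OF True, of "snd p"] that by (simp add: power2_norm_eq_inner mult.assoc)
    then have "cmod (a (fst p, 0)) * exp (- k * h (fst p) (snd p)) \<le> M * exp (- (k * c) * (snd p \<bullet> snd p))"
      using M True by (intro mult_mono) auto
    then show ?thesis using True by (simp add: E_def Bd_def norm_mult mem_Times_iff)
  qed (simp add: E_def Bd_def mem_Times_iff)
  have intE: "integrable lborel (E k)" if "0 < k" for k
  proof (rule Bochner_Integration.integrable_bound)
    show "integrable lborel (\<lambda>p. M * Bd (k * c) p)"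
      using integral_gaussian_strip(1)[OF Y, of "k * c", where 'b='b] that c by (simp add: Bd_def)
    show "AE p in lborel. norm (E k p) \<le> norm (M * Bd (k * c) p)"
      using nE[OF that] order_trans[OF nE[OF that] abs_ge_self] by simp
  qed (use mE in simp)
  have E: "integral\<^sup>L lborel (E k) = of_real (sqrt (pi / k) ^ ?n) * (LINT y:Y|lborel. a (y, 0) * of_real (jac (Q y)))"
    if "0 < k" for k
  proof -
    have inner: "(\<integral>s. E k (y, s) \<partial>lborel) = of_real (sqrt (pi / k) ^ ?n) * (indicator Y y *\<^sub>R (a (y, 0) * of_real (jac (Q y))))" for y
    proof (cases "y \<in> Y")
      case True
      have "(\<integral>s. complex_of_real (exp (- k * h y s)) \<partial>lborel) = of_real (jac (Q y) * sqrt (pi / k) ^ ?n)"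
        using has_bochner_integral_gaussian_form[OF that Q[OF True]]
        by (simp add: has_bochner_integral_iff integral_of_real)
      then show ?thesis using True by (simp add: E_def mult_ac)
    qed (simp add: E_def)
    have "integrable (lborel \<Otimes>\<^sub>M lborel) (E k)" using intE[OF that] by (simp add: lborel_prod)
    from lborel_pair.integral_fst'[OF this]
    have "integral\<^sup>L lborel (E k) = (\<integral>y. (\<integral>s. E k (y, s) \<partial>lborel) \<partial>lborel)" by (simp add: lborel_prod)
    then show ?thesis by (simp only: inner set_lebesgue_integral_def integral_mult_right_zero)
  qed
  \<comment> \<open>The first four terms come from \<open>symmetrized_integrand_bound\<close> by way
    of \<open>gaussian_absorb\<close>; the last one bounds the tail of the model.\<close>
  define D1 where "D1 = M * C * (16 / c\<^sup>2) + 2 * M * C\<^sup>2 * (216 / c ^ 3) + 2 * C\<^sup>2 * (16 / c\<^sup>2) + C * (2 / c) + 2 * M / \<rho>\<^sup>2 * (2 / c)"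
  have D1: "0 \<le> D1" using M C c by (simp add: D1_def)
  have bound: "cmod (G k p + G k (fst p, - snd p) - 2 * E k p) \<le> D1 / k * Bd (c / 2 * k) p" if k: "1 \<le> k" for k p
  proof -
    obtain y s where p: "p = (y, s)" by (cases p)
    define r where "r = norm s"
    have r: "0 \<le> r" by (simp add: r_def)
    let ?e = "exp (- (c * k * r\<^sup>2))" and ?f = "exp (- (c / 2 * k * r\<^sup>2))"
    note ab = gaussian_absorb[OF k c r]
    have Bd: "Bd (c / 2 * k) p = indicator Y y * ?f"
      by (simp add: Bd_def p r_def power2_norm_eq_inner)
    consider "y \<notin> Y" | "y \<in> Y" "r \<le> \<rho>" | "y \<in> Y" "\<rho> < r" by linarith
    then show ?thesis
    proof cases
      case 1
      then show ?thesis unfolding Bd by (simp add: G_def E_def p)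
    next
      case 2
      have s: "norm s \<le> \<rho>" "norm (- s) \<le> \<rho>" using 2 by (auto simp: r_def)
      have "cmod (G k p + G k (fst p, - snd p) - 2 * E k p) =
         cmod (a (y, s) * of_real (exp (- (k * \<phi> (y, s)))) + a (y, - s) * of_real (exp (- (k * \<phi> (y, - s)))) -
           2 * (a (y, 0) * of_real (exp (- (k * h y s)))))"
        using 2 s by (simp add: G_def E_def p)
      also have "\<dots> \<le> (M * (k * C * r ^ 4 + 2 * C\<^sup>2 * k\<^sup>2 * r ^ 6) + 2 * C\<^sup>2 * k * r ^ 4 + C * r\<^sup>2) * ?e"
      proof (rule symmetrized_integrand_bound)
        show "c * k * r\<^sup>2 \<le> k * \<phi> (y, s)" "c * k * r\<^sup>2 \<le> k * \<phi> (y, - s)" "c * k * r\<^sup>2 \<le> k * h y s"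
          using \<phi>lower[OF 2(1) s(1)] \<phi>lower[OF 2(1) s(2)] hlower[OF 2(1), of s] k
          by (simp_all add: r_def mult.assoc mult.left_commute[of c])
        have kk: "\<bar>k * u\<bar> \<le> k * v" if "\<bar>u\<bar> \<le> v" for u v using that k by (simp add: abs_mult)
        show "\<bar>k * \<phi> (y, s) - k * h y s\<bar> \<le> k * (C * r ^ 3)"
          using kk[OF \<phi>3[OF 2(1) s(1)]] by (simp add: r_def right_diff_distrib)
        show "\<bar>k * \<phi> (y, - s) - k * h y s\<bar> \<le> k * (C * r ^ 3)"
          using kk[OF \<phi>3[OF 2(1) s(2)]] by (simp add: r_def right_diff_distrib hm[OF 2(1)])
        show "\<bar>k * \<phi> (y, s) + k * \<phi> (y, - s) - 2 * (k * h y s)\<bar> \<le> k * (C * r ^ 4)"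
          using kk[OF \<phi>4[OF 2(1) s(1)]] by (simp add: r_def algebra_simps)
        show "cmod (a (y, s) - a (y, 0)) \<le> C * r" "cmod (a (y, s) + a (y, - s) - 2 * a (y, 0)) \<le> C * r\<^sup>2"
          using a1[OF 2(1) s(1)] a2[OF 2(1) s(1)] by (simp_all add: r_def)
      qed (use k r C M(2)[OF 2(1)] in auto)
      also have "\<dots> = M * C * (k * r ^ 4 * ?e) + 2 * M * C\<^sup>2 * (k\<^sup>2 * r ^ 6 * ?e) + 2 * C\<^sup>2 * (k * r ^ 4 * ?e) + C * (r\<^sup>2 * ?e)"
        by (simp add: algebra_simps)
      also have "\<dots> \<le> M * C * ((16 / c\<^sup>2) / k * ?f) + 2 * M * C\<^sup>2 * ((216 / c ^ 3) / k * ?f) +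
          2 * C\<^sup>2 * ((16 / c\<^sup>2) / k * ?f) + C * ((2 / c) / k * ?f)"
        by (intro add_mono mult_left_mono ab) (use M C in auto)
      also have "\<dots> = (D1 - 2 * M / \<rho>\<^sup>2 * (2 / c)) / k * ?f"
        by (simp add: D1_def add_divide_distrib distrib_right mult.assoc)
      also have "\<dots> \<le> D1 / k * ?f"
        using M c k by (intro mult_right_mono divide_right_mono) auto
      finally show ?thesis using 2 unfolding Bd by simp
    next
      \<comment> \<open>Beyond rho the integrand is cut off and only the model is left; inserting
        the factor r^2/rho^2 \<ge> 1 makes its tail of order 1/k.\<close>
      case 3
      then have "cmod (G k p + G k (fst p, - snd p) - 2 * E k p) = 2 * cmod (E k p)"
        by (simp add: G_def p r_def norm_mult)
      also have "\<dots> \<le> 2 * (M * ?e)"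
        using nE[of k p] k 3 by (simp add: Bd_def p r_def power2_norm_eq_inner mult.commute[of c])
      also have "\<dots> \<le> 2 * (M * (r\<^sup>2 / \<rho>\<^sup>2 * ?e))"
      proof -
        have "1 \<le> r\<^sup>2 / \<rho>\<^sup>2" using 3 \<rho> by (simp add: power_mono)
        then have "?e \<le> r\<^sup>2 / \<rho>\<^sup>2 * ?e" using mult_right_mono[of 1 "r\<^sup>2 / \<rho>\<^sup>2" ?e] by simp
        then show ?thesis using M(1) by (intro mult_left_mono) auto
      qed
      also have "\<dots> = 2 * M / \<rho>\<^sup>2 * (r\<^sup>2 * ?e)" by simp
      also have "\<dots> \<le> 2 * M / \<rho>\<^sup>2 * ((2 / c) / k * ?f)"
        by (intro mult_left_mono ab) (use M in auto)
      also have "\<dots> = (2 * M / \<rho>\<^sup>2 * (2 / c)) / k * ?f" by simp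
      also have "\<dots> \<le> D1 / k * ?f"
        using M C c k by (intro mult_right_mono divide_right_mono) (auto simp: D1_def)
      finally show ?thesis using 3 unfolding Bd by simp
    qed
  qed
  show ?thesis
  proof (rule that)
    fix k :: real assume k: "1 \<le> k"
    then have k0: "0 < k" by simp
    let ?I = "LINT p:?Z|lborel. a p * of_real (exp (- k * \<phi> p))"
    let ?J = "LINT y:Y|lborel. a (y, 0) * of_real (jac (Q y))"
    have I: "?I = integral\<^sup>L lborel (G k)" unfolding G_def set_lebesgue_integral_def ..
    have Bdi: "integrable lborel (Bd (c / 2 * k))"
      "integral\<^sup>L lborel (Bd (c / 2 * k)) = measure lborel Y * sqrt (pi / (c / 2 * k)) ^ ?n"
      using integral_gaussian_strip[OF Y, of "c / 2 * k", where 'b='b] c k unfolding Bd_eq by auto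
    \<comment> \<open>By invariance under the reflection of s, symmetrizing merely doubles the
      integral of the error.\<close>
    have "(\<integral>p. G k p + G k (fst p, - snd p) - 2 * E k p \<partial>lborel) = 2 * (integral\<^sup>L lborel (G k) - integral\<^sup>L lborel (E k))"
      using integral_reflect_snd[OF intG[of k]] intG intE[OF k0] by (simp add: algebra_simps)
    moreover have "cmod (\<integral>p. G k p + G k (fst p, - snd p) - 2 * E k p \<partial>lborel) \<le> (\<integral>p. D1 / k * Bd (c / 2 * k) p \<partial>lborel)"
      using integral_reflect_snd(1)[OF intG[of k]] intG intE[OF k0] Bdi bound[OF k]
      by (intro Bochner_Integration.integral_norm_bound_integral) auto
    ultimately have "2 * cmod (integral\<^sup>L lborel (G k) - integral\<^sup>L lborel (E k)) \<le>
       D1 / k * (measure lborel Y * sqrt (pi / (c / 2 * k)) ^ ?n)"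
      unfolding integral_mult_right_zero Bdi(2) by (simp only: norm_mult norm_numeral)
    then have *: "cmod (integral\<^sup>L lborel (G k) - integral\<^sup>L lborel (E k)) \<le>
       (D1 * measure lborel Y / 2) / k * sqrt (pi / (c / 2 * k)) ^ ?n" by simp
    \<comment> \<open>The mass of \<open>Bd\<close> scales in k inversely to the prefactor, so the
      bound keeps its factor 1/k.\<close>
    have s1: "sqrt (k / pi) * sqrt (pi / k) = 1" "sqrt (k / pi) * sqrt (pi / (c / 2 * k)) = sqrt (2 / c)"
      using k0 c by (simp_all flip: real_sqrt_mult)
    then have s2: "sqrt (k / pi) ^ ?n * sqrt (pi / k) ^ ?n = 1"
      "sqrt (k / pi) ^ ?n * sqrt (pi / (c / 2 * k)) ^ ?n = sqrt (2 / c) ^ ?n"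
      by (simp_all flip: power_mult_distrib)
    have "of_real (sqrt (k / pi) ^ ?n) * ?I - ?J = of_real (sqrt (k / pi) ^ ?n) * (integral\<^sup>L lborel (G k) - integral\<^sup>L lborel (E k))"
      using s2(1) unfolding E[OF k0] I
      by (simp only: right_diff_distrib mult.assoc[symmetric] of_real_mult[symmetric]) simp
    then have "cmod (of_real (sqrt (k / pi) ^ ?n) * ?I - ?J) = sqrt (k / pi) ^ ?n * cmod (integral\<^sup>L lborel (G k) - integral\<^sup>L lborel (E k))"
      using k0 by (simp add: norm_mult norm_power)
    also have "\<dots> \<le> sqrt (k / pi) ^ ?n * ((D1 * measure lborel Y / 2) / k * sqrt (pi / (c / 2 * k)) ^ ?n)"
      using k0 by (intro mult_left_mono *) auto
    also have "\<dots> = (D1 * measure lborel Y / 2) / k * (sqrt (k / pi) ^ ?n * sqrt (pi / (c / 2 * k)) ^ ?n)"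
      by (simp only: mult_ac)
    also have "\<dots> = (D1 * measure lborel Y / 2 * sqrt (2 / c) ^ ?n) / k"
      unfolding s2(2) by simp
    finally show "cmod (of_real (sqrt (k / pi) ^ ?n) * ?I - ?J) \<le> (D1 * measure lborel Y / 2 * sqrt (2 / c) ^ ?n) / k" .
  qed
qed

section \<open>Laplace asymptotics along a totally real submanifold\<close>

text \<open>The inverse function theorem, with derivatives packed as bounded linear functions only
  inside the proof.\<close>

lemma local_diffeomorphism:
  fixes g :: "'a::euclidean_space \<Rightarrow> 'a"
  assumes "open U" "Ck 1 U g" "x0 \<in> U" "inj (frechet_derivative g (at x0))"
  obtains U' where "open U'" "x0 \<in> U'" "U' \<subseteq> U" "inj_on g U'"
    "\<And>x. x \<in> U' \<Longrightarrow> inj (frechet_derivative g (at x))"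
proof -
  let ?D = "\<lambda>x. frechet_derivative g (at x)"
  have d: "(g has_derivative ?D x) (at x)" if "x \<in> U" for x
    using Ck_Suc_has_derivative[of 0 U g x] assms that by simp
  have bl: "bounded_linear (?D x)" if "x \<in> U" for x using d[OF that] by (rule has_derivative_bounded_linear)
  have ap: "blinfun_apply (Blinfun (?D x)) = ?D x" if "x \<in> U" for x
    by (rule bounded_linear_Blinfun_apply[OF bl[OF that]])
  obtain R where R: "linear R" "\<And>x. R (?D x0 x) = x"
    using linear_injective_left_inverse[OF bounded_linear.linear[OF bl[OF assms(3)]] assms(4)]
    by (auto simp: o_def fun_eq_iff)
  have Rb: "bounded_linear R" using R(1) by (simp add: linear_conv_bounded_linear)
  have cont: "continuous_on U (\<lambda>x. Blinfun (?D x))"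
  proof (rule continuous_on_blinfun_componentwise)
    fix i :: 'a
    have "continuous_on U (\<lambda>x. ?D x i)" using Ck_Suc_derivative[of 0 U g i] assms by simp
    then show "continuous_on U (\<lambda>x. blinfun_apply (Blinfun (?D x)) i)"
      by (simp add: ap cong: continuous_on_cong)
  qed
  have inv: "Blinfun R o\<^sub>L Blinfun (?D x0) = id_blinfun"
    by (intro blinfun_eqI) (simp add: ap assms(3) bounded_linear_Blinfun_apply[OF Rb] R(2))
  obtain U' V h h' where UV: "open U'" "U' \<subseteq> U" "x0 \<in> U'" "open V" "g x0 \<in> V" "homeomorphism U' V g h"
    "\<And>y. y \<in> V \<Longrightarrow> (h has_derivative (h' y)) (at y)"
    "\<And>y. y \<in> V \<Longrightarrow> h' y = inv (blinfun_apply (Blinfun (?D (h y))))"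
    "\<And>y. y \<in> V \<Longrightarrow> bij (blinfun_apply (Blinfun (?D (h y))))"
    using inverse_function_theorem[OF assms(1) _ cont assms(3) inv] d ap by (metis (no_types, lifting))
  show ?thesis
  proof (rule that[OF UV(1,3,2)])
    show "inj_on g U'" using UV(6) by (metis homeomorphism_apply1 inj_onI)
    fix x assume x: "x \<in> U'"
    then have "g x \<in> V" "h (g x) = x" using UV(6) by (auto simp: homeomorphism_def)
    then have "bij (?D x)" using UV(9)[of "g x"] ap x UV(2) by auto
    then show "inj (?D x)" by (rule bij_is_inj)
  qed
qed

lemma integral_Complex_vec:
  fixes F :: "complex^'n \<Rightarrow> 'b::{banach, second_countable_topology}"
  assumes "F \<in> borel_measurable borel"
  shows "integral\<^sup>L lborel F = integral\<^sup>L lborel (\<lambda>p. F (Complex_vec p))"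
proof -
  have "integral\<^sup>L lborel F = integral\<^sup>L (distr lborel borel Complex_vec) F"
    by (simp add: distr_Complex_vec)
  also have "\<dots> = integral\<^sup>L lborel (\<lambda>p. F (Complex_vec p))"
    using borel_measurable_linear[OF linear_Complex_vec] assms by (intro integral_distr) auto
  finally show ?thesis .
qed

lemma bounded_linear_ii: "bounded_linear ((*s) \<i> :: complex^'n \<Rightarrow> complex^'n)"
  by (auto simp: linear_conv_bounded_linear[symmetric] vec_eq_iff algebra_simps intro!: linearI)

lemma linear_Im_nth: "linear (\<lambda>z::complex^'n. Im (z $ j))"
  by (rule linearI) auto

lemma bilinear_coords:
  fixes B :: "'a::euclidean_space \<Rightarrow> 'a \<Rightarrow> real"
  assumes "bilinear B"
  shows "B v w = (\<Sum>a\<in>Basis. \<Sum>b\<in>Basis. (v \<bullet> a) * (w \<bullet> b) * B a b)"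
proof -
  have "B v w = B (\<Sum>a\<in>Basis. (v \<bullet> a) *\<^sub>R a) (\<Sum>b\<in>Basis. (w \<bullet> b) *\<^sub>R b)"
    by (simp add: euclidean_representation)
  also have "\<dots> = (\<Sum>(a, b)\<in>Basis \<times> Basis. (v \<bullet> a) * (w \<bullet> b) * B a b)"
    unfolding bilinear_sum[OF assms]
    by (intro sum.cong) (auto simp: bilinear_lmul[OF assms] bilinear_rmul[OF assms])
  finally show ?thesis by (simp add: sum.cartesian_product)
qed

text \<open>Continuity for fixed vectors suffices, by expansion in a basis.\<close>

lemma continuous_on_two_form:
  assumes "\<And>x. x \<in> S \<Longrightarrow> bilinear (B x)" "\<And>v w. continuous_on S (\<lambda>x. B x v w)"
    "continuous_on S V" "continuous_on S W"
  shows "continuous_on S (\<lambda>x. B x (V x :: 'a::euclidean_space) (W x :: 'a) :: real)"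
proof -
  have "continuous_on S (\<lambda>x. \<Sum>a\<in>Basis. \<Sum>b\<in>Basis. (V x \<bullet> a) * (W x \<bullet> b) * B x a b)"
    by (intro continuous_intros assms)
  then show ?thesis by (simp add: bilinear_coords[OF assms(1)] cong: continuous_on_cong)
qed

text \<open>Omega and D are coordinate domains of M and of Gamma, f is the embedding read in them,
  phi the phase. The conditions on phi say that it vanishes to first order along Gamma and has the
  prescribed Hessian in the directions i T Gamma.\<close>

locale local_model =
  fixes \<Omega> :: "(complex^'n) set" and D :: "(real^'n) set" and f :: "real^'n \<Rightarrow> complex^'n"
    and \<phi> :: "complex^'n \<Rightarrow> real" and \<omega> :: "complex^'n \<Rightarrow> complex^'n \<Rightarrow> complex^'n \<Rightarrow> real"
    and Q :: "real^'n \<Rightarrow> real^'n \<Rightarrow> real^'n"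
  assumes open_\<Omega>: "open \<Omega>" and open_D: "open D" and f_\<Omega>: "f ` D \<subseteq> \<Omega>"
    and f_Ck: "\<And>n. Ck n D f" and \<phi>_Ck: "Ck 4 \<Omega> \<phi>"
    and \<omega>_pos: "\<And>x. x \<in> \<Omega> \<Longrightarrow> positive_form (\<omega> x)"
    and \<omega>_cont: "\<And>v w. continuous_on \<Omega> (\<lambda>x. \<omega> x v w)"
    and df_inj: "\<And>y. y \<in> D \<Longrightarrow> inj (frechet_derivative f (at y))"
    and \<phi>0: "\<And>y. y \<in> D \<Longrightarrow> \<phi> (f y) = 0"
    and \<phi>1: "\<And>y v. y \<in> D \<Longrightarrow> frechet_derivative \<phi> (at (f y)) v = 0"
    and \<phi>2: "\<And>y s. y \<in> D \<Longrightarrow>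
      frechet_derivative (\<lambda>x. frechet_derivative \<phi> (at x) (\<i> *s frechet_derivative f (at y) s)) (at (f y))
        (\<i> *s frechet_derivative f (at y) s) = 2 * \<omega> (f y) (frechet_derivative f (at y) s) (\<i> *s frechet_derivative f (at y) s)"
    and lag: "\<And>y a b. y \<in> D \<Longrightarrow> \<omega> (f y) (frechet_derivative f (at y) a) (frechet_derivative f (at y) b) = 0"
    and Q: "\<And>y. y \<in> D \<Longrightarrow> linear (Q y)" "\<And>y. y \<in> D \<Longrightarrow> inj (Q y)"
      "\<And>y x. y \<in> D \<Longrightarrow> \<omega> (f y) (frechet_derivative f (at y) (Q y x)) (\<i> *s frechet_derivative f (at y) (Q y x)) = x \<bullet> x"
begin

abbreviation df :: "real^'n \<Rightarrow> real^'n \<Rightarrow> complex^'n" where "df y \<equiv> frechet_derivative f (at y)"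

definition h :: "real^'n \<Rightarrow> real^'n \<Rightarrow> real" where "h y s = \<omega> (f y) (df y s) (\<i> *s df y s)"

text \<open>The sum over fixed directions gives a formula to which the rules for \<open>Ck\<close>
  apply; \<open>\<Phi>_eq\<close> recovers f(y) + i f'(y) s.\<close>

definition \<Phi> :: "complex^'n \<Rightarrow> complex^'n" where
  "\<Phi> z = f (Re_vec z) + (\<Sum>j\<in>UNIV. Im (z $ j) *\<^sub>R (\<i> *s df (Re_vec z) (axis j 1)))"

lemma linear_df: "y \<in> D \<Longrightarrow> linear (df y)"
  using Ck_Suc_has_derivative[OF f_Ck] has_derivative_linear by blast

lemma df_expand: "y \<in> D \<Longrightarrow> df y s = (\<Sum>j\<in>UNIV. s $ j *\<^sub>R df y (axis j 1))"
proof -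
  assume y: "y \<in> D"
  have "df y s = df y (\<Sum>j\<in>UNIV. s $ j *\<^sub>R axis j 1)"
    by (rule arg_cong[where f="df y"]) (simp add: vec_eq_iff axis_def if_distrib[of "(*) _"] cong: if_cong)
  then show ?thesis by (simp add: linear_sum[OF linear_df[OF y]] linear_scale[OF linear_df[OF y]])
qed

lemma \<Phi>_eq: "Re_vec z \<in> D \<Longrightarrow> \<Phi> z = f (Re_vec z) + \<i> *s df (Re_vec z) (Im_vec z)"
  unfolding \<Phi>_def df_expand[of "Re_vec z" "Im_vec z"]
  by (simp add: Im_vec_def vec_eq_iff sum_distrib_left)

abbreviation D' :: "(complex^'n) set" where "D' \<equiv> Re_vec -` D"

lemma open_D': "open D'"
  by (intro open_vimage open_D linear_continuous_on) (simp add: linear_Re_vec linear_conv_bounded_linear[symmetric])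

lemma \<Phi>_Ck: "Ck n D' \<Phi>"
proof -
  have re: "Ck n D' Re_vec" and im: "Ck n D' (\<lambda>z. Im (z $ j))" for j
    using linear_Re_vec linear_Im_nth[of j]
    by (auto intro!: Ck_bounded_linear[OF open_D'] simp: linear_conv_bounded_linear[symmetric])
  show ?thesis
    unfolding \<Phi>_def
    by (intro Ck_add Ck_sum Ck_scaleR open_D' im Ck_linear_compose[OF open_D' bounded_linear_ii]
        Ck_compose[OF open_D' open_D _ re] Ck_Suc_derivative[OF f_Ck] f_Ck) auto
qed

text \<open>The derivatives of f' come with the factor s and drop out at s = 0.\<close>

lemma frechet_\<Phi>_real:
  assumes y: "y \<in> D"
  shows "frechet_derivative \<Phi> (at (Complex_vec (y, 0))) = complexify (df y)"
proof -
  let ?z = "Complex_vec (y, 0)"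
  have re: "(Re_vec has_derivative Re_vec) (at z)" for z :: "complex^'n"
    by (rule linear_imp_has_derivative[OF linear_Re_vec])
  have im: "((\<lambda>z. Im (z $ j)) has_derivative (\<lambda>w. Im (w $ j))) (at z)" for z :: "complex^'n" and j
    by (rule linear_imp_has_derivative[OF linear_Im_nth])
  have f: "(f has_derivative df y) (at (Re_vec ?z))"
    using Ck_Suc_has_derivative[OF f_Ck y] by simp
  have dj: "((\<lambda>y. df y (axis j 1)) has_derivative frechet_derivative (\<lambda>y. df y (axis j 1)) (at y)) (at (Re_vec ?z))" for j
    using Ck_Suc_has_derivative[OF Ck_Suc_derivative[OF f_Ck] y] by simp
  have "(\<Phi> has_derivative (\<lambda>w. df y (Re_vec w) + (\<Sum>j\<in>UNIV.
      Im (?z $ j) *\<^sub>R (\<i> *s frechet_derivative (\<lambda>y. df y (axis j 1)) (at y) (Re_vec w)) + Im (w $ j) *\<^sub>R (\<i> *s df (Re_vec ?z) (axis j 1))))) (at ?z)"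
    unfolding \<Phi>_def
    by (intro has_derivative_add has_derivative_sum has_derivative_scaleR im
        has_derivative_compose[OF re f] bounded_linear.has_derivative[OF bounded_linear_ii] has_derivative_compose[OF re dj])
  moreover have "Im (?z $ j) = 0" for j by (simp add: Complex_vec_def)
  moreover have "(\<Sum>j\<in>UNIV. Im (w $ j) *\<^sub>R (\<i> *s df y (axis j 1))) = \<i> *s df y (Im_vec w)" for w
    unfolding df_expand[OF y, of "Im_vec w"] by (simp add: Im_vec_def vec_eq_iff sum_distrib_left)
  ultimately have "(\<Phi> has_derivative complexify (df y)) (at ?z)"
    by (simp add: complexify_def[abs_def])
  then show ?thesis by (rule frechet_derivative_at[symmetric])
qed

text \<open>Tangent spaces of Gamma are totally real: if b = i a with a and b tangent, then omega(a,
  i a) = omega(a, b) = 0 forces a = 0.\<close>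

lemma inj_complexify:
  assumes y: "y \<in> D"
  shows "inj (complexify (df y))"
proof (rule linear_injective_0[OF linear_complexify[OF linear_df[OF y]], THEN iffD2], clarify)
  fix z assume z: "complexify (df y) z = 0"
  let ?B = "\<omega> (f y)" and ?a = "df y (Re_vec z)" and ?b = "df y (Im_vec z)"
  have B: "positive_form ?B" using \<omega>_pos y f_\<Omega> by auto
  have ii: "\<i> *s (\<i> *s v) = - v" for v :: "complex^'n" unfolding vec_eq_iff by simp
  have "\<i> *s (?a + \<i> *s ?b) = 0" using z unfolding complexify_def by simp
  then have "?b = \<i> *s ?a" by (simp add: vector_add_ldistrib ii)
  then have "?B ?a (\<i> *s ?a) = 0" using lag[OF y, of "Re_vec z" "Im_vec z"] by simp
  then have a: "?a = 0" using positive_formD(4)[OF B, of ?a] by auto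
  with \<open>?b = \<i> *s ?a\<close> have "?b = 0" by simp
  with a have "Re_vec z = 0" "Im_vec z = 0"
    using linear_injective_0[OF linear_df[OF y]] df_inj[OF y] by auto
  then show "z = 0" by (metis Re_Im_Complex_vec(3) linear_0 linear_Complex_vec zero_prod_def)
qed

lemma h_Q: "y \<in> D \<Longrightarrow> h y (Q y x) = x \<bullet> x"
  by (simp add: h_def Q)

lemma h_pos: "y \<in> D \<Longrightarrow> s \<noteq> 0 \<Longrightarrow> h y s > 0"
proof -
  assume y: "y \<in> D" and "s \<noteq> 0"
  then have "df y s \<noteq> 0" using linear_injective_0[OF linear_df[OF y]] df_inj[OF y] by auto
  moreover have "positive_form (\<omega> (f y))" using \<omega>_pos y f_\<Omega> by auto
  ultimately show ?thesis unfolding h_def by (intro positive_formD(4))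
qed

lemma h_scale: "y \<in> D \<Longrightarrow> h y (t *\<^sub>R s) = t\<^sup>2 * h y s"
proof -
  assume y: "y \<in> D"
  then have b: "bilinear (\<omega> (f y))" using \<omega>_pos f_\<Omega> by (intro positive_formD(1)) auto
  have "\<i> *s (t *\<^sub>R v) = t *\<^sub>R (\<i> *s v)" for v :: "complex^'n" by (simp add: vec_eq_iff)
  then show ?thesis
    by (simp add: h_def linear_scale[OF linear_df[OF y]] bilinear_lmul[OF b] bilinear_rmul[OF b] power2_eq_square)
qed

lemma h_cont: "continuous_on (D \<times> UNIV) (\<lambda>p. h (fst p) (snd p))"
  unfolding h_def
proof (rule continuous_on_two_form[where B="\<lambda>x. \<omega> (f (fst x))" and V="\<lambda>x. df (fst x) (snd x)"
      and W="\<lambda>x. \<i> *s df (fst x) (snd x)"])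
  show "bilinear (\<omega> (f (fst x)))" if "x \<in> D \<times> UNIV" for x :: "(real^'n) \<times> (real^'n)"
    using that f_\<Omega> by (intro positive_formD(1) \<omega>_pos) auto
  have f: "continuous_on (D \<times> UNIV) (\<lambda>x :: (real^'n) \<times> (real^'n). f (fst x))"
    by (rule continuous_on_compose2[OF Ck_imp_continuous_on[OF f_Ck]]) (auto intro!: continuous_intros)
  show "continuous_on (D \<times> UNIV) (\<lambda>x :: (real^'n) \<times> (real^'n). \<omega> (f (fst x)) v w)" for v w
    by (rule continuous_on_compose2[OF \<omega>_cont f]) (use f_\<Omega> in auto)
  have j: "continuous_on (D \<times> UNIV) (\<lambda>x :: (real^'n) \<times> (real^'n). df (fst x) (axis j 1))" for j
    by (rule continuous_on_compose2[OF Ck_imp_continuous_on[OF Ck_Suc_derivative[OF f_Ck]]]) (auto intro!: continuous_intros)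
  show d: "continuous_on (D \<times> UNIV) (\<lambda>x. df (fst x) (snd x))"
  proof (rule continuous_on_cong[THEN iffD1, OF refl])
    show "continuous_on (D \<times> UNIV) (\<lambda>x :: (real^'n) \<times> (real^'n). \<Sum>j\<in>UNIV. (snd x $ j) *\<^sub>R df (fst x) (axis j 1))"
      by (intro continuous_intros j)
  qed (auto simp: df_expand[symmetric])
  show "continuous_on (D \<times> UNIV) (\<lambda>x. \<i> *s df (fst x) (snd x))"
    by (rule bounded_linear.continuous_on[OF bounded_linear_ii d])
qed

text \<open>Along a fibre the coordinates are affine in t, so second derivatives of the phase along
  it are those of the Hessian of phi, with no term from second derivatives of
  \<open>\<Phi>\<close>.\<close>

lemma \<Phi>_ray: "y \<in> D \<Longrightarrow> \<Phi> (Complex_vec (y, t *\<^sub>R s)) = f y + t *\<^sub>R (\<i> *s df y s)"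
  by (simp add: \<Phi>_eq linear_scale[OF linear_df] vec_eq_iff)

context
  fixes U r
  assumes UD: "U \<subseteq> D" and oU: "open U" and r: "0 < r"
    and \<Phi>\<Omega>: "\<And>p. p \<in> U \<times> ball 0 r \<Longrightarrow> \<Phi> (Complex_vec p) \<in> \<Omega>"
begin

lemma \<Phi>p_Ck: "Ck n (U \<times> ball 0 r) (\<lambda>p. \<Phi> (Complex_vec p))"
  by (rule Ck_compose[OF _ open_D' \<Phi>_Ck Ck_bounded_linear])
    (use oU UD in \<open>auto intro!: open_Times simp: linear_Complex_vec linear_conv_bounded_linear[symmetric]\<close>)

lemma phase_Ck: "Ck 4 (U \<times> ball 0 r) (\<lambda>p. \<phi> (\<Phi> (Complex_vec p)))"
  by (rule Ck_compose[OF _ open_\<Omega> \<phi>_Ck \<Phi>p_Ck]) (use oU \<Phi>\<Omega> in \<open>auto intro!: open_Times\<close>)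

text \<open>One function of t is differentiated in two ways, through the coordinates (y, s) and
  along the straight ray in \<open>\<Omega>\<close>.\<close>

lemma phase_ray_derivative:
  assumes y: "y \<in> U" and t: "norm (t *\<^sub>R s) < r"
  shows "frechet_derivative (\<lambda>p. \<phi> (\<Phi> (Complex_vec p))) (at (y, t *\<^sub>R s)) (0, s) =
    frechet_derivative \<phi> (at (f y + t *\<^sub>R (\<i> *s df y s))) (\<i> *s df y s)"
proof -
  let ?P = "\<lambda>p. \<phi> (\<Phi> (Complex_vec p))" and ?v = "\<i> *s df y s"
  have yD: "y \<in> D" using y UD by auto
  have p: "(y, t *\<^sub>R s) \<in> U \<times> ball 0 r" using y t by auto
  have P: "(?P has_derivative frechet_derivative ?P (at (y, t *\<^sub>R s))) (at (y, t *\<^sub>R s))"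
    by (rule Ck_Suc_has_derivative[OF Ck_mono[OF phase_Ck, of 1, simplified] p]) 
  have 1: "((\<lambda>t. ?P (y, t *\<^sub>R s)) has_derivative (\<lambda>u. frechet_derivative ?P (at (y, t *\<^sub>R s)) (0, u *\<^sub>R s))) (at t)"
    by (rule has_derivative_compose[where f="\<lambda>t. (y, t *\<^sub>R s)" and g="?P", OF _ P])
      (auto intro!: derivative_eq_intros)
  have \<Omega>: "f y + t *\<^sub>R ?v \<in> \<Omega>" using \<Phi>\<Omega>[OF p] \<Phi>_ray[OF yD] by simp
  have F: "(\<phi> has_derivative frechet_derivative \<phi> (at (f y + t *\<^sub>R ?v))) (at (f y + t *\<^sub>R ?v))"
    by (rule Ck_Suc_has_derivative[OF Ck_mono[OF \<phi>_Ck, of 1, simplified] \<Omega>])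
  have 2: "((\<lambda>t. \<phi> (f y + t *\<^sub>R ?v)) has_derivative (\<lambda>u. frechet_derivative \<phi> (at (f y + t *\<^sub>R ?v)) (u *\<^sub>R ?v))) (at t)"
    by (rule has_derivative_compose[where f="\<lambda>t. f y + t *\<^sub>R ?v" and g="\<phi>", OF _ F])
      (auto intro!: derivative_eq_intros)
  have eq: "(\<lambda>t. ?P (y, t *\<^sub>R s)) = (\<lambda>t. \<phi> (f y + t *\<^sub>R ?v))" by (simp add: \<Phi>_ray[OF yD])
  show ?thesis
    using fun_cong[OF has_derivative_unique[OF 1[unfolded eq] 2], of 1] by simp
qed

lemma phase_second_derivative:
  assumes y: "y \<in> U"
  shows "frechet_derivative (\<lambda>x. frechet_derivative (\<lambda>p. \<phi> (\<Phi> (Complex_vec p))) (at x) (0, s)) (at (y, 0)) (0, s) = 2 * h y s"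
proof -
  let ?P = "\<lambda>p. \<phi> (\<Phi> (Complex_vec p))" and ?v = "\<i> *s df y s"
  let ?G = "\<lambda>x. frechet_derivative ?P (at x) (0, s)" and ?H = "\<lambda>x. frechet_derivative \<phi> (at x) ?v"
  have yD: "y \<in> D" using y UD by auto
  have G: "(?G has_derivative frechet_derivative ?G (at (y, 0))) (at (y, 0 *\<^sub>R s))"
    using Ck_Suc_has_derivative[OF Ck_Suc_derivative[OF Ck_mono[OF phase_Ck, of "Suc 1", simplified]], of "(y, 0)"] y r
    by simp
  have 1: "((\<lambda>t. ?G (y, t *\<^sub>R s)) has_derivative (\<lambda>u. frechet_derivative ?G (at (y, 0)) (0, u *\<^sub>R s))) (at 0)"
    by (rule has_derivative_compose[where f="\<lambda>t. (y, t *\<^sub>R s)" and g="?G", OF _ G])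
      (auto intro!: derivative_eq_intros)
  have H: "(?H has_derivative frechet_derivative ?H (at (f y))) (at (f y + 0 *\<^sub>R ?v))"
    using Ck_Suc_has_derivative[OF Ck_Suc_derivative[OF Ck_mono[OF \<phi>_Ck, of "Suc 1", simplified]], of "f y"] yD f_\<Omega>
    by auto
  have 2: "((\<lambda>t. ?H (f y + t *\<^sub>R ?v)) has_derivative (\<lambda>u. frechet_derivative ?H (at (f y)) (u *\<^sub>R ?v))) (at 0)"
    by (rule has_derivative_compose[where f="\<lambda>t. f y + t *\<^sub>R ?v" and g="?H", OF _ H])
      (auto intro!: derivative_eq_intros)
  have "open {t. norm (t *\<^sub>R s) < r}" by (intro open_Collect_less continuous_intros)
  from has_derivative_transform_within_open[OF 2 this, of "\<lambda>t. ?G (y, t *\<^sub>R s)"] r phase_ray_derivative[OF y]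
  have 3: "((\<lambda>t. ?G (y, t *\<^sub>R s)) has_derivative (\<lambda>u. frechet_derivative ?H (at (f y)) (u *\<^sub>R ?v))) (at 0)"
    by simp
  show ?thesis
    using fun_cong[OF has_derivative_unique[OF 1 3], of 1] \<phi>2[OF yD, of s] by (simp add: h_def)
qed

end

end

text \<open>It removes the absolute value from the Jacobian: on a connected set this is a constant
  multiple of the determinant, and so keeps its differentiability.\<close>

lemma connected_nonzero_sign:
  fixes d :: "'a::topological_space \<Rightarrow> real"
  assumes "connected S" "continuous_on S d" "\<And>x. x \<in> S \<Longrightarrow> d x \<noteq> 0"
  obtains e where "\<And>x. x \<in> S \<Longrightarrow> \<bar>d x\<bar> = e * d x"
proof -
  have conn: "connected (d ` S)" by (rule connected_continuous_image[OF assms(2,1)])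
  have "(\<forall>x\<in>S. d x > 0) \<or> (\<forall>x\<in>S. d x < 0)"
  proof (rule ccontr)
    assume "\<not> ?thesis"
    then obtain x y where xy: "x \<in> S" "y \<in> S" "d x \<le> 0" "0 \<le> d y" by (meson not_less)
    then have "0 \<in> d ` S" using connectedD_interval[OF conn, of "d x" "d y" 0] by blast
    then show False using assms(3) by auto
  qed
  then show ?thesis
  proof
    assume "\<forall>x\<in>S. d x > 0"
    then show ?thesis by (intro that[of 1]) auto
  next
    assume "\<forall>x\<in>S. d x < 0"
    then show ?thesis by (intro that[of "-1"]) auto
  qed
qed

section \<open>Laplace asymptotics in adapted coordinates\<close>

context local_model
begin

text \<open>The inverse function theorem at (y0, 0), followed by shrinking to a product of balls,
  which separates the parameter of Gamma from the fibre variable.\<close>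

lemma local_chart:
  assumes y0: "y0 \<in> D"
  obtains U' r where "open U'" "U' \<subseteq> D'" "inj_on \<Phi> U'" "\<And>z. z \<in> U' \<Longrightarrow> \<Phi> z \<in> \<Omega>"
    "\<And>z. z \<in> U' \<Longrightarrow> inj (frechet_derivative \<Phi> (at z))" "0 < r"
    "\<And>p. p \<in> ball y0 r \<times> ball 0 r \<Longrightarrow> Complex_vec p \<in> U'"
proof -
  let ?z0 = "Complex_vec (y0, 0)"
  define U1 where "U1 = D' \<inter> \<Phi> -` \<Omega>"
  have U1: "open U1"
    unfolding U1_def using Ck_imp_continuous_on[OF \<Phi>_Ck] open_D' open_\<Omega> by (intro continuous_open_preimage)
  have "\<Phi> ?z0 = f y0" using \<Phi>_ray[OF y0, of 0 0] by simp
  then have z0: "?z0 \<in> U1" using y0 f_\<Omega> by (auto simp: U1_def)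
  have "Ck 1 U1 \<Phi>" by (rule Ck_subset[OF \<Phi>_Ck]) (auto simp: U1_def)
  moreover have "inj (frechet_derivative \<Phi> (at ?z0))"
    unfolding frechet_\<Phi>_real[OF y0] by (rule inj_complexify[OF y0])
  ultimately obtain U' where U': "open U'" "?z0 \<in> U'" "U' \<subseteq> U1" "inj_on \<Phi> U'"
    "\<And>x. x \<in> U' \<Longrightarrow> inj (frechet_derivative \<Phi> (at x))"
    using local_diffeomorphism[OF U1 _ z0] by metis
  have "open (Complex_vec -` U')"
    using linear_Complex_vec by (intro open_vimage U' linear_continuous_on) (simp add: linear_conv_bounded_linear[symmetric])
  moreover have "(y0, 0) \<in> Complex_vec -` U'" using U'(2) by simp
  ultimately obtain A B where AB: "open A" "open B" "(y0, 0) \<in> A \<times> B" "A \<times> B \<subseteq> Complex_vec -` U'"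
    by (rule open_prod_elim)
  from AB obtain r1 r2 where r: "r1 > 0" "r2 > 0" "ball y0 r1 \<subseteq> A" "ball 0 r2 \<subseteq> B"
    by (meson mem_Sigma_iff open_contains_ball)
  show ?thesis
  proof (rule that[OF U'(1) _ U'(4) _ U'(5)])
    show "0 < min r1 r2" using r by simp
    show "Complex_vec p \<in> U'" if "p \<in> ball y0 (min r1 r2) \<times> ball 0 (min r1 r2)" for p
    proof -
      have "fst p \<in> A" "snd p \<in> B" using that r(3,4) by (auto simp: subset_iff)
      then have "p \<in> A \<times> B" by (simp add: mem_Times_iff)
      then show ?thesis using AB(4) by blast
    qed
  qed (use U'(3) in \<open>auto simp: U1_def\<close>)
qed

lemma phase_quadratic:
  assumes UD: "U \<subseteq> D" and oU: "open U" and r: "0 < r"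
    and \<Phi>\<Omega>: "\<And>p. p \<in> U \<times> ball 0 r \<Longrightarrow> \<Phi> (Complex_vec p) \<in> \<Omega>"
    and Y: "compact Y" "Y \<subseteq> U" "Y \<noteq> {}"
  obtains \<rho> c C where "0 < \<rho>" "\<rho> < r" "0 < c" "0 < C"
    "\<And>y s. y \<in> Y \<Longrightarrow> c * (norm s)\<^sup>2 \<le> h y s"
    "\<And>y s. y \<in> Y \<Longrightarrow> norm s \<le> \<rho> \<Longrightarrow> c * (norm s)\<^sup>2 \<le> \<phi> (\<Phi> (Complex_vec (y, s)))"
    "\<And>y s. y \<in> Y \<Longrightarrow> norm s \<le> \<rho> \<Longrightarrow> \<bar>\<phi> (\<Phi> (Complex_vec (y, s))) - h y s\<bar> \<le> C * (norm s) ^ 3"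
    "\<And>y s. y \<in> Y \<Longrightarrow> norm s \<le> \<rho> \<Longrightarrow>
      \<bar>\<phi> (\<Phi> (Complex_vec (y, s))) + \<phi> (\<Phi> (Complex_vec (y, - s))) - 2 * h y s\<bar> \<le> C * (norm s) ^ 4"
proof -
  let ?P = "\<lambda>p. \<phi> (\<Phi> (Complex_vec p))"
  have "\<exists>C>0. \<forall>y\<in>Y. \<forall>s. norm s \<le> r / 2 \<longrightarrow>
    \<bar>?P (y, s) - h y s\<bar> \<le> C * (norm s)^3 \<and> \<bar>?P (y, s) + ?P (y, - s) - 2 * h y s\<bar> \<le> C * (norm s)^4"
  proof (rule phase_taylor[OF oU phase_Ck[OF UD oU r \<Phi>\<Omega>] Y(1,2)])
    fix y s assume y: "y \<in> Y"
    then have yU: "y \<in> U" and yD: "y \<in> D" using Y UD by auto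
    show "?P (y, 0) = 0" using \<Phi>_ray[OF yD, of 0 0] \<phi>0[OF yD] by simp
    show "frechet_derivative ?P (at (y, 0)) (0, s) = 0"
      using phase_ray_derivative[OF UD oU r \<Phi>\<Omega> yU, of 0 s] r \<phi>1[OF yD] by simp
    show "frechet_derivative (\<lambda>x. frechet_derivative ?P (at x) (0, s)) (at (y, 0)) (0, s) = 2 * h y s"
      by (rule phase_second_derivative[OF UD oU r \<Phi>\<Omega> yU])
  qed (use r in auto)
  then obtain C where C: "C > 0"
    and C3: "\<And>y s. y \<in> Y \<Longrightarrow> norm s \<le> r / 2 \<Longrightarrow> \<bar>?P (y, s) - h y s\<bar> \<le> C * (norm s)^3"
    and C4: "\<And>y s. y \<in> Y \<Longrightarrow> norm s \<le> r / 2 \<Longrightarrow> \<bar>?P (y, s) + ?P (y, - s) - 2 * h y s\<bar> \<le> C * (norm s)^4"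
    by blast
  have cont: "continuous_on (Y \<times> sphere 0 1) (\<lambda>p. h (fst p) (snd p))"
    by (rule continuous_on_subset[OF h_cont]) (use Y UD in auto)
  have ne: "Y \<times> sphere (0 :: real^'n) 1 \<noteq> {}" using Y(3) by simp
  obtain y1 s1 where m: "y1 \<in> Y" "norm s1 = 1" "\<And>y s. y \<in> Y \<Longrightarrow> norm s = 1 \<Longrightarrow> h y1 s1 \<le> h y s"
    using continuous_attains_inf[OF compact_Times[OF Y(1) compact_sphere] ne cont] by auto
  \<comment> \<open>Half the minimum of h over unit vectors. The other half absorbs the cubic error,
    for which rho is chosen below with C rho \<le> c.\<close>
  define c where "c = h y1 s1 / 2"
  have c: "0 < c" using h_pos[of y1 s1] m Y UD by (force simp: c_def)
  have hl: "2 * c * (norm s)\<^sup>2 \<le> h y s" if y: "y \<in> Y" for y s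
  proof -
    obtain u t where u: "norm u = 1" "t *\<^sub>R u = s" "norm s = t" by (rule polar_cball)
    have "h y s = t\<^sup>2 * h y u" using h_scale[of y t u] u(2) y Y UD by auto
    moreover have "t\<^sup>2 * h y1 s1 \<le> t\<^sup>2 * h y u" using m(3)[OF y u(1)] by (intro mult_left_mono) auto
    ultimately show ?thesis unfolding u(3) c_def by (simp add: mult.commute)
  qed
  define \<rho> where "\<rho> = min (r / 2) (c / C)"
  have \<rho>: "0 < \<rho>" "\<rho> \<le> r / 2" "C * \<rho> \<le> c" using r c C by (auto simp: \<rho>_def min_def field_simps)
  show ?thesis
  proof (rule that[OF \<rho>(1) _ c C])
    show "\<rho> < r" using \<rho> r by simp
    fix y s assume y: "y \<in> Y"
    show "c * (norm s)\<^sup>2 \<le> h y s" using hl[OF y, of s] mult_nonneg_nonneg[OF less_imp_le[OF c] zero_le_power2[of "norm s"]] by linarith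
    assume s: "norm s \<le> \<rho>"
    then have s2: "norm s \<le> r / 2" using \<rho> by simp
    have "C * (norm s)^3 = C * norm s * (norm s)\<^sup>2" by (simp add: power2_eq_square power3_eq_cube)
    also have "\<dots> \<le> C * \<rho> * (norm s)\<^sup>2" using s C by (intro mult_right_mono mult_left_mono) auto
    also have "\<dots> \<le> c * (norm s)\<^sup>2" using \<rho>(3) by (intro mult_right_mono) auto
    finally show "c * (norm s)\<^sup>2 \<le> ?P (y, s)" using C3[OF y s2] hl[OF y, of s] by linarith
    show "\<bar>?P (y, s) - h y s\<bar> \<le> C * (norm s) ^ 3" "\<bar>?P (y, s) + ?P (y, - s) - 2 * h y s\<bar> \<le> C * (norm s) ^ 4"
      using C3[OF y s2] C4[OF y s2] by auto
  qed
qed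

text \<open>The Jacobian of the coordinates is made part of the amplitude; real and imaginary parts
  are then expanded separately.\<close>

lemma amplitude_expansion:
  assumes UD: "U \<subseteq> D" and oU: "open U" and r: "0 < r" and conn: "connected U"
    and \<Phi>\<Omega>: "\<And>p. p \<in> U \<times> ball 0 r \<Longrightarrow> \<Phi> (Complex_vec p) \<in> \<Omega>"
    and inj: "\<And>p. p \<in> U \<times> ball 0 r \<Longrightarrow> inj (frechet_derivative \<Phi> (at (Complex_vec p)))"
    and Y: "compact Y" "Y \<subseteq> U" and \<rho>: "0 < \<rho>" "\<rho> < r"
    and a: "Ck 2 \<Omega> a"
  defines "b \<equiv> \<lambda>p. a (\<Phi> (Complex_vec p)) * complex_of_real (Jac \<Phi> (Complex_vec p))"
  obtains C where "C > 0" "\<And>y s. y \<in> Y \<Longrightarrow> norm s \<le> \<rho> \<Longrightarrow> cmod (b (y, s) - b (y, 0)) \<le> C * norm s"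
    "\<And>y s. y \<in> Y \<Longrightarrow> norm s \<le> \<rho> \<Longrightarrow> cmod (b (y, s) + b (y, - s) - 2 * b (y, 0)) \<le> C * (norm s)\<^sup>2"
    "continuous_on (Y \<times> cball 0 \<rho>) b"
proof -
  let ?O = "U \<times> ball (0 :: real^'n) r"
  let ?d = "\<lambda>p. det (matrix (\<lambda>v. to_vec (frechet_derivative \<Phi> (at (Complex_vec p)) (of_vec v))))"
  have oO: "open ?O" using oU by (intro open_Times) auto
  have sub: "Complex_vec ` ?O \<subseteq> D'" using UD by auto
  have CC: "Ck n ?O Complex_vec" for n
    by (rule Ck_bounded_linear[OF oO]) (simp add: linear_Complex_vec linear_conv_bounded_linear[symmetric])
  have d: "Ck 2 ?O ?d"
    by (rule Ck_compose[OF oO open_D' Ck_det_derivative[OF open_D' \<Phi>_Ck] CC sub])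
  have nz: "?d p \<noteq> 0" if "p \<in> ?O" for p
  proof -
    have "Complex_vec p \<in> D'" using sub that by blast
    then have "linear (frechet_derivative \<Phi> (at (Complex_vec p)))"
      using Ck_Suc_has_derivative[OF \<Phi>_Ck] has_derivative_linear by blast
    from jac_nonzero[OF this inj[OF that]] show ?thesis by (simp add: jac_def)
  qed
  have "connected ?O" using conn by (intro connected_Times) auto
  from connected_nonzero_sign[OF this Ck_imp_continuous_on[OF d] nz]
  obtain e where e: "\<And>p. p \<in> ?O \<Longrightarrow> \<bar>?d p\<bar> = e * ?d p" by metis
  have J: "Ck 2 ?O (\<lambda>p. Jac \<Phi> (Complex_vec p))"
    by (rule Ck_cong[OF oO _ Ck_mult[OF oO Ck_const[OF oO, of 2 e] d]]) (simp add: jac_def e)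
  have aa: "Ck 2 ?O (\<lambda>p. a (\<Phi> (Complex_vec p)))"
    by (rule Ck_compose[OF oO open_\<Omega> a \<Phi>p_Ck[OF UD oU r \<Phi>\<Omega>]]) (use \<Phi>\<Omega> in auto)
  have b: "Ck 2 ?O b"
    unfolding b_def by (intro Ck_mult oO aa Ck_linear_compose[OF oO bounded_linear_of_real J])
  have Re: "Ck 2 ?O (\<lambda>p. Re (b p))" and Im: "Ck 2 ?O (\<lambda>p. Im (b p))"
    using Ck_linear_compose[OF oO bounded_linear_Re b] Ck_linear_compose[OF oO bounded_linear_Im b] by auto
  obtain C1 where C1: "C1 > 0"
    "\<And>y s. y \<in> Y \<Longrightarrow> norm s \<le> \<rho> \<Longrightarrow> \<bar>Re (b (y, s)) - Re (b (y, 0))\<bar> \<le> C1 * norm s"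
    "\<And>y s. y \<in> Y \<Longrightarrow> norm s \<le> \<rho> \<Longrightarrow> \<bar>Re (b (y, s)) + Re (b (y, - s)) - 2 * Re (b (y, 0))\<bar> \<le> C1 * (norm s)\<^sup>2"
    using amplitude_taylor[OF oU Re Y \<rho>] by metis
  obtain C2 where C2: "C2 > 0"
    "\<And>y s. y \<in> Y \<Longrightarrow> norm s \<le> \<rho> \<Longrightarrow> \<bar>Im (b (y, s)) - Im (b (y, 0))\<bar> \<le> C2 * norm s"
    "\<And>y s. y \<in> Y \<Longrightarrow> norm s \<le> \<rho> \<Longrightarrow> \<bar>Im (b (y, s)) + Im (b (y, - s)) - 2 * Im (b (y, 0))\<bar> \<le> C2 * (norm s)\<^sup>2"
    using amplitude_taylor[OF oU Im Y \<rho>] by metis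
  show ?thesis
  proof (rule that[of "C1 + C2"])
    show "C1 + C2 > 0" using C1(1) C2(1) by simp
    fix y and s :: "real^'n" assume y: "y \<in> Y" and s: "norm s \<le> \<rho>"
    have "cmod (b (y, s) - b (y, 0)) \<le> C1 * norm s + C2 * norm s"
      by (rule order_trans[OF cmod_le]) (use C1(2)[OF y s] C2(2)[OF y s] in simp)
    then show "cmod (b (y, s) - b (y, 0)) \<le> (C1 + C2) * norm s" by (simp add: distrib_right)
    have "cmod (b (y, s) + b (y, - s) - 2 * b (y, 0)) \<le> C1 * (norm s)\<^sup>2 + C2 * (norm s)\<^sup>2"
      by (rule order_trans[OF cmod_le]) (use C1(3)[OF y s] C2(3)[OF y s] in simp)
    then show "cmod (b (y, s) + b (y, - s) - 2 * b (y, 0)) \<le> (C1 + C2) * (norm s)\<^sup>2" by (simp add: distrib_right)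
  next
    show "continuous_on (Y \<times> cball 0 \<rho>) b"
      by (rule continuous_on_subset[OF Ck_imp_continuous_on[OF b]]) (use Y \<rho> in auto)
  qed
qed

text \<open>An amplitude that vanishes off W, the image of an open strip, may be integrated over the
  closed strip, so no boundary terms arise. On W the phase is at least c |s|^2, and its zeros are
  therefore points of Gamma with parameter in Y.\<close>

theorem local_asymptotics:
  assumes y0: "y0 \<in> D"
  obtains W Y where "open W" "f y0 \<in> W" "W \<subseteq> \<Omega>" "compact Y" "Y \<subseteq> D"
    "\<And>x. x \<in> W \<Longrightarrow> \<phi> x = 0 \<Longrightarrow> x \<in> f ` Y"
    "\<And>a. Ck 2 \<Omega> a \<Longrightarrow> (\<And>x. x \<notin> W \<Longrightarrow> a x = 0) \<Longrightarrow>
      \<exists>C. \<forall>k\<ge>1. cmod (of_real (sqrt (k / (2 * pi)) ^ CARD('n)) * (LINT x:W|lborel. a x * of_real (exp (- k * \<phi> x)))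
        - (LINT y:Y|lborel. a (f y) * of_real (jac (complexify (df y)) * jac (Q y) / sqrt 2 ^ CARD('n)))) \<le> C / k"
proof -
  obtain U' r where U': "open U'" "U' \<subseteq> D'" "inj_on \<Phi> U'" "\<And>z. z \<in> U' \<Longrightarrow> \<Phi> z \<in> \<Omega>"
    "\<And>z. z \<in> U' \<Longrightarrow> inj (frechet_derivative \<Phi> (at z))" and r: "0 < r"
    and rU': "\<And>p. p \<in> ball y0 r \<times> ball 0 r \<Longrightarrow> Complex_vec p \<in> U'"
    using local_chart[OF y0] by metis
  let ?U = "ball y0 r" and ?Y = "cball y0 (r / 2)"
  have UD: "?U \<subseteq> D"
  proof
    fix y assume "y \<in> ?U"
    then have "Complex_vec (y, 0) \<in> D'" using rU'[of "(y, 0)"] U'(2) r by auto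
    then show "y \<in> D" by simp
  qed
  have Y: "compact ?Y" "?Y \<subseteq> ?U" "?Y \<noteq> {}" using r by auto
  have YD: "?Y \<subseteq> D" using Y(2) UD by blast
  have \<Phi>\<Omega>: "\<Phi> (Complex_vec p) \<in> \<Omega>" if "p \<in> ?U \<times> ball 0 r" for p using rU'[OF that] U'(4) by blast
  have injD: "inj (frechet_derivative \<Phi> (at (Complex_vec p)))" if "p \<in> ?U \<times> ball 0 r" for p
    using rU'[OF that] U'(5) by blast
  obtain \<rho> c C where \<rho>: "0 < \<rho>" "\<rho> < r" "0 < c" "0 < C"
    and hl: "\<And>y s. y \<in> ?Y \<Longrightarrow> c * (norm s)\<^sup>2 \<le> h y s"
    and pl: "\<And>y s. y \<in> ?Y \<Longrightarrow> norm s \<le> \<rho> \<Longrightarrow> c * (norm s)\<^sup>2 \<le> \<phi> (\<Phi> (Complex_vec (y, s)))"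
    and p3: "\<And>y s. y \<in> ?Y \<Longrightarrow> norm s \<le> \<rho> \<Longrightarrow> \<bar>\<phi> (\<Phi> (Complex_vec (y, s))) - h y s\<bar> \<le> C * (norm s) ^ 3"
    and p4: "\<And>y s. y \<in> ?Y \<Longrightarrow> norm s \<le> \<rho> \<Longrightarrow>
      \<bar>\<phi> (\<Phi> (Complex_vec (y, s))) + \<phi> (\<Phi> (Complex_vec (y, - s))) - 2 * h y s\<bar> \<le> C * (norm s) ^ 4"
    using phase_quadratic[OF UD open_ball r \<Phi>\<Omega> Y] by metis
  let ?Z = "?Y \<times> cball (0 :: real^'n) \<rho>"
  have ZU: "Complex_vec p \<in> U'" if "p \<in> ?Z" for p
    using that r \<rho> by (intro rU') auto
  define S where "S = {z. Re_vec z \<in> ball y0 (r / 2) \<and> Im_vec z \<in> ball 0 \<rho>}"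
  have cR: "continuous_on UNIV Re_vec" "continuous_on UNIV Im_vec"
    using linear_Re_vec linear_Im_vec by (auto intro!: linear_continuous_on simp: linear_conv_bounded_linear[symmetric])
  have oS: "open S"
  proof -
    have "S = Re_vec -` ball y0 (r / 2) \<inter> Im_vec -` ball 0 \<rho>" by (auto simp: S_def)
    then show ?thesis using cR by (auto intro!: open_Int open_vimage)
  qed
  have SU: "S \<subseteq> U'"
  proof
    fix z assume "z \<in> S"
    then show "z \<in> U'" using ZU[of "(Re_vec z, Im_vec z)"] by (auto simp: S_def)
  qed
  define W where "W = \<Phi> ` S"
  have cont\<Phi>: "continuous_on U' \<Phi>" by (rule continuous_on_subset[OF Ck_imp_continuous_on[OF \<Phi>_Ck] U'(2)])
  have oW: "open W"
    unfolding W_def using oS continuous_on_subset[OF cont\<Phi> SU] inj_on_subset[OF U'(3) SU] by (intro invariance_of_domain)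
  have W\<Omega>: "W \<subseteq> \<Omega>" using SU U'(4) by (auto simp: W_def)
  \<comment> \<open>By injectivity of \<open>\<Phi>\<close>, points of the closed strip outside the
    open one are not mapped into W, so the amplitude vanishes at their images.\<close>
  have inW: "Complex_vec p \<in> S" if pZ: "p \<in> ?Z" and pW: "\<Phi> (Complex_vec p) \<in> W" for p
  proof -
    obtain z where z: "z \<in> S" "\<Phi> (Complex_vec p) = \<Phi> z" using pW by (auto simp: W_def)
    then have "z \<in> U'" using SU by blast
    from inj_onD[OF U'(3) z(2) ZU[OF pZ] this] show ?thesis using z(1) by simp
  qed
  have ZS: "p \<in> ?Z" if "Complex_vec p \<in> S" for p using that by (cases p) (auto simp: S_def)
  show ?thesis
  proof (rule that[of W ?Y, OF oW _ W\<Omega> Y(1) YD])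
    have "Complex_vec (y0, 0) \<in> S" using r \<rho> by (simp add: S_def)
    moreover have "\<Phi> (Complex_vec (y0, 0)) = f y0" using \<Phi>_ray[OF y0, of 0 0] by simp
    ultimately show "f y0 \<in> W" unfolding W_def by (metis imageI)
  next
    fix x assume x: "x \<in> W" "\<phi> x = 0"
    then obtain z where z: "z \<in> S" "x = \<Phi> z" by (auto simp: W_def)
    let ?y = "Re_vec z" and ?s = "Im_vec z"
    have ys: "?y \<in> ?Y" "norm ?s \<le> \<rho>" using z(1) by (auto simp: S_def)
    have "c * (norm ?s)\<^sup>2 \<le> 0" using pl[OF ys] x(2) z(2) by simp
    then have s0: "?s = 0" using \<rho>(3) by (simp add: mult_le_0_iff)
    have "Re_vec z \<in> D" using ys(1) YD by auto
    from \<Phi>_eq[OF this] have "x = f ?y"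
      using s0 z(2) linear_0[OF linear_df[OF \<open>Re_vec z \<in> D\<close>]] by simp
    then show "x \<in> f ` ?Y" using ys(1) by blast
  next
    fix a assume a: "Ck 2 \<Omega> a" and a0: "\<And>x. x \<notin> W \<Longrightarrow> a x = (0::complex)"
    let ?b = "\<lambda>p. a (\<Phi> (Complex_vec p)) * complex_of_real (Jac \<Phi> (Complex_vec p))"
    let ?P = "\<lambda>p. \<phi> (\<Phi> (Complex_vec p))"
    obtain C' where C': "C' > 0" "\<And>y s. y \<in> ?Y \<Longrightarrow> norm s \<le> \<rho> \<Longrightarrow> cmod (?b (y, s) - ?b (y, 0)) \<le> C' * norm s"
      "\<And>y s. y \<in> ?Y \<Longrightarrow> norm s \<le> \<rho> \<Longrightarrow> cmod (?b (y, s) + ?b (y, - s) - 2 * ?b (y, 0)) \<le> C' * (norm s)\<^sup>2"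
      "continuous_on ?Z ?b"
    proof (rule amplitude_expansion[OF UD open_ball r connected_ball \<Phi>\<Omega> injD Y(1,2) \<rho>(1,2) a], goal_cases)
      case (3 C')
      show thesis using 3(2-5) by (rule 3(1))
    qed
    have le: "u \<le> (C + C') * t" if "u \<le> C * t \<or> u \<le> C' * t" "0 \<le> t" for u t
    proof -
      have "C * t \<le> (C + C') * t" "C' * t \<le> (C + C') * t"
        using that(2) \<rho>(4) C'(1) by (auto intro!: mult_right_mono)
      then show ?thesis using that(1) by linarith
    qed
    obtain E where E: "\<And>k. 1 \<le> k \<Longrightarrow> cmod (of_real (sqrt (k / pi) ^ DIM(real^'n)) *
        (LINT p:?Z|lborel. ?b p * of_real (exp (- k * ?P p))) - (LINT y:?Y|lborel. ?b (y, 0) * of_real (jac (Q y)))) \<le> E / k"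
    proof (rule laplace_method[of ?Y \<rho> c "C + C'" ?b ?P h Q])
      show "continuous_on ?Z ?P"
        by (rule continuous_on_subset[OF Ck_imp_continuous_on[OF phase_Ck[OF UD open_ball r \<Phi>\<Omega>]]]) (use Y \<rho> in auto)
      show "continuous_on (?Y \<times> UNIV) (\<lambda>p. h (fst p) (snd p))"
        by (rule continuous_on_subset[OF h_cont]) (use YD in auto)
      show "linear (Q y)" "inj (Q y)" "h y (Q y x) = x \<bullet> x" if "y \<in> ?Y" for y x
        using that YD Q h_Q by blast+
    qed (use Y \<rho> C' hl pl p3 p4 le in auto)
    \<comment> \<open>Change of variables through \<open>\<Phi>\<close>, after which Lebesgue
      measure on complex space is split into the variables y and s.\<close>
    have I: "(LINT x:W|lborel. a x * of_real (exp (- k * \<phi> x))) = (LINT p:?Z|lborel. ?b p * of_real (exp (- k * ?P p)))" for k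
    proof -
      let ?F = "\<lambda>x. a x * of_real (exp (- k * \<phi> x))"
      have ca: "continuous_on \<Omega> ?F"
        by (intro continuous_intros Ck_imp_continuous_on[OF a] Ck_imp_continuous_on[OF \<phi>_Ck])
      have meas: "set_borel_measurable borel (\<Phi> ` S) ?F"
        unfolding set_borel_measurable_def
        using oW W\<Omega> ca by (intro borel_measurable_continuous_on_indicator) (auto simp: W_def intro: continuous_on_subset)
      have "(LINT x:W|lborel. ?F x) = (LINT z:S|lborel. Jac \<Phi> z *\<^sub>R ?F (\<Phi> z))"
        unfolding W_def
        by (rule change_of_variables(2)[OF U'(1) Ck_subset[OF \<Phi>_Ck U'(2)] U'(3) _ SU meas]) (use oS in auto)
      also have "\<dots> = integral\<^sup>L lborel (\<lambda>p. indicator S (Complex_vec p) *\<^sub>R (Jac \<Phi> (Complex_vec p) *\<^sub>R ?F (\<Phi> (Complex_vec p))))"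
        unfolding set_lebesgue_integral_def
      proof (rule integral_Complex_vec, rule borel_measurable_continuous_on_indicator)
        have "continuous_on S (Jac \<Phi>)"
          by (rule continuous_on_Jac[OF oS, of 0]) (rule Ck_subset[OF \<Phi>_Ck], use SU U'(2) in auto)
        moreover have "continuous_on S (\<lambda>z. ?F (\<Phi> z))"
          by (rule continuous_on_compose2[OF ca continuous_on_subset[OF cont\<Phi> SU]]) (use SU U'(4) in auto)
        ultimately show "continuous_on S (\<lambda>z. Jac \<Phi> z *\<^sub>R ?F (\<Phi> z))" by (intro continuous_on_scaleR)
      qed (use oS in auto)
      also have "\<dots> = (LINT p:?Z|lborel. ?b p * of_real (exp (- k * ?P p)))"
        unfolding set_lebesgue_integral_def
      proof (rule Bochner_Integration.integral_cong[OF refl])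
        fix p :: "(real^'n) \<times> (real^'n)"
        show "indicator S (Complex_vec p) *\<^sub>R (Jac \<Phi> (Complex_vec p) *\<^sub>R ?F (\<Phi> (Complex_vec p))) =
          indicator ?Z p *\<^sub>R (?b p * of_real (exp (- k * ?P p)))"
        proof (cases "Complex_vec p \<in> S")
          case True
          then show ?thesis using ZS[OF True] by (simp add: scaleR_conv_of_real mult_ac)
        next
          case False
          then have "p \<in> ?Z \<Longrightarrow> a (\<Phi> (Complex_vec p)) = 0" using inW a0 by blast
          then show ?thesis using False by (auto simp: indicator_def)
        qed
      qed
      finally show ?thesis .
    qed
    have bY: "?b (y, 0) = a (f y) * of_real (jac (complexify (df y)))" if "y \<in> ?Y" for y
    proof -
      have yD: "y \<in> D" using that YD by blast
      have "\<Phi> (Complex_vec (y, 0)) = f y" using \<Phi>_ray[OF yD, of 0 0] by simp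
      then show ?thesis by (simp add: frechet_\<Phi>_real[OF yD])
    qed
    let ?s = "complex_of_real (1 / sqrt 2 ^ CARD('n))"
    have J: "(LINT y:?Y|lborel. a (f y) * of_real (jac (complexify (df y)) * jac (Q y) / sqrt 2 ^ CARD('n)))
      = ?s * (LINT y:?Y|lborel. ?b (y, 0) * of_real (jac (Q y)))"
      unfolding set_lebesgue_integral_def integral_mult_right_zero[symmetric]
    proof (rule Bochner_Integration.integral_cong[OF refl])
      fix y
      show "indicator ?Y y *\<^sub>R (a (f y) * of_real (jac (complexify (df y)) * jac (Q y) / sqrt 2 ^ CARD('n))) =
        ?s * (indicator ?Y y *\<^sub>R (?b (y, 0) * of_real (jac (Q y))))"
        using bY[of y] by (cases "y \<in> ?Y") (simp_all add: field_simps)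
    qed
    \<comment> \<open>The Gaussian integral is normalized by k/pi and the section by k/(2 pi); this
      is the origin of the factor 2^(-n/2) in the density.\<close>
    have "sqrt (k / (2 * pi)) ^ CARD('n) = 1 / sqrt 2 ^ CARD('n) * sqrt (k / pi) ^ CARD('n)" for k
      by (simp add: real_sqrt_divide real_sqrt_mult power_divide power_mult_distrib)
    then have K: "complex_of_real (sqrt (k / (2 * pi)) ^ CARD('n)) = ?s * of_real (sqrt (k / pi) ^ CARD('n))" for k
      by (metis of_real_mult)
    have "cmod (of_real (sqrt (k / (2 * pi)) ^ CARD('n)) * (LINT x:W|lborel. a x * of_real (exp (- k * \<phi> x)))
        - (LINT y:?Y|lborel. a (f y) * of_real (jac (complexify (df y)) * jac (Q y) / sqrt 2 ^ CARD('n))))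
        \<le> (E / sqrt 2 ^ CARD('n)) / k" if k: "1 \<le> k" for k
    proof -
      have "cmod (of_real (sqrt (k / (2 * pi)) ^ CARD('n)) * (LINT x:W|lborel. a x * of_real (exp (- k * \<phi> x)))
        - (LINT y:?Y|lborel. a (f y) * of_real (jac (complexify (df y)) * jac (Q y) / sqrt 2 ^ CARD('n))))
        = cmod (?s * (of_real (sqrt (k / pi) ^ CARD('n)) * (LINT p:?Z|lborel. ?b p * of_real (exp (- k * ?P p)))
          - (LINT y:?Y|lborel. ?b (y, 0) * of_real (jac (Q y)))))"
        unfolding I J K by (simp only: right_diff_distrib mult.assoc)
      also have "\<dots> = 1 / sqrt 2 ^ CARD('n) * cmod (of_real (sqrt (k / pi) ^ CARD('n)) * (LINT p:?Z|lborel. ?b p * of_real (exp (- k * ?P p)))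
          - (LINT y:?Y|lborel. ?b (y, 0) * of_real (jac (Q y))))"
        unfolding norm_mult norm_of_real by simp
      also have "\<dots> \<le> 1 / sqrt 2 ^ CARD('n) * (E / k)"
        using E[OF k] by (intro mult_left_mono) auto
      finally show ?thesis by simp
    qed
    then show "\<exists>C. \<forall>k\<ge>1. cmod (of_real (sqrt (k / (2 * pi)) ^ CARD('n)) * (LINT x:W|lborel. a x * of_real (exp (- k * \<phi> x)))
        - (LINT y:?Y|lborel. a (f y) * of_real (jac (complexify (df y)) * jac (Q y) / sqrt 2 ^ CARD('n)))) \<le> C / k"
      by blast
  qed
qed

end

section \<open>Charts\<close>

lemma Ck_diff: "open S \<Longrightarrow> Ck n S f \<Longrightarrow> Ck n S g \<Longrightarrow> Ck n S (\<lambda>x. f x - g x)"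
  using Ck_add[of S n f "\<lambda>x. - g x"]
    Ck_linear_compose[of S "\<lambda>x. - x" n g, OF _ bounded_linear_minus[OF bounded_linear_ident]] by simp

lemma is_chartD:
  assumes "is_chart c"
  shows "open (fst c)" "open (snd c ` fst c)" "continuous_on (fst c) (snd c)"
    "continuous_on (snd c ` fst c) (chart_inv c)" "p \<in> fst c \<Longrightarrow> chart_inv c (snd c p) = p"
    "inj_on (snd c) (fst c)"
  using assms by (auto simp: is_chart_def homeomorphism_def intro: inj_on_inverseI[of _ "chart_inv c"])

lemma open_chart_image:
  assumes "is_chart c" "open S"
  shows "open (snd c ` (fst c \<inter> S))"
proof -
  have "snd c ` (fst c \<inter> S) = (snd c ` fst c) \<inter> chart_inv c -` S"
    using is_chartD(5)[OF assms(1)] by force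
  then show ?thesis
    using continuous_open_preimage[OF is_chartD(4,2)[OF assms(1)] assms(2)] by simp
qed

lemma open_chart_preimage:
  assumes "is_chart c" "open T"
  shows "open (fst c \<inter> snd c -` T)"
  using continuous_open_preimage[OF is_chartD(3,1)[OF assms(1)] assms(2)] .

lemma smooth_atlas_chart: "smooth_atlas A \<Longrightarrow> c \<in> A \<Longrightarrow> is_chart c"
  by (simp add: smooth_atlas_def)

lemma smooth_atlas_cover: "smooth_atlas A \<Longrightarrow> \<exists>c\<in>A. p \<in> fst c"
  unfolding smooth_atlas_def by blast

lemma transition_Ck:
  "smooth_atlas A \<Longrightarrow> c \<in> A \<Longrightarrow> d \<in> A \<Longrightarrow> Ck n (snd c ` (fst c \<inter> fst d)) (snd d \<circ> chart_inv c)"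
  by (auto simp: smooth_atlas_def intro: smooth_on_imp_Ck)

lemma tangent_map_id: "tangent_map c d id p = frechet_derivative (snd d \<circ> chart_inv c) (at (snd c p))"
  by (simp add: tangent_map_def)

lemma finite_chart_cover:
  assumes "smooth_atlas A" "compact (UNIV :: 'm::topological_space set)"
  shows "\<exists>cs :: ('m, 'e::euclidean_space) chart list. set cs \<subseteq> A \<and> (\<Union>c\<in>set cs. fst c) = UNIV"
proof -
  have "UNIV \<subseteq> (\<Union>c\<in>A. fst c)" using assms(1) by (simp add: smooth_atlas_def)
  moreover have "open (fst c)" if "c \<in> A" for c using is_chartD(1) smooth_atlas_chart[OF assms(1) that] by blast
  ultimately obtain C where "C \<subseteq> A" "finite C" "UNIV \<subseteq> (\<Union>c\<in>C. fst c)"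
    using compactE_image[OF assms(2), of A fst] by metis
  moreover obtain cs where "set cs = C" using finite_list[OF \<open>finite C\<close>] by blast
  ultimately show ?thesis by (intro exI[of _ cs]) auto
qed

section \<open>Integration of densities\<close>

text \<open>\<open>density_integral\<close> picks its cover by choice, and its pieces are images of
  a chart domain minus an open set. Integrability on all sets of this form covers every possible
  choice, which is what additivity requires.\<close>

definition piecewise_integrable ::
  "('m::topological_space, 'e::euclidean_space) chart set \<Rightarrow> (('m, 'e) chart \<Rightarrow> 'm \<Rightarrow> complex) \<Rightarrow> bool" where
  "piecewise_integrable A \<sigma> \<longleftrightarrow> (\<forall>d\<in>A. \<forall>H. open H \<longrightarrow>
     set_integrable lborel (snd d ` (fst d - H)) (\<lambda>y. \<sigma> d (chart_inv d y)))"

text \<open>A density carried by a single chart; its integral can be computed in that chart,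
  whatever cover is chosen.\<close>

locale chart_density =
  fixes A :: "('m::topological_space, 'e::euclidean_space) chart set" and c and \<sigma>
  assumes atlas: "smooth_atlas A" and c: "c \<in> A"
    and zero: "\<And>d p. d \<in> A \<Longrightarrow> p \<in> fst d \<Longrightarrow> p \<notin> fst c \<Longrightarrow> \<sigma> d p = (0::complex)"
    and transform: "\<And>d p. d \<in> A \<Longrightarrow> p \<in> fst c \<Longrightarrow> p \<in> fst d \<Longrightarrow>
      \<sigma> d p = of_real (jac (tangent_map d c id p)) * \<sigma> c p"
    and integrable: "set_integrable lborel (snd c ` fst c) (\<lambda>y. \<sigma> c (chart_inv c y))"
begin

lemma chart_c: "is_chart c"
  by (rule smooth_atlas_chart[OF atlas c])

lemma borel_piece:
  assumes "is_chart d" "open G" "open H"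
  shows "snd d ` (fst d \<inter> G - H) \<in> sets borel"
proof -
  have "snd d ` (fst d \<inter> G - H) = snd d ` (fst d \<inter> G) - snd d ` (fst d \<inter> H)"
    using is_chartD(6)[OF assms(1)] by (auto simp: inj_on_def)
  then show ?thesis using open_chart_image[OF assms(1,2)] open_chart_image[OF assms(1,3)] by auto
qed

text \<open>The part of a piece outside c contributes 0; on the overlap the transformation rule for
  densities is the change of variables formula.\<close>

lemma piece:
  assumes d: "d \<in> A" and H: "open H"
  shows "set_integrable lborel (snd d ` (fst d - H)) (\<lambda>y. \<sigma> d (chart_inv d y))"
    and "(LINT y:snd d ` (fst d - H)|lborel. \<sigma> d (chart_inv d y)) =
      (LINT y:snd c ` (fst c \<inter> fst d - H)|lborel. \<sigma> c (chart_inv c y))"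
proof -
  note cd = smooth_atlas_chart[OF atlas d] and cc = chart_c
  let ?S = "snd d ` (fst d \<inter> fst c - H)" and ?g = "snd c \<circ> chart_inv d"
  let ?U = "snd d ` (fst d \<inter> fst c)"
  have inv_d: "chart_inv d (snd d p) = p" if "p \<in> fst d" for p using is_chartD(5)[OF cd that] .
  have inv_c: "chart_inv c (snd c p) = p" if "p \<in> fst c" for p using is_chartD(5)[OF cc that] .
  have oU: "open ?U" by (rule open_chart_image[OF cd is_chartD(1)[OF cc]])
  have g: "Ck 1 ?U ?g" by (rule transition_Ck[OF atlas d c])
  have inj: "inj_on ?g ?U"
    using is_chartD(6)[OF cc] by (auto simp: inj_on_def inv_d)
  have S: "?S \<in> sets borel" "?S \<subseteq> ?U"
    using borel_piece[OF cd is_chartD(1)[OF cc] H] by auto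
  have gS: "?g ` ?S = snd c ` (fst c \<inter> fst d - H)"
    by (force simp: inv_d image_iff)
  have Sc: "snd c ` (fst c \<inter> fst d - H) \<in> sets borel" by (rule borel_piece[OF cc is_chartD(1)[OF cd] H])
  have intc: "set_integrable lborel (?g ` ?S) (\<lambda>y. \<sigma> c (chart_inv c y))"
    unfolding gS by (rule set_integrable_subset[OF integrable]) (use Sc in auto)
  then have meas: "set_borel_measurable borel (?g ` ?S) (\<lambda>y. \<sigma> c (chart_inv c y))"
    by (auto simp: set_integrable_def set_borel_measurable_def dest: borel_measurable_integrable)
  note cov = change_of_variables[OF oU g inj S meas]
  have eq: "Jac ?g y *\<^sub>R \<sigma> c (chart_inv c (?g y)) = \<sigma> d (chart_inv d y)" if "y \<in> ?S" for y
    using that transform[OF d] by (auto simp: inv_d inv_c tangent_map_id scaleR_conv_of_real)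
  have zero': "indicator ?S y *\<^sub>R \<sigma> d (chart_inv d y) = indicator (snd d ` (fst d - H)) y *\<^sub>R \<sigma> d (chart_inv d y)" for y
  proof (cases "y \<in> snd d ` (fst d - H)")
    case True
    then obtain p where p: "p \<in> fst d" "p \<notin> H" "y = snd d p" by auto
    show ?thesis
    proof (cases "p \<in> fst c")
      case pc: True
      then have "y \<in> ?S" using p by blast
      with True show ?thesis by simp
    next
      case False
      then have "\<sigma> d (chart_inv d y) = 0" using zero[OF d p(1)] inv_d[OF p(1)] p(3) by simp
      then show ?thesis by simp
    qed
  next
    case False
    then have "y \<notin> ?S" by auto
    with False show ?thesis by simp
  qed
  have ind: "indicator ?S y *\<^sub>R (Jac ?g y *\<^sub>R \<sigma> c (chart_inv c (?g y))) =
      indicator (snd d ` (fst d - H)) y *\<^sub>R \<sigma> d (chart_inv d y)" for y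
    using eq[of y] zero'[of y] by (cases "y \<in> ?S") auto
  show "set_integrable lborel (snd d ` (fst d - H)) (\<lambda>y. \<sigma> d (chart_inv d y))"
    using cov(1) intc by (simp only: set_integrable_def ind)
  show "(LINT y:snd d ` (fst d - H)|lborel. \<sigma> d (chart_inv d y)) =
      (LINT y:snd c ` (fst c \<inter> fst d - H)|lborel. \<sigma> c (chart_inv c y))"
    using cov(2) unfolding gS by (simp only: set_lebesgue_integral_def ind)
qed

lemma piecewise_integrable: "piecewise_integrable A \<sigma>"
  using piece(1) by (simp add: piecewise_integrable_def)

text \<open>Transported to c, the pieces are disjoint and exhaust the domain of c.\<close>

lemma density_integral_eq:
  assumes "compact (UNIV :: 'm set)"
  shows "density_integral A \<sigma> = (LINT y:snd c ` fst c|lborel. \<sigma> c (chart_inv c y))"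
proof -
  define cs where "cs = (SOME cs. set cs \<subseteq> A \<and> (\<Union>c\<in>set cs. fst c) = UNIV)"
  have cs: "set cs \<subseteq> A" "(\<Union>c\<in>set cs. fst c) = UNIV"
    using someI_ex[OF finite_chart_cover[OF atlas assms]] by (auto simp: cs_def)
  define H where "H r = (\<Union>q<r. fst (cs ! q))" for r
  have A: "cs ! r \<in> A" if "r < length cs" for r using cs(1) that by auto
  have H: "open (H r)" if "r \<le> length cs" for r
    using that is_chartD(1)[OF smooth_atlas_chart[OF atlas A]] by (auto simp: H_def)
  let ?P = "\<lambda>r. snd c ` (fst c \<inter> fst (cs ! r) - H r)"
  have cover: "(\<Union>r<length cs. ?P r) = snd c ` fst c"
  proof -
    have "\<exists>r<length cs. p \<in> fst (cs ! r) - H r" for p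
    proof -
      have ex: "\<exists>r. r < length cs \<and> p \<in> fst (cs ! r)" using cs(2) by (metis UNIV_I UN_E in_set_conv_nth)
      \<comment> \<open>Each point belongs to the piece of the first chart in the list that contains
        it.\<close>
      define r where "r = (LEAST r. r < length cs \<and> p \<in> fst (cs ! r))"
      have r: "r < length cs \<and> p \<in> fst (cs ! r)" unfolding r_def by (rule LeastI_ex[OF ex])
      moreover have "p \<notin> fst (cs ! q)" if "q < r" for q
        using not_less_Least[OF that[unfolded r_def]] that r by auto
      ultimately show ?thesis by (auto simp: H_def)
    qed
    then show ?thesis by blast
  qed
  have disj: "disjoint_family_on ?P {..<length cs}"
    unfolding disjoint_family_on_def
  proof (intro ballI impI)
    fix r s assume rs: "r \<in> {..<length cs}" "s \<in> {..<length cs}" "r \<noteq> s"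
    have "(fst (cs ! r) - H r) \<inter> (fst (cs ! s) - H s) = {}"
      using rs by (cases "r < s") (auto simp: H_def linorder_neq_iff)
    then have "(fst c \<inter> fst (cs ! r) - H r) \<inter> (fst c \<inter> fst (cs ! s) - H s) = {}" by blast
    moreover have "?P r \<inter> ?P s = snd c ` ((fst c \<inter> fst (cs ! r) - H r) \<inter> (fst c \<inter> fst (cs ! s) - H s))"
      by (rule inj_on_image_Int[OF is_chartD(6)[OF chart_c], symmetric]) auto
    ultimately show "?P r \<inter> ?P s = {}" by simp
  qed
  have "density_integral A \<sigma> = (\<Sum>r<length cs. LINT y:snd (cs ! r) ` (fst (cs ! r) - H r)|lborel. \<sigma> (cs ! r) (chart_inv (cs ! r) y))"
    by (simp add: density_integral_def cs_def[symmetric] H_def)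
  also have "\<dots> = (\<Sum>r<length cs. LINT y:?P r|lborel. \<sigma> c (chart_inv c y))"
    by (intro sum.cong refl piece(2) A H) auto
  also have "\<dots> = (LINT y:(\<Union>r<length cs. ?P r)|lborel. \<sigma> c (chart_inv c y))"
  proof (rule set_integral_finite_Union[symmetric])
    fix r assume r: "r \<in> {..<length cs}"
    show s: "?P r \<in> sets lborel"
      using r borel_piece[OF chart_c is_chartD(1)[OF smooth_atlas_chart[OF atlas A]] H] by auto
    show "set_integrable lborel (?P r) (\<lambda>y. \<sigma> c (chart_inv c y))"
      by (rule set_integrable_subset[OF integrable s]) auto
  qed (use disj in auto)
  finally show ?thesis unfolding cover .
qed

end

lemma density_integral_add:
  assumes "smooth_atlas A" "compact (UNIV :: 'm::topological_space set)"
    "piecewise_integrable A \<sigma>" "piecewise_integrable A (\<tau> :: ('m, 'e::euclidean_space) chart \<Rightarrow> 'm \<Rightarrow> complex)"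
  shows "density_integral A (\<lambda>c p. \<sigma> c p + \<tau> c p) = density_integral A \<sigma> + density_integral A \<tau>"
    and "piecewise_integrable A (\<lambda>c p. \<sigma> c p + \<tau> c p)"
proof -
  define cs where "cs = (SOME cs. set cs \<subseteq> A \<and> (\<Union>c\<in>set cs. fst c) = UNIV)"
  have cs: "set cs \<subseteq> A"
    using someI_ex[OF finite_chart_cover[OF assms(1,2)]] by (auto simp: cs_def)
  have csA: "cs ! r \<in> A" if "r < length cs" for r using that cs by auto
  have op: "open (\<Union>q<r. fst (cs ! q))" if "r < length cs" for r
    using that is_chartD(1)[OF smooth_atlas_chart[OF assms(1) csA]] by (intro open_UN) auto
  have "set_integrable lborel (snd (cs ! r) ` (fst (cs ! r) - (\<Union>q<r. fst (cs ! q)))) (\<lambda>y. \<sigma> (cs ! r) (chart_inv (cs ! r) y))"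
    "set_integrable lborel (snd (cs ! r) ` (fst (cs ! r) - (\<Union>q<r. fst (cs ! q)))) (\<lambda>y. \<tau> (cs ! r) (chart_inv (cs ! r) y))"
    if "r < length cs" for r
    using assms(3,4) csA[OF that] op[OF that] unfolding piecewise_integrable_def by blast+
  then show "density_integral A (\<lambda>c p. \<sigma> c p + \<tau> c p) = density_integral A \<sigma> + density_integral A \<tau>"
    unfolding density_integral_def Let_def cs_def[symmetric] sum.distrib[symmetric]
    by (intro sum.cong refl set_integral_add(2)) auto
  show "piecewise_integrable A (\<lambda>c p. \<sigma> c p + \<tau> c p)"
    using assms(3,4) by (auto simp: piecewise_integrable_def)
qed

section \<open>Localization by cutoff functions\<close>

text \<open>The class in which the localization argument runs: it contains the test functions and
  their products with the bumps.\<close>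

definition C2_function :: "('m::topological_space, 'e::euclidean_space) chart set \<Rightarrow> ('m \<Rightarrow> complex) \<Rightarrow> bool" where
  "C2_function A u \<longleftrightarrow> (\<forall>c\<in>A. Ck 2 (snd c ` fst c) (\<lambda>x. u (chart_inv c x)))"

lemma C2_functionI_smooth: "smooth_function A u \<Longrightarrow> C2_function A u"
  by (auto simp: C2_function_def smooth_function_def comp_def intro: smooth_on_imp_Ck)

lemma C2_function_mult: "smooth_atlas A \<Longrightarrow> C2_function A u \<Longrightarrow> C2_function A v \<Longrightarrow> C2_function A (\<lambda>x. u x * v x)"
  by (auto simp: C2_function_def intro!: Ck_mult is_chartD(2) smooth_atlas_chart)

lemma C2_function_one_minus: "smooth_atlas A \<Longrightarrow> C2_function A u \<Longrightarrow> C2_function A (\<lambda>x. 1 - u x)"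
  unfolding C2_function_def by (intro ballI Ck_diff Ck_const is_chartD(2)) (auto intro: smooth_atlas_chart)

text \<open>Cubes of positive parts make this C^2. With r = |x - x0| the inner positive part is 0
  for r \<le> R/2, and the outer one is 0 as soon as 2 r^2 \<ge> R^2, in particular for r \<ge>
  R.\<close>

definition euclidean_bump :: "real \<Rightarrow> 'e::euclidean_space \<Rightarrow> 'e \<Rightarrow> real" where
  "euclidean_bump R x0 x = (max 0 (1 - (max 0 (4 / R\<^sup>2 * ((x - x0) \<bullet> (x - x0)) - 1)) ^ 3)) ^ 3"

lemma euclidean_bump_Ck: "Ck 2 UNIV (euclidean_bump R (x0 :: 'e::euclidean_space))"
proof -
  have d: "Ck 2 UNIV (\<lambda>x. x - x0)"
    by (intro Ck_diff Ck_const Ck_bounded_linear) auto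
  have "Ck 2 UNIV (\<lambda>x. 4 / R\<^sup>2 * ((x - x0) \<bullet> (x - x0)) - 1)"
    by (intro Ck_diff Ck_mult Ck_inner Ck_const d) auto
  from Ck_compose[OF open_UNIV open_UNIV Ck_pos_part_cube this]
  have "Ck 2 UNIV (\<lambda>x. 1 - (max 0 (4 / R\<^sup>2 * ((x - x0) \<bullet> (x - x0)) - 1)) ^ 3)"
    by (intro Ck_diff Ck_const) auto
  from Ck_compose[OF open_UNIV open_UNIV Ck_pos_part_cube this] show ?thesis
    by (simp add: euclidean_bump_def[abs_def])
qed

lemma euclidean_bump_eq:
  assumes "0 < R"
  shows "norm (x - x0) \<le> R / 2 \<Longrightarrow> euclidean_bump R x0 x = 1" "R \<le> norm (x - x0) \<Longrightarrow> euclidean_bump R x0 x = 0"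
proof -
  have n: "(x - x0) \<bullet> (x - x0) = (norm (x - x0))\<^sup>2" by (simp add: power2_norm_eq_inner)
  show "euclidean_bump R x0 x = 1" if "norm (x - x0) \<le> R / 2"
  proof -
    have "(norm (x - x0))\<^sup>2 \<le> (R / 2)\<^sup>2" using that by (intro power_mono) auto
    then have "4 / R\<^sup>2 * (norm (x - x0))\<^sup>2 \<le> 1" using assms by (simp add: field_simps)
    then have "max 0 (4 / R\<^sup>2 * (norm (x - x0))\<^sup>2 - 1) = 0" by simp
    then show ?thesis unfolding euclidean_bump_def n by simp
  qed
  show "euclidean_bump R x0 x = 0" if "R \<le> norm (x - x0)"
  proof -
    have "R\<^sup>2 \<le> (norm (x - x0))\<^sup>2" using that assms by (intro power_mono) auto
    then have "4 \<le> 4 / R\<^sup>2 * (norm (x - x0))\<^sup>2" using assms by (simp add: field_simps)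
    then have "1 \<le> (max 0 (4 / R\<^sup>2 * (norm (x - x0))\<^sup>2 - 1)) ^ 3"
      by (intro one_le_power) simp
    then have "max 0 (1 - (max 0 (4 / R\<^sup>2 * (norm (x - x0))\<^sup>2 - 1)) ^ 3) = 0" by simp
    then show ?thesis unfolding euclidean_bump_def n by simp
  qed
qed

lemma bump_exists:
  fixes A :: "('m::t2_space, 'e::euclidean_space) chart set"
  assumes A: "smooth_atlas A" and W: "open W" "p \<in> W"
  obtains b N K where "C2_function A b" "open N" "p \<in> N" "\<And>q. q \<in> N \<Longrightarrow> b q = 1"
    "compact K" "K \<subseteq> W" "\<And>q. q \<notin> K \<Longrightarrow> b q = 0"
proof -
  obtain c where c: "c \<in> A" "p \<in> fst c" using smooth_atlas_cover[OF A] by blast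
  note cc = smooth_atlas_chart[OF A c(1)]
  let ?x = "snd c p"
  have "open (snd c ` (fst c \<inter> W))" "?x \<in> snd c ` (fst c \<inter> W)"
    using open_chart_image[OF cc W(1)] c W by auto
  then obtain R where R: "0 < R" "cball ?x R \<subseteq> snd c ` (fst c \<inter> W)"
    using open_contains_cball by meson
  define b where "b q = (if q \<in> fst c then complex_of_real (euclidean_bump R ?x (snd c q)) else 0)" for q
  define K where "K = chart_inv c ` cball ?x R"
  define N where "N = fst c \<inter> snd c -` ball ?x (R / 2)"
  have Kc: "q \<in> K \<longleftrightarrow> q \<in> fst c \<and> snd c q \<in> cball ?x R" for q
    using R(2) is_chartD(5)[OF cc] by (force simp: K_def image_iff subset_iff)
  have KW: "K \<subseteq> W" using R(2) is_chartD(5)[OF cc] by (force simp: K_def subset_iff)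
  have cK: "compact K"
    unfolding K_def by (rule compact_continuous_image[OF continuous_on_subset[OF is_chartD(4)[OF cc]]]) (use R in auto)
  have b0: "b q = 0" if "q \<notin> K" for q
    using that euclidean_bump_eq(2)[OF R(1), of "snd c q" ?x] by (auto simp: b_def Kc dist_norm norm_minus_commute)
  have "C2_function A b"
    unfolding C2_function_def
  proof
    fix d assume d: "d \<in> A"
    note cd = smooth_atlas_chart[OF A d]
    have inv_d: "chart_inv d (snd d q) = q" if "q \<in> fst d" for q using is_chartD(5)[OF cd that] .
    have o1: "open (snd d ` (fst d \<inter> fst c))" by (rule open_chart_image[OF cd is_chartD(1)[OF cc]])
    have o2: "open (snd d ` (fst d \<inter> - K))" using cK by (intro open_chart_image[OF cd]) (simp add: compact_imp_closed open_Compl)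
    have "Ck 2 (snd d ` (fst d \<inter> fst c)) (\<lambda>y. euclidean_bump R ?x ((snd c \<circ> chart_inv d) y))"
      by (rule Ck_compose[OF o1 open_UNIV euclidean_bump_Ck transition_Ck[OF A d c(1)]]) auto
    from Ck_linear_compose[OF o1 bounded_linear_of_real this]
    have "Ck 2 (snd d ` (fst d \<inter> fst c)) (\<lambda>y. b (chart_inv d y))"
      by (rule Ck_cong[OF o1, rotated]) (auto simp: b_def inv_d)
    moreover have "Ck 2 (snd d ` (fst d \<inter> - K)) (\<lambda>y. b (chart_inv d y))"
      by (rule Ck_cong[OF o2 _ Ck_const[OF o2]]) (auto simp: b0 inv_d)
    \<comment> \<open>The bump read through c and the constant 0 agree on the overlap of two open
      sets; these cover the domain of d because K is a compact subset of the domain of c.\<close>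
    moreover have "snd d ` (fst d \<inter> fst c) \<union> snd d ` (fst d \<inter> - K) = snd d ` fst d"
      using Kc by auto
    ultimately show "Ck 2 (snd d ` fst d) (\<lambda>y. b (chart_inv d y))"
      using Ck_Un[OF o1 o2] by metis
  qed
  moreover have "open N" unfolding N_def by (rule open_chart_preimage[OF cc open_ball])
  moreover have "p \<in> N" using c R by (simp add: N_def)
  moreover have "b q = 1" if "q \<in> N" for q
    using that euclidean_bump_eq(1)[OF R(1), of "snd c q" ?x] by (auto simp: b_def N_def dist_norm norm_minus_commute)
  ultimately show ?thesis using cK KW b0 that by blast
qed

text \<open>In place of a normalized partition of unity, u is split as u b + u (1 - b) for one bump
  b after another, which needs no division and only closure of P under sums.\<close>

lemma C2_localization:
  fixes A :: "('m::t2_space, 'e::euclidean_space) chart set"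
  assumes A: "smooth_atlas A" and u: "C2_function A u" and C: "compact C" "\<And>x. x \<notin> C \<Longrightarrow> u x = 0"
    and local: "\<And>p. p \<in> C \<Longrightarrow> \<exists>W. open W \<and> p \<in> W \<and> (\<forall>v K. C2_function A v \<longrightarrow> compact K \<longrightarrow> K \<subseteq> W \<longrightarrow>
       (\<forall>x. x \<notin> K \<longrightarrow> v x = 0) \<longrightarrow> P v)"
    and zero: "P (\<lambda>x. 0)" and add: "\<And>v w. P v \<Longrightarrow> P w \<Longrightarrow> P (\<lambda>x. v x + w x)"
  shows "P u"
proof -
  define R where "R p b N \<longleftrightarrow> C2_function A b \<and> open N \<and> p \<in> N \<and> (\<forall>q\<in>N. b q = 1) \<and>
    (\<forall>v. C2_function A v \<longrightarrow> P (\<lambda>x. v x * b x))" for p b N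
  have "\<exists>b N. R p b N" if p: "p \<in> C" for p
  proof -
    obtain W where W: "open W" "p \<in> W" and PW: "\<And>v K. C2_function A v \<Longrightarrow> compact K \<Longrightarrow> K \<subseteq> W \<Longrightarrow>
       (\<forall>x. x \<notin> K \<longrightarrow> v x = 0) \<Longrightarrow> P v"
      using local[OF p] by blast
    obtain b N K where b: "C2_function A b" "open N" "p \<in> N" "\<And>q. q \<in> N \<Longrightarrow> b q = 1"
      "compact K" "K \<subseteq> W" "\<And>q. q \<notin> K \<Longrightarrow> b q = 0"
      using bump_exists[OF A W] by metis
    have "P (\<lambda>x. v x * b x)" if "C2_function A v" for v
      by (rule PW[OF C2_function_mult[OF A that b(1)] b(5,6)]) (simp add: b(7))
    then show ?thesis using b(1-4) unfolding R_def by blast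
  qed
  then obtain b N where "\<And>p. p \<in> C \<Longrightarrow> R p (b p) (N p)" by metis
  then have bN: "\<And>p. p \<in> C \<Longrightarrow> C2_function A (b p)" "\<And>p. p \<in> C \<Longrightarrow> open (N p)" "\<And>p. p \<in> C \<Longrightarrow> p \<in> N p"
    "\<And>p q. p \<in> C \<Longrightarrow> q \<in> N p \<Longrightarrow> b p q = 1" "\<And>p v. p \<in> C \<Longrightarrow> C2_function A v \<Longrightarrow> P (\<lambda>x. v x * b p x)"
    unfolding R_def by auto
  have "C \<subseteq> (\<Union>p\<in>C. N p)" using bN(3) by auto
  then obtain F where F: "F \<subseteq> C" "finite F" "C \<subseteq> (\<Union>p\<in>F. N p)"
    using compactE_image[OF C(1), of C N] bN(2) by metis
  have "P v" if "C2_function A v" "\<And>x. x \<notin> (\<Union>p\<in>F. N p) \<Longrightarrow> v x = 0" for v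
    using F(2,1) that
  proof (induction F arbitrary: v rule: finite_induct)
    case empty
    then have "v = (\<lambda>x. 0)" by auto
    then show ?case using zero by simp
  next
    case (insert p F)
    then have p: "p \<in> C" by simp
    \<comment> \<open>The remainder vanishes where the bump is 1, hence off the union of the
      remaining neighbourhoods.\<close>
    have "P (\<lambda>x. v x * (1 - b p x))"
    proof (rule insert.IH)
      show "C2_function A (\<lambda>x. v x * (1 - b p x))"
        by (intro C2_function_mult[OF A] C2_function_one_minus[OF A] bN(1)[OF p] insert.prems)
      fix x assume "x \<notin> (\<Union>p\<in>F. N p)"
      then show "v x * (1 - b p x) = 0"
        using bN(4)[OF p, of x] insert.prems(3)[of x] by (cases "x \<in> N p") auto
    qed (use insert.prems in auto)
    from add[OF bN(5)[OF p insert.prems(2)] this] show ?case by (simp add: algebra_simps)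
  qed
  then show ?thesis using u C(2) F(3) by blast
qed

section \<open>The phase of a Lagrangian section\<close>

lemma directional_DERIV:
  fixes f :: "'a::euclidean_space \<Rightarrow> real"
  assumes "Ck 1 S f" "x + t *\<^sub>R u \<in> S"
  shows "((\<lambda>t. f (x + t *\<^sub>R u)) has_real_derivative frechet_derivative f (at (x + t *\<^sub>R u)) u) (at t)"
proof -
  have f: "(f has_derivative frechet_derivative f (at (x + t *\<^sub>R u))) (at (x + t *\<^sub>R u))"
    using Ck_Suc_has_derivative[of 0 S f] assms by simp
  have "((\<lambda>t. f (x + t *\<^sub>R u)) has_derivative (\<lambda>s. frechet_derivative f (at (x + t *\<^sub>R u)) (s *\<^sub>R u))) (at t)"
    by (rule has_derivative_compose[where f="\<lambda>t. x + t *\<^sub>R u" and g=f, OF _ f]) (auto intro!: derivative_eq_intros)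
  then show ?thesis
    by (simp add: has_field_derivative_def linear_scale[OF has_derivative_linear[OF f]] mult.commute[of _ "frechet_derivative f _ u"])
qed

text \<open>The mean value theorem applied twice: in the direction u to the difference over t v,
  then in the direction v.\<close>

lemma second_difference:
  fixes f :: "'a::euclidean_space \<Rightarrow> real"
  assumes "Ck 2 (ball x r) f" "0 < t" "t * (norm u + norm v) < r"
  obtains y where "norm (y - x) \<le> t * (norm u + norm v)"
    "f (x + t *\<^sub>R u + t *\<^sub>R v) - f (x + t *\<^sub>R u) - f (x + t *\<^sub>R v) + f x =
     t\<^sup>2 * frechet_derivative (\<lambda>y. frechet_derivative f (at y) u) (at y) v"
proof -
  let ?B = "ball x r" and ?G = "\<lambda>y. frechet_derivative f (at y) u"
  have f1: "Ck 1 ?B f" using Ck_mono[OF assms(1), of 1] by simp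
  have G1: "Ck 1 ?B ?G" using Ck_Suc_derivative[of 1 ?B f u] assms(1) by (simp add: numeral_2_eq_2)
  have n: "norm (a *\<^sub>R u + b *\<^sub>R v) \<le> t * (norm u + norm v)" if "0 \<le> a" "a \<le> t" "0 \<le> b" "b \<le> t" for a b
  proof -
    have "norm (a *\<^sub>R u + b *\<^sub>R v) \<le> a * norm u + b * norm v"
      using norm_triangle_ineq[of "a *\<^sub>R u" "b *\<^sub>R v"] that by simp
    also have "\<dots> \<le> t * norm u + t * norm v" using that by (intro add_mono mult_right_mono) auto
    finally show ?thesis by (simp add: distrib_left)
  qed
  have inB: "x + a *\<^sub>R u + b *\<^sub>R v \<in> ?B" if "0 \<le> a" "a \<le> t" "0 \<le> b" "b \<le> t" for a b
  proof -
    have "x - (x + a *\<^sub>R u + b *\<^sub>R v) = - (a *\<^sub>R u + b *\<^sub>R v)" by simp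
    then have "dist x (x + a *\<^sub>R u + b *\<^sub>R v) = norm (a *\<^sub>R u + b *\<^sub>R v)"
      unfolding dist_norm by (simp only: norm_minus_cancel)
    then show ?thesis using n[OF that] assms(3) by simp
  qed
  have "((\<lambda>s. f (x + s *\<^sub>R u + t *\<^sub>R v) - f (x + s *\<^sub>R u)) has_real_derivative
      ?G (x + s *\<^sub>R u + t *\<^sub>R v) - ?G (x + s *\<^sub>R u)) (at s)" if "0 \<le> s" "s \<le> t" for s
    using directional_DERIV[OF f1, of "x + t *\<^sub>R v" s u] directional_DERIV[OF f1, of x s u]
      inB[OF that, of t] inB[OF that, of 0] assms(2)
    by (intro DERIV_diff) (simp_all add: add.assoc add.commute[of "t *\<^sub>R v"])
  from MVT2[OF assms(2) this] obtain s where s: "0 < s" "s < t"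
    "f (x + t *\<^sub>R u + t *\<^sub>R v) - f (x + t *\<^sub>R u) - (f (x + t *\<^sub>R v) - f x) = t * (?G (x + s *\<^sub>R u + t *\<^sub>R v) - ?G (x + s *\<^sub>R u))"
    by auto
  have "((\<lambda>q. ?G (x + s *\<^sub>R u + q *\<^sub>R v)) has_real_derivative frechet_derivative ?G (at (x + s *\<^sub>R u + q *\<^sub>R v)) v) (at q)"
    if "0 \<le> q" "q \<le> t" for q
    by (rule directional_DERIV[OF G1]) (use inB[of s q] that s in auto)
  from MVT2[OF assms(2) this] obtain q where q: "0 < q" "q < t"
    "?G (x + s *\<^sub>R u + t *\<^sub>R v) - ?G (x + s *\<^sub>R u) = t * frechet_derivative ?G (at (x + s *\<^sub>R u + q *\<^sub>R v)) v"
    by auto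
  show ?thesis
  proof (rule that)
    show "norm (x + s *\<^sub>R u + q *\<^sub>R v - x) \<le> t * (norm u + norm v)"
      using n[of s q] s q by (simp add: add.assoc)
    show "f (x + t *\<^sub>R u + t *\<^sub>R v) - f (x + t *\<^sub>R u) - f (x + t *\<^sub>R v) + f x =
     t\<^sup>2 * frechet_derivative ?G (at (x + s *\<^sub>R u + q *\<^sub>R v)) v"
      using s(3) q(3) by (simp add: power2_eq_square)
  qed
qed

text \<open>The second difference does not depend on the order of u and v. Both mixed derivatives
  represent it at points near x, and they agree at x by continuity.\<close>

lemma second_derivative_symmetric_real:
  fixes f :: "'a::euclidean_space \<Rightarrow> real"
  assumes "open S" "Ck 2 S f" "x \<in> S"
  shows "frechet_derivative (\<lambda>y. frechet_derivative f (at y) u) (at x) v =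
    frechet_derivative (\<lambda>y. frechet_derivative f (at y) v) (at x) u"
proof -
  let ?G = "\<lambda>u v y. frechet_derivative (\<lambda>y. frechet_derivative f (at y) u) (at y) v"
  have "Ck (Suc (Suc 0)) S f" using assms(2) by (simp add: numeral_2_eq_2)
  then have cont: "continuous_on S (?G u v)" for u v
    using Ck_Suc_derivative[OF Ck_Suc_derivative] by fastforce
  have "\<bar>?G u v x - ?G v u x\<bar> \<le> 0 + e" if e: "0 < e" for e
  proof -
    have ev: "\<exists>r>0. \<forall>y. norm (y - x) < r \<longrightarrow> \<bar>?G u v y - ?G u v x\<bar> < e / 2" for u v
    proof -
      have "continuous (at x) (?G u v)"
        using cont assms(1,3) by (simp add: continuous_on_eq_continuous_at)
      then show ?thesis using e unfolding continuous_at_eps_delta by (metis dist_norm dist_real_def half_gt_zero)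
    qed
    obtain r1 where r1: "r1 > 0" "\<And>y. norm (y - x) < r1 \<Longrightarrow> \<bar>?G u v y - ?G u v x\<bar> < e / 2" using ev by blast
    obtain r2 where r2: "r2 > 0" "\<And>y. norm (y - x) < r2 \<Longrightarrow> \<bar>?G v u y - ?G v u x\<bar> < e / 2" using ev by blast
    obtain r3 where r3: "r3 > 0" "ball x r3 \<subseteq> S" using assms(1,3) open_contains_ball by blast
    define r where "r = min r1 (min r2 r3)"
    have r: "0 < r" "r \<le> r1" "r \<le> r2" "r \<le> r3" using r1 r2 r3 by (auto simp: r_def)
    \<comment> \<open>The summand 1 keeps the denominator positive when u = v = 0 and makes the
      bound t (|u| + |v|) < r strict.\<close>
    define t where "t = r / (norm u + norm v + 1)"
    have pos: "0 < norm u + norm v + 1" by (simp add: add_nonneg_pos)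
    have t: "0 < t" using r pos by (simp add: t_def)
    have "t * (norm u + norm v + 1) = r" using pos by (simp add: t_def)
    then have tr: "t * (norm u + norm v) < r" using t by (simp add: distrib_left)
    have B: "Ck 2 (ball x r) f" using Ck_subset[OF assms(2)] r3(2) r(4) by (meson order_trans subset_ball)
    obtain y1 where y1: "norm (y1 - x) \<le> t * (norm u + norm v)"
      "f (x + t *\<^sub>R u + t *\<^sub>R v) - f (x + t *\<^sub>R u) - f (x + t *\<^sub>R v) + f x = t\<^sup>2 * ?G u v y1"
      by (rule second_difference[OF B t tr])
    obtain y2 where y2: "norm (y2 - x) \<le> t * (norm v + norm u)"
      "f (x + t *\<^sub>R v + t *\<^sub>R u) - f (x + t *\<^sub>R v) - f (x + t *\<^sub>R u) + f x = t\<^sup>2 * ?G v u y2"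
      by (rule second_difference[OF B t, of v u]) (use tr in \<open>simp add: add.commute\<close>)
    have swap: "x + t *\<^sub>R u + t *\<^sub>R v = x + t *\<^sub>R v + t *\<^sub>R u" by simp
    have "t\<^sup>2 * ?G u v y1 = t\<^sup>2 * ?G v u y2"
      using y1(2) y2(2) arg_cong[OF swap, of f] by linarith
    then have "?G u v y1 = ?G v u y2" using t by simp
    moreover have "norm (y1 - x) < r1" "norm (y2 - x) < r2" using y1(1) y2(1) tr r by (auto simp: add.commute)
    ultimately show ?thesis using r1(2)[of y1] r2(2)[of y2] by linarith
  qed
  then have "\<bar>?G u v x - ?G v u x\<bar> \<le> 0" by (rule field_le_epsilon)
  then show ?thesis by simp
qed

lemma frechet_derivative_bounded_linear_compose:
  assumes "bounded_linear l" "f differentiable at x"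
  shows "frechet_derivative (\<lambda>y. l (f y)) (at x) v = l (frechet_derivative f (at x) v)"
  using frechet_derivative_at[OF bounded_linear.has_derivative[OF assms(1) frechet_derivative_works[THEN iffD1, OF assms(2)]]]
  by (metis (no_types))

lemma second_derivative_symmetric:
  fixes f :: "'a::euclidean_space \<Rightarrow> complex"
  assumes "open S" "Ck 2 S f" "x \<in> S"
  shows "frechet_derivative (\<lambda>y. frechet_derivative f (at y) u) (at x) v =
    frechet_derivative (\<lambda>y. frechet_derivative f (at y) v) (at x) u"
proof -
  have 2: "Ck (Suc (Suc 0)) S f" using assms(2) by (simp add: numeral_2_eq_2)
  have d1: "f differentiable at y" if "y \<in> S" for y
    using Ck_Suc_has_derivative[OF 2 that] by (auto simp: differentiable_def)
  have d2: "(\<lambda>y. frechet_derivative f (at y) u) differentiable at x" for u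
    using Ck_Suc_has_derivative[OF Ck_Suc_derivative[OF 2] assms(3)] by (auto simp: differentiable_def)
  have l: "frechet_derivative (\<lambda>y. frechet_derivative (\<lambda>z. l (f z)) (at y) u) (at x) v =
      l (frechet_derivative (\<lambda>y. frechet_derivative f (at y) u) (at x) v)"
    if "bounded_linear l" for l :: "complex \<Rightarrow> real" and u v
  proof -
    have "frechet_derivative (\<lambda>y. frechet_derivative (\<lambda>z. l (f z)) (at y) u) (at x) =
      frechet_derivative (\<lambda>y. l (frechet_derivative f (at y) u)) (at x)"
      by (rule frechet_derivative_cong_open[OF assms(1,3)])
        (rule frechet_derivative_bounded_linear_compose[OF that d1])
    then show ?thesis by (simp add: frechet_derivative_bounded_linear_compose[OF that d2])
  qed
  have s: "l (frechet_derivative (\<lambda>y. frechet_derivative f (at y) u) (at x) v) =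
      l (frechet_derivative (\<lambda>y. frechet_derivative f (at y) v) (at x) u)"
    if "bounded_linear l" for l :: "complex \<Rightarrow> real"
    using second_derivative_symmetric_real[OF assms(1) Ck_linear_compose[OF assms(1) that assms(2)] assms(3), of u v]
    unfolding l[OF that] .
  show ?thesis
    using s[OF bounded_linear_Re] s[OF bounded_linear_Im] by (simp add: complex_eq_iff)
qed

text \<open>F, w and beta are the coefficient of the section, the squared norm of the frame and the
  connection form, read in a chart of M. \<open>dbar0\<close> and \<open>dbar1\<close> are the
  flatness of dbar F along Gamma in orders zero and one.\<close>

locale phase_data =
  fixes \<Omega> :: "(complex^'n) set" and D :: "(real^'n) set" and f :: "real^'n \<Rightarrow> complex^'n"
    and F :: "complex^'n \<Rightarrow> complex" and w :: "complex^'n \<Rightarrow> real"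
    and \<beta> :: "complex^'n \<Rightarrow> complex^'n \<Rightarrow> complex" and \<omega> :: "complex^'n \<Rightarrow> complex^'n \<Rightarrow> complex^'n \<Rightarrow> real"
  assumes open_\<Omega>: "open \<Omega>" and open_D: "open D" and f_\<Omega>: "f ` D \<subseteq> \<Omega>"
    and f_Ck: "\<And>n. Ck n D f" and F_Ck: "\<And>n. Ck n \<Omega> F" and w_Ck: "\<And>n. Ck n \<Omega> w"
    and \<beta>_Ck: "\<And>n v. Ck n \<Omega> (\<lambda>x. \<beta> x v)"
    and F_nz: "\<And>x. x \<in> \<Omega> \<Longrightarrow> F x \<noteq> 0" and w_pos: "\<And>x. x \<in> \<Omega> \<Longrightarrow> 0 < w x"
    and dw: "\<And>x v. x \<in> \<Omega> \<Longrightarrow> frechet_derivative w (at x) v = 2 * Re (\<beta> x v) * w x"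
    and curvature: "\<And>x u v. x \<in> \<Omega> \<Longrightarrow> frechet_derivative (\<lambda>x. \<beta> x v) (at x) u - frechet_derivative (\<lambda>x. \<beta> x u) (at x) v =
      (1 / \<i>) * of_real (\<omega> x u v)"
    and \<omega>_pos: "\<And>x. x \<in> \<Omega> \<Longrightarrow> positive_form (\<omega> x)"
    and le_one: "\<And>x. x \<in> \<Omega> \<Longrightarrow> w x * (cmod (F x))\<^sup>2 \<le> 1"
    and eq_one: "\<And>y. y \<in> D \<Longrightarrow> w (f y) * (cmod (F (f y)))\<^sup>2 = 1"
    and dbar0: "\<And>y v. y \<in> D \<Longrightarrow> (frechet_derivative F (at (f y)) v + \<beta> (f y) v * F (f y)) +
       \<i> * (frechet_derivative F (at (f y)) (\<i> *s v) + \<beta> (f y) (\<i> *s v) * F (f y)) = 0"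
    and dbar1: "\<And>y u v. y \<in> D \<Longrightarrow> frechet_derivative (\<lambda>x. ((frechet_derivative F (at x) v + \<beta> x v * F x) +
       \<i> * (frechet_derivative F (at x) (\<i> *s v) + \<beta> x (\<i> *s v) * F x)) / 2) (at (f y)) u = 0"
begin

definition \<phi> :: "complex^'n \<Rightarrow> real" where "\<phi> x = - ln (w x * (cmod (F x))\<^sup>2)"

text \<open>The logarithmic covariant derivative of the section with coefficient \<open>F\<close>. Its real part is
  \<open>- d\<phi>/2\<close>, and its exterior derivative is the curvature; this is how \<open>\<omega>\<close> enters the Hessian of \<open>\<phi>\<close>.\<close>

definition \<alpha> :: "complex^'n \<Rightarrow> complex^'n \<Rightarrow> complex" where
  "\<alpha> v x = frechet_derivative F (at x) v / F x + \<beta> x v"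

lemma q_pos: "x \<in> \<Omega> \<Longrightarrow> 0 < w x * (cmod (F x))\<^sup>2"
  using F_nz[of x] w_pos[of x] by simp

lemma q_Ck: "Ck n \<Omega> (\<lambda>x. w x * (cmod (F x))\<^sup>2)"
  unfolding cmod_power2
  by (intro Ck_mult Ck_add Ck_power open_\<Omega> w_Ck Ck_linear_compose[OF open_\<Omega> bounded_linear_Re F_Ck]
      Ck_linear_compose[OF open_\<Omega> bounded_linear_Im F_Ck])

lemma \<phi>_Ck: "Ck n \<Omega> \<phi>"
proof -
  have "Ck n \<Omega> (\<lambda>x. ln (w x * (cmod (F x))\<^sup>2))"
    by (rule Ck_compose[OF open_\<Omega> _ Ck_ln q_Ck]) (use q_pos in auto)
  from Ck_linear_compose[OF open_\<Omega> bounded_linear_minus[OF bounded_linear_ident] this]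
  show ?thesis by (simp add: \<phi>_def[abs_def])
qed

lemma \<phi>_nonneg: "x \<in> \<Omega> \<Longrightarrow> 0 \<le> \<phi> x"
  using le_one[of x] q_pos[of x] by (simp add: \<phi>_def ln_le_zero_iff)

lemma \<phi>_zero: "y \<in> D \<Longrightarrow> \<phi> (f y) = 0"
  using eq_one by (simp add: \<phi>_def)

lemma exp_\<phi>: "x \<in> \<Omega> \<Longrightarrow> exp (- \<phi> x) = w x * (cmod (F x))\<^sup>2"
  using q_pos by (simp add: \<phi>_def)

text \<open>The logarithmic derivative of |F|^2 is 2 Re(F'/F), and compatibility of the connection
  with the metric makes that of w equal to 2 Re beta.\<close>

lemma frechet_\<phi>: "x \<in> \<Omega> \<Longrightarrow> frechet_derivative \<phi> (at x) v = - 2 * Re (\<alpha> v x)"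
proof -
  assume x: "x \<in> \<Omega>"
  let ?dF = "frechet_derivative F (at x)" and ?dw = "frechet_derivative w (at x)"
  have F: "(F has_derivative ?dF) (at x)" and w: "(w has_derivative ?dw) (at x)"
    using Ck_Suc_has_derivative[OF F_Ck x] Ck_Suc_has_derivative[OF w_Ck x] by auto
  have R: "((\<lambda>x. Re (F x)) has_derivative (\<lambda>v. Re (?dF v))) (at x)"
    by (rule bounded_linear.has_derivative[OF bounded_linear_Re F])
  have I: "((\<lambda>x. Im (F x)) has_derivative (\<lambda>v. Im (?dF v))) (at x)"
    by (rule bounded_linear.has_derivative[OF bounded_linear_Im F])
  let ?N = "(Re (F x))\<^sup>2 + (Im (F x))\<^sup>2"
  have N: "?N > 0" using F_nz[OF x] by (simp add: complex_neq_0)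
  have wx: "w x > 0" by (rule w_pos[OF x])
  have D: "((\<lambda>x. w x * ((Re (F x))\<^sup>2 + (Im (F x))\<^sup>2)) has_derivative
      (\<lambda>v. w x * (2 * Re (F x) * Re (?dF v) + 2 * Im (F x) * Im (?dF v)) + ?dw v * ?N)) (at x)"
    using has_derivative_mult[OF w has_derivative_add[OF has_derivative_power[OF R, of 2] has_derivative_power[OF I, of 2]]]
    by (rule has_derivative_eq_rhs) (simp add: fun_eq_iff mult_ac)
  have D\<phi>: "(\<phi> has_derivative (\<lambda>v. - ((w x * (2 * Re (F x) * Re (?dF v) + 2 * Im (F x) * Im (?dF v)) + ?dw v * ?N) / (w x * ?N)))) (at x)"
    unfolding \<phi>_def[abs_def] cmod_power2
    using has_derivative_minus[OF has_derivative_ln[OF _ D]] N wx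
    by (simp add: divide_inverse)
  have alg: "- ((w' * (2 * a * b + 2 * c * d) + 2 * e * w' * N) / (w' * N)) = - 2 * ((a * b + c * d) / N + e)"
    if "0 < w'" "0 < N" for w' N a b c d e :: real
    using that by (simp add: field_simps)
  from fun_cong[OF frechet_derivative_at[OF D\<phi>], of v]
  have "frechet_derivative \<phi> (at x) v = - ((w x * (2 * Re (F x) * Re (?dF v) + 2 * Im (F x) * Im (?dF v)) + ?dw v * ?N) / (w x * ?N))"
    by (rule sym)
  also have "\<dots> = - 2 * ((Re (F x) * Re (?dF v) + Im (F x) * Im (?dF v)) / ?N + Re (\<beta> x v))"
    unfolding dw[OF x] by (rule alg[OF wx N])
  also have "(Re (F x) * Re (?dF v) + Im (F x) * Im (?dF v)) / ?N = Re (?dF v / F x)"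
    by (simp add: Re_divide mult.commute)
  finally show ?thesis by (simp add: \<alpha>_def)
qed

text \<open>Points of Gamma are minima: phi is nonnegative and vanishes there.\<close>

lemma \<phi>_critical: "y \<in> D \<Longrightarrow> frechet_derivative \<phi> (at (f y)) v = 0"
proof -
  assume y: "y \<in> D"
  have x: "f y \<in> \<Omega>" using y f_\<Omega> by auto
  have d: "(\<phi> has_derivative frechet_derivative \<phi> (at (f y))) (at (f y))"
    by (rule Ck_Suc_has_derivative[OF \<phi>_Ck x])
  have "frechet_derivative \<phi> (at (f y)) = (\<lambda>v. 0)"
  proof (rule has_derivative_local_min[OF d])
    have "\<forall>\<^sub>F z in at (f y). z \<in> \<Omega>" using open_\<Omega> x by (rule eventually_at_in_open')
    then show "\<forall>\<^sub>F z in at (f y). \<phi> (f y) \<le> \<phi> z"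
      by (rule eventually_mono) (simp add: \<phi>_nonneg \<phi>_zero[OF y])
  qed
  then show ?thesis by simp
qed

lemma \<alpha>_dbar: "x \<in> \<Omega> \<Longrightarrow> \<alpha> v x + \<i> * \<alpha> (\<i> *s v) x = 2 * (((frechet_derivative F (at x) v + \<beta> x v * F x) +
       \<i> * (frechet_derivative F (at x) (\<i> *s v) + \<beta> x (\<i> *s v) * F x)) / 2) / F x"
  using F_nz[of x] by (simp add: \<alpha>_def field_simps)

text \<open>The real part is -dphi/2 and vanishes in every direction. The equation dbar F = 0
  expresses the imaginary part in direction v by the real part in direction iv.\<close>

lemma \<alpha>_zero: "y \<in> D \<Longrightarrow> \<alpha> v (f y) = 0"
proof -
  assume y: "y \<in> D"
  have x: "f y \<in> \<Omega>" using y f_\<Omega> by auto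
  have re: "Re (\<alpha> v (f y)) = 0" for v using frechet_\<phi>[OF x] \<phi>_critical[OF y] by simp
  have "\<alpha> v (f y) + \<i> * \<alpha> (\<i> *s v) (f y) = 0"
    using \<alpha>_dbar[OF x, of v] dbar0[OF y, of v] by simp
  then have "Im (\<alpha> v (f y)) + Re (\<alpha> (\<i> *s v) (f y)) = 0" by (simp add: complex_eq_iff)
  with re show ?thesis by (simp add: complex_eq_iff)
qed

abbreviation H :: "complex^'n \<Rightarrow> complex^'n \<Rightarrow> complex^'n \<Rightarrow> complex" where
  "H x u v \<equiv> frechet_derivative (\<alpha> v) (at x) u"

lemma has_derivative_\<alpha>:
  assumes x: "x \<in> \<Omega>"
  shows "(\<alpha> v has_derivative (\<lambda>u. frechet_derivative (\<lambda>x. frechet_derivative F (at x) v) (at x) u / F x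
     - frechet_derivative F (at x) v * frechet_derivative F (at x) u / (F x)\<^sup>2 + frechet_derivative (\<lambda>x. \<beta> x v) (at x) u)) (at x)"
proof -
  have F: "(F has_derivative frechet_derivative F (at x)) (at x)" by (rule Ck_Suc_has_derivative[OF F_Ck x])
  have G: "((\<lambda>x. frechet_derivative F (at x) v) has_derivative frechet_derivative (\<lambda>x. frechet_derivative F (at x) v) (at x)) (at x)"
    by (rule Ck_Suc_has_derivative[OF Ck_Suc_derivative[OF F_Ck] x])
  have B: "((\<lambda>x. \<beta> x v) has_derivative frechet_derivative (\<lambda>x. \<beta> x v) (at x)) (at x)"
    by (rule Ck_Suc_has_derivative[OF \<beta>_Ck x])
  show ?thesis
    unfolding \<alpha>_def[abs_def]
    using has_derivative_add[OF has_derivative_divide[OF G F F_nz[OF x]] B]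
    by (rule has_derivative_eq_rhs) (simp add: fun_eq_iff divide_inverse power2_eq_square mult_ac)
qed

text \<open>Under antisymmetrization the second derivatives of F and the products of its first
  derivatives cancel, and the curvature of beta remains.\<close>

lemma H_curvature: "x \<in> \<Omega> \<Longrightarrow> H x u v - H x v u = (1 / \<i>) * of_real (\<omega> x u v)"
  using second_derivative_symmetric[OF open_\<Omega> F_Ck[of 2], where x=x and u=u and v=v]
    curvature[where x=x and u=u and v=v]
  by (simp add: frechet_derivative_at[OF has_derivative_\<alpha>, symmetric] algebra_simps)

lemma \<alpha>_differentiable: "x \<in> \<Omega> \<Longrightarrow> (\<alpha> v has_derivative frechet_derivative (\<alpha> v) (at x)) (at x)"
  by (rule frechet_derivative_works[THEN iffD1]) (rule differentiableI[OF has_derivative_\<alpha>])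

text \<open>alpha vanishes along Gamma, hence so do its derivatives in tangential
  directions.\<close>

lemma H_tangential: "y \<in> D \<Longrightarrow> H (f y) (frechet_derivative f (at y) a) v = 0"
proof -
  assume y: "y \<in> D"
  have x: "f y \<in> \<Omega>" using y f_\<Omega> by auto
  have "((\<lambda>y. \<alpha> v (f y)) has_derivative (\<lambda>a. H (f y) (frechet_derivative f (at y) a) v)) (at y)"
    by (rule has_derivative_compose[OF Ck_Suc_has_derivative[OF f_Ck y] \<alpha>_differentiable[OF x]])
  from has_derivative_unique[OF this has_derivative_transform_within_open[OF has_derivative_const[of 0] open_D y]]
  have "(\<lambda>a. H (f y) (frechet_derivative f (at y) a) v) = (\<lambda>a. 0)" by (simp add: \<alpha>_zero)
  then show ?thesis by (rule fun_cong)
qed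

text \<open>The (0,1)-part of alpha is dbar F / F up to a constant. Since dbar F and its first
  derivatives vanish along Gamma, the variation of 1/F contributes nothing.\<close>

lemma H_complex: "y \<in> D \<Longrightarrow> H (f y) u v + \<i> * H (f y) u (\<i> *s v) = 0"
proof -
  assume y: "y \<in> D"
  have x: "f y \<in> \<Omega>" using y f_\<Omega> by auto
  let ?B = "\<lambda>x. ((frechet_derivative F (at x) v + \<beta> x v * F x) +
       \<i> * (frechet_derivative F (at x) (\<i> *s v) + \<beta> x (\<i> *s v) * F x)) / 2"
  have "Ck 1 \<Omega> (\<lambda>x. ((frechet_derivative F (at x) v + \<beta> x v * F x) +
       \<i> * (frechet_derivative F (at x) (\<i> *s v) + \<beta> x (\<i> *s v) * F x)) * (1 / 2))"
    by (intro Ck_add Ck_mult Ck_const open_\<Omega> F_Ck \<beta>_Ck Ck_Suc_derivative)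
  then have "Ck (Suc 0) \<Omega> ?B" by simp
  from Ck_Suc_has_derivative[OF this x]
  have B: "(?B has_derivative (\<lambda>u. 0)) (at (f y))"
    by (rule has_derivative_eq_rhs) (rule ext, rule dbar1[OF y])
  have F: "(F has_derivative frechet_derivative F (at (f y))) (at (f y))" by (rule Ck_Suc_has_derivative[OF F_Ck x])
  have B0: "?B (f y) = 0" using dbar0[OF y, of v] by simp
  have "((\<lambda>x. 2 * ?B x / F x) has_derivative (\<lambda>u. 0)) (at (f y))"
    using has_derivative_divide[OF has_derivative_mult_right[OF B, of 2] F F_nz[OF x]]
    by (rule has_derivative_eq_rhs) (use B0 in \<open>simp add: fun_eq_iff\<close>)
  then have "((\<lambda>x. \<alpha> v x + \<i> * \<alpha> (\<i> *s v) x) has_derivative (\<lambda>u. 0)) (at (f y))"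
    by (rule has_derivative_transform_within_open[OF _ open_\<Omega> x]) (simp only: \<alpha>_dbar)
  moreover have "((\<lambda>x. \<alpha> v x + \<i> * \<alpha> (\<i> *s v) x) has_derivative (\<lambda>u. H (f y) u v + \<i> * H (f y) u (\<i> *s v))) (at (f y))"
    by (intro has_derivative_add has_derivative_mult_right \<alpha>_differentiable x)
  ultimately have "(\<lambda>u. 0) = (\<lambda>u. H (f y) u v + \<i> * H (f y) u (\<i> *s v))" by (rule has_derivative_unique)
  from fun_cong[OF this, of u] show ?thesis by simp
qed

text \<open>Put u = i t. Then H(u, u) = i H(u, t) by \<open>H_complex\<close>, and H(u, t) = H(u, t)
  - H(t, u) = -i omega(u, t), since t is tangential. Hence -2 Re H(u, u) = -2 omega(u, t) = 2
  omega(t, u).\<close>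

lemma \<phi>_hessian:
  fixes s :: "real^'n"
  assumes y: "y \<in> D"
  defines "t \<equiv> frechet_derivative f (at y) s"
  shows "frechet_derivative (\<lambda>x. frechet_derivative \<phi> (at x) (\<i> *s t)) (at (f y)) (\<i> *s t) = 2 * \<omega> (f y) t (\<i> *s t)"
proof -
  have x: "f y \<in> \<Omega>" using y f_\<Omega> by auto
  have "frechet_derivative (\<lambda>x. frechet_derivative \<phi> (at x) (\<i> *s t)) (at (f y)) =
    frechet_derivative (\<lambda>x. - 2 * Re (\<alpha> (\<i> *s t) x)) (at (f y))"
    by (rule frechet_derivative_cong_open[OF open_\<Omega> x frechet_\<phi>])
  also have "\<dots> = (\<lambda>u. - 2 * Re (H (f y) u (\<i> *s t)))"
    by (rule frechet_derivative_at[symmetric])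
      (intro has_derivative_mult_right bounded_linear.has_derivative[OF bounded_linear_Re] \<alpha>_differentiable x)
  finally have 1: "frechet_derivative (\<lambda>x. frechet_derivative \<phi> (at x) (\<i> *s t)) (at (f y)) (\<i> *s t) =
    - 2 * Re (H (f y) (\<i> *s t) (\<i> *s t))" by simp
  have 2: "H (f y) (\<i> *s t) t = (1 / \<i>) * of_real (\<omega> (f y) (\<i> *s t) t)"
    using H_curvature[OF x, where u="\<i> *s t" and v=t] H_tangential[OF y, where a=s and v="\<i> *s t"] by (simp add: t_def)
  have 3: "H (f y) (\<i> *s t) (\<i> *s t) = \<i> * H (f y) (\<i> *s t) t"
    using H_complex[OF y, where u="\<i> *s t" and v=t] by (simp add: complex_eq_iff)
  have "\<omega> (f y) (\<i> *s t) t = - \<omega> (f y) t (\<i> *s t)"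
    by (rule positive_formD(6)[OF \<omega>_pos[OF x]])
  then show ?thesis unfolding 1 3 2 by simp
qed

end

section \<open>Asymptotics with an approximate integrand\<close>

text \<open>The error C/k (1 + q) is integrated against |v|; the masses of |v| q stay bounded in k,
  so the result is still of order 1/k.\<close>

lemma perturbed_integral_bound:
  fixes v :: "'e::euclidean_space \<Rightarrow> complex" and N q :: "nat \<Rightarrow> 'e \<Rightarrow> real"
  assumes K: "compact K" and v: "continuous_on K v" and b: "continuous_on K b"
    and N: "\<And>k. 1 \<le> k \<Longrightarrow> continuous_on K (N k)" and q: "\<And>k. 1 \<le> k \<Longrightarrow> continuous_on K (q k)"
    and q0: "\<And>k x. 1 \<le> k \<Longrightarrow> x \<in> K \<Longrightarrow> 0 \<le> q k x"
    and approx: "\<And>k x. 1 \<le> k \<Longrightarrow> x \<in> K \<Longrightarrow> \<bar>N k x - q k x * b x\<bar> \<le> C / real k * (1 + q k x)"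
    and bound: "\<And>k. 1 \<le> k \<Longrightarrow> (LINT x:K|lborel. cmod (v x) * q k x) \<le> M"
  shows "\<exists>C'. \<forall>k\<ge>1. cmod ((LINT x:K|lborel. v x * of_real (N k x)) -
      (LINT x:K|lborel. (v x * of_real (b x)) * of_real (q k x))) \<le> C' / real k"
proof -
  have int: "set_integrable lborel K u" if "continuous_on K u" for u :: "'e \<Rightarrow> 'b::{banach, second_countable_topology}"
    using borel_integrable_compact[OF K that] by (simp add: set_integrable_def)
  let ?c = "max C 0"
  let ?I = "LINT x:K|lborel. cmod (v x)"
  have "cmod ((LINT x:K|lborel. v x * of_real (N k x)) - (LINT x:K|lborel. (v x * of_real (b x)) * of_real (q k x)))
      \<le> (?c * (?I + M)) / real k" if k: "1 \<le> k" for k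
  proof -
    note cont = v b N[OF k] q[OF k]
    have i1: "set_integrable lborel K (\<lambda>x. v x * of_real (N k x))"
      and i2: "set_integrable lborel K (\<lambda>x. (v x * of_real (b x)) * of_real (q k x))"
      and i3: "set_integrable lborel K (\<lambda>x. cmod (v x))"
      and i4: "set_integrable lborel K (\<lambda>x. cmod (v x) * q k x)"
      by (intro int continuous_intros cont)+
    have "(LINT x:K|lborel. v x * of_real (N k x)) - (LINT x:K|lborel. (v x * of_real (b x)) * of_real (q k x))
        = (LINT x:K|lborel. v x * of_real (N k x) - (v x * of_real (b x)) * of_real (q k x))"
      by (rule set_integral_diff(2)[OF i1 i2, symmetric])
    also have "cmod \<dots> \<le> (LINT x:K|lborel. cmod (v x * of_real (N k x) - (v x * of_real (b x)) * of_real (q k x)))"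
      by (rule set_integral_norm_bound[OF set_integral_diff(1)[OF i1 i2]])
    also have "\<dots> \<le> (LINT x:K|lborel. ?c / real k * (cmod (v x) + cmod (v x) * q k x))"
    proof (rule set_integral_mono)
      show "set_integrable lborel K (\<lambda>x. cmod (v x * of_real (N k x) - (v x * of_real (b x)) * of_real (q k x)))"
        by (intro int continuous_intros cont)
      show "set_integrable lborel K (\<lambda>x. ?c / real k * (cmod (v x) + cmod (v x) * q k x))"
        using k by (intro int continuous_intros cont) auto
      fix x assume x: "x \<in> K"
      have "C / real k * (1 + q k x) \<le> ?c / real k * (1 + q k x)"
        using q0[OF k x] by (intro mult_right_mono divide_right_mono) auto
      with approx[OF k x] have le: "\<bar>N k x - q k x * b x\<bar> \<le> ?c / real k * (1 + q k x)" by linarith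
      have "cmod (v x * of_real (N k x) - (v x * of_real (b x)) * of_real (q k x)) = cmod (v x) * \<bar>N k x - q k x * b x\<bar>"
        by (metis (no_types, opaque_lifting) mult.assoc mult.commute norm_mult norm_of_real of_real_diff of_real_mult right_diff_distrib)
      also have "\<dots> \<le> cmod (v x) * (?c / real k * (1 + q k x))"
        by (intro mult_left_mono le) auto
      finally show "cmod (v x * of_real (N k x) - (v x * of_real (b x)) * of_real (q k x)) \<le>
        ?c / real k * (cmod (v x) + cmod (v x) * q k x)"
        by (simp add: algebra_simps add_divide_distrib)
    qed
    also have "\<dots> = ?c / real k * (?I + (LINT x:K|lborel. cmod (v x) * q k x))"
      by (simp add: set_integral_add(2)[OF i3 i4])
    also have "\<dots> \<le> ?c / real k * (?I + M)" using bound[OF k] by (intro mult_left_mono) auto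
    finally show ?thesis by simp
  qed
  then show ?thesis by blast
qed

context local_model
begin

lemma lagrangian_frame: "y \<in> D \<Longrightarrow> lagrangian_frame (\<omega> (f y)) (df y) (Q y)"
  using \<omega>_pos f_\<Omega> linear_df df_inj lag Q by (auto simp: lagrangian_frame_def)

text \<open>Q is chosen point by point, without continuity. This formula expresses its Jacobian
  through omega and f', which are continuous, and so makes the limit density integrable.\<close>

lemma jac_Q_eq: "y \<in> D \<Longrightarrow> jac (Q y) = 1 / sqrt (liouville_coeff (\<omega> (f y)) * jac (complexify (df y)))"
proof -
  assume y: "y \<in> D"
  interpret lagrangian_frame "\<omega> (f y)" "df y" "Q y" by (rule lagrangian_frame[OF y])
  have "liouville_coeff (\<omega> (f y)) * jac (complexify (df y)) = 1 / (jac (Q y))\<^sup>2"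
    using liouville_coeff_jac jac_Q_pos by (simp add: field_simps)
  then show ?thesis using jac_Q_pos by (simp add: real_sqrt_divide)
qed

lemma continuous_on_liouville_coeff: "continuous_on \<Omega> (\<lambda>x. liouville_coeff (\<omega> x))"
  unfolding liouville_coeff_def pfaffian_def
  by (intro continuous_intros \<omega>_cont) auto

lemma continuous_on_jac_complexify: "continuous_on D (\<lambda>y. jac (complexify (df y)))"
proof -
  have "continuous_on D (\<lambda>y. Jac \<Phi> (Complex_vec (y, 0)))"
    by (rule continuous_on_compose2[OF continuous_on_Jac[OF open_D' \<Phi>_Ck]])
      (auto intro!: linear_continuous_on_compose[OF _ linear_Complex_vec] continuous_intros)
  then show ?thesis by (rule continuous_on_eq) (simp add: frechet_\<Phi>_real)
qed

lemma continuous_on_jac_Q: "continuous_on D (\<lambda>y. jac (Q y))"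
proof -
  have pos: "0 < liouville_coeff (\<omega> (f y)) * jac (complexify (df y))" if y: "y \<in> D" for y
  proof -
    interpret lagrangian_frame "\<omega> (f y)" "df y" "Q y" by (rule lagrangian_frame[OF y])
    show ?thesis using liouville_coeff_jac jac_Q_pos
      by (metis mult_eq_0_iff zero_less_mult_pos2 zero_less_one zero_less_power)
  qed
  have "continuous_on D (\<lambda>y. 1 / sqrt (liouville_coeff (\<omega> (f y)) * jac (complexify (df y))))"
    by (intro continuous_intros continuous_on_jac_complexify
        continuous_on_compose2[OF continuous_on_liouville_coeff Ck_imp_continuous_on[OF f_Ck]])
      (use f_\<Omega> pos in fastforce)+
  then show ?thesis by (rule continuous_on_eq) (simp add: jac_Q_eq)
qed

text \<open>\<open>N\<close> stands for the true density of the section, which matches the model up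
  to an absolute and a relative error of order 1/k. W is a ball on which a bump equals 1, so that
  the masses of the model can be controlled.\<close>

theorem local_density_asymptotics:
  assumes y0: "y0 \<in> D" and inj: "inj_on f D" and b: "Ck 2 \<Omega> (b :: complex^'n \<Rightarrow> real)"
  obtains W where "open W" "f y0 \<in> W" "W \<subseteq> \<Omega>"
    "\<And>v K N C. Ck 2 \<Omega> v \<Longrightarrow> compact K \<Longrightarrow> K \<subseteq> W \<Longrightarrow> (\<And>x. x \<notin> K \<Longrightarrow> v x = 0) \<Longrightarrow>
       (\<And>k. 1 \<le> k \<Longrightarrow> continuous_on K (N k)) \<Longrightarrow>
       (\<And>k x. 1 \<le> k \<Longrightarrow> x \<in> K \<Longrightarrow> \<bar>N k x - sqrt (real k / (2 * pi)) ^ CARD('n) * exp (- real k * \<phi> x) * b x\<bar>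
          \<le> C / real k * (1 + sqrt (real k / (2 * pi)) ^ CARD('n) * exp (- real k * \<phi> x))) \<Longrightarrow>
       set_integrable lborel D (\<lambda>y. v (f y) * of_real (b (f y) * (jac (complexify (df y)) * jac (Q y) / sqrt 2 ^ CARD('n)))) \<and>
       (\<exists>C'. \<forall>k\<ge>1. cmod ((LINT x:K|lborel. v x * of_real (N k x)) -
          (LINT y:D|lborel. v (f y) * of_real (b (f y) * (jac (complexify (df y)) * jac (Q y) / sqrt 2 ^ CARD('n))))) \<le> C' / real k)"
proof -
  obtain W' Y where W': "open W'" "f y0 \<in> W'" "W' \<subseteq> \<Omega>" and Y: "compact Y" "Y \<subseteq> D"
    "\<And>x. x \<in> W' \<Longrightarrow> \<phi> x = 0 \<Longrightarrow> x \<in> f ` Y"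
    and asym: "\<And>a. Ck 2 \<Omega> a \<Longrightarrow> (\<And>x. x \<notin> W' \<Longrightarrow> a x = 0) \<Longrightarrow>
      \<exists>C. \<forall>k\<ge>1. cmod (of_real (sqrt (k / (2 * pi)) ^ CARD('n)) * (LINT x:W'|lborel. a x * of_real (exp (- k * \<phi> x)))
        - (LINT y:Y|lborel. a (f y) * of_real (jac (complexify (df y)) * jac (Q y) / sqrt 2 ^ CARD('n)))) \<le> C / k"
  proof (rule local_asymptotics[OF y0], goal_cases)
    case (1 W Y)
    show thesis using 1(2-8) by (rule 1(1))
  qed
  let ?l = "\<lambda>k::nat. sqrt (real k / (2 * pi)) ^ CARD('n)"
  let ?\<rho> = "\<lambda>y. jac (complexify (df y)) * jac (Q y) / sqrt 2 ^ CARD('n)"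
  obtain R where R: "0 < R" "cball (f y0) R \<subseteq> W'" using W' open_contains_cball by meson
  define \<eta> where "\<eta> = euclidean_bump R (f y0)"
  have \<eta>0: "\<eta> x = 0" if "x \<notin> cball (f y0) R" for x
    using euclidean_bump_eq(2)[OF R(1), of x "f y0"] that by (simp add: \<eta>_def dist_norm norm_minus_commute)
  have \<eta>1: "\<eta> x = 1" if "x \<in> ball (f y0) (R / 2)" for x
    using euclidean_bump_eq(1)[OF R(1), of x "f y0"] that by (simp add: \<eta>_def dist_norm norm_minus_commute)
  have \<eta>pos: "0 \<le> \<eta> x" for x by (simp add: \<eta>_def euclidean_bump_def)
  have \<eta>: "Ck 2 \<Omega> \<eta>" unfolding \<eta>_def by (rule Ck_subset[OF euclidean_bump_Ck]) simp
  have \<phi>c: "continuous_on \<Omega> \<phi>" by (rule Ck_imp_continuous_on[OF \<phi>_Ck])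
  have fc: "continuous_on D f" by (rule Ck_imp_continuous_on[OF f_Ck])
  have int: "set_integrable lborel K u" if "compact K" "continuous_on K u"
    for u :: "complex^'n \<Rightarrow> 'b::{banach, second_countable_topology}" and K
    using borel_integrable_compact[OF that] by (simp add: set_integrable_def)
  \<comment> \<open>The uniform bound on the masses comes from \<open>asym\<close> itself, with a
    fixed bump as amplitude.\<close>
  obtain M where M: "\<And>k. 1 \<le> k \<Longrightarrow> ?l k * (LINT x:W'|lborel. \<eta> x * exp (- real k * \<phi> x)) \<le> M"
  proof -
    have "Ck 2 \<Omega> (\<lambda>x. complex_of_real (\<eta> x))" by (rule Ck_linear_compose[OF open_\<Omega> bounded_linear_of_real \<eta>])
    moreover have "complex_of_real (\<eta> x) = 0" if "x \<notin> W'" for x using that R(2) \<eta>0[of x] by (metis of_real_0 subsetD)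
    ultimately obtain C where C: "\<And>k. 1 \<le> k \<Longrightarrow> cmod (of_real (sqrt (k / (2 * pi)) ^ CARD('n)) * (LINT x:W'|lborel. of_real (\<eta> x) * of_real (exp (- k * \<phi> x)))
        - (LINT y:Y|lborel. of_real (\<eta> (f y)) * of_real (?\<rho> y))) \<le> C / k"
      using asym by blast
    let ?J = "LINT y:Y|lborel. complex_of_real (\<eta> (f y)) * of_real (?\<rho> y)"
    have "?l k * (LINT x:W'|lborel. \<eta> x * exp (- real k * \<phi> x)) \<le> cmod ?J + \<bar>C\<bar>" if k: "1 \<le> k" for k
    proof -
      have e: "(LINT x:W'|lborel. complex_of_real (\<eta> x) * of_real (exp (- real k * \<phi> x))) =
          of_real (LINT x:W'|lborel. \<eta> x * exp (- real k * \<phi> x))"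
        by (simp only: of_real_mult[symmetric] set_integral_complex_of_real)
      have "C / real k \<le> \<bar>C\<bar> / real k" by (intro divide_right_mono) auto
      also have "\<dots> \<le> \<bar>C\<bar>" using k by (simp add: divide_le_eq mult_le_cancel_left1)
      finally have "C / real k \<le> \<bar>C\<bar>" .
      then have "cmod (of_real (?l k * (LINT x:W'|lborel. \<eta> x * exp (- real k * \<phi> x))) - ?J) \<le> \<bar>C\<bar>"
        using C[of "real k"] k unfolding e of_real_mult by simp
      then have "cmod (of_real (?l k * (LINT x:W'|lborel. \<eta> x * exp (- real k * \<phi> x)))) \<le> cmod ?J + \<bar>C\<bar>"
        using norm_triangle_sub[of "of_real (?l k * (LINT x:W'|lborel. \<eta> x * exp (- real k * \<phi> x)))" ?J] by linarith
      then show ?thesis unfolding norm_of_real by linarith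
    qed
    then show thesis by (rule that)
  qed
  show thesis
  proof (rule that[of "ball (f y0) (R / 2)"])
    show "f y0 \<in> ball (f y0) (R / 2)" "ball (f y0) (R / 2) \<subseteq> \<Omega>"
      using R W'(3) by (auto simp: subset_iff)
    fix v :: "complex^'n \<Rightarrow> complex" and K and N :: "nat \<Rightarrow> complex^'n \<Rightarrow> real" and C :: real
    assume v: "Ck 2 \<Omega> v" and K: "compact K" "K \<subseteq> ball (f y0) (R / 2)" and v0: "\<And>x. x \<notin> K \<Longrightarrow> v x = 0"
      and N: "\<And>k. 1 \<le> k \<Longrightarrow> continuous_on K (N k)"
      and approx: "\<And>k x. 1 \<le> k \<Longrightarrow> x \<in> K \<Longrightarrow> \<bar>N k x - ?l k * exp (- real k * \<phi> x) * b x\<bar>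
          \<le> C / real k * (1 + ?l k * exp (- real k * \<phi> x))"
    have KW: "K \<subseteq> W'" using K(2) R by (auto simp: subset_iff)
    then have K\<Omega>: "K \<subseteq> \<Omega>" using W'(3) by blast
    have vc: "continuous_on K v" and bc: "continuous_on K b" and \<phi>K: "continuous_on K \<phi>"
      using Ck_imp_continuous_on[OF v] Ck_imp_continuous_on[OF b] \<phi>c K\<Omega> continuous_on_subset by blast+
    let ?g = "\<lambda>y. v (f y) * of_real (b (f y) * ?\<rho> y)"
    have vb: "Ck 2 \<Omega> (\<lambda>x. v x * of_real (b x))"
      by (intro Ck_mult open_\<Omega> v Ck_linear_compose[OF open_\<Omega> bounded_linear_of_real b])
    \<comment> \<open>If f y lies in K, it is a zero of the phase in W', hence a point of f(Y), and
      injectivity of f puts y into Y. Off K the amplitude is 0.\<close>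
    have ind: "indicator D y *\<^sub>R ?g y = indicator Y y *\<^sub>R ?g y" for y
    proof (cases "y \<in> D \<and> f y \<in> K")
      case True
      then have "f y \<in> f ` Y" using KW \<phi>0 by (intro Y(3)) auto
      then have "y \<in> Y" using True inj Y(2) by (auto dest: inj_onD)
      then show ?thesis using True by simp
    next
      case False
      then show ?thesis using v0[of "f y"] Y(2) by (cases "y \<in> Y") auto
    qed
    have "continuous_on D (\<lambda>y. v (f y) * of_real (b (f y) * ?\<rho> y))"
      by (intro continuous_intros continuous_on_jac_complexify continuous_on_jac_Q
          continuous_on_compose2[OF Ck_imp_continuous_on[OF v] fc f_\<Omega>]
          continuous_on_compose2[OF Ck_imp_continuous_on[OF b] fc f_\<Omega>]) auto
    from borel_integrable_compact[OF Y(1) continuous_on_subset[OF this Y(2)]]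
    have intD: "set_integrable lborel D ?g"
      unfolding set_integrable_def ind .
    have eqD: "(LINT y:D|lborel. ?g y) = (LINT y:Y|lborel. (v (f y) * of_real (b (f y))) * of_real (?\<rho> y))"
      unfolding set_lebesgue_integral_def ind by (simp only: of_real_mult mult.assoc)
    obtain C1 where C1: "\<And>k. 1 \<le> k \<Longrightarrow> cmod (of_real (sqrt (k / (2 * pi)) ^ CARD('n)) * (LINT x:W'|lborel. (v x * of_real (b x)) * of_real (exp (- k * \<phi> x)))
        - (LINT y:Y|lborel. (v (f y) * of_real (b (f y))) * of_real (?\<rho> y))) \<le> C1 / k"
    proof -
      have "v x * of_real (b x) = 0" if "x \<notin> W'" for x using v0[of x] that KW by auto
      from asym[OF vb this] show thesis using that by blast
    qed
    have toK: "(LINT x:W'|lborel. (v x * of_real (b x)) * of_real (exp (- k * \<phi> x))) =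
        (LINT x:K|lborel. (v x * of_real (b x)) * of_real (exp (- k * \<phi> x)))" for k
      unfolding set_lebesgue_integral_def
      by (rule Bochner_Integration.integral_cong[OF refl]) (use v0 KW in \<open>auto simp: indicator_def\<close>)
    obtain m where m: "\<And>x. x \<in> K \<Longrightarrow> cmod (v x) \<le> m" "0 \<le> m"
    proof -
      have "bounded (v ` K)" by (rule compact_imp_bounded[OF compact_continuous_image[OF vc K(1)]])
      then obtain m where "\<And>x. x \<in> K \<Longrightarrow> cmod (v x) \<le> m" by (auto simp: bounded_iff)
      then show thesis by (intro that[of "max m 0"]) (auto simp: le_max_iff_disj)
    qed
    have bound: "(LINT x:K|lborel. cmod (v x) * (?l k * exp (- real k * \<phi> x))) \<le> m * M" if k: "1 \<le> k" for k
    proof -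
      have iW: "set_integrable lborel W' (\<lambda>x. \<eta> x * exp (- real k * \<phi> x))"
      proof -
        have "set_integrable lborel (cball (f y0) R) (\<lambda>x. \<eta> x * exp (- real k * \<phi> x))"
          using R W'(3) by (intro int continuous_intros continuous_on_subset[OF \<phi>c]
             continuous_on_subset[OF Ck_imp_continuous_on[OF \<eta>]]) auto
        moreover have "indicator W' x *\<^sub>R (\<eta> x * exp (- real k * \<phi> x)) =
            indicator (cball (f y0) R) x *\<^sub>R (\<eta> x * exp (- real k * \<phi> x))" for x
          using R(2) \<eta>0[of x] by (cases "x \<in> cball (f y0) R") auto
        ultimately show ?thesis by (simp only: set_integrable_def)
      qed
      have "(LINT x:K|lborel. cmod (v x) * (?l k * exp (- real k * \<phi> x))) \<le>
          (LINT x:W'|lborel. m * ?l k * (\<eta> x * exp (- real k * \<phi> x)))"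
        unfolding set_lebesgue_integral_def
      proof (rule integral_mono)
        have "continuous_on K (\<lambda>x. cmod (v x) * (?l k * exp (- real k * \<phi> x)))"
          by (intro continuous_intros vc \<phi>K)
        from int[OF K(1) this]
        show "integrable lborel (\<lambda>x. indicator K x *\<^sub>R (cmod (v x) * (?l k * exp (- real k * \<phi> x))))"
          by (simp add: set_integrable_def)
        show "integrable lborel (\<lambda>x. indicator W' x *\<^sub>R (m * ?l k * (\<eta> x * exp (- real k * \<phi> x))))"
          using set_integrable_mult_right[OF iW, of "m * ?l k"] by (simp add: set_integrable_def)
        fix x
        have nn: "0 \<le> m * ?l k * (\<eta> x * exp (- real k * \<phi> x))" using m(2) \<eta>pos[of x] by simp
        show "indicator K x *\<^sub>R (cmod (v x) * (?l k * exp (- real k * \<phi> x))) \<le>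
          indicator W' x *\<^sub>R (m * ?l k * (\<eta> x * exp (- real k * \<phi> x)))"
        proof (cases "x \<in> K")
          case True
          then have "\<eta> x = 1" "x \<in> W'" using \<eta>1 K(2) KW by auto
          moreover have "cmod (v x) * (?l k * exp (- real k * \<phi> x)) \<le> m * (?l k * exp (- real k * \<phi> x))"
            using m(1)[OF True] by (intro mult_right_mono) auto
          ultimately show ?thesis using True by (simp add: mult.assoc)
        next
          case False
          then show ?thesis using nn by (simp add: indicator_def)
        qed
      qed
      also have "\<dots> = m * (?l k * (LINT x:W'|lborel. \<eta> x * exp (- real k * \<phi> x)))" by (simp add: mult.assoc)
      also have "\<dots> \<le> m * M" by (intro mult_left_mono M k m)
      finally show ?thesis .
    qed
    have "\<exists>C2. \<forall>k\<ge>1. cmod ((LINT x:K|lborel. v x * of_real (N k x)) -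
      (LINT x:K|lborel. (v x * of_real (b x)) * of_real (?l k * exp (- real k * \<phi> x)))) \<le> C2 / real k"
      by (rule perturbed_integral_bound[OF K(1) vc bc N _ _ approx bound])
        (auto intro!: continuous_intros \<phi>K)
    then obtain C2 where C2: "\<And>k. 1 \<le> k \<Longrightarrow> cmod ((LINT x:K|lborel. v x * of_real (N k x)) -
      (LINT x:K|lborel. (v x * of_real (b x)) * of_real (?l k * exp (- real k * \<phi> x)))) \<le> C2 / real k" by blast
    have "cmod ((LINT x:K|lborel. v x * of_real (N k x)) - (LINT y:D|lborel. ?g y)) \<le> (C1 + C2) / real k"
      if k: "1 \<le> k" for k
    proof -
      have "(LINT x:K|lborel. (v x * of_real (b x)) * of_real (?l k * exp (- real k * \<phi> x))) =
        of_real (?l k) * (LINT x:W'|lborel. (v x * of_real (b x)) * of_real (exp (- real k * \<phi> x)))"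
        unfolding toK set_integral_mult_right[symmetric] by (simp only: of_real_mult mult_ac)
      then have "cmod ((LINT x:K|lborel. (v x * of_real (b x)) * of_real (?l k * exp (- real k * \<phi> x))) - (LINT y:D|lborel. ?g y)) \<le> C1 / real k"
        using C1[of "real k"] k unfolding eqD by simp
      with C2[OF k] norm_triangle_ineq[of "(LINT x:K|lborel. v x * of_real (N k x)) -
        (LINT x:K|lborel. (v x * of_real (b x)) * of_real (?l k * exp (- real k * \<phi> x)))"
        "(LINT x:K|lborel. (v x * of_real (b x)) * of_real (?l k * exp (- real k * \<phi> x))) - (LINT y:D|lborel. ?g y)"]
      show ?thesis by (simp add: add_divide_distrib)
    qed
    with intD show "set_integrable lborel D ?g \<and> (\<exists>C'. \<forall>k\<ge>1. cmod ((LINT x:K|lborel. v x * of_real (N k x)) - (LINT y:D|lborel. ?g y)) \<le> C' / real k)"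
      by blast
  qed auto
qed

end

section \<open>Sections in local frames\<close>

text \<open>Frees the norm from the frame picked in its definition.\<close>

lemma section_norm_frame:
  assumes i: "p \<in> bdom E i"
    and w: "\<And>j. p \<in> bdom E j \<Longrightarrow> bweight E j p = bweight E i p * (cmod (btrans E i j p))\<^sup>2"
    and s: "\<And>j. p \<in> bdom E j \<Longrightarrow> s i p = btrans E i j p * s j p"
  shows "section_norm E s p = sqrt (bweight E i p) * cmod (s i p)"
proof -
  define j where "j = (SOME j. p \<in> bdom E j)"
  have j: "p \<in> bdom E j" unfolding j_def using i by (rule someI)
  show ?thesis
    unfolding section_norm_def Let_def j_def[symmetric] w[OF j] s[OF j]
    by (simp add: real_sqrt_mult norm_mult)
qed

lemma hermitian_bundleD:
  assumes "hermitian_bundle A S E"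
  shows "open (bdom E i)" "(\<Union>i. bdom E i) = S"
    "p \<in> bdom E i \<Longrightarrow> bweight E i p > 0"
    "p \<in> bdom E i \<Longrightarrow> p \<in> bdom E j \<Longrightarrow> bweight E j p = bweight E i p * (cmod (btrans E i j p))\<^sup>2"
    "c \<in> A \<Longrightarrow> smooth_on (snd c ` (fst c \<inter> bdom E i)) (bweight E i \<circ> chart_inv c)"
  using assms unfolding hermitian_bundle_def by blast+

lemma smooth_sectionD:
  assumes "smooth_section A E S s"
  shows "p \<in> S \<Longrightarrow> p \<in> bdom E i \<Longrightarrow> p \<in> bdom E j \<Longrightarrow> s i p = btrans E i j p * s j p"
    "c \<in> A \<Longrightarrow> smooth_on (snd c ` (fst c \<inter> (S \<inter> bdom E i))) (s i \<circ> chart_inv c)"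
  using assms unfolding smooth_section_def by blast+

lemma section_norm_hermitian:
  assumes "hermitian_bundle A S' E" "smooth_section A E S s" "p \<in> S" "p \<in> bdom E i"
  shows "section_norm E s p = sqrt (bweight E i p) * cmod (s i p)"
  using hermitian_bundleD(4)[OF assms(1,4)] smooth_sectionD(1)[OF assms(2,3,4)]
  by (intro section_norm_frame assms(4))

lemma Ck_chart_imp_continuous_on:
  assumes c: "is_chart c" and f: "Ck n (snd c ` (fst c \<inter> S)) (f \<circ> chart_inv c)"
  shows "continuous_on (fst c \<inter> S) f"
proof -
  have "continuous_on (fst c \<inter> S) (\<lambda>p. (f \<circ> chart_inv c) (snd c p))"
    by (rule continuous_on_compose2[OF Ck_imp_continuous_on[OF f] continuous_on_subset[OF is_chartD(3)[OF c]]]) auto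
  then show ?thesis by (rule continuous_on_eq) (simp add: is_chartD(5)[OF c])
qed

lemmas smooth_chart_imp_continuous_on = Ck_chart_imp_continuous_on[OF _ smooth_on_imp_Ck[of _ _ 0]]

lemma norm_square_diff_le:
  fixes x y :: "'a::real_normed_vector"
  assumes "norm (x - y) \<le> r"
  shows "\<bar>(norm x)\<^sup>2 - (norm y)\<^sup>2\<bar> \<le> r * (2 * norm y + r)"
proof -
  have d: "\<bar>norm x - norm y\<bar> \<le> r" using norm_triangle_ineq3[of x y] assms by linarith
  have "\<bar>(norm x)\<^sup>2 - (norm y)\<^sup>2\<bar> = \<bar>norm x - norm y\<bar> * (norm x + norm y)"
    by (simp add: power2_eq_square square_diff_square_factored abs_mult mult.commute)
  also have "\<dots> \<le> r * (2 * norm y + r)"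
    using d by (intro mult_mono) auto
  finally show ?thesis .
qed

lemma compact_norm_bounded:
  fixes f :: "'a::topological_space \<Rightarrow> 'b::real_normed_vector"
  assumes "compact K" "continuous_on K f"
  obtains m where "0 \<le> m" "\<And>x. x \<in> K \<Longrightarrow> norm (f x) \<le> m"
proof -
  have "bounded (f ` K)" by (rule compact_imp_bounded[OF compact_continuous_image[OF assms(2,1)]])
  then obtain m where "\<And>x. x \<in> K \<Longrightarrow> norm (f x) \<le> m" by (auto simp: bounded_iff)
  then show thesis by (intro that[of "max m 0"]) (auto simp: le_max_iff_disj)
qed

lemma Ck_imp_differentiable:
  assumes "Ck n S f" "0 < n" "x \<in> S" shows "f differentiable at x"
  using Ck_mono[OF assms(1), of 1] assms(2,3) Ck_Suc_has_derivative[of 0 S f x]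
  by (auto simp: differentiable_def)

lemma tangent_map_compose:
  assumes c: "is_chart c" and d: "is_chart d" and S: "open S" "p \<in> S" "S \<subseteq> fst c" "f ` S \<subseteq> fst d"
    and f: "(snd d \<circ> f \<circ> chart_inv c) differentiable at (snd c p)"
    and h: "(snd e \<circ> h \<circ> chart_inv d) differentiable at (snd d (f p))"
  shows "tangent_map c e (h \<circ> f) p v = tangent_map d e h (f p) (tangent_map c d f p v)"
proof -
  let ?f = "snd d \<circ> f \<circ> chart_inv c" and ?h = "snd e \<circ> h \<circ> chart_inv d"
  have pc: "chart_inv c (snd c p) = p" using S is_chartD(5)[OF c] by auto
  have "(?f has_derivative frechet_derivative ?f (at (snd c p))) (at (snd c p))"
    using f by (simp add: frechet_derivative_works)
  moreover have "(?h has_derivative frechet_derivative ?h (at (snd d (f p)))) (at (?f (snd c p)))"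
    using h by (simp add: frechet_derivative_works pc)
  ultimately have "((\<lambda>x. ?h (?f x)) has_derivative (\<lambda>v. frechet_derivative ?h (at (snd d (f p))) (frechet_derivative ?f (at (snd c p)) v))) (at (snd c p))"
    by (rule has_derivative_compose)
  moreover have "open (snd c ` (fst c \<inter> S))" "snd c p \<in> snd c ` (fst c \<inter> S)"
    using open_chart_image[OF c S(1)] S by auto
  moreover have "?h (?f x) = (snd e \<circ> (h \<circ> f) \<circ> chart_inv c) x" if "x \<in> snd c ` (fst c \<inter> S)" for x
    using that S(4) is_chartD(5)[OF c] is_chartD(5)[OF d] by auto
  ultimately have "((snd e \<circ> (h \<circ> f) \<circ> chart_inv c) has_derivative (\<lambda>v. frechet_derivative ?h (at (snd d (f p))) (frechet_derivative ?f (at (snd c p)) v))) (at (snd c p))"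
    by (rule has_derivative_transform_within_open)
  from fun_cong[OF frechet_derivative_at[OF this], of v]
  show ?thesis by (simp add: tangent_map_def)
qed

section \<open>The local data of a Lagrangian section\<close>

text \<open>The witnesses in \<open>lagrangian_section\<close> are fixed here; the flat unitary
  section enters through the condition |F| = 1 along Gamma.\<close>

locale lagrangian_state =
  fixes A :: "('m::t2_space, complex^'n) chart set"
    and \<omega> :: "('m, complex^'n) two_form"
    and L :: "('m, 'a, complex^'n) conn_bundle"
    and K :: "('m, 'b, complex^'n) conn_bundle"
    and B :: "('g::t2_space, real^'n) chart set"
    and \<iota> :: "'g \<Rightarrow> 'm"
    and U V :: "'m set"
    and L1 :: "('m, 'c, complex^'n) conn_bundle"
    and \<delta> :: "('m, 'd, complex^'n) conn_bundle"
    and \<phi> :: "('m, complex^'n) chart \<Rightarrow> 'd \<Rightarrow> 'm \<Rightarrow> complex"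
    and \<tau> :: "'b \<Rightarrow> 'c \<times> 'd \<Rightarrow> 'm \<Rightarrow> complex"
    and g0 :: "('g, 'b) bsec"
    and \<Psi> :: "nat \<Rightarrow> ('m, 'a \<times> 'b) bsec"
    and F :: "('m, 'a) bsec" and gt gl :: "nat \<Rightarrow> ('m, 'b) bsec"
  assumes kaehler: "compact_connected_kaehler A \<omega>"
    and prequantum: "prequantum_bundle A \<omega> L"
    and K: "hermitian_holomorphic_bundle A UNIV K"
    and embedding: "closed_lagrangian_embedding A \<omega> B \<iota>"
    and U: "open U" and V: "open V" "V \<subseteq> U"
    and half_form: "half_form_bundle A \<omega> U \<delta> \<phi>"
    and L1: "hermitian_holomorphic_bundle A U L1"
    and \<tau>: "bundle_iso A U (bundle_tensor L1 \<delta>) K \<tau>"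
    and \<Psi>: "\<And>k. 1 \<le> k \<Longrightarrow> holomorphic_section A (quantum_bundle L K k) (\<Psi> k)"
    and g0: "smooth_section B (bundle_pullback A \<iota> K :: ('g, 'b, real^'n) conn_bundle) (\<iota> -` U) g0"
    and F: "smooth_section A L U F"
    and F_flat: "dbar_flat_along A L U (range \<iota>) F"
    and F_less: "\<And>x. x \<in> U - range \<iota> \<Longrightarrow> section_norm L F x < 1"
    and F_one: "\<And>p. \<iota> p \<in> U \<Longrightarrow> section_norm L F (\<iota> p) = 1"
    and gt: "\<And>k. 1 \<le> k \<Longrightarrow> smooth_section A K U (gt k)"
    and gl: "smooth_section A K U (gl 0)"
    and expansion: "asymptotic_expansion A K U gt gl"
    and gl_g0: "\<And>j p. \<iota> p \<in> U \<Longrightarrow> \<iota> p \<in> bdom K j \<Longrightarrow> gl 0 j (\<iota> p) = g0 j p"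
    and remainder: "\<And>N. \<exists>C. \<forall>k\<ge>1. \<forall>x\<in>V.
           section_norm (quantum_bundle L K k)
             (\<lambda>ij p. \<Psi> k ij p - of_real ((real k / (2 * pi)) powr (real CARD('n) / 4)) *
                section_tensor (section_power F k) (gt k) ij p) x
           \<le> C / real k ^ N"
begin

lemma atlas_A: "smooth_atlas A" and compact_M: "compact (UNIV :: 'm set)"
  and atlas_B: "smooth_atlas B" and compact_G: "compact (UNIV :: 'g set)"
  and \<iota>_smooth: "smooth_map B A \<iota>"
  using kaehler embedding
  unfolding compact_connected_kaehler_def complex_atlas_def closed_lagrangian_embedding_def by blast+

lemma positive_\<omega>: "c \<in> A \<Longrightarrow> p \<in> fst c \<Longrightarrow> positive_form (\<omega> c p)"
  using kaehler
  unfolding compact_connected_kaehler_def kaehler_form_def smooth_two_form_def positive_form_def by blast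

lemma hermitian_L: "hermitian_bundle A UNIV L" and hermitian_K: "hermitian_bundle A UNIV K"
  and hermitian_L1: "hermitian_bundle A U L1" and hermitian_\<delta>: "hermitian_bundle A U \<delta>"
  using prequantum K L1 half_form
  unfolding prequantum_bundle_def hermitian_holomorphic_bundle_def half_form_bundle_def by blast+

text \<open>\<open>N\<close>, \<open>q\<close> and \<open>a0\<close> are the squared norms of Psi_k,
  of F and of the leading coefficient. The last two are written in a frame, since they are
  differentiated in charts.\<close>

definition N :: "nat \<Rightarrow> 'm \<Rightarrow> real" where "N k p = (section_norm (quantum_bundle L K k) (\<Psi> k) p)\<^sup>2"

definition q :: "'a \<Rightarrow> 'm \<Rightarrow> real" where "q i p = bweight L i p * (cmod (F i p))\<^sup>2"

definition a0 :: "'b \<Rightarrow> 'm \<Rightarrow> real" where "a0 j p = bweight K j p * (cmod (gl 0 j p))\<^sup>2"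

text \<open>Applied to Psi_k and also to the remainder, which is a section over U; hence the
  transformation rule is asked at the single point p.\<close>

lemma quantum_section_norm:
  assumes p: "p \<in> bdom L i" "p \<in> bdom K j"
    and s: "\<And>i' j'. p \<in> bdom L i' \<Longrightarrow> p \<in> bdom K j' \<Longrightarrow>
      s (i, j) p = btrans L i i' p ^ k * btrans K j j' p * s (i', j') p"
  shows "section_norm (quantum_bundle L K k) s p = sqrt (bweight L i p ^ k * bweight K j p) * cmod (s (i, j) p)"
proof -
  have "section_norm (quantum_bundle L K k) s p = sqrt (bweight (quantum_bundle L K k) (i, j) p) * cmod (s (i, j) p)"
  proof (rule section_norm_frame)
    show "p \<in> bdom (quantum_bundle L K k) (i, j)" using p by (simp add: bundle_tensor_def bundle_power_def)
    fix ij assume ij: "p \<in> bdom (quantum_bundle L K k) ij"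
    obtain i' j' where e: "ij = (i', j')" by (cases ij)
    have p': "p \<in> bdom L i'" "p \<in> bdom K j'" using ij by (auto simp: e bundle_tensor_def bundle_power_def)
    show "s (i, j) p = btrans (quantum_bundle L K k) (i, j) ij p * s ij p"
      using s[OF p'] by (simp add: e bundle_tensor_def bundle_power_def)
    show "bweight (quantum_bundle L K k) ij p = bweight (quantum_bundle L K k) (i, j) p * (cmod (btrans (quantum_bundle L K k) (i, j) ij p))\<^sup>2"
      by (simp add: e bundle_tensor_def bundle_power_def hermitian_bundleD(4)[OF hermitian_L p(1) p'(1)]
        hermitian_bundleD(4)[OF hermitian_K p(2) p'(2)] norm_mult norm_power power_mult_distrib mult_ac flip: power_mult)
  qed
  then show ?thesis by (simp add: bundle_tensor_def bundle_power_def)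
qed

lemma \<Psi>_transition:
  assumes "1 \<le> k" "p \<in> bdom L i" "p \<in> bdom K j" "p \<in> bdom L i'" "p \<in> bdom K j'"
  shows "\<Psi> k (i, j) p = btrans L i i' p ^ k * btrans K j j' p * \<Psi> k (i', j') p"
  using \<Psi>[OF assms(1)] smooth_sectionD(1)[of A "quantum_bundle L K k" UNIV "\<Psi> k" p "(i, j)" "(i', j')"] assms(2-)
  by (simp add: holomorphic_section_def bundle_tensor_def bundle_power_def)

lemma N_eq:
  assumes "1 \<le> k" "p \<in> bdom L i" "p \<in> bdom K j"
  shows "N k p = bweight L i p ^ k * bweight K j p * (cmod (\<Psi> k (i, j) p))\<^sup>2"
proof -
  have "0 \<le> bweight L i p ^ k * bweight K j p"
    using hermitian_bundleD(3)[OF hermitian_L assms(2)] hermitian_bundleD(3)[OF hermitian_K assms(3)] by simp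
  moreover have "section_norm (quantum_bundle L K k) (\<Psi> k) p = sqrt (bweight L i p ^ k * bweight K j p) * cmod (\<Psi> k (i, j) p)"
    by (rule quantum_section_norm[OF assms(2,3)]) (rule \<Psi>_transition[OF assms])
  ultimately show ?thesis by (simp add: N_def power_mult_distrib)
qed

lemma q_eq: "p \<in> U \<Longrightarrow> p \<in> bdom L i \<Longrightarrow> q i p = (section_norm L F p)\<^sup>2"
  using hermitian_bundleD(3)[OF hermitian_L, of p i]
  by (simp add: q_def section_norm_hermitian[OF hermitian_L F] power_mult_distrib)

lemma section_norm_nonneg: "p \<in> U \<Longrightarrow> p \<in> bdom L i \<Longrightarrow> 0 \<le> section_norm L F p"
  using hermitian_bundleD(3)[OF hermitian_L, of p i] by (simp add: section_norm_hermitian[OF hermitian_L F])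

lemma q_nonneg: "p \<in> bdom L i \<Longrightarrow> 0 \<le> q i p"
  using hermitian_bundleD(3)[OF hermitian_L, of p i] by (simp add: q_def)

lemma q_one: "\<iota> p \<in> U \<Longrightarrow> \<iota> p \<in> bdom L i \<Longrightarrow> q i (\<iota> p) = 1"
  by (simp add: q_eq F_one)

lemma q_less: "p \<in> U - range \<iota> \<Longrightarrow> p \<in> bdom L i \<Longrightarrow> q i p < 1"
  using F_less[of p] section_norm_nonneg[of p i] by (simp add: q_eq power_less_one_iff abs_less_iff power2_less_1_iff)

lemma q_le: "p \<in> U \<Longrightarrow> p \<in> bdom L i \<Longrightarrow> q i p \<le> 1"
  using q_less[of p i] q_one[of _ i] by (cases "p \<in> range \<iota>") (auto intro: less_imp_le)

lemma continuous_on_frame: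
  assumes "c \<in> A"
  shows "continuous_on (fst c \<inter> bdom L i) (bweight L i)" "continuous_on (fst c \<inter> bdom K j) (bweight K j)"
    "continuous_on (fst c \<inter> (U \<inter> bdom L i)) (F i)" "continuous_on (fst c \<inter> (U \<inter> bdom K j)) (gl 0 j)"
    "1 \<le> k \<Longrightarrow> continuous_on (fst c \<inter> (bdom L i \<inter> bdom K j)) (\<Psi> k (i, j))"
proof -
  note cc = smooth_atlas_chart[OF atlas_A assms]
  note cont = smooth_chart_imp_continuous_on[OF cc]
  show "continuous_on (fst c \<inter> bdom L i) (bweight L i)" "continuous_on (fst c \<inter> bdom K j) (bweight K j)"
    using hermitian_bundleD(5)[OF hermitian_L assms] hermitian_bundleD(5)[OF hermitian_K assms] by (auto intro: cont)
  show "continuous_on (fst c \<inter> (U \<inter> bdom L i)) (F i)" "continuous_on (fst c \<inter> (U \<inter> bdom K j)) (gl 0 j)"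
    using smooth_sectionD(2)[OF F assms] smooth_sectionD(2)[OF gl assms] by (auto intro: cont)
  show "continuous_on (fst c \<inter> (bdom L i \<inter> bdom K j)) (\<Psi> k (i, j))" if "1 \<le> k"
  proof -
    have "smooth_section A (quantum_bundle L K k) UNIV (\<Psi> k)" using \<Psi>[OF that] by (simp add: holomorphic_section_def)
    from smooth_sectionD(2)[OF this assms, of "(i, j)"] show ?thesis
      by (intro cont) (simp add: bundle_tensor_def bundle_power_def)
  qed
qed

lemma continuous_on_N:
  assumes "c \<in> A" "1 \<le> k"
  shows "continuous_on (fst c \<inter> (bdom L i \<inter> bdom K j)) (N k)"
proof -
  have "continuous_on (fst c \<inter> (bdom L i \<inter> bdom K j)) (\<lambda>p. bweight L i p ^ k * bweight K j p * (cmod (\<Psi> k (i, j) p))\<^sup>2)"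
    by (intro continuous_intros continuous_on_frame(5)[OF assms]
        continuous_on_subset[OF continuous_on_frame(1)[OF assms(1)]] continuous_on_subset[OF continuous_on_frame(2)[OF assms(1)]]) auto
  then show ?thesis by (rule continuous_on_eq) (simp add: N_eq[OF assms(2), where i=i and j=j])
qed

text \<open>A crude bound, which keeps the exponents integral; the remainder is small enough to
  afford it.\<close>

lemma scale_bounds: "1 \<le> k \<Longrightarrow> 0 \<le> sqrt (real k / (2 * pi)) ^ CARD('n) \<and> sqrt (real k / (2 * pi)) ^ CARD('n) \<le> real k ^ CARD('n)"
proof -
  assume k: "1 \<le> k"
  have "real k / (2 * pi) \<le> real k"
    using k pi_gt3 by (simp add: divide_le_eq mult_le_cancel_left1)
  also have "\<dots> \<le> (real k)\<^sup>2" using k by (simp add: power2_eq_square)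
  finally have "sqrt (real k / (2 * pi)) \<le> real k" by (simp add: real_le_lsqrt)
  then show ?thesis by (auto intro!: power_mono)
qed

lemma scale_powr: "1 \<le> k \<Longrightarrow> ((real k / (2 * pi)) powr (real CARD('n) / 4))\<^sup>2 = sqrt (real k / (2 * pi)) ^ CARD('n)"
proof -
  assume k: "1 \<le> k"
  have "((real k / (2 * pi)) powr (real CARD('n) / 4))\<^sup>2 = (real k / (2 * pi)) powr (1 / 2 * real CARD('n))"
    by (simp add: power2_eq_square powr_add[symmetric])
  also have "\<dots> = ((real k / (2 * pi)) powr (1 / 2)) powr real CARD('n)" by (simp add: powr_powr)
  also have "\<dots> = sqrt (real k / (2 * pi)) ^ CARD('n)" using k by (simp add: powr_half_sqrt powr_realpow)
  finally show ?thesis .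
qed

text \<open>Psi_k differs from its model by O(k^(-n-1)), and \<open>gt k\<close> from
  \<open>gl 0\<close> by O(1/k). The second error is multiplied by |F|^(2k) and the prefactor, which
  gives the relative part of the bound.\<close>

lemma density_approximation:
  assumes c: "c \<in> A" and K0: "compact K0" "K0 \<subseteq> fst c \<inter> bdom L i \<inter> bdom K j \<inter> V"
  obtains C where "\<And>k p. 1 \<le> k \<Longrightarrow> p \<in> K0 \<Longrightarrow> \<bar>N k p - sqrt (real k / (2 * pi)) ^ CARD('n) * q i p ^ k * a0 j p\<bar> \<le> C / real k * (1 + sqrt (real k / (2 * pi)) ^ CARD('n) * q i p ^ k)"
proof -
  have cw: "continuous_on K0 (bweight K j)"
    by (rule continuous_on_subset[OF continuous_on_frame(2)[OF c]]) (use K0(2) in blast)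
  have cg: "continuous_on K0 (gl 0 j)"
    by (rule continuous_on_subset[OF continuous_on_frame(4)[OF c]]) (use K0(2) V(2) in blast)
  obtain m1 where m1: "0 \<le> m1" "\<And>p. p \<in> K0 \<Longrightarrow> norm (bweight K j p) \<le> m1" using compact_norm_bounded[OF K0(1) cw] by metis
  obtain m2 where m2: "0 \<le> m2" "\<And>p. p \<in> K0 \<Longrightarrow> norm (gl 0 j p) \<le> m2" using compact_norm_bounded[OF K0(1) cg] by metis
  \<comment> \<open>The power n + 1 makes up for the factor k^n by which the cross term can
    grow.\<close>
  obtain C1' where C1': "\<And>k x. 1 \<le> k \<Longrightarrow> x \<in> V \<Longrightarrow> section_norm (quantum_bundle L K k)
             (\<lambda>ij p. \<Psi> k ij p - of_real ((real k / (2 * pi)) powr (real CARD('n) / 4)) *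
                section_tensor (section_power F k) (gt k) ij p) x \<le> C1' / real k ^ Suc CARD('n)"
    using remainder by blast
  define C1 where "C1 = max C1' 0"
  have "K0 \<subseteq> fst c \<inter> bdom K j \<inter> U" using K0(2) V(2) by blast
  \<comment> \<open>The expansion is broken off after its leading term, and the empty list means
    that no derivatives are taken.\<close>
  then have "\<exists>C2. \<forall>k\<ge>1. \<forall>p\<in>K0. cmod (iter_deriv [] ((\<lambda>q. gt k j q - (\<Sum>l<1. gl l j q / of_nat k ^ l)) \<circ> chart_inv c) (snd c p)) \<le> C2 / real k ^ 1"
    using expansion c K0(1) unfolding asymptotic_expansion_def by blast
  then obtain C2' where *: "\<forall>k\<ge>1. \<forall>p\<in>K0. cmod (iter_deriv [] ((\<lambda>q. gt k j q - (\<Sum>l<1. gl l j q / of_nat k ^ l)) \<circ> chart_inv c) (snd c p)) \<le> C2' / real k ^ 1"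
    by blast
  have C2': "cmod (gt k j p - gl 0 j p) \<le> C2' / real k" if k: "1 \<le> k" and p: "p \<in> K0" for k p
  proof -
    have "chart_inv c (snd c p) = p" using p K0(2) is_chartD(5)[OF smooth_atlas_chart[OF atlas_A c]] by blast
    then show ?thesis using *[rule_format, OF k p] by simp
  qed
  define C2 where "C2 = max C2' 0"
  have C0: "0 \<le> C1" "0 \<le> C2" by (auto simp: C1_def C2_def)
  \<comment> \<open>\<open>C3\<close> controls the change of |gt|^2, \<open>M\<close> the squared
    model without its factor k^n, and \<open>C4\<close> the difference of squares caused by the
    remainder.\<close>
  define C3 where "C3 = C2 * (2 * m2 + C2)"
  define M where "M = m1 * (m2\<^sup>2 + C3)"
  have C3: "0 \<le> C3" and M: "0 \<le> M" using C0 m1(1) m2(1) by (auto simp: C3_def M_def)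
  define C4 where "C4 = C1 * (2 * (1 + M) + C1)"
  have C4: "0 \<le> C4" using C0 M by (auto simp: C4_def)
  have "\<bar>N k p - sqrt (real k / (2 * pi)) ^ CARD('n) * q i p ^ k * a0 j p\<bar> \<le> (C4 + m1 * C3) / real k * (1 + sqrt (real k / (2 * pi)) ^ CARD('n) * q i p ^ k)"
    if k: "1 \<le> k" and p: "p \<in> K0" for k p
  proof -
    have pd: "p \<in> bdom L i" "p \<in> bdom K j" "p \<in> V" "p \<in> U" using p K0(2) V(2) by auto
    have k0: "0 < real k" "1 \<le> real k" using k by auto
    let ?\<mu> = "(real k / (2 * pi)) powr (real CARD('n) / 4)"
    let ?w = "bweight L i p ^ k * bweight K j p"
    have w0: "0 \<le> ?w" "0 \<le> bweight K j p"
      using hermitian_bundleD(3)[OF hermitian_L pd(1)] hermitian_bundleD(3)[OF hermitian_K pd(2)] by auto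
    let ?X = "of_real (sqrt ?w) * \<Psi> k (i, j) p"
    let ?Y = "of_real (sqrt ?w) * (of_real ?\<mu> * (F i p ^ k * gt k j p))"
    let ?s = "\<lambda>ij p. \<Psi> k ij p - of_real ?\<mu> * section_tensor (section_power F k) (gt k) ij p"
    have "section_norm (quantum_bundle L K k) ?s p = sqrt ?w * cmod (?s (i, j) p)"
    proof (rule quantum_section_norm[OF pd(1,2)])
      fix i' j' assume p': "p \<in> bdom L i'" "p \<in> bdom K j'"
      show "?s (i, j) p = btrans L i i' p ^ k * btrans K j j' p * ?s (i', j') p"
        unfolding \<Psi>_transition[OF k pd(1,2) p']
        by (simp add: section_tensor_def section_power_def smooth_sectionD(1)[OF F pd(4,1) p'(1)]
            smooth_sectionD(1)[OF gt[OF k] pd(4,2) p'(2)] power_mult_distrib algebra_simps)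
    qed
    also have "\<dots> = cmod (?X - ?Y)"
      using w0 by (simp add: section_tensor_def section_power_def norm_mult flip: right_diff_distrib)
    finally have "cmod (?X - ?Y) \<le> C1' / real k ^ Suc CARD('n)" using C1'[OF k pd(3)] by simp
    also have "\<dots> \<le> C1 / real k ^ Suc CARD('n)" by (intro divide_right_mono) (auto simp: C1_def)
    finally have XY: "cmod (?X - ?Y) \<le> C1 / real k ^ Suc CARD('n)" .
    have X: "(cmod ?X)\<^sup>2 = N k p" using w0 by (simp add: N_eq[OF k pd(1,2)] norm_mult power_mult_distrib)
    have "(cmod ?Y)\<^sup>2 = ?w * (?\<mu>\<^sup>2 * ((cmod (F i p))\<^sup>2 ^ k * (cmod (gt k j p))\<^sup>2))"
      using w0 by (simp add: norm_mult norm_power power_mult_distrib power_mult[symmetric] mult.commute[of k])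
    then have Y: "(cmod ?Y)\<^sup>2 = sqrt (real k / (2 * pi)) ^ CARD('n) * q i p ^ k * (bweight K j p * (cmod (gt k j p))\<^sup>2)"
      unfolding scale_powr[OF k] by (simp add: q_def power_mult_distrib mult_ac)
    have "cmod (gt k j p - gl 0 j p) \<le> C2 / real k"
      using order_trans[OF C2'[OF k p], of "C2 / real k"] by (simp add: C2_def divide_right_mono)
    from norm_square_diff_le[OF this]
    have "\<bar>(cmod (gt k j p))\<^sup>2 - (cmod (gl 0 j p))\<^sup>2\<bar> \<le> C2 / real k * (2 * cmod (gl 0 j p) + C2 / real k)" .
    also have "\<dots> \<le> C2 / real k * (2 * m2 + C2)"
    proof -
      have "C2 / real k \<le> C2" using C0 k0 by (simp add: divide_le_eq mult_le_cancel_left1)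
      then show ?thesis using m2(2)[OF p] C0 k0 by (intro mult_left_mono add_mono) auto
    qed
    finally have G: "\<bar>(cmod (gt k j p))\<^sup>2 - (cmod (gl 0 j p))\<^sup>2\<bar> \<le> C3 / real k" by (simp add: C3_def)
    have wm: "bweight K j p \<le> m1" using m1(2)[OF p] by simp
    have ql: "0 \<le> q i p ^ k" "q i p ^ k \<le> 1" using q_nonneg[OF pd(1)] q_le[OF pd(4,1)] by (auto simp: power_le_one)
    have l: "0 \<le> sqrt (real k / (2 * pi)) ^ CARD('n)" "sqrt (real k / (2 * pi)) ^ CARD('n) \<le> real k ^ CARD('n)" using scale_bounds[OF k] by auto
    have lq: "0 \<le> sqrt (real k / (2 * pi)) ^ CARD('n) * q i p ^ k" "sqrt (real k / (2 * pi)) ^ CARD('n) * q i p ^ k \<le> real k ^ CARD('n)"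
      using ql l mult_mono[OF l(2) ql(2)] by auto
    have "C3 / real k \<le> C3" using C3 k0 by (simp add: divide_le_eq mult_le_cancel_left1)
    moreover have "(cmod (gl 0 j p))\<^sup>2 \<le> m2\<^sup>2" using m2(2)[OF p] by (intro power_mono) auto
    ultimately have "(cmod (gt k j p))\<^sup>2 \<le> m2\<^sup>2 + C3" using G by linarith
    then have "bweight K j p * (cmod (gt k j p))\<^sup>2 \<le> M"
      unfolding M_def using wm m1(1) w0(2) by (intro mult_mono) auto
    then have "(cmod ?Y)\<^sup>2 \<le> real k ^ CARD('n) * M"
      unfolding Y using lq w0(2) by (intro mult_mono) auto
    \<comment> \<open>Bounding Y by its square avoids half-integral powers of k.\<close>
    moreover have "cmod ?Y \<le> 1 + (cmod ?Y)\<^sup>2"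
      using sum_power2_ge_zero[of "cmod ?Y - 1" 0] zero_le_power2[of "cmod ?Y"]
      by (simp add: power2_eq_square algebra_simps) (smt (verit) norm_ge_zero)
    moreover have k1: "1 \<le> real k ^ CARD('n)" using k0 by simp
    ultimately have Yb: "cmod ?Y \<le> real k ^ CARD('n) * (1 + M)" by (simp add: distrib_left)
    have "\<bar>N k p - (cmod ?Y)\<^sup>2\<bar> \<le> C1 / real k ^ Suc CARD('n) * (2 * cmod ?Y + C1 / real k ^ Suc CARD('n))"
      using norm_square_diff_le[OF XY] unfolding X .
    also have "\<dots> \<le> C1 / real k ^ Suc CARD('n) * (real k ^ CARD('n) * (2 * (1 + M) + C1))"
    proof (rule mult_left_mono)
      have "1 \<le> real k ^ Suc CARD('n)" using k0 by (intro one_le_power)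
      then have "C1 / real k ^ Suc CARD('n) \<le> C1" using C0 by (simp add: divide_le_eq mult_le_cancel_left1)
      also have "\<dots> \<le> real k ^ CARD('n) * C1" using C0 k1 by (simp add: mult_le_cancel_right1)
      finally show "2 * cmod ?Y + C1 / real k ^ Suc CARD('n) \<le> real k ^ CARD('n) * (2 * (1 + M) + C1)"
        using Yb by (simp add: distrib_left)
    qed (use C0 k0 in auto)
    also have "\<dots> = C4 / real k" using k0 by (simp add: C4_def)
    finally have 1: "\<bar>N k p - (cmod ?Y)\<^sup>2\<bar> \<le> C4 / real k" .
    have "\<bar>(cmod ?Y)\<^sup>2 - sqrt (real k / (2 * pi)) ^ CARD('n) * q i p ^ k * a0 j p\<bar> =
        sqrt (real k / (2 * pi)) ^ CARD('n) * q i p ^ k * (bweight K j p * \<bar>(cmod (gt k j p))\<^sup>2 - (cmod (gl 0 j p))\<^sup>2\<bar>)"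
    proof -
      have "(cmod ?Y)\<^sup>2 - sqrt (real k / (2 * pi)) ^ CARD('n) * q i p ^ k * a0 j p =
          sqrt (real k / (2 * pi)) ^ CARD('n) * q i p ^ k * (bweight K j p * ((cmod (gt k j p))\<^sup>2 - (cmod (gl 0 j p))\<^sup>2))"
        unfolding Y a0_def by (simp only: right_diff_distrib)
      then show ?thesis using lq(1) w0(2)
        by (simp only: abs_mult[of "sqrt (real k / (2 * pi)) ^ CARD('n) * q i p ^ k"] abs_mult[of "bweight K j p"] abs_of_nonneg)
    qed
    also have "\<dots> \<le> sqrt (real k / (2 * pi)) ^ CARD('n) * q i p ^ k * (m1 * (C3 / real k))"
      using lq(1) w0(2) wm G m1(1) by (intro mult_left_mono mult_mono) auto
    finally have 2: "\<bar>(cmod ?Y)\<^sup>2 - sqrt (real k / (2 * pi)) ^ CARD('n) * q i p ^ k * a0 j p\<bar> \<le> sqrt (real k / (2 * pi)) ^ CARD('n) * q i p ^ k * (m1 * (C3 / real k))" .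
    have "\<bar>N k p - sqrt (real k / (2 * pi)) ^ CARD('n) * q i p ^ k * a0 j p\<bar> \<le> C4 / real k + sqrt (real k / (2 * pi)) ^ CARD('n) * q i p ^ k * (m1 * (C3 / real k))"
      using 1 2 by linarith
    also have "\<dots> \<le> (C4 + m1 * C3) / real k * (1 + sqrt (real k / (2 * pi)) ^ CARD('n) * q i p ^ k)"
    proof -
      have "0 \<le> m1 * C3 / real k + C4 / real k * (sqrt (real k / (2 * pi)) ^ CARD('n) * q i p ^ k)"
        using C4 C3 m1(1) l(1) ql(1) k0 by (intro add_nonneg_nonneg mult_nonneg_nonneg) auto
      then show ?thesis by (simp add: algebra_simps add_divide_distrib)
    qed
    finally show ?thesis .
  qed
  then show thesis by (rule that)
qed

end

section \<open>The density of the principal symbol\<close>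

context lagrangian_state
begin

lemma linear_transition:
  assumes "c \<in> A" "c' \<in> A" "x \<in> fst c" "x \<in> fst c'"
  shows "linear (tangent_map c c' id x)"
    and "tangent_map c c' id x (\<i> *s v) = \<i> *s tangent_map c c' id x v"
    and "\<omega> c x v w = \<omega> c' x (tangent_map c c' id x v) (tangent_map c c' id x w)"
proof -
  have "snd c x \<in> snd c ` (fst c \<inter> fst c')" using assms by blast
  from Ck_Suc_has_derivative[OF transition_Ck[OF atlas_A assms(1,2)] this]
  show "linear (tangent_map c c' id x)" unfolding tangent_map_id by (rule has_derivative_linear)
  show "tangent_map c c' id x (\<i> *s v) = \<i> *s tangent_map c c' id x v"
    using kaehler assms unfolding compact_connected_kaehler_def complex_atlas_def by blast
  show "\<omega> c x v w = \<omega> c' x (tangent_map c c' id x v) (tangent_map c c' id x w)"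
    using kaehler assms unfolding compact_connected_kaehler_def kaehler_form_def smooth_two_form_def by blast
qed

lemma continuous_\<iota>: "continuous_on UNIV \<iota>"
  using \<iota>_smooth unfolding smooth_map_def by blast

lemma open_vimage_\<iota>: "open S \<Longrightarrow> open (\<iota> -` S)"
  using continuous_\<iota> by (rule open_vimage[rotated])

lemma \<iota>_Ck: "d \<in> B \<Longrightarrow> c \<in> A \<Longrightarrow> Ck n (snd d ` (fst d \<inter> \<iota> -` fst c)) (snd c \<circ> \<iota> \<circ> chart_inv d)"
  using \<iota>_smooth unfolding smooth_map_def by (blast intro: smooth_on_imp_Ck)

lemma tangent_\<iota>:
  assumes "d \<in> B" "c \<in> A" "p \<in> fst d" "\<iota> p \<in> fst c"
  shows "linear (tangent_map d c \<iota> p)" "inj (tangent_map d c \<iota> p)"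
    "\<omega> c (\<iota> p) (tangent_map d c \<iota> p v) (tangent_map d c \<iota> p w) = 0"
proof -
  have "snd d p \<in> snd d ` (fst d \<inter> \<iota> -` fst c)" using assms by blast
  from Ck_Suc_has_derivative[OF \<iota>_Ck[OF assms(1,2)] this]
  show "linear (tangent_map d c \<iota> p)" unfolding tangent_map_def by (rule has_derivative_linear)
  show "inj (tangent_map d c \<iota> p)" "\<omega> c (\<iota> p) (tangent_map d c \<iota> p v) (tangent_map d c \<iota> p w) = 0"
    using embedding assms unfolding closed_lagrangian_embedding_def by blast+
qed

lemma tangent_\<iota>_target:
  assumes "d \<in> B" "c \<in> A" "c' \<in> A" "p \<in> fst d" "\<iota> p \<in> fst c" "\<iota> p \<in> fst c'"
  shows "tangent_map d c' \<iota> p v = tangent_map c c' id (\<iota> p) (tangent_map d c \<iota> p v)"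
proof -
  note cd = smooth_atlas_chart[OF atlas_B assms(1)] and cc = smooth_atlas_chart[OF atlas_A assms(2)]
  have "tangent_map d c' (id \<circ> \<iota>) p v = tangent_map c c' id (\<iota> p) (tangent_map d c \<iota> p v)"
  proof (rule tangent_map_compose[OF cd cc, where S="fst d \<inter> \<iota> -` fst c"])
    show "open (fst d \<inter> \<iota> -` fst c)"
      by (intro open_Int open_vimage_\<iota> is_chartD(1) cd cc)
    show "(snd c \<circ> \<iota> \<circ> chart_inv d) differentiable at (snd d p)"
      by (rule Ck_imp_differentiable[OF \<iota>_Ck[OF assms(1,2), of 1]]) (use assms in auto)
    show "(snd c' \<circ> id \<circ> chart_inv c) differentiable at (snd c (\<iota> p))"
      using Ck_imp_differentiable[OF transition_Ck[OF atlas_A assms(2,3), of 1], of "snd c (\<iota> p)"] assms by simp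
  qed (use assms in auto)
  then show ?thesis by simp
qed

lemma tangent_\<iota>_source:
  assumes "d \<in> B" "d' \<in> B" "c \<in> A" "p \<in> fst d" "p \<in> fst d'" "\<iota> p \<in> fst c"
  shows "tangent_map d' c \<iota> p v = tangent_map d c \<iota> p (tangent_map d' d id p v)"
    and "linear (tangent_map d' d id p)"
proof -
  note cd = smooth_atlas_chart[OF atlas_B assms(1)] and cd' = smooth_atlas_chart[OF atlas_B assms(2)]
  have "tangent_map d' c (\<iota> \<circ> id) p v = tangent_map d c \<iota> (id p) (tangent_map d' d id p v)"
  proof (rule tangent_map_compose[OF cd' cd, where S="fst d' \<inter> fst d"])
    show "open (fst d' \<inter> fst d)" by (intro open_Int is_chartD(1) cd cd')
    show "(snd d \<circ> id \<circ> chart_inv d') differentiable at (snd d' p)"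
      using Ck_imp_differentiable[OF transition_Ck[OF atlas_B assms(2,1), of 1], of "snd d' p"] assms by simp
    show "(snd c \<circ> \<iota> \<circ> chart_inv d) differentiable at (snd d (id p))"
      by (rule Ck_imp_differentiable[OF \<iota>_Ck[OF assms(1,3), of 1]]) (use assms in auto)
  qed (use assms in auto)
  then show "tangent_map d' c \<iota> p v = tangent_map d c \<iota> p (tangent_map d' d id p v)" by simp
  have "snd d' p \<in> snd d' ` (fst d' \<inter> fst d)" using assms by blast
  from Ck_Suc_has_derivative[OF transition_Ck[OF atlas_B assms(2,1)] this]
  show "linear (tangent_map d' d id p)" unfolding tangent_map_id by (rule has_derivative_linear)
qed

lemma liouville_eq: "liouville \<omega> c x = liouville_coeff (\<omega> c x)"
  by (simp add: liouville_eq_pfaffian liouville_coeff_def)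

lemma liouville_transform:
  assumes "c \<in> A" "d \<in> A" "x \<in> fst c" "x \<in> fst d"
  shows "liouville \<omega> d x = jac (tangent_map d c id x) * liouville \<omega> c x"
  unfolding liouville_eq mult.commute[of "jac _"]
  by (rule liouville_coeff_transform[OF positive_\<omega>[OF assms(2,4)] positive_\<omega>[OF assms(1,3)]
      linear_transition(1,3)[OF assms(2,1,4,3)]])

abbreviation m :: "('g, real^'n) chart \<Rightarrow> 'g \<Rightarrow> real" where "m \<equiv> m_density A \<iota> K L1 \<delta> \<phi> \<tau> g0"

text \<open>All choices made in \<open>m_density\<close> are removed here. The isometries
  \<open>\<tau>\<close> and \<open>\<phi>\<close> trade the weights of L1 and delta for that of K,
  and \<open>det_coord_matrix\<close> evaluates the quotient that is left.\<close>

lemma m_density_eq: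
  assumes d: "d \<in> B" "p \<in> fst d" and c: "c \<in> A" "\<iota> p \<in> fst c" and U: "\<iota> p \<in> U" and j: "\<iota> p \<in> bdom K j"
    and Q: "lagrangian_frame (\<omega> c (\<iota> p)) (tangent_map d c \<iota> p) Q"
  shows "m d p = a0 j (\<iota> p) * (1 / (sqrt 2 ^ CARD('n) * jac Q))"
proof -
  let ?x = "\<iota> p"
  define c0 where "c0 = (SOME c. c \<in> A \<and> ?x \<in> fst c)"
  define l0 where "l0 = (SOME l. ?x \<in> bdom K l)"
  define i0 where "i0 = (SOME i. ?x \<in> bdom L1 i)"
  define j0 where "j0 = (SOME j. ?x \<in> bdom \<delta> j)"
  have c0: "c0 \<in> A \<and> ?x \<in> fst c0"
    unfolding c0_def by (rule someI[of _ c]) (use c in blast)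
  have l0: "?x \<in> bdom K l0" unfolding l0_def by (rule someI[of _ j]) (rule j)
  have "\<exists>i. ?x \<in> bdom L1 i" using hermitian_bundleD(2)[OF hermitian_L1] U by blast
  then have i0: "?x \<in> bdom L1 i0" unfolding i0_def by (rule someI_ex)
  have "\<exists>j. ?x \<in> bdom \<delta> j" using hermitian_bundleD(2)[OF hermitian_\<delta>] U by blast
  then have j0: "?x \<in> bdom \<delta> j0" unfolding j0_def by (rule someI_ex)
  let ?T = "tangent_map d c0 \<iota> p"
  interpret Q: lagrangian_frame "\<omega> c ?x" "tangent_map d c \<iota> p" Q by (rule Q)
  \<comment> \<open>The same Q serves for the chart picked in the definition, because transition
    maps are complex linear and preserve omega.\<close>
  interpret Q0: lagrangian_frame "\<omega> c0 ?x" ?T Q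
  proof (rule lagrangian_frame.intro)
    note S = linear_transition[OF c(1) conjunct1[OF c0] c(2) conjunct2[OF c0]]
    note T = tangent_\<iota>_target[OF d(1) c(1) conjunct1[OF c0] d(2) c(2) conjunct2[OF c0]]
    show "\<omega> c0 ?x (?T (Q x)) (\<i> *s ?T (Q x)) = x \<bullet> x" for x
      unfolding T S(2)[symmetric] S(3)[symmetric] by (rule Q.Q(2))
    show "positive_form (\<omega> c0 ?x)" using positive_\<omega> c0 by blast
    show "linear ?T" "\<omega> c0 ?x (?T a) (?T b) = 0" for a b using tangent_\<iota>(1,3)[OF d(1) _ d(2)] c0 by blast+
    show "linear Q" by (rule Q.Q(1))
  qed
  define P where "P = (SOME P. unitary_basis (\<omega> c0 ?x) P)"
  have P: "unitary_basis (\<omega> c0 ?x) P"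
    unfolding P_def by (rule someI_ex[OF unitary_basis_exists[OF Q0.B]])
  have P0: "0 < cmod (det P)" by (rule unitary_basis_cmod_det(2)[OF Q0.B P P])
  have "\<phi> c0 j0 ?x \<noteq> 0 \<and> bweight (bundle_power \<delta> 2) j0 ?x = bweight (canonical_bundle A \<omega>) c0 ?x * (cmod (\<phi> c0 j0 ?x))\<^sup>2"
  proof -
    have "?x \<in> U \<inter> bdom (bundle_power \<delta> 2) j0 \<inter> bdom (canonical_bundle A \<omega>) c0"
      using U j0 c0 by (simp add: bundle_power_def canonical_bundle_def)
    then show ?thesis using half_form unfolding half_form_bundle_def bundle_iso_def by blast
  qed
  then have \<phi>: "\<phi> c0 j0 ?x \<noteq> 0" and "(bweight \<delta> j0 ?x)\<^sup>2 = (cmod (det P) * cmod (\<phi> c0 j0 ?x))\<^sup>2"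
    by (simp_all add: bundle_power_def canonical_bundle_def P_def power_mult_distrib)
  \<comment> \<open>The isometry concerns the square of delta; both sides are nonnegative, so the
    root can be taken.\<close>
  then have w\<delta>: "bweight \<delta> j0 ?x = cmod (det P) * cmod (\<phi> c0 j0 ?x)"
    using hermitian_bundleD(3)[OF hermitian_\<delta> j0] by (simp add: power2_eq_iff_nonneg)
  have "\<tau> l0 (i0, j0) ?x \<noteq> 0 \<and> bweight (bundle_tensor L1 \<delta>) (i0, j0) ?x = bweight K l0 ?x * (cmod (\<tau> l0 (i0, j0) ?x))\<^sup>2"
  proof -
    have "?x \<in> U \<inter> bdom (bundle_tensor L1 \<delta>) (i0, j0) \<inter> bdom K l0"
      using U i0 j0 l0 by (simp add: bundle_tensor_def)
    then show ?thesis using \<tau> unfolding bundle_iso_def by blast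
  qed
  then have t: "\<tau> l0 (i0, j0) ?x \<noteq> 0"
    and w: "bweight L1 i0 ?x * bweight \<delta> j0 ?x = bweight K l0 ?x * (cmod (\<tau> l0 (i0, j0) ?x))\<^sup>2"
    by (simp_all add: bundle_tensor_def)
  have wK: "bweight K l0 ?x * (cmod (g0 l0 p))\<^sup>2 = a0 j ?x"
  proof -
    have "g0 j p = btrans K j l0 ?x * g0 l0 p"
      using smooth_sectionD(1)[OF g0, of p j l0] U j l0 by (simp add: bundle_pullback_def)
    then show ?thesis
      by (simp add: a0_def gl_g0[OF U j] hermitian_bundleD(4)[OF hermitian_K j l0] norm_mult power_mult_distrib)
  qed
  have "m d p = bweight L1 i0 ?x * (cmod (g0 l0 p / \<tau> l0 (i0, j0) ?x))\<^sup>2 * cmod (phi_Gamma \<iota> \<phi> c0 j0 d p 1)"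
    unfolding m_density_def Let_def c0_def l0_def i0_def j0_def ..
  also have "\<dots> = (bweight L1 i0 ?x * (cmod (det P) * cmod (\<phi> c0 j0 ?x))) * (cmod (g0 l0 p))\<^sup>2 / (cmod (\<tau> l0 (i0, j0) ?x))\<^sup>2
      * (cmod (det (coord_matrix ?T)) / cmod (det P))"
    using P0 by (simp add: phi_Gamma_def coord_matrix_def norm_mult norm_divide power_divide)
  also have "\<dots> = a0 j ?x * (cmod (det (coord_matrix ?T)) / cmod (det P))"
    unfolding w\<delta>[symmetric] w wK[symmetric] using t by simp
  also have "\<dots> = a0 j ?x * (1 / (sqrt 2 ^ CARD('n) * jac Q))"
    unfolding Q0.det_coord_matrix[OF P] ..
  finally show ?thesis .
qed

text \<open>If Q' is orthonormal for d', its composition with the transition map is orthonormal for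
  d, and \<open>jac\<close> is multiplicative.\<close>

lemma m_density_transform:
  assumes d: "d \<in> B" "d' \<in> B" "p \<in> fst d" "p \<in> fst d'" and U: "\<iota> p \<in> U"
  shows "m d' p = jac (tangent_map d' d id p) * m d p"
proof -
  obtain c where c: "c \<in> A" "\<iota> p \<in> fst c" using smooth_atlas_cover[OF atlas_A] by blast
  obtain j where j: "\<iota> p \<in> bdom K j" using hermitian_bundleD(2)[OF hermitian_K] by blast
  let ?T = "tangent_map d c \<iota> p" and ?T' = "tangent_map d' c \<iota> p" and ?R = "tangent_map d' d id p"
  note T = tangent_\<iota>[OF d(1) c(1) d(3) c(2)] and T' = tangent_\<iota>[OF d(2) c(1) d(4) c(2)]
  note R = tangent_\<iota>_source[OF d(1,2) c(1) d(3,4) c(2)]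
  obtain Q' :: "real^'n \<Rightarrow> real^'n" where Q': "linear Q'" "\<And>x. \<omega> c (\<iota> p) (?T' (Q' x)) (\<i> *s ?T' (Q' x)) = x \<bullet> x"
    using lagrangian_orthonormal_exists[OF positive_\<omega>[OF c] T'] by blast
  have f': "lagrangian_frame (\<omega> c (\<iota> p)) ?T' Q'"
    by (rule lagrangian_frame.intro[OF positive_\<omega>[OF c] T'(1,3) Q'])
  have f: "lagrangian_frame (\<omega> c (\<iota> p)) ?T (\<lambda>x. ?R (Q' x))"
    by (rule lagrangian_frame.intro[OF positive_\<omega>[OF c] T(1,3)])
      (rule linear_compose[OF Q'(1) R(2), unfolded comp_def], unfold R(1)[symmetric], rule Q'(2))
  have pos: "0 < jac (\<lambda>x. ?R (Q' x))" by (rule lagrangian_frame.jac_Q_pos[OF f])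
  moreover have "jac (\<lambda>x. ?R (Q' x)) = jac ?R * jac Q'" by (rule jac_compose[OF R(2) Q'(1)])
  ultimately show ?thesis
    by (auto simp: m_density_eq[OF d(1,3) c U j f] m_density_eq[OF d(2,4) c U j f'])
qed

end

section \<open>Asymptotics for localized test functions\<close>

text \<open>The sequence k s^k is bounded for the root s of r of order n + 1; its power of order n +
  1 is the sequence in question.\<close>

lemma power_times_geometric_bounded:
  fixes r :: real
  assumes r: "0 \<le> r" "r < 1"
  obtains E where "0 \<le> E" "\<And>k. real k ^ Suc n * r ^ k \<le> E"
proof -
  define s where "s = root (Suc n) r"
  have s: "0 \<le> s" "s < 1" "s ^ Suc n = r"
    using r real_root_pow_pos2[of "Suc n" r] by (simp_all add: s_def del: power_Suc)
  have "(\<lambda>k. of_nat k * s ^ k) \<longlonglongrightarrow> 0" by (rule powser_times_n_limit_0) (use s in simp)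
  then have "Bseq (\<lambda>k. of_nat k * s ^ k)" by (intro convergent_imp_Bseq convergentI)
  then obtain E where E: "0 < E" "\<And>k. real k * s ^ k \<le> E" using s(1) by (auto elim!: BseqE)
  have "real k ^ Suc n * r ^ k \<le> E ^ Suc n" for k
  proof -
    have "real k ^ Suc n * r ^ k = (real k * s ^ k) ^ Suc n"
      unfolding s(3)[symmetric] power_mult_distrib power_mult[symmetric] by (simp only: mult.commute)
    also have "\<dots> \<le> E ^ Suc n" using E(2)[of k] s(1) by (intro power_mono) auto
    finally show ?thesis .
  qed
  then show thesis using E(1) by (intro that[of "E ^ Suc n"]) auto
qed

lemma set_integrable_continuous_compact:
  fixes u :: "'e::euclidean_space \<Rightarrow> 'b::{banach, second_countable_topology}"
  assumes "compact K" "continuous_on K u"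
  shows "set_integrable lborel K u"
  using borel_integrable_compact[OF assms] by (simp add: set_integrable_def)

context lagrangian_state
begin

definition \<sigma> :: "nat \<Rightarrow> ('m \<Rightarrow> complex) \<Rightarrow> ('m, complex^'n) chart \<Rightarrow> 'm \<Rightarrow> complex" where
  "\<sigma> k u = (\<lambda>c x. u x * of_real (N k x * liouville \<omega> c x))"

definition \<mu> :: "('m \<Rightarrow> complex) \<Rightarrow> ('g, real^'n) chart \<Rightarrow> 'g \<Rightarrow> complex" where
  "\<mu> u = (\<lambda>d p. u (\<iota> p) * of_real (m d p))"

text \<open>Integrability is part of the property because it is needed to add density integrals;
  with it the property is closed under sums, as \<open>C2_localization\<close> demands.\<close>

definition asymptotic :: "('m \<Rightarrow> complex) \<Rightarrow> bool" where
  "asymptotic u \<longleftrightarrow> (\<forall>k\<ge>1. piecewise_integrable A (\<sigma> k u)) \<and> piecewise_integrable B (\<mu> u) \<and>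
     (\<exists>C. \<forall>k\<ge>1. cmod (density_integral A (\<sigma> k u) - density_integral B (\<mu> u)) \<le> C / real k)"

lemma asymptotic_zero: "asymptotic (\<lambda>x. 0)"
  by (auto simp: asymptotic_def \<sigma>_def \<mu>_def piecewise_integrable_def set_integrable_def density_integral_def
      intro!: exI[of _ 0])

lemma asymptotic_add:
  assumes "asymptotic u" "asymptotic v"
  shows "asymptotic (\<lambda>x. u x + v x)"
proof -
  have s: "\<sigma> k (\<lambda>x. u x + v x) = (\<lambda>c p. \<sigma> k u c p + \<sigma> k v c p)" for k
    by (simp add: \<sigma>_def distrib_right)
  have t: "\<mu> (\<lambda>x. u x + v x) = (\<lambda>c p. \<mu> u c p + \<mu> v c p)"
    by (simp add: \<mu>_def distrib_right)
  obtain C where C: "\<And>k. 1 \<le> k \<Longrightarrow> cmod (density_integral A (\<sigma> k u) - density_integral B (\<mu> u)) \<le> C / real k"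
    using assms(1) unfolding asymptotic_def by blast
  obtain C' where C': "\<And>k. 1 \<le> k \<Longrightarrow> cmod (density_integral A (\<sigma> k v) - density_integral B (\<mu> v)) \<le> C' / real k"
    using assms(2) unfolding asymptotic_def by blast
  have iA: "piecewise_integrable A (\<sigma> k u)" "piecewise_integrable A (\<sigma> k v)" if "1 \<le> k" for k
    using assms that unfolding asymptotic_def by blast+
  have iB: "piecewise_integrable B (\<mu> u)" "piecewise_integrable B (\<mu> v)"
    using assms unfolding asymptotic_def by blast+
  have "cmod (density_integral A (\<sigma> k (\<lambda>x. u x + v x)) - density_integral B (\<mu> (\<lambda>x. u x + v x))) \<le> (C + C') / real k"
    if k: "1 \<le> k" for k
  proof -
    have "density_integral A (\<sigma> k (\<lambda>x. u x + v x)) - density_integral B (\<mu> (\<lambda>x. u x + v x)) =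
      (density_integral A (\<sigma> k u) - density_integral B (\<mu> u)) + (density_integral A (\<sigma> k v) - density_integral B (\<mu> v))"
      unfolding s t density_integral_add(1)[OF atlas_A compact_M iA[OF k]] density_integral_add(1)[OF atlas_B compact_G iB]
      by simp
    also have "cmod \<dots> \<le> C / real k + C' / real k"
      by (intro norm_triangle_le add_mono C C' k)
    finally show ?thesis by (simp add: add_divide_distrib)
  qed
  moreover have "piecewise_integrable A (\<sigma> k (\<lambda>x. u x + v x))" if "1 \<le> k" for k
    unfolding s by (rule density_integral_add(2)[OF atlas_A compact_M iA[OF that]])
  moreover have "piecewise_integrable B (\<mu> (\<lambda>x. u x + v x))"
    unfolding t by (rule density_integral_add(2)[OF atlas_B compact_G iB])
  ultimately show ?thesis unfolding asymptotic_def by blast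
qed

lemma smooth_\<omega>: "c \<in> A \<Longrightarrow> smooth_on (snd c ` fst c) (\<lambda>x. \<omega> c (chart_inv c x) v w)"
  using kaehler unfolding compact_connected_kaehler_def kaehler_form_def smooth_two_form_def by blast

lemma liouville_Ck:
  assumes c: "c \<in> A"
  shows "Ck n (snd c ` fst c) (\<lambda>x. liouville \<omega> c (chart_inv c x))"
proof -
  have o: "open (snd c ` fst c)" by (rule is_chartD(2)[OF smooth_atlas_chart[OF atlas_A c]])
  show ?thesis
    unfolding liouville_def divide_inverse
    by (intro Ck_mult Ck_sum Ck_prod Ck_const o smooth_on_imp_Ck smooth_\<omega> c)
qed

text \<open>The support lies in one chart and one pair of frames, so the integrand is continuous
  there and \<open>chart_density\<close> applies.\<close>

lemma chart_integral:
  assumes c: "c \<in> A" and k: "1 \<le> k" and K0: "compact K0" "K0 \<subseteq> fst c \<inter> (bdom L i \<inter> bdom K j)"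
    and u: "C2_function A u" "\<And>x. x \<notin> K0 \<Longrightarrow> u x = 0"
  shows "piecewise_integrable A (\<sigma> k u)"
    and "density_integral A (\<sigma> k u) = (LINT x:snd c ` K0|lborel.
      (u (chart_inv c x) * of_real (liouville \<omega> c (chart_inv c x))) * of_real (N k (chart_inv c x)))"
proof -
  note cc = smooth_atlas_chart[OF atlas_A c]
  let ?g = "\<lambda>x. (u (chart_inv c x) * of_real (liouville \<omega> c (chart_inv c x))) * of_real (N k (chart_inv c x))"
  have Kc: "compact (snd c ` K0)" "snd c ` K0 \<subseteq> snd c ` fst c" "chart_inv c ` snd c ` K0 = K0"
    using K0 is_chartD(5)[OF cc]
    by (auto intro!: compact_continuous_image continuous_on_subset[OF is_chartD(3)[OF cc]] simp: image_image subset_iff)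
  have "continuous_on (snd c ` fst c) (\<lambda>x. u (chart_inv c x))"
    using u(1) c Ck_imp_continuous_on by (auto simp: C2_function_def)
  moreover have "continuous_on (snd c ` K0) (\<lambda>x. N k (chart_inv c x))"
    by (rule continuous_on_compose2[OF continuous_on_N[OF c k] continuous_on_subset[OF is_chartD(4)[OF cc] Kc(2)]])
      (use Kc(3) K0(2) in auto)
  ultimately have "continuous_on (snd c ` K0) ?g"
    by (intro continuous_intros continuous_on_subset[OF Ck_imp_continuous_on[OF liouville_Ck[OF c]] Kc(2)])
      (auto intro: continuous_on_subset[OF _ Kc(2)])
  from set_integrable_continuous_compact[OF Kc(1) this] have int: "set_integrable lborel (snd c ` K0) ?g" .
  have ind: "indicator (snd c ` fst c) x *\<^sub>R \<sigma> k u c (chart_inv c x) = indicator (snd c ` K0) x *\<^sub>R ?g x" for x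
  proof (cases "x \<in> snd c ` K0")
    case True
    then show ?thesis using Kc(2) by (auto simp: \<sigma>_def)
  next
    case False
    then have "x \<in> snd c ` fst c \<Longrightarrow> chart_inv c x \<notin> K0" using is_chartD(5)[OF cc] K0(2) by force
    then show ?thesis using False u(2) by (auto simp: \<sigma>_def indicator_def)
  qed
  interpret chart_density A c "\<sigma> k u"
  proof
    show "\<sigma> k u d p = 0" if "d \<in> A" "p \<in> fst d" "p \<notin> fst c" for d p
      using u(2)[of p] K0(2) that by (auto simp: \<sigma>_def)
    show "\<sigma> k u d p = of_real (jac (tangent_map d c id p)) * \<sigma> k u c p" if "d \<in> A" "p \<in> fst c" "p \<in> fst d" for d p
      using liouville_transform[OF that(1) c that(3,2)] liouville_transform[OF c that] by (simp add: \<sigma>_def)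
    show "set_integrable lborel (snd c ` fst c) (\<lambda>y. \<sigma> k u c (chart_inv c y))"
      using int unfolding set_integrable_def ind .
  qed (use atlas_A c in auto)
  show "piecewise_integrable A (\<sigma> k u)" by (rule piecewise_integrable)
  show "density_integral A (\<sigma> k u) = (LINT x:snd c ` K0|lborel. ?g x)"
    unfolding density_integral_eq[OF compact_M] set_lebesgue_integral_def ind ..
qed

text \<open>On a compact set off Gamma |F|^2 has a maximum below 1, so the leading term decays
  exponentially and the whole density is O(1/k); the integral over Gamma is 0.\<close>

lemma asymptotic_away:
  assumes p: "p \<in> V" "p \<notin> range \<iota>"
  shows "\<exists>W. open W \<and> p \<in> W \<and> (\<forall>v K. C2_function A v \<longrightarrow> compact K \<longrightarrow> K \<subseteq> W \<longrightarrow>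
    (\<forall>x. x \<notin> K \<longrightarrow> v x = 0) \<longrightarrow> asymptotic v)"
proof -
  obtain c where c: "c \<in> A" "p \<in> fst c" using smooth_atlas_cover[OF atlas_A] by blast
  obtain i where i: "p \<in> bdom L i" using hermitian_bundleD(2)[OF hermitian_L] by blast
  obtain j where j: "p \<in> bdom K j" using hermitian_bundleD(2)[OF hermitian_K] by blast
  note cc = smooth_atlas_chart[OF atlas_A c(1)]
  let ?W = "fst c \<inter> bdom L i \<inter> bdom K j \<inter> V \<inter> - range \<iota>"
  have "closed (range \<iota>)" by (intro compact_imp_closed compact_continuous_image continuous_\<iota> compact_G)
  then have W: "open ?W"
    by (intro open_Int open_Compl is_chartD(1) cc V hermitian_bundleD(1)[OF hermitian_L] hermitian_bundleD(1)[OF hermitian_K])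
  have "asymptotic v" if v: "C2_function A v" and K0: "compact K0" "K0 \<subseteq> ?W" and v0: "\<forall>x. x \<notin> K0 \<longrightarrow> v x = 0" for v K0
  proof -
    have K0': "K0 \<subseteq> fst c \<inter> bdom L i \<inter> bdom K j \<inter> V" "K0 \<subseteq> fst c \<inter> (bdom L i \<inter> bdom K j)" using K0(2) by blast+
    have "\<mu> v = (\<lambda>d p. 0)" using v0 K0(2) by (fastforce simp: \<mu>_def)
    then have B: "density_integral B (\<mu> v) = 0" "piecewise_integrable B (\<mu> v)"
      by (simp_all add: density_integral_def piecewise_integrable_def set_integrable_def)
    obtain C where C: "\<And>k p. 1 \<le> k \<Longrightarrow> p \<in> K0 \<Longrightarrow> \<bar>N k p - sqrt (real k / (2 * pi)) ^ CARD('n) * q i p ^ k * a0 j p\<bar>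
        \<le> C / real k * (1 + sqrt (real k / (2 * pi)) ^ CARD('n) * q i p ^ k)"
      using density_approximation[OF c(1) K0(1) K0'(1)] by metis
    have cF: "continuous_on K0 (F i)" "continuous_on K0 (gl 0 j)" "continuous_on K0 (bweight L i)" "continuous_on K0 (bweight K j)"
      using K0' V(2) by (auto intro!: continuous_on_subset[OF continuous_on_frame(3)[OF c(1)]]
        continuous_on_subset[OF continuous_on_frame(4)[OF c(1)]] continuous_on_subset[OF continuous_on_frame(1)[OF c(1)]]
        continuous_on_subset[OF continuous_on_frame(2)[OF c(1)]])
    have cq: "continuous_on K0 (q i)" and ca: "continuous_on K0 (a0 j)"
      unfolding q_def a0_def by (intro continuous_intros cF)+
    have q: "0 \<le> q i x" "q i x < 1" if "x \<in> K0" for x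
      using that K0(2) V(2) q_less[of x i] q_nonneg[of x i] by blast+
    obtain r where r: "0 \<le> r" "r < 1" "\<And>x. x \<in> K0 \<Longrightarrow> q i x \<le> r"
    proof (cases "K0 = {}")
      case False
      obtain x where "x \<in> K0" "\<And>y. y \<in> K0 \<Longrightarrow> q i y \<le> q i x"
        using continuous_attains_sup[OF K0(1) False cq] by blast
      then show thesis using q by (intro that[of "q i x"]) auto
    qed (use that[of 0] in auto)
    \<comment> \<open>One power of k more than the prefactor can grow, in order to gain the factor
      1/k.\<close>
    obtain E where E: "0 \<le> E" "\<And>k. real k ^ Suc CARD('n) * r ^ k \<le> E"
      using power_times_geometric_bounded[OF r(1,2)] by metis
    obtain a where a: "0 \<le> a" "\<And>x. x \<in> K0 \<Longrightarrow> norm (a0 j x) \<le> a" using compact_norm_bounded[OF K0(1) ca] by metis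
    define M where "M = E * a + \<bar>C\<bar> * (1 + E)"
    have N: "\<bar>N k x\<bar> \<le> M / real k" if k: "1 \<le> k" and x: "x \<in> K0" for k x
    proof -
      let ?t = "sqrt (real k / (2 * pi)) ^ CARD('n) * q i x ^ k"
      have t0: "0 \<le> ?t" using q(1)[OF x] by simp
      have "?t \<le> real k ^ CARD('n) * r ^ k"
        using scale_bounds[OF k] q(1)[OF x] r(3)[OF x] by (intro mult_mono power_mono) auto
      also have "\<dots> \<le> E / real k" using E(2)[of k] k by (simp add: field_simps)
      finally have t: "?t \<le> E / real k" .
      have "E / real k \<le> E" using E(1) k by (simp add: divide_le_eq mult_le_cancel_left1)
      with t have t1: "?t \<le> E" by linarith
      have "\<bar>N k x\<bar> \<le> \<bar>?t * a0 j x\<bar> + C / real k * (1 + ?t)" using C[OF k x] by linarith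
      also have "\<bar>?t * a0 j x\<bar> \<le> E / real k * a"
        unfolding abs_mult[of ?t] using t t0 a(2)[OF x] E(1) by (intro mult_mono) auto
      also have "C / real k * (1 + ?t) \<le> \<bar>C\<bar> / real k * (1 + E)"
        using t0 t1 by (intro mult_mono divide_right_mono) auto
      finally show ?thesis by (simp add: M_def add_divide_distrib)
    qed
    let ?h = "\<lambda>x. v (chart_inv c x) * complex_of_real (liouville \<omega> c (chart_inv c x))"
    have Kc: "compact (snd c ` K0)" "snd c ` K0 \<subseteq> snd c ` fst c" "chart_inv c ` snd c ` K0 = K0"
      using K0(1) K0' is_chartD(5)[OF cc]
      by (auto intro!: compact_continuous_image continuous_on_subset[OF is_chartD(3)[OF cc]] simp: image_image subset_iff)
    have "continuous_on (snd c ` fst c) (\<lambda>x. v (chart_inv c x))"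
      using v c Ck_imp_continuous_on by (auto simp: C2_function_def)
    then have ch: "continuous_on (snd c ` K0) ?h"
      by (intro continuous_intros continuous_on_subset[OF Ck_imp_continuous_on[OF liouville_Ck[OF c(1)]] Kc(2)])
        (auto intro: continuous_on_subset[OF _ Kc(2)])
    have cN: "continuous_on (snd c ` K0) (\<lambda>x. N k (chart_inv c x))" if "1 \<le> k" for k
      by (rule continuous_on_compose2[OF continuous_on_N[OF c(1) that] continuous_on_subset[OF is_chartD(4)[OF cc] Kc(2)]])
        (use Kc(3) K0'(2) in auto)
    note int = set_integrable_continuous_compact[OF Kc(1)]
    have "cmod (density_integral A (\<sigma> k v) - density_integral B (\<mu> v)) \<le> ((LINT x:snd c ` K0|lborel. cmod (?h x)) * M) / real k"
      if k: "1 \<le> k" for k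
    proof -
      have "cmod (density_integral A (\<sigma> k v) - density_integral B (\<mu> v)) = cmod (LINT x:snd c ` K0|lborel. ?h x * of_real (N k (chart_inv c x)))"
        using chart_integral(2)[OF c(1) k K0(1) K0'(2) v] v0 by (simp add: B)
      also have "\<dots> \<le> (LINT x:snd c ` K0|lborel. cmod (?h x * of_real (N k (chart_inv c x))))"
        by (intro set_integral_norm_bound int continuous_intros ch cN k)
      also have "\<dots> \<le> (LINT x:snd c ` K0|lborel. cmod (?h x) * (M / real k))"
      proof (rule set_integral_mono)
        show "set_integrable lborel (snd c ` K0) (\<lambda>x. cmod (?h x * of_real (N k (chart_inv c x))))"
          by (intro int continuous_intros ch cN k)
        show "set_integrable lborel (snd c ` K0) (\<lambda>x. cmod (?h x) * (M / real k))"
          using k by (intro int continuous_intros ch) auto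
        fix x assume "x \<in> snd c ` K0"
        then have "chart_inv c x \<in> K0" using Kc(3) by blast
        from N[OF k this] show "cmod (?h x * of_real (N k (chart_inv c x))) \<le> cmod (?h x) * (M / real k)"
          unfolding norm_mult[of "?h x"] norm_of_real by (intro mult_left_mono) auto
      qed
      also have "\<dots> = ((LINT x:snd c ` K0|lborel. cmod (?h x)) * M) / real k" by simp
      finally show ?thesis .
    qed
    moreover have "piecewise_integrable A (\<sigma> k v)" if "1 \<le> k" for k
      using chart_integral(1)[OF c(1) that K0(1) K0'(2) v] v0 by blast
    ultimately show ?thesis unfolding asymptotic_def using B(2) by blast
  qed
  then show ?thesis using W c(2) i j p by (intro exI[of _ ?W]) blast
qed

end

section \<open>The contribution of neighbourhoods of points of Gamma\<close>

context lagrangian_state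
begin

lemma bconn_L:
  assumes "c \<in> A"
  shows "smooth_on (snd c ` (fst c \<inter> bdom L i)) (\<lambda>x. bconn L i c (chart_inv c x) v)"
    and "p \<in> fst c \<Longrightarrow> p \<in> bdom L i \<Longrightarrow>
      frechet_derivative (bweight L i \<circ> chart_inv c) (at (snd c p)) v = 2 * Re (bconn L i c p v) * bweight L i p"
    and "x \<in> snd c ` (fst c \<inter> bdom L i) \<Longrightarrow>
      frechet_derivative (\<lambda>x. bconn L i c (chart_inv c x) v) (at x) u -
      frechet_derivative (\<lambda>x. bconn L i c (chart_inv c x) u) (at x) v = (1 / \<i>) * of_real (\<omega> c (chart_inv c x) u v)"
proof -
  have u: "unitary_connection A L" and curv: "\<forall>i. \<forall>c\<in>A. \<forall>x\<in>snd c ` (fst c \<inter> bdom L i). \<forall>v w.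
        frechet_derivative (\<lambda>x. bconn L i c (chart_inv c x) w) (at x) v -
        frechet_derivative (\<lambda>x. bconn L i c (chart_inv c x) v) (at x) w =
          (1/\<i>) * complex_of_real (\<omega> c (chart_inv c x) v w)"
    using prequantum unfolding prequantum_bundle_def by simp_all
  show "smooth_on (snd c ` (fst c \<inter> bdom L i)) (\<lambda>x. bconn L i c (chart_inv c x) v)"
    by (rule u[unfolded unitary_connection_def, THEN conjunct2, THEN conjunct1, rule_format, OF assms])
  show "frechet_derivative (bweight L i \<circ> chart_inv c) (at (snd c p)) v = 2 * Re (bconn L i c p v) * bweight L i p"
    if "p \<in> fst c" "p \<in> bdom L i"
    by (rule u[unfolded unitary_connection_def, THEN conjunct2, THEN conjunct2, THEN conjunct2, THEN conjunct2, rule_format, OF assms])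
      (use that in simp)
  show "frechet_derivative (\<lambda>x. bconn L i c (chart_inv c x) v) (at x) u -
      frechet_derivative (\<lambda>x. bconn L i c (chart_inv c x) u) (at x) v = (1 / \<i>) * of_real (\<omega> c (chart_inv c x) u v)"
    if "x \<in> snd c ` (fst c \<inter> bdom L i)"
    by (rule curv[rule_format, OF assms that])
qed

lemma F_flatD:
  assumes "c \<in> A" "\<iota> p \<in> fst c" "\<iota> p \<in> bdom L i" "\<iota> p \<in> U"
  shows "iter_deriv vs (\<lambda>x. dbar L F i c (chart_inv c x) v) (snd c (\<iota> p)) = 0"
  using F_flat assms unfolding dbar_flat_along_def by blast

lemma inj_\<iota>: "inj \<iota>"
  using embedding unfolding closed_lagrangian_embedding_def homeomorphism_def
  by (metis UNIV_I injI)

lemma asymptotic_near: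
  assumes p0: "\<iota> p0 \<in> V"
  shows "\<exists>W. open W \<and> \<iota> p0 \<in> W \<and> (\<forall>v K. C2_function A v \<longrightarrow> compact K \<longrightarrow> K \<subseteq> W \<longrightarrow>
    (\<forall>x. x \<notin> K \<longrightarrow> v x = 0) \<longrightarrow> asymptotic v)"
proof -
  obtain c where c: "c \<in> A" "\<iota> p0 \<in> fst c" using smooth_atlas_cover[OF atlas_A] by blast
  obtain d where d: "d \<in> B" "p0 \<in> fst d" using smooth_atlas_cover[OF atlas_B] by blast
  obtain i where i: "\<iota> p0 \<in> bdom L i" using hermitian_bundleD(2)[OF hermitian_L] by blast
  obtain j where j: "\<iota> p0 \<in> bdom K j" using hermitian_bundleD(2)[OF hermitian_K] by blast
  note cc = smooth_atlas_chart[OF atlas_A c(1)] and cd = smooth_atlas_chart[OF atlas_B d(1)]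
  \<comment> \<open>Since |F| = 1 at the given point, F has no zeros nearby, and the logarithm of
    |F|^2 is available.\<close>
  define G where "G = (fst c \<inter> (U \<inter> bdom L i)) \<inter> F i -` (- {0}) \<inter> (V \<inter> bdom K j)"
  have "open (fst c \<inter> (U \<inter> bdom L i))"
    by (intro open_Int is_chartD(1) cc U hermitian_bundleD(1)[OF hermitian_L])
  then have "open ((fst c \<inter> (U \<inter> bdom L i)) \<inter> F i -` (- {0}))"
    by (intro continuous_open_preimage continuous_on_frame(3) c) auto
  then have oG: "open G"
    unfolding G_def by (rule open_Int[OF _ open_Int[OF V(1) hermitian_bundleD(1)[OF hermitian_K]]])
  have GD: "x \<in> fst c" "x \<in> U" "x \<in> bdom L i" "F i x \<noteq> 0" "x \<in> V" "x \<in> bdom K j" if "x \<in> G" for x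
    using that by (auto simp: G_def)
  have p0G: "\<iota> p0 \<in> G"
    using q_one[of p0 i] p0 V(2) c i j by (auto simp: G_def q_def)
  define \<Omega> where "\<Omega> = snd c ` (fst c \<inter> G)"
  define D where "D = snd d ` (fst d \<inter> \<iota> -` G)"
  define f where "f = snd c \<circ> \<iota> \<circ> chart_inv d"
  have inv_c: "chart_inv c (snd c x) = x" if "x \<in> fst c" for x using is_chartD(5)[OF cc that] .
  have inv_d: "chart_inv d (snd d p) = p" if "p \<in> fst d" for p using is_chartD(5)[OF cd that] .
  have o\<Omega>: "open \<Omega>" unfolding \<Omega>_def by (rule open_chart_image[OF cc oG])
  have oD: "open D" unfolding D_def by (rule open_chart_image[OF cd open_vimage_\<iota>[OF oG]])
  have \<Omega>D: "chart_inv c x \<in> G" "snd c (chart_inv c x) = x" if "x \<in> \<Omega>" for x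
    using that by (auto simp: \<Omega>_def inv_c)
  have DD: "chart_inv d y \<in> fst d" "\<iota> (chart_inv d y) \<in> G" "snd d (chart_inv d y) = y" "chart_inv c (f y) = \<iota> (chart_inv d y)"
    if "y \<in> D" for y using that GD(1) by (auto simp: D_def f_def inv_d inv_c)
  have f\<Omega>: "f ` D \<subseteq> \<Omega>" using DD GD(1) by (auto simp: \<Omega>_def f_def)
  have tan: "frechet_derivative f (at y) = tangent_map d c \<iota> (chart_inv d y)" if "y \<in> D" for y
    using DD(3)[OF that] by (simp add: f_def tangent_map_def)
  let ?F = "F i \<circ> chart_inv c" and ?w = "bweight L i \<circ> chart_inv c"
  let ?\<beta> = "\<lambda>x. bconn L i c (chart_inv c x)" and ?\<omega> = "\<lambda>x. \<omega> c (chart_inv c x)"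
  have sub: "\<Omega> \<subseteq> snd c ` (fst c \<inter> (U \<inter> bdom L i))" "\<Omega> \<subseteq> snd c ` (fst c \<inter> bdom L i)"
    "\<Omega> \<subseteq> snd c ` (fst c \<inter> (U \<inter> bdom K j))" "\<Omega> \<subseteq> snd c ` (fst c \<inter> bdom K j)" "\<Omega> \<subseteq> snd c ` fst c"
    using GD by (auto simp: \<Omega>_def)
  have F_Ck: "Ck n \<Omega> ?F" for n
    by (rule Ck_subset[OF smooth_on_imp_Ck[OF smooth_sectionD(2)[OF F c(1)]] sub(1)])
  have dbar_eq: "dbar L F i c (chart_inv c x) v = ((frechet_derivative ?F (at x) v + ?\<beta> x v * ?F x) +
       \<i> * (frechet_derivative ?F (at x) (\<i> *s v) + ?\<beta> x (\<i> *s v) * ?F x)) / 2" if "x \<in> \<Omega>" for x v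
    using \<Omega>D(2)[OF that] by (simp add: dbar_def covariant_derivative_def)
  have flat: "iter_deriv vs (\<lambda>x. dbar L F i c (chart_inv c x) v) (f y) = 0" if y: "y \<in> D" for y v vs
    using F_flatD[OF c(1), of "chart_inv d y" i vs v] GD[OF DD(2)[OF y]] by (simp add: f_def)
  \<comment> \<open>The two conditions on dbar F are instances of \<open>flat\<close>, for the empty
    list and for a single direction.\<close>
  interpret ph: phase_data \<Omega> D f ?F ?w ?\<beta> ?\<omega>
  proof (rule phase_data.intro)
    show "Ck n D f" for n
      unfolding f_def by (rule Ck_subset[OF \<iota>_Ck[OF d(1) c(1)]]) (use GD(1) in \<open>auto simp: D_def\<close>)
    show "Ck n \<Omega> ?w" for n
      by (rule Ck_subset[OF smooth_on_imp_Ck[OF hermitian_bundleD(5)[OF hermitian_L c(1)]] sub(2)])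
    show "Ck n \<Omega> (\<lambda>x. ?\<beta> x v)" for n v
      by (rule Ck_subset[OF smooth_on_imp_Ck[OF bconn_L(1)[OF c(1)]] sub(2)])
    show "?F x \<noteq> 0" if "x \<in> \<Omega>" for x using GD(4)[OF \<Omega>D(1)[OF that]] by simp
    show "0 < ?w x" if "x \<in> \<Omega>" for x using hermitian_bundleD(3)[OF hermitian_L GD(3)[OF \<Omega>D(1)[OF that]]] by simp
    show "frechet_derivative ?w (at x) v = 2 * Re (?\<beta> x v) * ?w x" if "x \<in> \<Omega>" for x v
      using bconn_L(2)[OF c(1), of "chart_inv c x" i v] GD[OF \<Omega>D(1)[OF that]] \<Omega>D(2)[OF that] by simp
    show "frechet_derivative (\<lambda>x. ?\<beta> x v) (at x) u - frechet_derivative (\<lambda>x. ?\<beta> x u) (at x) v =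
      (1 / \<i>) * of_real (?\<omega> x u v)" if "x \<in> \<Omega>" for x u v
      by (rule bconn_L(3)[OF c(1)]) (use that sub(2) in blast)
    show "positive_form (?\<omega> x)" if "x \<in> \<Omega>" for x by (rule positive_\<omega>[OF c(1) GD(1)[OF \<Omega>D(1)[OF that]]])
    show "?w x * (cmod (?F x))\<^sup>2 \<le> 1" if "x \<in> \<Omega>" for x
      using q_le[of "chart_inv c x" i] GD[OF \<Omega>D(1)[OF that]] by (simp add: q_def)
    show "?w (f y) * (cmod (?F (f y)))\<^sup>2 = 1" if y: "y \<in> D" for y
      using q_one[of "chart_inv d y" i] GD[OF DD(2)[OF y]] DD(4)[OF y] by (simp add: q_def)
    show "(frechet_derivative ?F (at (f y)) v + ?\<beta> (f y) v * ?F (f y)) +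
       \<i> * (frechet_derivative ?F (at (f y)) (\<i> *s v) + ?\<beta> (f y) (\<i> *s v) * ?F (f y)) = 0" if y: "y \<in> D" for y v
    proof -
      have "f y \<in> \<Omega>" using y f\<Omega> by blast
      from dbar_eq[OF this, of v] flat[OF y, of "[]" v] show ?thesis by simp
    qed
    show "frechet_derivative (\<lambda>x. ((frechet_derivative ?F (at x) v + ?\<beta> x v * ?F x) +
       \<i> * (frechet_derivative ?F (at x) (\<i> *s v) + ?\<beta> x (\<i> *s v) * ?F x)) / 2) (at (f y)) u = 0" if y: "y \<in> D" for y u v
    proof -
      have "f y \<in> \<Omega>" using y f\<Omega> by blast
      from frechet_derivative_cong_open[OF o\<Omega> this dbar_eq[of _ v]] flat[OF y, of "[u]" v] show ?thesis by simp
    qed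
  qed (fact o\<Omega> oD f\<Omega> F_Ck)+
  have "\<exists>Q. linear Q \<and> (\<forall>x. ?\<omega> (f y) (frechet_derivative f (at y) (Q x)) (\<i> *s frechet_derivative f (at y) (Q x)) = x \<bullet> (x :: real^'n))"
    if y: "y \<in> D" for y
  proof -
    note T = tangent_\<iota>[OF d(1) c(1) DD(1)[OF y] GD(1)[OF DD(2)[OF y]]]
    obtain Q :: "real^'n \<Rightarrow> real^'n" where "linear Q" "\<And>x. \<omega> c (\<iota> (chart_inv d y)) (tangent_map d c \<iota> (chart_inv d y) (Q x))
        (\<i> *s tangent_map d c \<iota> (chart_inv d y) (Q x)) = x \<bullet> x"
      using lagrangian_orthonormal_exists[OF positive_\<omega>[OF c(1) GD(1)[OF DD(2)[OF y]]] T] by blast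
    then show ?thesis unfolding tan[OF y] DD(4)[OF y] by blast
  qed
  then obtain Q :: "real^'n \<Rightarrow> real^'n \<Rightarrow> real^'n" where Q: "\<And>y. y \<in> D \<Longrightarrow> linear (Q y)"
    "\<And>y x. y \<in> D \<Longrightarrow> ?\<omega> (f y) (frechet_derivative f (at y) (Q y x)) (\<i> *s frechet_derivative f (at y) (Q y x)) = x \<bullet> x"
    by metis
  have frame: "lagrangian_frame (\<omega> c (\<iota> (chart_inv d y))) (tangent_map d c \<iota> (chart_inv d y)) (Q y)" if y: "y \<in> D" for y
  proof (rule lagrangian_frame.intro)
    note T = tangent_\<iota>[OF d(1) c(1) DD(1)[OF y] GD(1)[OF DD(2)[OF y]]]
    show "positive_form (\<omega> c (\<iota> (chart_inv d y)))" by (rule positive_\<omega>[OF c(1) GD(1)[OF DD(2)[OF y]]])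
    show "linear (tangent_map d c \<iota> (chart_inv d y))" by (rule T(1))
    show "\<omega> c (\<iota> (chart_inv d y)) (tangent_map d c \<iota> (chart_inv d y) a) (tangent_map d c \<iota> (chart_inv d y) b) = 0" for a b
      by (rule T(3))
    show "linear (Q y)" by (rule Q(1)[OF y])
    show "\<omega> c (\<iota> (chart_inv d y)) (tangent_map d c \<iota> (chart_inv d y) (Q y x)) (\<i> *s tangent_map d c \<iota> (chart_inv d y) (Q y x)) = x \<bullet> x" for x
      using Q(2)[OF y, of x] unfolding tan[OF y] DD(4)[OF y] .
  qed
  interpret lm: local_model \<Omega> D f ph.\<phi> ?\<omega> Q
  proof (rule local_model.intro)
    show "continuous_on \<Omega> (\<lambda>x. ?\<omega> x v w)" for v w
      by (rule continuous_on_subset[OF Ck_imp_continuous_on[OF smooth_on_imp_Ck[OF smooth_\<omega>[OF c(1)], of 0]] sub(5)])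
    show "inj (frechet_derivative f (at y))" if y: "y \<in> D" for y
      unfolding tan[OF y] by (rule tangent_\<iota>(2)[OF d(1) c(1) DD(1)[OF y] GD(1)[OF DD(2)[OF y]]])
    show "?\<omega> (f y) (frechet_derivative f (at y) a) (frechet_derivative f (at y) b) = 0" if y: "y \<in> D" for y a b
      unfolding tan[OF y] DD(4)[OF y] by (rule tangent_\<iota>(3)[OF d(1) c(1) DD(1)[OF y] GD(1)[OF DD(2)[OF y]]])
    show "inj (Q y)" if y: "y \<in> D" for y by (rule lagrangian_frame.inj_Q[OF frame[OF y]])
  qed (fact o\<Omega> oD f\<Omega> ph.f_Ck ph.\<phi>_Ck ph.\<omega>_pos ph.\<phi>_zero ph.\<phi>_critical ph.\<phi>_hessian Q)+
  let ?b = "a0 j \<circ> chart_inv c"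
  have b: "Ck 2 \<Omega> ?b"
  proof -
    have w: "Ck 2 \<Omega> (bweight K j \<circ> chart_inv c)"
      by (rule Ck_subset[OF smooth_on_imp_Ck[OF hermitian_bundleD(5)[OF hermitian_K c(1)]] sub(4)])
    have g: "Ck 2 \<Omega> (gl 0 j \<circ> chart_inv c)"
      by (rule Ck_subset[OF smooth_on_imp_Ck[OF smooth_sectionD(2)[OF gl c(1)]] sub(3)])
    have "Ck 2 \<Omega> (\<lambda>x. (bweight K j \<circ> chart_inv c) x * ((Re ((gl 0 j \<circ> chart_inv c) x))\<^sup>2 + (Im ((gl 0 j \<circ> chart_inv c) x))\<^sup>2))"
      by (intro Ck_mult Ck_add Ck_power o\<Omega> w Ck_linear_compose[OF o\<Omega> bounded_linear_Re g] Ck_linear_compose[OF o\<Omega> bounded_linear_Im g])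
    then show ?thesis by (simp add: a0_def cmod_power2 comp_def)
  qed
  have y0: "snd d p0 \<in> D" using d p0G by (auto simp: D_def)
  have fy0: "f (snd d p0) = snd c (\<iota> p0)" by (simp add: f_def inv_d d)
  have injf: "inj_on f D"
  proof (rule inj_onI)
    fix y y' assume y: "y \<in> D" "y' \<in> D" "f y = f y'"
    then have "\<iota> (chart_inv d y) = \<iota> (chart_inv d y')" using DD(4) by metis
    then have "chart_inv d y = chart_inv d y'" by (rule injD[OF inj_\<iota>])
    then show "y = y'" using DD(3) y by metis
  qed
  let ?r = "\<lambda>y. ?b (f y) * (jac (complexify (frechet_derivative f (at y))) * jac (Q y) / sqrt 2 ^ CARD('n))"
  obtain W where W: "open W" "f (snd d p0) \<in> W" "W \<subseteq> \<Omega>" and asym: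
    "\<And>v K N C. Ck 2 \<Omega> v \<Longrightarrow> compact K \<Longrightarrow> K \<subseteq> W \<Longrightarrow> (\<And>x. x \<notin> K \<Longrightarrow> v x = 0) \<Longrightarrow>
       (\<And>k. 1 \<le> k \<Longrightarrow> continuous_on K (N k)) \<Longrightarrow>
       (\<And>k x. 1 \<le> k \<Longrightarrow> x \<in> K \<Longrightarrow> \<bar>N k x - sqrt (real k / (2 * pi)) ^ CARD('n) * exp (- real k * ph.\<phi> x) * ?b x\<bar>
          \<le> C / real k * (1 + sqrt (real k / (2 * pi)) ^ CARD('n) * exp (- real k * ph.\<phi> x))) \<Longrightarrow>
       set_integrable lborel D (\<lambda>y. v (f y) * of_real (?r y)) \<and>
       (\<exists>C'. \<forall>k\<ge>1. cmod ((LINT x:K|lborel. v x * of_real (N k x)) - (LINT y:D|lborel. v (f y) * of_real (?r y))) \<le> C' / real k)"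
  proof (rule lm.local_density_asymptotics[OF y0 injf b], goal_cases)
    case (1 W)
    show thesis using 1(2-5) by (rule 1(1))
  qed
  \<comment> \<open>The image of the complement of the chart d is compact, hence closed. Removing it
    keeps other parts of Gamma out, so that a function supported in this set pulls back into the
    domain of d.\<close>
  let ?W = "(fst c \<inter> snd c -` W) \<inter> G \<inter> - \<iota> ` (- fst d)"
  have "compact (- fst d)"
    using compact_Int_closed[OF compact_G, of "- fst d"] is_chartD(1)[OF cd] by (simp add: closed_Compl)
  then have "closed (\<iota> ` (- fst d))"
    by (intro compact_imp_closed compact_continuous_image continuous_on_subset[OF continuous_\<iota>]) auto
  then have oW: "open ?W"
    by (intro open_Int open_chart_preimage[OF cc W(1)] oG) auto
  have p0W: "\<iota> p0 \<in> ?W" using W(2) c(2) p0G d(2) injD[OF inj_\<iota>] by (auto simp: fy0)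
  have "asymptotic v" if v: "C2_function A v" and K0: "compact K0" "K0 \<subseteq> ?W" and v0: "\<forall>x. x \<notin> K0 \<longrightarrow> v x = 0" for v K0
  proof -
    have K0': "K0 \<subseteq> fst c \<inter> bdom L i \<inter> bdom K j \<inter> V" "K0 \<subseteq> fst c \<inter> (bdom L i \<inter> bdom K j)" "K0 \<subseteq> G" "K0 \<subseteq> fst c"
      using K0(2) GD by blast+
    obtain C where C: "\<And>k p. 1 \<le> k \<Longrightarrow> p \<in> K0 \<Longrightarrow> \<bar>N k p - sqrt (real k / (2 * pi)) ^ CARD('n) * q i p ^ k * a0 j p\<bar>
        \<le> C / real k * (1 + sqrt (real k / (2 * pi)) ^ CARD('n) * q i p ^ k)"
      using density_approximation[OF c(1) K0(1) K0'(1)] by metis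
    let ?K = "snd c ` K0"
    have Kc: "compact ?K" "chart_inv c ` ?K = K0"
      using K0(1) K0'(4) inv_c
      by (auto intro!: compact_continuous_image continuous_on_subset[OF is_chartD(3)[OF cc]] simp: image_image subset_iff)
    have KW: "?K \<subseteq> W" using K0(2) by blast
    have K\<Omega>: "?K \<subseteq> \<Omega>" using KW W(3) by blast
    \<comment> \<open>The Liouville coefficient becomes part of the amplitude; the extension by 0
      gives a function on the whole coordinate space.\<close>
    define v' where "v' x = (if x \<in> \<Omega> then v (chart_inv c x) * of_real (liouville \<omega> c (chart_inv c x)) else 0)" for x
    have v'_Ck: "Ck 2 \<Omega> v'"
    proof (rule Ck_cong[OF o\<Omega>])
      have "Ck 2 \<Omega> (\<lambda>x. v (chart_inv c x))"
        using v c(1) Ck_subset[OF _ sub(5)] unfolding C2_function_def by blast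
      then show "Ck 2 \<Omega> (\<lambda>x. v (chart_inv c x) * of_real (liouville \<omega> c (chart_inv c x)))"
        by (intro Ck_mult o\<Omega> Ck_linear_compose[OF o\<Omega> bounded_linear_of_real Ck_subset[OF liouville_Ck[OF c(1)] sub(5)]])
    qed (simp add: v'_def)
    have v'0: "v' x = 0" if "x \<notin> ?K" for x
      using that v0 \<Omega>D(2)[of x] by (force simp: v'_def)
    have cN: "continuous_on ?K (\<lambda>x. N k (chart_inv c x))" if "1 \<le> k" for k
      by (rule continuous_on_compose2[OF continuous_on_N[OF c(1) that] continuous_on_subset[OF is_chartD(4)[OF cc]]])
        (use Kc(2) K0'(2) K\<Omega> sub(5) in auto)
    have approx: "\<bar>N k (chart_inv c x) - sqrt (real k / (2 * pi)) ^ CARD('n) * exp (- real k * ph.\<phi> x) * ?b x\<bar>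
          \<le> C / real k * (1 + sqrt (real k / (2 * pi)) ^ CARD('n) * exp (- real k * ph.\<phi> x))"
      if k: "1 \<le> k" and x: "x \<in> ?K" for k x
    proof -
      have "exp (- ph.\<phi> x) = q i (chart_inv c x)"
        using ph.exp_\<phi>[of x] x K\<Omega> by (auto simp: q_def)
      then have "exp (- real k * ph.\<phi> x) = q i (chart_inv c x) ^ k"
        using exp_of_nat_mult[of k "- ph.\<phi> x"] by simp
      moreover have "chart_inv c x \<in> K0" using x Kc(2) by blast
      ultimately show ?thesis using C[OF k] by simp
    qed
    from asym[OF v'_Ck Kc(1) KW v'0 cN approx]
    obtain C' where int: "set_integrable lborel D (\<lambda>y. v' (f y) * of_real (?r y))"
      and C': "\<And>k. 1 \<le> k \<Longrightarrow> cmod ((LINT x:?K|lborel. v' x * of_real (N k (chart_inv c x))) -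
        (LINT y:D|lborel. v' (f y) * of_real (?r y))) \<le> C' / real k"
      by blast
    have DA: "density_integral A (\<sigma> k v) = (LINT x:?K|lborel. v' x * of_real (N k (chart_inv c x)))" if k: "1 \<le> k" for k
    proof -
      have "density_integral A (\<sigma> k v) = (LINT x:?K|lborel.
          (v (chart_inv c x) * of_real (liouville \<omega> c (chart_inv c x))) * of_real (N k (chart_inv c x)))"
        by (rule chart_integral(2)[OF c(1) k K0(1) K0'(2) v]) (use v0 in blast)
      also have "\<dots> = (LINT x:?K|lborel. v' x * of_real (N k (chart_inv c x)))"
        by (rule set_lebesgue_integral_cong) (use Kc(1) K\<Omega> in \<open>auto simp: v'_def compact_imp_closed\<close>)
      finally show ?thesis .
    qed
    \<comment> \<open>The factor |det Q| from the method of Laplace and 1/|det Q|^2 from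
      \<open>liouville_coeff_jac\<close> combine to the 1/|det Q| of
      \<open>m_density_eq\<close>.\<close>
    have mu: "v' (f y) * of_real (?r y) = \<mu> v d (chart_inv d y)" if y: "y \<in> D" for y
    proof -
      interpret fr: lagrangian_frame "\<omega> c (\<iota> (chart_inv d y))" "tangent_map d c \<iota> (chart_inv d y)" "Q y" by (rule frame[OF y])
      let ?x = "\<iota> (chart_inv d y)" and ?J = "jac (complexify (tangent_map d c \<iota> (chart_inv d y)))"
      have G: "?x \<in> G" by (rule DD(2)[OF y])
      have e: "liouville_coeff (\<omega> c ?x) * ?J * jac (Q y) = 1 / jac (Q y)"
        using fr.liouville_coeff_jac fr.jac_Q_pos by (simp add: field_simps power2_eq_square)
      have "liouville_coeff (\<omega> c ?x) * (a0 j ?x * (?J * jac (Q y) / sqrt 2 ^ CARD('n))) =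
          a0 j ?x * ((liouville_coeff (\<omega> c ?x) * ?J * jac (Q y)) / sqrt 2 ^ CARD('n))"
        by (simp add: mult_ac)
      then have M: "liouville \<omega> c ?x * (a0 j ?x * (?J * jac (Q y) / sqrt 2 ^ CARD('n))) = m d (chart_inv d y)"
        unfolding e m_density_eq[OF d(1) DD(1)[OF y] c(1) GD(1)[OF G] GD(2)[OF G] GD(6)[OF G] frame[OF y]] liouville_eq
        by (simp add: mult.commute)
      have "f y \<in> \<Omega>" using y f\<Omega> by blast
      then have 1: "v' (f y) = v ?x * of_real (liouville \<omega> c ?x)" by (simp add: v'_def DD(4)[OF y])
      have 2: "?r y = a0 j ?x * (?J * jac (Q y) / sqrt 2 ^ CARD('n))" by (simp add: DD(4)[OF y] tan[OF y])
      show ?thesis unfolding 1 2 mult.assoc of_real_mult[symmetric] M \<mu>_def ..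
    qed
    have ind: "indicator (snd d ` fst d) y *\<^sub>R \<mu> v d (chart_inv d y) = indicator D y *\<^sub>R (v' (f y) * of_real (?r y))" for y
    proof (cases "y \<in> D")
      case True
      then show ?thesis using mu[OF True] by (auto simp: D_def)
    next
      case False
      have "\<mu> v d (chart_inv d y) = 0" if y: "y \<in> snd d ` fst d"
      proof -
        have "\<iota> (chart_inv d y) \<notin> G" using False y by (auto simp: D_def inv_d)
        then show ?thesis using v0 K0'(3) by (auto simp: \<mu>_def)
      qed
      then show ?thesis using False by (auto simp: indicator_def)
    qed
    interpret dens: chart_density B d "\<mu> v"
    proof
      show "\<mu> v d' p = 0" if "d' \<in> B" "p \<in> fst d'" "p \<notin> fst d" for d' p
        using v0 K0(2) that by (auto simp: \<mu>_def)
      show "\<mu> v d' p = of_real (jac (tangent_map d' d id p)) * \<mu> v d p" if "d' \<in> B" "p \<in> fst d" "p \<in> fst d'" for d' p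
      \<comment> \<open>The transformation rule for \<open>m_density\<close> is available over U,
        which contains \<open>K0\<close>; off \<open>K0\<close> the function v is 0.\<close>
      proof (cases "\<iota> p \<in> K0")
        case True
        then have "\<iota> p \<in> U" using K0'(3) GD(2) by blast
        from m_density_transform[OF d(1) that this] show ?thesis by (simp add: \<mu>_def)
      next
        case False
        then show ?thesis using v0 by (simp add: \<mu>_def)
      qed
      show "set_integrable lborel (snd d ` fst d) (\<lambda>y. \<mu> v d (chart_inv d y))"
        using int unfolding set_integrable_def ind .
    qed (use atlas_B d in auto)
    have "density_integral B (\<mu> v) = (LINT y:D|lborel. v' (f y) * of_real (?r y))"
      unfolding dens.density_integral_eq[OF compact_G] set_lebesgue_integral_def ind ..
    then have "cmod (density_integral A (\<sigma> k v) - density_integral B (\<mu> v)) \<le> C' / real k" if "1 \<le> k" for k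
      using C'[OF that] DA[OF that] by simp
    moreover have "piecewise_integrable A (\<sigma> k v)" if "1 \<le> k" for k
      by (rule chart_integral(1)[OF c(1) that K0(1) K0'(2) v]) (use v0 in blast)
    ultimately show ?thesis unfolding asymptotic_def using dens.piecewise_integrable by blast
  qed
  then show ?thesis using oW p0W by (intro exI[of _ ?W]) blast
qed

lemma asymptotic_test_function:
  assumes "test_function A V u"
  shows "asymptotic u"
proof -
  obtain C where C: "compact C" "C \<subseteq> V" "\<And>x. x \<notin> C \<Longrightarrow> u x = 0" and u: "smooth_function A u"
    using assms unfolding test_function_def by blast
  show ?thesis
  proof (rule C2_localization[OF atlas_A C2_functionI_smooth[OF u] C(1,3)])
    fix p assume "p \<in> C"
    then have p: "p \<in> V" using C(2) by blast
    show "\<exists>W. open W \<and> p \<in> W \<and> (\<forall>v K. C2_function A v \<longrightarrow> compact K \<longrightarrow> K \<subseteq> W \<longrightarrow>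
       (\<forall>x. x \<notin> K \<longrightarrow> v x = 0) \<longrightarrow> asymptotic v)"
    proof (cases "p \<in> range \<iota>")
      case True
      then obtain p0 where "p = \<iota> p0" by blast
      with asymptotic_near[of p0] p show ?thesis by simp
    next
      case False
      from asymptotic_away[OF p this] show ?thesis .
    qed
  qed (use asymptotic_zero asymptotic_add in auto)
qed

end

theorem theorem3p2:
  fixes A :: "('m::t2_space, complex^'n) chart set"
    and \<omega> :: "('m, complex^'n) two_form"
    and L :: "('m, 'a, complex^'n) conn_bundle"
    and K :: "('m, 'b, complex^'n) conn_bundle"
    and B :: "('g::t2_space, real^'n) chart set"
    and \<iota> :: "'g \<Rightarrow> 'm"
    and U V :: "'m set"
    and t :: "('g, 'a) bsec"
    and L1 :: "('m, 'c, complex^'n) conn_bundle"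
    and \<delta> :: "('m, 'd, complex^'n) conn_bundle"
    and \<phi> :: "('m, complex^'n) chart \<Rightarrow> 'd \<Rightarrow> 'm \<Rightarrow> complex"
    and \<tau> :: "'b \<Rightarrow> 'c \<times> 'd \<Rightarrow> 'm \<Rightarrow> complex"
    and g :: "nat \<Rightarrow> ('g, 'b) bsec"
    and \<Psi> :: "nat \<Rightarrow> ('m, 'a \<times> 'b) bsec"
    and \<xi> :: "'m \<Rightarrow> complex"
  assumes "compact_connected_kaehler A \<omega>"
    and "prequantum_bundle A \<omega> L"
    and "hermitian_holomorphic_bundle A UNIV K"
    and "closed_lagrangian_embedding A \<omega> B \<iota>"
    and "open U" and "contractible (\<iota> -` U)"
    and "flat_unitary_section B (bundle_pullback A \<iota> L) (\<iota> -` U) t"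
    and "open V" and "closure V \<subseteq> U"
    and "half_form_bundle A \<omega> U \<delta> \<phi>"
    and "hermitian_holomorphic_bundle A U L1"
    and "bundle_iso A U (bundle_tensor L1 \<delta>) K \<tau>"
    and "lagrangian_section A L K B \<iota> U V t g \<Psi>"
    and "test_function A V \<xi>"
  shows "(\<lambda>k.
      density_integral A (\<lambda>c x. \<xi> x *
        of_real ((section_norm (quantum_bundle L K k) (\<Psi> k) x)\<^sup>2 * liouville \<omega> c x))
      - density_integral B (\<lambda>d p. \<xi> (\<iota> p) * of_real (m_density A \<iota> K L1 \<delta> \<phi> \<tau> (g 0) d p)))
    \<in> O(\<lambda>k. 1 / of_nat k)"
proof -
  from \<open>lagrangian_section A L K B \<iota> U V t g \<Psi>\<close>[unfolded lagrangian_section_def]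
  obtain F gt gl where 
    F: "smooth_section A L U F" "\<forall>i. \<forall>p\<in>\<iota> -` (U \<inter> bdom L i). F i (\<iota> p) = t i p"
      "dbar_flat_along A L U (range \<iota>) F" "\<forall>x\<in>U - range \<iota>. section_norm L F x < 1"
    and gt: "\<forall>k\<ge>1. smooth_section A K U (gt k)" and gl: "\<forall>l. smooth_section A K U (gl l)"
    and expansion: "asymptotic_expansion A K U gt gl"
    and gl_g: "\<forall>l j. \<forall>p\<in>\<iota> -` (U \<inter> bdom K j). gl l j (\<iota> p) = g l j p"
    and remainder: "\<forall>N. \<exists>C. \<forall>k\<ge>1. \<forall>x\<in>V. section_norm (quantum_bundle L K k)
             (\<lambda>ij p. \<Psi> k ij p - of_real ((real k / (2 * pi)) powr (real CARD('n) / 4)) *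
                section_tensor (section_power F k) (gt k) ij p) x \<le> C / real k ^ N"
    and \<Psi>: "\<forall>k\<ge>1. holomorphic_section A (quantum_bundle L K k) (\<Psi> k)"
    and g: "\<forall>l. smooth_section B (bundle_pullback A \<iota> K :: ('g, 'b, real^'n) conn_bundle) (\<iota> -` U) (g l)"
    by (elim conjE exE) (rule that)
  have F_one: "section_norm L F (\<iota> p) = 1" if p: "\<iota> p \<in> U" for p
  proof -
    \<comment> \<open>This is the frame picked inside \<open>section_norm\<close>. The frame domains
      of the pulled-back bundle are preimages, so the choice is literally the same for t at p and
      for F at \<open>\<iota> p\<close>.\<close>
    define i where "i = (SOME i. \<iota> p \<in> bdom L i)"
    have "\<exists>i. \<iota> p \<in> bdom L i"
      using hermitian_bundleD(2)[OF conjunct1[OF assms(2)[unfolded prequantum_bundle_def]]] by blast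
    then have i: "\<iota> p \<in> bdom L i" unfolding i_def by (rule someI_ex)
    have "section_norm (bundle_pullback A \<iota> L :: ('g, 'a, real^'n) conn_bundle) t p = 1"
      using \<open>flat_unitary_section B (bundle_pullback A \<iota> L) (\<iota> -` U) t\<close> p unfolding flat_unitary_section_def by simp
    then have "sqrt (bweight L i (\<iota> p)) * cmod (t i p) = 1"
      by (simp add: section_norm_def bundle_pullback_def i_def Let_def)
    moreover have "F i (\<iota> p) = t i p" using F(2) p i by simp
    ultimately show ?thesis by (simp add: section_norm_def i_def[symmetric] Let_def)
  qed
  interpret lagrangian_state A \<omega> L K B \<iota> U V L1 \<delta> \<phi> \<tau> "g 0" \<Psi> F gt gl
  proof (rule lagrangian_state.intro)
    show "V \<subseteq> U" using \<open>closure V \<subseteq> U\<close> closure_subset by blast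
    show "holomorphic_section A (quantum_bundle L K k) (\<Psi> k)" if "1 \<le> k" for k using \<Psi> that by blast
    show "section_norm L F x < 1" if "x \<in> U - range \<iota>" for x using F(4) that by blast
    show "section_norm L F (\<iota> p) = 1" if "\<iota> p \<in> U" for p by (rule F_one[OF that])
    show "smooth_section A K U (gt k)" if "1 \<le> k" for k using gt that by blast
    show "smooth_section A K U (gl 0)" using gl by blast
    show "gl 0 j (\<iota> p) = g 0 j p" if "\<iota> p \<in> U" "\<iota> p \<in> bdom K j" for j p using gl_g that by blast
    show "smooth_section B (bundle_pullback A \<iota> K :: ('g, 'b, real^'n) conn_bundle) (\<iota> -` U) (g 0)" using g by blast
  qed (fact assms F expansion spec[OF remainder])+
  obtain C where "\<And>k. 1 \<le> k \<Longrightarrow> cmod (density_integral A (\<sigma> k \<xi>) - density_integral B (\<mu> \<xi>)) \<le> C / real k"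
    using asymptotic_test_function[OF \<open>test_function A V \<xi>\<close>] unfolding asymptotic_def by blast
  then have "(\<lambda>k. density_integral A (\<sigma> k \<xi>) - density_integral B (\<mu> \<xi>)) \<in> O(\<lambda>k. 1 / of_nat k)"
    by (intro bigoI[of _ C] eventually_sequentiallyI[of 1]) (simp add: norm_divide)
  then show ?thesis by (simp only: \<sigma>_def N_def \<mu>_def)
qed

end
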